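(* There is an algorithm that, given a monotone submodular function $g:2^E\to\mathbb{R}_+$, a monotone linear function $\ell:2^E\to\mathbb{R}_+$, a weight function $w:E\to[0,1]$, and $\epsilon\in(0,1)$, outputs a (random) set $S\subseteq E$ with $w(S)\le 1$ satisfying \[ \mathbf{E}[g(S)+\ell(S)]\ \ge\ \Bigl(1-\frac1e\Bigr)g(O)+\ell(O)-\epsilon\bigl(g(O)+\ell(O)\bigr), \] where $O=\arg\max_{T\subseteq E:\,w(T)\le 1}\bigl(g(T)+\ell(T)\bigr)$ is an optimal solution. The running time is \[ O\Bigl(\frac{n^4\,\mathrm{polylog}(n)}{(1-c_g)^2}\Bigr)\cdot\Bigl(\frac1\epsilon\log\frac{1}{1-c_g}\Bigr)^{\mathrm{poly}(1/\epsilon)/(1-c_g)}, \] where $n=|E|$.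
   Context: $E$ is a finite ground set; $g$ is accessed via value queries. A function $\ell$ is linear if $\ell(S)=\sum_{e\in S}\ell(e)$ for all $S\subseteq E$. For $S\subseteq E$, $w(S)=\sum_{e\in S}w(e)$. For $S,T\subseteq E$, $g_S(T)=g(S\cup T)-g(S)$, and $g(e)$ means $g(\{e\})$. The (total) curvature of $g$ is $c_g=1-\min_{e\in E}\frac{g_{E-e}(e)}{g(e)}\in[0,1]$.
   Formalization: In the running time, log(1/(1-c_g)) is replaced by max{1, ln(1/(1-c_g))}, because the literal bound is 0 when c_g = 0; the bound is claimed for n ≥ 1 and c_g < 1, and elements with g(e) = 0 count with ratio 1 in c_g. *)

theory Defs
  imports "HOL-Probability.Probability" "HOL-Computational_Algebra.Polynomial"
begin

section \<open>Set functions\<close>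

definition nonneg_on :: "'a set \<Rightarrow> ('a set \<Rightarrow> real) \<Rightarrow> bool" where
  "nonneg_on E f \<longleftrightarrow> (\<forall>S\<subseteq>E. 0 \<le> f S)"

definition monotone_setfun :: "'a set \<Rightarrow> ('a set \<Rightarrow> real) \<Rightarrow> bool" where
  "monotone_setfun E f \<longleftrightarrow> (\<forall>S T. S \<subseteq> T \<and> T \<subseteq> E \<longrightarrow> f S \<le> f T)"

definition submodular :: "'a set \<Rightarrow> ('a set \<Rightarrow> real) \<Rightarrow> bool" where
  "submodular E f \<longleftrightarrow> (\<forall>S T. S \<subseteq> E \<and> T \<subseteq> E \<longrightarrow> f (S \<union> T) + f (S \<inter> T) \<le> f S + f T)"

definition linear_setfun :: "'a set \<Rightarrow> ('a set \<Rightarrow> real) \<Rightarrow> bool" where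
  "linear_setfun E f \<longleftrightarrow> (\<forall>S\<subseteq>E. f S = (\<Sum>e\<in>S. f {e}))"

definition marginal :: "('a set \<Rightarrow> real) \<Rightarrow> 'a set \<Rightarrow> 'a set \<Rightarrow> real" where
  "marginal g S T = g (S \<union> T) - g S"

text \<open>
  An element with \<open>g {e} = 0\<close> has marginal value 0 everywhere (for nonnegative, monotone,
  submodular \<open>g\<close>), so its ratio is 0/0. It is counted as 1, so that such elements have no
  influence on the curvature; the division of HOL would make it 0 and the curvature 1.
  The value is meaningful for finite nonempty \<open>E\<close> only.
\<close>
definition curvature :: "'a set \<Rightarrow> ('a set \<Rightarrow> real) \<Rightarrow> real" where
  "curvature E g =
     1 - Min ((\<lambda>e. if g {e} = 0 then 1 else marginal g (E - {e}) {e} / g {e}) ` E)"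


section \<open>Randomized algorithms with a value oracle\<close>

text \<open>
  Algorithms are programs for a real RAM with unbounded arrays of natural numbers and of reals.
  A program is a finite piece of syntax, fixed once for inputs of all sizes; a scalar variable is
  cell 0 of an array. Exact real arithmetic and comparison are available at unit cost, but no
  rounding of reals to integers, and no multiplication of natural numbers.
  The only constants are natural numbers: arbitrary real constants would amount to
  an advice string. Expressions in a fixed program have bounded size, so charging one unit for the
  evaluation of an expression affects running times by a constant factor only.
\<close>

datatype nexp =
    NConst nat
  | NRead nat nexp
  | NAdd nexp nexp
  | NSub nexp nexp

datatype rexp =
    ROfNat nexp
  | RRead nat nexp
  | RAdd rexp rexp
  | RSub rexp rexp
  | RMul rexp rexp
  | RDiv rexp rexp

datatype bexp =
    NLess nexp nexp
  | RLess rexp rexp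
  | Neg bexp
  | Conj bexp bexp

datatype com =
    Skip
  | NAssign nat nexp nexp
  | RAssign nat nexp rexp
  | Query nat nexp nat
  | Flip nat nexp rexp
  | Seq com com
  | Cond bexp com com
  | While bexp com

record memory =
  narr :: "nat \<Rightarrow> nat \<Rightarrow> nat"
  rarr :: "nat \<Rightarrow> nat \<Rightarrow> real"

primrec nval :: "memory \<Rightarrow> nexp \<Rightarrow> nat" where
  "nval m (NConst k) = k"
| "nval m (NRead a i) = narr m a (nval m i)"
| "nval m (NAdd x y) = nval m x + nval m y"
| "nval m (NSub x y) = nval m x - nval m y"

primrec rval :: "memory \<Rightarrow> rexp \<Rightarrow> real" where
  "rval m (ROfNat x) = real (nval m x)"
| "rval m (RRead a i) = rarr m a (nval m i)"
| "rval m (RAdd x y) = rval m x + rval m y"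
| "rval m (RSub x y) = rval m x - rval m y"
| "rval m (RMul x y) = rval m x * rval m y"
| "rval m (RDiv x y) = rval m x / rval m y"

primrec bval :: "memory \<Rightarrow> bexp \<Rightarrow> bool" where
  "bval m (NLess x y) = (nval m x < nval m y)"
| "bval m (RLess x y) = (rval m x < rval m y)"
| "bval m (Neg b) = (\<not> bval m b)"
| "bval m (Conj b c) = (bval m b \<and> bval m c)"

definition nwrite :: "nat \<Rightarrow> nat \<Rightarrow> nat \<Rightarrow> memory \<Rightarrow> memory" where
  "nwrite a i v m = m\<lparr>narr := (narr m)(a := (narr m a)(i := v))\<rparr>"

definition rwrite :: "nat \<Rightarrow> nat \<Rightarrow> real \<Rightarrow> memory \<Rightarrow> memory" where
  "rwrite a i v m = m\<lparr>rarr := (rarr m)(a := (rarr m a)(i := v))\<rparr>"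

text \<open>The subset of \<open>{..<n}\<close> whose indicator vector is stored in the \<open>b\<close>-th array of naturals.\<close>
definition stored_set :: "nat \<Rightarrow> nat \<Rightarrow> memory \<Rightarrow> nat set" where
  "stored_set n b m = {j. j < n \<and> narr m b j \<noteq> 0}"

text \<open>
  A configuration is a stack of commands still to be executed together with the memory; the
  program has halted when the stack is empty. \<open>Query a i b\<close> is a value query: it writes
  the value of \<open>g\<close> at the set stored in \<open>b\<close>. \<open>Flip a i p\<close> writes the result of an independent
  coin toss with success probability \<open>p\<close> (truncated to the unit interval by
  \<^const>\<open>bernoulli_pmf\<close>). Every step costs one unit of time.
\<close>

type_synonym config = "com list \<times> memory"

fun step :: "nat \<Rightarrow> (nat set \<Rightarrow> real) \<Rightarrow> config \<Rightarrow> config pmf" where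
  "step n g ([], m) = return_pmf ([], m)"
| "step n g (Skip # cs, m) = return_pmf (cs, m)"
| "step n g (NAssign a i x # cs, m) = return_pmf (cs, nwrite a (nval m i) (nval m x) m)"
| "step n g (RAssign a i x # cs, m) = return_pmf (cs, rwrite a (nval m i) (rval m x) m)"
| "step n g (Query a i b # cs, m) =
     return_pmf (cs, rwrite a (nval m i) (g (stored_set n b m)) m)"
| "step n g (Flip a i p # cs, m) =
     map_pmf (\<lambda>h. (cs, nwrite a (nval m i) (if h then 1 else 0) m)) (bernoulli_pmf (rval m p))"
| "step n g (Seq c d # cs, m) = return_pmf (c # d # cs, m)"
| "step n g (Cond b c d # cs, m) = return_pmf ((if bval m b then c else d) # cs, m)"
| "step n g (While b c # cs, m) =
     return_pmf (if bval m b then c # While b c # cs else cs, m)"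

text \<open>
  Inputs are the size \<open>n\<close> of the ground set \<open>{..<n}\<close>, the parameter \<open>\<epsilon>\<close>, the weights, and the
  values of the linear function on singletons; \<open>g\<close> is accessible through value queries only.
\<close>
definition init_memory :: "nat \<Rightarrow> (nat set \<Rightarrow> real) \<Rightarrow> (nat \<Rightarrow> real) \<Rightarrow> real \<Rightarrow> memory" where
  "init_memory n l w \<epsilon> =
     \<lparr>narr = (\<lambda>a i. if a = 0 \<and> i = 0 then n else 0),
      rarr = (\<lambda>a i. if a = 0 \<and> i = 0 then \<epsilon>
                    else if a = 1 \<and> i < n then w i
                    else if a = 2 \<and> i < n then l {i}
                    else 0)\<rparr>"

primrec run :: "nat \<Rightarrow> (nat set \<Rightarrow> real) \<Rightarrow> config \<Rightarrow> nat \<Rightarrow> config pmf" where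
  "run n g cfg 0 = return_pmf cfg"
| "run n g cfg (Suc t) = bind_pmf (run n g cfg t) (step n g)"

definition exec ::
  "com \<Rightarrow> nat \<Rightarrow> (nat set \<Rightarrow> real) \<Rightarrow> (nat set \<Rightarrow> real) \<Rightarrow> (nat \<Rightarrow> real) \<Rightarrow> real \<Rightarrow> nat \<Rightarrow> config pmf"
  where "exec P n g l w \<epsilon> t = run n g ([P], init_memory n l w \<epsilon>) t"

text \<open>Termination within \<open>t\<close> steps is required for all outcomes of the coin tosses.\<close>
definition halts_within ::
  "com \<Rightarrow> nat \<Rightarrow> (nat set \<Rightarrow> real) \<Rightarrow> (nat set \<Rightarrow> real) \<Rightarrow> (nat \<Rightarrow> real) \<Rightarrow> real \<Rightarrow> nat \<Rightarrow> bool"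
  where "halts_within P n g l w \<epsilon> t \<longleftrightarrow> (\<forall>cfg\<in>set_pmf (exec P n g l w \<epsilon> t). fst cfg = [])"

text \<open>
  The output is the set stored in array 1 of the naturals. Halted configurations no longer
  change, so the result does not depend on \<open>t\<close> once the program halts within \<open>t\<close> steps.
\<close>
definition output_set ::
  "com \<Rightarrow> nat \<Rightarrow> (nat set \<Rightarrow> real) \<Rightarrow> (nat set \<Rightarrow> real) \<Rightarrow> (nat \<Rightarrow> real) \<Rightarrow> real \<Rightarrow> nat \<Rightarrow> nat set pmf"
  where "output_set P n g l w \<epsilon> t = map_pmf (\<lambda>cfg. stored_set n 1 (snd cfg)) (exec P n g l w \<epsilon> t)"

end

theory Submission
  imports Defs
begin

text \<open>
  Write \<open>z = \<lceil>10 / \<epsilon>\<rceil>\<close>. Colouring an optimal solution with \<open>z\<close> colours of nearly equal weight and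
  deleting the cheapest class loses an \<open>\<epsilon>\<close>-fraction of the value and leaves room for rounding errors.
  The \<open>k = z\<^sup>6\<close> heaviest items of what remains are heavy, the others light. A discretised
  continuous greedy procedure with \<open>z\<close> rows simulates adding each optimal item with probability
  \<open>1 / z\<close> per row: a row has one slot per heavy optimal item, filled with a lightest item whose
  linear value and averaged marginal gain reach guessed thresholds, the average being taken over all
  ways to choose a row for every slot; light items are added greedily by density, separately for
  classes of nearly equal linear density, so that the linear function is matched in full. Since the
  weights of the light items are small, only the heavy slots need rounding: some choice of rows
  attains the average, and spare candidates resolve the collisions between slots. All guesses range
  over polynomially many values of magnitude and threshold, and the best feasible set is kept.
\<close>

section \<open>Submodular functions and balanced colourings\<close>

text \<open>Following the density of \<open>g\<close> and following that of \<open>l\<close>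
  conflict. A band of almost constant linear density removes the conflict: any light items of equal
  weight nearly match the linear value of the optimum there, so the choice inside the band may
  follow \<open>g\<close>. Only the top band has no upper density bound. Its optimal items have
  value at most \<open>T\<close> and density at least \<open>Q * unit_light / Bt\<close>, hence
  weight at most \<open>Bt / z^2\<close>, little enough to serve the band twice, once per criterion.
  The gain thresholds of heavy slots depend on the state reached so far; they are rounded to
  multiples of a small unit, and as the run is deterministic, the whole sequence of right thresholds
  is one finite vector of numbers below \<open>z^8\<close>. Averages over row choices are exact sums
  of \<open>z^k\<close> terms, a number that depends on \<open>\<epsilon>\<close> only. The
  overshoot of at most \<open>z * (Q + 2)\<close> light items is paid from
  \<open>k = z * z^5\<close>: with weights capped at \<open>w t\<close>, each of the
  \<open>z\<close> colour classes is worth at least \<open>(z^5 - 1) * w t\<close> besides its share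
  of the light weight.\<close>

locale mono_submod =
  fixes g :: "nat set \<Rightarrow> real"
  assumes mono: "S \<subseteq> S' \<Longrightarrow> g S \<le> g S'"
    and submod: "g (S \<union> T) + g (S \<inter> T) \<le> g S + g T"
    and nonneg: "0 \<le> g S"
begin

lemma diminishing:
  assumes "A \<subseteq> B"
  shows "g (B \<union> X) - g B \<le> g (A \<union> X) - g A"
proof -
  have "g ((A \<union> X) \<union> B) + g ((A \<union> X) \<inter> B) \<le> g (A \<union> X) + g B"
    by (rule submod)
  moreover have "(A \<union> X) \<union> B = B \<union> X" using assms by auto
  moreover have "g A \<le> g ((A \<union> X) \<inter> B)" using assms by (intro mono) auto
  ultimately show ?thesis by simp
qed

lemma diminishing_insert:
  assumes "A \<subseteq> B"
  shows "g (insert x B) - g B \<le> g (insert x A) - g A"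
  using diminishing[OF assms, of "{x}"] by simp

lemma gain_le_sum_marginals:
  assumes "finite S"
  shows "g (S \<union> B) - g B \<le> (\<Sum>e\<in>S. g (insert e B) - g B)"
  using assms
proof (induction S rule: finite_induct)
  case (insert x F)
  have "g (insert x (F \<union> B)) - g (F \<union> B) \<le> g (insert x B) - g B"
    by (rule diminishing_insert) auto
  then show ?case using insert by simp
qed simp

end

text \<open>Greedy colouring: every item joins a class that is lightest at that moment, so two
  classes never differ by more than \<open>d\<close>. A class then stays within \<open>d\<close> of
  the average.\<close>

lemma balanced_colouring:
  fixes v :: "'a \<Rightarrow> real"
  assumes "finite P" "\<And>e. e \<in> P \<Longrightarrow> 0 \<le> v e \<and> v e \<le> d" "0 < z" "0 \<le> d"
  shows "\<exists>c. \<forall>r<z. (\<Sum>e\<in>P. v e) / real z - d \<le> (\<Sum>e\<in>{e\<in>P. c e = (r::nat)}. v e)"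
proof -
  have "\<exists>c. (\<forall>e\<in>P. c e < z) \<and> (\<forall>r<z. \<forall>s<z. (\<Sum>e\<in>{e\<in>P. c e = (r::nat)}. v e) \<le> (\<Sum>e\<in>{e\<in>P. c e = s}. v e) + d)"
    using assms(1,2)
  proof (induction P rule: finite_induct)
    case empty
    then show ?case using assms by auto
  next
    case (insert x F)
    then obtain c where c: "\<forall>e\<in>F. c e < z"
      "\<And>r s. r < z \<Longrightarrow> s < z \<Longrightarrow> (\<Sum>e\<in>{e\<in>F. c e = (r::nat)}. v e) \<le> (\<Sum>e\<in>{e\<in>F. c e = s}. v e) + d"
      by auto
    define W where "W r = (\<Sum>e\<in>{e\<in>F. c e = r}. v e)" for r
    define m where "m = arg_min_on W {..<z}"
    have m: "m < z" "\<And>r. r < z \<Longrightarrow> W m \<le> W r"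
      using arg_min_if_finite(1)[of "{..<z}" W] arg_min_least[of "{..<z}" _ W] assms(3)
      unfolding m_def by auto
    let ?c = "c(x := m)"
    have W': "(\<Sum>e\<in>{e\<in>insert x F. ?c e = r}. v e) = W r + (if r = m then v x else 0)" for r
    proof -
      have "{e\<in>insert x F. ?c e = r} = (if r = m then insert x {e\<in>F. c e = r} else {e\<in>F. c e = r})"
        using insert.hyps by auto
      then show ?thesis using insert.hyps by (simp add: W_def)
    qed
    have vx: "0 \<le> v x" "v x \<le> d" using insert.prems by auto
    show ?case
    proof (intro exI[of _ ?c] conjI allI impI)
      show "\<forall>e\<in>insert x F. ?c e < z" using c(1) m(1) by auto
      fix r s assume rs: "r < z" "s < z"
      have "W r \<le> W s + d" using c(2) rs by (simp add: W_def)
      then show "(\<Sum>e\<in>{e\<in>insert x F. ?c e = r}. v e) \<le> (\<Sum>e\<in>{e\<in>insert x F. ?c e = s}. v e) + d"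
        unfolding W' using vx m(2)[OF rs(2)] by auto
    qed
  qed
  then obtain c where c: "\<forall>e\<in>P. c e < z"
    "\<And>r s. r < z \<Longrightarrow> s < z \<Longrightarrow> (\<Sum>e\<in>{e\<in>P. c e = (r::nat)}. v e) \<le> (\<Sum>e\<in>{e\<in>P. c e = s}. v e) + d"
    by auto
  show ?thesis
  proof (intro exI[of _ c] allI impI)
    fix r assume r: "r < z"
    have "(\<Sum>e\<in>P. v e) = (\<Sum>s<z. \<Sum>e\<in>{e\<in>P. c e = s}. v e)"
      using sum.group[of P "{..<z}" c v] assms(1) c(1) by (auto simp: image_subset_iff)
    also have "\<dots> \<le> (\<Sum>s<z. (\<Sum>e\<in>{e\<in>P. c e = r}. v e) + d)"
      by (intro sum_mono c(2)) (use r in auto)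
    finally have "(\<Sum>e\<in>P. v e) \<le> real z * ((\<Sum>e\<in>{e\<in>P. c e = r}. v e) + d)" by simp
    then show "(\<Sum>e\<in>P. v e) / real z - d \<le> (\<Sum>e\<in>{e\<in>P. c e = r}. v e)"
      using assms(3) by (simp add: field_simps)
  qed
qed

text \<open>Telescoping: what class \<open>r\<close> contributes on top of the rest of
  \<open>S\<close> is at most what it contributes on top of the classes before it, and the latter
  contributions add up to at most \<open>g S\<close>. Averaging over \<open>z\<close> classes then
  yields one whose removal is cheap.\<close>

lemma (in mono_submod) removal_loss:
  fixes c :: "nat \<Rightarrow> nat"
  shows "(\<Sum>r<z. g S - g (S - {e. e \<in> P \<and> c e = r})) \<le> g S"
proof -
  let ?X = "\<lambda>r. {e. e \<in> P \<and> c e = r}"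
  let ?U = "\<lambda>m. S \<inter> {e. e \<in> P \<and> c e < m}"
  have "(\<Sum>r<m. g S - g (S - ?X r)) \<le> g (?U m)" for m
  proof (induction m)
    case (Suc m)
    have "g ((S - ?X m) \<union> (S \<inter> ?X m)) - g (S - ?X m) \<le> g (?U m \<union> (S \<inter> ?X m)) - g (?U m)"
      by (rule diminishing) auto
    moreover have "(S - ?X m) \<union> (S \<inter> ?X m) = S" by auto
    moreover have "?U m \<union> (S \<inter> ?X m) = ?U (Suc m)" by (auto simp: less_Suc_eq)
    ultimately show ?case using Suc by simp
  qed (simp add: nonneg)
  moreover have "g (?U z) \<le> g S" by (intro mono) auto
  ultimately show ?thesis using order_trans by blast
qed

text \<open>Supplies the threshold item that separates exactly \<open>k\<close> items from the rest.
  Passing from \<open>k\<close> to \<open>k + 1\<close> moves the threshold to the largest item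
  below it.\<close>

lemma kth_largest:
  fixes f :: "'a \<Rightarrow> 'b :: linorder"
  assumes "finite P" "inj_on f P" "1 \<le> k" "k \<le> card P"
  shows "\<exists>t\<in>P. card {e\<in>P. f t \<le> f e} = k"
  using assms(3,4)
proof (induction k rule: dec_induct)
  case base
  then have "P \<noteq> {}" by auto
  then have "Max (f ` P) \<in> f ` P" using assms(1) by simp
  then obtain t where t: "t \<in> P" "f t = Max (f ` P)" by auto
  have "{e\<in>P. f t \<le> f e} = {t}"
  proof -
    have "e = t" if "e \<in> P" "f t \<le> f e" for e
    proof -
      have "f e \<le> f t" using t assms(1) that(1) by simp
      then show ?thesis using that t(1) inj_onD[OF assms(2), of e t] by (meson antisym)
    qed
    then show ?thesis using t(1) by auto
  qed
  then show ?case using t by (intro bexI[of _ t]) auto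
next
  case (step k)
  then obtain t where t: "t \<in> P" "card {e\<in>P. f t \<le> f e} = k" by auto
  define L where "L = {e\<in>P. f e < f t}"
  have L: "finite L" using assms(1) by (simp add: L_def)
  have "P = {e\<in>P. f t \<le> f e} \<union> L" by (auto simp: L_def)
  then have "L \<noteq> {}" using t step.prems by auto
  then have "Max (f ` L) \<in> f ` L" using L by simp
  then obtain s where s: "s \<in> L" "f s = Max (f ` L)" by auto
  have sP: "s \<in> P" "f s < f t" using s by (auto simp: L_def)
  have max: "f e \<le> f s" if "e \<in> L" for e using that s L by simp
  have "{e\<in>P. f s \<le> f e} = insert s {e\<in>P. f t \<le> f e}"
  proof
    show "{e\<in>P. f s \<le> f e} \<subseteq> insert s {e\<in>P. f t \<le> f e}"
    proof
      fix e assume e: "e \<in> {e\<in>P. f s \<le> f e}"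
      show "e \<in> insert s {e\<in>P. f t \<le> f e}"
      proof (cases "f t \<le> f e")
        case False
        then have "e \<in> L" using e by (auto simp: L_def)
        then have "f e = f s" using max e by (auto intro: antisym)
        then have "e = s" using e sP(1) assms(2) by (auto dest: inj_onD)
        then show ?thesis by simp
      qed (use e in auto)
    qed
  qed (use sP in auto)
  then have "card {e\<in>P. f s \<le> f e} = Suc k"
    using t assms(1) sP by simp
  then show ?case using sP by blast
qed

text \<open>
  Collisions between slots are resolved by a partial assignment that is maximal, first in size and
  then in the number of slots holding their own item.
\<close>
lemma slot_assignment:
  fixes J :: "'s set" and own x :: "'s \<Rightarrow> 'e" and ok :: "'s \<Rightarrow> 'e \<Rightarrow> bool"
  assumes "finite J" "finite Pool" "inj_on own J"
    and x: "\<And>j. j \<in> J \<Longrightarrow> x j \<in> Pool \<and> ok j (x j)"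
    and own: "\<And>j. j \<in> J \<Longrightarrow> ok j (own j)"
    and fill: "\<And>j. j \<in> J \<Longrightarrow> own j \<in> Pool \<or>
                  (\<exists>F\<subseteq>Pool. card J \<le> card F \<and> (\<forall>e\<in>F. ok j e))"
  shows "\<exists>y. inj_on y J \<and> x ` J \<subseteq> y ` J \<and> (\<forall>j\<in>J. y j \<in> Pool \<and> ok j (y j))"
proof -
  define part where "part = (\<lambda>(J', y). J' \<subseteq> J \<and> inj_on y J' \<and> x ` J \<subseteq> y ` J' \<and>
      (\<forall>j\<in>J'. y j \<in> Pool \<and> ok j (y j)))"
  define msr where "msr = (\<lambda>(J', y). card J' * (card J + 1) + card {j\<in>J'. y j = own j})"
  have card_own: "card {j\<in>J'. (y :: 's \<Rightarrow> 'e) j = own j} \<le> card J" if "J' \<subseteq> J" for J' y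
    using that assms(1) by (intro card_mono) auto
  have bound: "msr s < card J * (card J + 1) + card J + 1" if part_s: "part s" for s
  proof -
    obtain J' y where s: "s = (J', y)" by (cases s)
    have sub: "J' \<subseteq> J" using part_s by (simp add: part_def s)
    have "card J' * (card J + 1) \<le> card J * (card J + 1)"
      using card_mono[OF assms(1) sub] by (intro mult_right_mono) auto
    then show ?thesis using card_own[OF sub, of y] by (simp add: msr_def s)
  qed
  have "\<exists>s. part s"
  proof -
    \<comment> \<open>One representative slot per value of \<open>x\<close>: every chosen item keeps
      a slot, and slots with a duplicate are released.\<close>
    define J' where "J' = inv_into J x ` (x ` J)"
    have "J' \<subseteq> J" by (auto simp: J'_def intro: inv_into_into)
    moreover have "inj_on x J'"
      unfolding J'_def by (auto intro!: inj_onI simp: f_inv_into_f)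
    moreover have "x ` J \<subseteq> x ` J'"
      unfolding J'_def by (auto simp: f_inv_into_f image_iff)
    ultimately have "part (J', x)" using x unfolding part_def by auto
    then show ?thesis by blast
  qed
  then obtain s where s: "part s" "\<And>s'. part s' \<Longrightarrow> msr s' \<le> msr s"
    using ex_has_greatest_nat[of part _ msr] bound by (metis less_imp_le)
  obtain J' y where s_eq: "s = (J', y)" by (cases s)
  have p: "J' \<subseteq> J" "inj_on y J'" "x ` J \<subseteq> y ` J'" "\<And>j. j \<in> J' \<Longrightarrow> y j \<in> Pool \<and> ok j (y j)"
    using s(1) by (auto simp: part_def s_eq)
  have finJ': "finite J'" using p(1) assms(1) by (rule finite_subset)
  have ext: False if j: "j \<in> J" "j \<notin> J'" and e: "e \<in> Pool" "ok j e" "e \<notin> y ` J'" for j e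
  proof -
    have "part (insert j J', y(j := e))"
      using p j e unfolding part_def by (auto simp: inj_on_def image_iff)
    then have "msr (insert j J', y(j := e)) \<le> msr (J', y)" using s(2) s_eq by blast
    then show False
      using finJ' j(2) card_own[OF p(1), of y] by (simp add: msr_def)
  qed
  have "J' = J"
  proof (rule ccontr)
    assume "J' \<noteq> J"
    then obtain j where j: "j \<in> J" "j \<notin> J'" using p(1) by auto
    show False
    proof (cases "own j \<in> Pool")
      case True
      then have "own j \<in> y ` J'" using ext[OF j True own[OF j(1)]] by auto
      then obtain i where i: "i \<in> J'" "y i = own j" by auto
      have ij: "i \<noteq> j" "own i \<noteq> own j" using i j p(1) assms(3) by (auto dest: inj_onD)
      \<comment> \<open>Slot \<open>i\<close> holds the item owned by slot \<open>j\<close>. Handing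
        the item over and releasing \<open>i\<close> keeps the size and lets one more slot hold its
        own item, because \<open>i\<close> does not own this item.\<close>
      let ?J = "insert j (J' - {i})" and ?y = "y(j := own j)"
      have img: "?y ` ?J = y ` J'"
        using i j by (auto simp: image_iff) (metis)
      have "inj_on ?y ?J"
        using p(2) i j by (auto simp: inj_on_def)
      then have "part (?J, ?y)"
        using p j i img True own[OF j(1)] unfolding part_def by auto
      then have le: "msr (?J, ?y) \<le> msr (J', y)" using s(2) s_eq by blast
      have "card ?J = card J'" using finJ' i j by (simp add: card_Diff_singleton) (metis card_gt_0_iff Suc_pred empty_iff)
      moreover have "{l\<in>?J. ?y l = own l} = insert j {l\<in>J'. y l = own l}"
        using i j ij by auto
      ultimately show False using le finJ' j(2) by (simp add: msr_def)
    next
      case False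
      then obtain F where F: "F \<subseteq> Pool" "card J \<le> card F" "\<forall>e\<in>F. ok j e"
        using fill[OF j(1)] by auto
      have "J' \<subset> J" using p(1) j by auto
      then have "card (y ` J') < card J"
        using card_image_le[OF finJ', of y] psubset_card_mono[OF assms(1)] le_less_trans by blast
      then have "\<not> F \<subseteq> y ` J'"
        using F(2) card_mono[of "y ` J'" F] finJ' by auto
      then obtain e where "e \<in> F" "e \<notin> y ` J'" by auto
      then show False using ext[OF j, of e] F by auto
    qed
  qed
  then show ?thesis using p by (intro exI[of _ y]) auto
qed

section \<open>Continuous greedy with heavy slots\<close>

text \<open>The value \<open>d\<close> says that nothing eligible has been met. The recursion is
  that of the program's loop over the items, so the loop invariant is just a prefix of the
  scan.\<close>

primrec scan :: "nat \<Rightarrow> (nat \<Rightarrow> bool) \<Rightarrow> (nat \<Rightarrow> real) \<Rightarrow> nat \<Rightarrow> nat" where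
  "scan d el sc 0 = d"
| "scan d el sc (Suc e) =
     (let b = scan d el sc e in if el e \<and> (b = d \<or> sc b < sc e) then e else b)"

lemma scan_cases:
  assumes "N \<le> d"
  shows "(scan d el sc N = d \<and> (\<forall>e<N. \<not> el e)) \<or>
    (scan d el sc N < N \<and> el (scan d el sc N) \<and> (\<forall>e<N. el e \<longrightarrow> sc e \<le> sc (scan d el sc N)))"
  using assms
proof (induction N)
  case (Suc N)
  let ?b = "scan d el sc N"
  consider "?b = d" "\<forall>e<N. \<not> el e" | "?b < N" "el ?b" "\<forall>e<N. el e \<longrightarrow> sc e \<le> sc ?b"
    using Suc by auto
  then show ?case
  proof cases
    case 1
    then show ?thesis by (auto simp: Let_def less_Suc_eq)
  next
    case 2
    have "?b \<noteq> d" using 2(1) Suc.prems by simp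
    then show ?thesis using 2
      by (cases "el N \<and> sc ?b < sc N") (fastforce simp: Let_def less_Suc_eq)+
  qed
qed simp

text \<open>
  \<open>h i j\<close> is the item that row \<open>i\<close> puts into slot \<open>j\<close>, with \<open>n\<close> for none; rows \<open>z, \<dots>, z + k - 1\<close> hold
  the spare candidates. Items of weight 0 are neither light nor heavy, so they are always taken.
  Class \<open>Q\<close> and class \<open>Q + 1\<close> both consist of the items of top density; the former is filled by \<open>l\<close>,
  the latter by the marginal gain of \<open>g\<close>.
\<close>
locale knapsack_data =
  fixes g :: "nat set \<Rightarrow> real" and n :: nat and l w :: "nat \<Rightarrow> real" and z k Q t :: nat
    and T Bt :: real and lam c :: "nat \<Rightarrow> nat"
begin

definition unit_heavy :: real where "unit_heavy = T / (real k * real z)"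
definition unit_light :: real where "unit_light = T / real z"
text \<open>Rounding up the \<open>Q + 2\<close> class budgets costs at most one unit each,
  \<open>Bt / (2 * z)\<close> altogether. The other half of \<open>Bt / z\<close> pays for serving
  the top class twice.\<close>

definition unit_weight :: real where "unit_weight = Bt / (2 * real z * (real Q + 2))"

text \<open>This is \<open>z^k\<close> times the expectation of \<open>g\<close> when every slot
  draws one of the \<open>z\<close> rows independently and uniformly. Working with the sum avoids
  divisions and explains the factor \<open>z^k\<close> in the thresholds.\<close>

definition val :: "nat set \<Rightarrow> (nat \<Rightarrow> nat \<Rightarrow> nat) \<Rightarrow> real" where
  "val A h = (\<Sum>\<pi>\<in>PiE {..<k} (\<lambda>_. {..<z}). g (A \<union> (\<lambda>j. h (\<pi> j) j) ` {..<k}))"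

definition marg :: "nat set \<Rightarrow> (nat \<Rightarrow> nat \<Rightarrow> nat) \<Rightarrow> nat \<Rightarrow> real" where
  "marg A h e = val (insert e A) h - val A h"

text \<open>Ties are broken by index, so that \<open>t\<close> cuts a total order and a prescribed
  number of heavy items can be hit exactly. With \<open>t = n\<close> and \<open>w n = 0\<close> no
  item is light.\<close>

definition light :: "nat \<Rightarrow> bool" where
  "light e \<longleftrightarrow> 0 < w e \<and> (w e < w t \<or> (w e = w t \<and> e < t))"

definition heavy :: "nat \<Rightarrow> bool" where
  "heavy e \<longleftrightarrow> 0 < w e \<and> \<not> light e"

text \<open>Bands of the density \<open>l e / w e\<close> of width \<open>unit_light / Bt\<close>,
  multiplied out so that no division by \<open>w e\<close> or \<open>Bt\<close> occurs.\<close>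

definition cls :: "nat \<Rightarrow> nat \<Rightarrow> bool" where
  "cls q e \<longleftrightarrow> (if q < Q
     then real q * unit_light * w e \<le> l e * Bt \<and> l e * Bt < (real q + 1) * unit_light * w e
     else real Q * unit_light * w e \<le> l e * Bt)"

definition pool :: "(nat \<Rightarrow> nat \<Rightarrow> nat) \<Rightarrow> nat set" where
  "pool h = {h i j | i j. i < z + k \<and> j < k}"

text \<open>In a filler row the gain of \<open>g\<close> is of no interest; excluding the pool
  forces every filler to be an item that is new to the table.\<close>

definition helig :: "nat \<Rightarrow> nat \<Rightarrow> nat \<Rightarrow> nat set \<Rightarrow> (nat \<Rightarrow> nat \<Rightarrow> nat) \<Rightarrow> nat \<Rightarrow> bool" where
  "helig v i j A h e \<longleftrightarrow> heavy e \<and> real (lam j) * unit_heavy \<le> l e \<and>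
     (if i < z then real v * unit_heavy * real z ^ k \<le> marg A h e else e \<notin> pool h)"

definition hpick :: "nat \<Rightarrow> nat \<Rightarrow> nat \<Rightarrow> nat set \<Rightarrow> (nat \<Rightarrow> nat \<Rightarrow> nat) \<Rightarrow> nat" where
  "hpick v i j A h = scan n (helig v i j A h) (\<lambda>e. - w e) n"

text \<open>The threshold \<open>V\<close> may look at the current state. This admits both the
  adaptive policy of the analysis and the fixed guess vector of the program.\<close>

primrec hrow :: "(nat \<Rightarrow> nat \<Rightarrow> nat set \<Rightarrow> (nat \<Rightarrow> nat \<Rightarrow> nat) \<Rightarrow> nat) \<Rightarrow> nat \<Rightarrow> nat set \<Rightarrow>
    (nat \<Rightarrow> nat \<Rightarrow> nat) \<Rightarrow> nat \<Rightarrow> (nat \<Rightarrow> nat \<Rightarrow> nat)" where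
  "hrow V i A h 0 = h"
| "hrow V i A h (Suc j) =
     (let h' = hrow V i A h j in h'(i := (h' i)(j := hpick (V i j A h') i j A h')))"

definition lpick :: "nat \<Rightarrow> (nat \<Rightarrow> nat \<Rightarrow> nat) \<Rightarrow> nat set \<Rightarrow> nat" where
  "lpick q h A = scan n (\<lambda>e. e \<notin> A \<and> light e \<and> cls q e)
     (\<lambda>e. (if q = Q then l e else marg A h e) / w e) n"

text \<open>The weight is tested before an item is added, so the share
  \<open>c q * unit_weight / z\<close> of the budget can be exceeded by one light item, that is, by
  at most \<open>w t\<close>.\<close>

primrec lproc :: "nat \<Rightarrow> (nat \<Rightarrow> nat \<Rightarrow> nat) \<Rightarrow> nat set \<Rightarrow> nat \<Rightarrow> nat set \<times> real" where
  "lproc q h A 0 = (A, 0)"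
| "lproc q h A (Suc r) = (case lproc q h A r of (A', W) \<Rightarrow>
     if W * real z < real (c q) * unit_weight \<and> lpick q h A' < n
     then (insert (lpick q h A') A', W + w (lpick q h A')) else (A', W))"

primrec lrow :: "(nat \<Rightarrow> nat \<Rightarrow> nat) \<Rightarrow> nat set \<Rightarrow> nat \<Rightarrow> nat set" where
  "lrow h A 0 = A"
| "lrow h A (Suc q) = fst (lproc q h (lrow h A q) n)"

primrec rows :: "(nat \<Rightarrow> nat \<Rightarrow> nat set \<Rightarrow> (nat \<Rightarrow> nat \<Rightarrow> nat) \<Rightarrow> nat) \<Rightarrow> nat \<Rightarrow>
    nat set \<times> (nat \<Rightarrow> nat \<Rightarrow> nat)" where
  "rows V 0 = ({e. e < n \<and> w e = 0}, \<lambda>_ _. n)"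
| "rows V (Suc i) = (case rows V i of (A, h) \<Rightarrow>
     (let h' = hrow V i A h k in (lrow h' A (Q + 2), h')))"

primrec fillers :: "(nat \<Rightarrow> nat \<Rightarrow> nat set \<Rightarrow> (nat \<Rightarrow> nat \<Rightarrow> nat) \<Rightarrow> nat) \<Rightarrow> nat \<Rightarrow>
    (nat \<Rightarrow> nat \<Rightarrow> nat)" where
  "fillers V 0 = snd (rows V z)"
| "fillers V (Suc r) = hrow V (z + r) (fst (rows V z)) (fillers V r) k"

lemma hrow_untouched:
  shows "i' \<noteq> i \<Longrightarrow> hrow V i A h j i' = h i'"
    and "j \<le> j' \<Longrightarrow> hrow V i A h j i j' = h i j'"
  by (induction j) (auto simp: Let_def)

end

section \<open>Monotonicity and exchange inequalities of the procedure\<close>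

locale knapsack = mono_submod g + knapsack_data g n l w z k Q t T Bt lam c
  for g n l w z k Q t T Bt lam c +
  assumes dummy: "g (insert n S) = g S"
    and w_nonneg: "0 \<le> w e" and l_nonneg: "0 \<le> l e"
    and z_pos: "0 < z" and k_pos: "0 < k" and Q_pos: "0 < Q"
    and T_pos: "0 < T" and Bt_nonneg: "0 \<le> Bt"
begin

text \<open>The order in which tables arise over time: an entry changes only from the empty mark
  \<open>n\<close> to an item. Values grow and marginal gains shrink along this order.\<close>

definition hext :: "(nat \<Rightarrow> nat \<Rightarrow> nat) \<Rightarrow> (nat \<Rightarrow> nat \<Rightarrow> nat) \<Rightarrow> bool" where
  "hext h h' \<longleftrightarrow> (\<forall>i j. h i j = n \<or> h' i j = h i j)"

lemma hext_refl: "hext h h"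
  by (simp add: hext_def)

lemma hext_trans: "hext h h' \<Longrightarrow> hext h' h'' \<Longrightarrow> hext h h''"
  unfolding hext_def by metis

lemma unit_heavy_pos: "0 < unit_heavy"
  using T_pos z_pos k_pos by (simp add: unit_heavy_def)

lemma unit_light_pos: "0 < unit_light"
  using T_pos z_pos by (simp add: unit_light_def)

lemma unit_weight_nonneg: "0 \<le> unit_weight"
  using Bt_nonneg by (simp add: unit_weight_def)

lemma finite_choices: "finite (PiE {..<k} (\<lambda>_. {..<z}))"
  by (intro finite_PiE) auto

lemma card_choices: "card (PiE {..<k} (\<lambda>_. {..<z})) = z ^ k"
  by (simp add: card_PiE)

text \<open>An empty cell holds the worthless item \<open>n\<close>, so the \<open>n\<close> on the
  right absorbs all cells that are filled later.\<close>

lemma choice_subset: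
  assumes "A \<subseteq> A'" "hext h h'"
  shows "A \<union> (\<lambda>j. h (\<pi> j) j) ` {..<k} \<subseteq> insert n (A' \<union> (\<lambda>j. h' (\<pi> j) j) ` {..<k})"
proof -
  have "h (\<pi> j) j \<in> insert n (A' \<union> (\<lambda>j. h' (\<pi> j) j) ` {..<k})" if "j < k" for j
  proof (cases "h (\<pi> j) j = n")
    case False
    then have "h (\<pi> j) j = h' (\<pi> j) j" using assms(2) unfolding hext_def by metis
    then show ?thesis using that by auto
  qed simp
  then show ?thesis using assms(1) by auto
qed

lemma val_mono:
  assumes "A \<subseteq> A'" "hext h h'"
  shows "val A h \<le> val A' h'"
  unfolding val_def
proof (rule sum_mono)
  fix \<pi>
  show "g (A \<union> (\<lambda>j. h (\<pi> j) j) ` {..<k}) \<le> g (A' \<union> (\<lambda>j. h' (\<pi> j) j) ` {..<k})"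
    using mono[OF choice_subset[OF assms]] dummy by simp
qed

lemma marg_nonneg: "0 \<le> marg A h e"
  using val_mono[of A "insert e A" h h] by (simp add: marg_def hext_refl subset_insertI)

lemma marg_in: "e \<in> A \<Longrightarrow> marg A h e = 0"
  by (simp add: marg_def insert_absorb)

lemma marg_sum: "marg A h e = (\<Sum>\<pi>\<in>PiE {..<k} (\<lambda>_. {..<z}).
    g (insert e (A \<union> (\<lambda>j. h (\<pi> j) j) ` {..<k})) - g (A \<union> (\<lambda>j. h (\<pi> j) j) ` {..<k}))"
  by (simp add: marg_def val_def sum_subtractf)

text \<open>Lets the gains of optimal items be measured at the end of a row although the picks
  happened earlier.\<close>

lemma marg_antimono:
  assumes "A \<subseteq> A'" "hext h h'"
  shows "marg A' h' e \<le> marg A h e"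
  unfolding marg_sum
proof (rule sum_mono)
  fix \<pi>
  let ?R = "A \<union> (\<lambda>j. h (\<pi> j) j) ` {..<k}" and ?R' = "A' \<union> (\<lambda>j. h' (\<pi> j) j) ` {..<k}"
  have "g (insert e (insert n ?R')) - g (insert n ?R') \<le> g (insert e ?R) - g ?R"
    by (rule diminishing_insert[OF choice_subset[OF assms]])
  then show "g (insert e ?R') - g ?R' \<le> g (insert e ?R) - g ?R"
    using dummy by (simp add: insert_commute[of e n])
qed

lemma marg_le: "marg A h e \<le> g {e} * real z ^ k"
proof -
  have "marg A h e \<le> (\<Sum>\<pi>\<in>PiE {..<k} (\<lambda>_. {..<z}). g {e})"
    unfolding marg_sum
  proof (rule sum_mono)
    fix \<pi>
    let ?R = "A \<union> (\<lambda>j. h (\<pi> j) j) ` {..<k}"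
    have "g (insert e ?R) - g ?R \<le> g (insert e {}) - g {}"
      by (rule diminishing_insert) auto
    then show "g (insert e ?R) - g ?R \<le> g {e}" using nonneg[of "{}"] by simp
  qed
  also have "\<dots> = g {e} * real z ^ k"
    by (simp only: sum_constant card_choices) (simp add: mult.commute)
  finally show ?thesis .
qed

text \<open>Slot \<open>j\<close> draws row \<open>i\<close> in one of \<open>z\<close> cases, so
  filling the cell realises a \<open>1 / z\<close> fraction of the marginal gain. The fraction is
  not smaller, because exactly in these cases slot \<open>j\<close> was empty, which makes the base
  set smallest and the gain largest.\<close>

lemma heavy_gain:
  assumes h: "h i j = n" and ij: "i < z" "j < k"
  shows "marg A h e / real z \<le> val A (h(i := (h i)(j := e))) - val A h"
proof -
  let ?P = "PiE {..<k} (\<lambda>_. {..<z})"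
  let ?h' = "h(i := (h i)(j := e))"
  define R where "R \<pi> = A \<union> (\<lambda>j. h (\<pi> j) j) ` {..<k}" for \<pi> :: "nat \<Rightarrow> nat"
  define R' where "R' \<pi> = A \<union> (\<lambda>j. ?h' (\<pi> j) j) ` {..<k}" for \<pi> :: "nat \<Rightarrow> nat"
  define m where "m \<pi> = g (insert e (R \<pi>)) - g (R \<pi>)" for \<pi>
  have R': "g (R' \<pi>) - g (R \<pi>) = (if \<pi> j = i then m \<pi> else 0)" for \<pi>
  proof (cases "\<pi> j = i")
    case True
    have *: "(\<lambda>j. ?h' (\<pi> j) j) ` {..<k} = insert e ((\<lambda>j. h (\<pi> j) j) ` ({..<k} - {j}))"
    proof -
      have eq: "(\<lambda>j. ?h' (\<pi> j) j) = (\<lambda>j. h (\<pi> j) j)(j := e)"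
        using True by auto
      show ?thesis unfolding eq fun_upd_image using ij by simp
    qed
    have **: "(\<lambda>j. h (\<pi> j) j) ` {..<k} = insert n ((\<lambda>j. h (\<pi> j) j) ` ({..<k} - {j}))"
    proof -
      have "{..<k} = insert j ({..<k} - {j})" using ij by auto
      then have "(\<lambda>j. h (\<pi> j) j) ` {..<k} = (\<lambda>j. h (\<pi> j) j) ` insert j ({..<k} - {j})" by simp
      also have "\<dots> = insert (h (\<pi> j) j) ((\<lambda>j. h (\<pi> j) j) ` ({..<k} - {j}))" by (rule image_insert)
      finally show ?thesis using True h by simp
    qed
    show ?thesis
      unfolding m_def R_def R'_def * ** using True dummy by (simp add: insert_commute[of e n])
  next
    case False
    then have "(\<lambda>j. ?h' (\<pi> j) j) ` {..<k} = (\<lambda>j. h (\<pi> j) j) ` {..<k}"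
      by (intro image_cong) auto
    then show ?thesis using False by (simp add: R_def R'_def)
  qed
  have m_upd: "m \<pi> \<le> m (\<pi>(j := i))" for \<pi>
  proof -
    have "R (\<pi>(j := i)) \<subseteq> insert n (R \<pi>)"
    proof -
      have eq: "(\<lambda>j'. h ((\<pi>(j := i)) j') j') = (\<lambda>j'. h (\<pi> j') j')(j := n)"
        using h by auto
      show ?thesis unfolding R_def eq fun_upd_image by auto
    qed
    then have "g (insert e (insert n (R \<pi>))) - g (insert n (R \<pi>)) \<le> m (\<pi>(j := i))"
      unfolding m_def by (rule diminishing_insert)
    then show ?thesis using dummy by (simp add: m_def insert_commute[of e n])
  qed
  have "marg A h e = (\<Sum>\<pi>\<in>?P. m \<pi>)"
    by (simp add: marg_sum m_def R_def)
  also have "\<dots> \<le> (\<Sum>\<pi>\<in>?P. m (\<pi>(j := i)))"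
    by (intro sum_mono m_upd)
  \<comment> \<open>A choice with \<open>\<pi> j = i\<close> comes from exactly \<open>z\<close>
    choices, which differ only in slot \<open>j\<close>.\<close>
  also have "\<dots> = (\<Sum>(a, \<pi>)\<in>{..<z} \<times> {\<pi>\<in>?P. \<pi> j = i}. m \<pi>)"
    by (rule sum.reindex_bij_witness[where j = "\<lambda>\<pi>. (\<pi> j, \<pi>(j := i))" and i = "\<lambda>(a, \<pi>). \<pi>(j := a)"])
       (use ij in \<open>auto simp: PiE_iff extensional_def fun_upd_idem\<close>)
  also have "\<dots> = real z * (\<Sum>\<pi>\<in>{\<pi>\<in>?P. \<pi> j = i}. m \<pi>)"
    by (simp add: sum.cartesian_product[symmetric])
  also have "(\<Sum>\<pi>\<in>{\<pi>\<in>?P. \<pi> j = i}. m \<pi>) = (\<Sum>\<pi>\<in>?P. g (R' \<pi>) - g (R \<pi>))"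
    unfolding R' by (rule sum.inter_filter[OF finite_choices])
  also have "\<dots> = val A ?h' - val A h"
    by (simp add: val_def R_def R'_def sum_subtractf)
  finally show ?thesis using z_pos by (simp add: field_simps)
qed

text \<open>The last disjunct counts rounds: as long as neither the budget nor the class is used up,
  each round adds a new item. This is why \<open>n\<close> rounds are always enough.\<close>

lemma lproc_gets:
  assumes "lproc q h A r = (A', W)"
  shows "A \<subseteq> A'" and "A' - A \<subseteq> {e. e < n \<and> light e \<and> cls q e}"
    and "finite A \<Longrightarrow> sum w A' = sum w A + W"
    and "0 \<le> W" and "W \<le> real (c q) * unit_weight / real z + w t"
    and "real (c q) * unit_weight \<le> W * real z \<or> (\<forall>e<n. light e \<longrightarrow> cls q e \<longrightarrow> e \<in> A') \<or>
           r \<le> card (A' - A)"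
proof -
  have "A \<subseteq> A' \<and> A' - A \<subseteq> {e. e < n \<and> light e \<and> cls q e} \<and> (finite A \<longrightarrow> sum w A' = sum w A + W)
     \<and> 0 \<le> W \<and> W \<le> real (c q) * unit_weight / real z + w t \<and>
     (real (c q) * unit_weight \<le> W * real z \<or> (\<forall>e<n. light e \<longrightarrow> cls q e \<longrightarrow> e \<in> A') \<or>
           r \<le> card (A' - A))"
    using assms
  proof (induction r arbitrary: A' W)
    case 0
    then show ?case using w_nonneg[of t] unit_weight_nonneg by simp
  next
    case (Suc r)
    obtain B V where BV: "lproc q h A r = (B, V)" by (cases "lproc q h A r")
    note IH = Suc.IH[OF BV]
    define e where "e = lpick q h B"
    have sc: "(e = n \<and> (\<forall>x<n. \<not> (x \<notin> B \<and> light x \<and> cls q x))) \<or>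
      (e < n \<and> e \<notin> B \<and> light e \<and> cls q e)"
      using scan_cases[of n n "\<lambda>e. e \<notin> B \<and> light e \<and> cls q e"
        "\<lambda>e. (if q = Q then l e else marg B h e) / w e"]
      unfolding e_def lpick_def by auto
    show ?case
    proof (cases "V * real z < real (c q) * unit_weight \<and> e < n")
      case True
      then have eq: "A' = insert e B" "W = V + w e"
        using Suc.prems BV by (auto simp: e_def)
      have e: "e < n" "e \<notin> B" "light e" "cls q e" using sc True by auto
      have fin: "finite (B - A)" using IH finite_subset[of "B - A" "{..<n}"] by auto
      have "V < real (c q) * unit_weight / real z" using True z_pos by (simp add: field_simps)
      moreover have "w e \<le> w t" using e(3) by (auto simp: light_def)
      moreover have "finite B" if "finite A" using fin that by simp
      moreover have "insert e B - A = insert e (B - A)" using e IH by auto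
      ultimately show ?thesis
        using IH e True fin w_nonneg[of e] by (auto simp: eq)
    next
      case False
      then have eq: "A' = B" "W = V" using Suc.prems BV by (auto simp: e_def)
      show ?thesis using IH False sc unfolding eq by (auto simp: not_less)
    qed
  qed
  then show "A \<subseteq> A'" "A' - A \<subseteq> {e. e < n \<and> light e \<and> cls q e}"
    "finite A \<Longrightarrow> sum w A' = sum w A + W"
    "0 \<le> W" "W \<le> real (c q) * unit_weight / real z + w t"
    "real (c q) * unit_weight \<le> W * real z \<or> (\<forall>e<n. light e \<longrightarrow> cls q e \<longrightarrow> e \<in> A') \<or>
       r \<le> card (A' - A)"
    by auto
qed

lemma lproc_saturated:
  assumes "lproc q h A n = (A', W)" "A \<subseteq> {..<n}"
  shows "real (c q) * unit_weight \<le> W * real z \<or> (\<forall>e<n. light e \<longrightarrow> cls q e \<longrightarrow> e \<in> A')"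
proof -
  have "A' - A = {..<n}" if "n \<le> card (A' - A)"
    using lproc_gets(2)[OF assms(1)] that by (intro card_seteq) auto
  then show ?thesis using lproc_gets(6)[OF assms(1)] by auto
qed

lemma lproc_step:
  assumes "lproc q h A r = (B, V)" "lproc q h A (Suc r) = (A', W)"
  shows "(A' = B \<and> W = V) \<or> (\<exists>e<n. e \<notin> B \<and> A' = insert e B \<and> W = V + w e \<and> light e \<and> cls q e \<and>
     (\<forall>x<n. x \<notin> B \<longrightarrow> light x \<longrightarrow> cls q x \<longrightarrow>
       (if q = Q then l x else marg B h x) * w e \<le> (if q = Q then l e else marg B h e) * w x))"
proof -
  define e where "e = lpick q h B"
  let ?k = "\<lambda>e. if q = Q then l e else marg B h e"
  have sc: "(e = n) \<or> (e < n \<and> e \<notin> B \<and> light e \<and> cls q e \<and>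
      (\<forall>x<n. x \<notin> B \<and> light x \<and> cls q x \<longrightarrow> ?k x / w x \<le> ?k e / w e))"
    using scan_cases[of n n "\<lambda>e. e \<notin> B \<and> light e \<and> cls q e" "\<lambda>e. ?k e / w e"]
    unfolding e_def lpick_def by auto
  show ?thesis
  proof (cases "V * real z < real (c q) * unit_weight \<and> e < n")
    case True
    then have eq: "A' = insert e B" "W = V + w e" using assms by (auto simp: e_def)
    have e: "e < n" "e \<notin> B" "light e" "cls q e"
      "\<And>x. x < n \<Longrightarrow> x \<notin> B \<Longrightarrow> light x \<Longrightarrow> cls q x \<Longrightarrow> ?k x / w x \<le> ?k e / w e"
      using sc True by auto
    have "?k x * w e \<le> ?k e * w x" if "x < n" "x \<notin> B" "light x" "cls q x" for x
    proof -
      have "0 < w x" "0 < w e" using that(3) e(3) by (auto simp: light_def)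
      then show ?thesis using e(5)[OF that] by (simp only: divide_le_eq pos_le_divide_eq) (simp add: field_simps)
    qed
    then show ?thesis using e eq by blast
  next
    case False
    then show ?thesis using assms by (auto simp: e_def)
  qed
qed

text \<open>When \<open>e\<close> is picked, each \<open>x\<close> of \<open>S\<close> still outside
  has at most its density, and each \<open>x\<close> taken by the end has marginal gain 0 there.
  Hence \<open>w e\<close> times the final gain of \<open>x\<close> is at most \<open>w x\<close>
  times the gain of \<open>e\<close>. Summing over the picks and over \<open>S\<close> gives the
  product form, which needs no positive weight.\<close>

lemma lproc_gain:
  assumes run: "lproc q h A r = (A', W)" and q: "q \<noteq> Q"
    and S: "finite S" "S \<subseteq> {e. e < n \<and> light e \<and> cls q e}"
    and later: "A' \<subseteq> A2" "hext h h2"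
  shows "W * (\<Sum>x\<in>S. marg A2 h2 x) \<le> sum w S * (val A' h - val A h)"
  using run later(1)
proof (induction r arbitrary: A' W)
  case (Suc r)
  obtain B V where BV: "lproc q h A r = (B, V)" by (cases "lproc q h A r")
  from lproc_step[OF BV Suc.prems(1)] show ?case
  proof (elim disjE exE conjE)
    assume "A' = B" "W = V"
    then show ?thesis using Suc.IH[OF BV] Suc.prems by simp
  next
    fix e assume e: "e < n" "e \<notin> B" "A' = insert e B" "W = V + w e" "light e" "cls q e"
      "\<forall>x<n. x \<notin> B \<longrightarrow> light x \<longrightarrow> cls q x \<longrightarrow>
       (if q = Q then l x else marg B h x) * w e \<le> (if q = Q then l e else marg B h e) * w x"
    have IH: "V * (\<Sum>x\<in>S. marg A2 h2 x) \<le> sum w S * (val B h - val A h)"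
      using Suc.IH[OF BV] Suc.prems e(3) by auto
    have "w e * marg A2 h2 x \<le> w x * marg B h e" if x: "x \<in> S" for x
    proof (cases "x \<in> A2")
      case True
      then show ?thesis using marg_in w_nonneg marg_nonneg by simp
    next
      case False
      have "x \<notin> B" using False Suc.prems(2) e(3) by auto
      then have "marg B h x * w e \<le> marg B h e * w x" using e(7) x S q by auto
      moreover have "marg A2 h2 x \<le> marg B h x"
        using Suc.prems(2) e(3) later(2) by (intro marg_antimono) auto
      ultimately show ?thesis
        using mult_left_mono[of "marg A2 h2 x" "marg B h x" "w e"] w_nonneg[of e]
        by (simp add: mult.commute)
    qed
    then have "w e * (\<Sum>x\<in>S. marg A2 h2 x) \<le> sum w S * marg B h e"
      by (simp add: sum_distrib_left sum_distrib_right sum_mono)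
    moreover have "val A' h = val B h + marg B h e" by (simp add: e(3) marg_def)
    ultimately show ?thesis using IH e(4) by (simp add: algebra_simps)
  qed
qed simp

text \<open>A pick \<open>e\<close> outside \<open>S\<close> brings \<open>l e * w x\<close>, at
  least \<open>l x * w e\<close> by density; a pick inside \<open>S\<close> is credited with
  \<open>l x * w e\<close> by definition. So the whole weight \<open>W\<close> counts at the density
  of an item \<open>x\<close> that was left out.\<close>

lemma lproc_linear_gain:
  assumes run: "lproc Q h A r = (A', W)" and fin: "finite A"
    and x: "x < n" "light x" "cls Q x" "x \<notin> A'"
  shows "sum l {e\<in>A. light e \<and> cls Q e \<and> e \<notin> S} * w x + l x * sum w (A \<inter> S) + l x * W
       \<le> sum l {e\<in>A'. light e \<and> cls Q e \<and> e \<notin> S} * w x + l x * sum w (A' \<inter> S)"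
  using run x(4)
proof (induction r arbitrary: A' W)
  case (Suc r)
  obtain B V where BV: "lproc Q h A r = (B, V)" by (cases "lproc Q h A r")
  have finB: "finite B"
    using lproc_gets(1,2)[OF BV] fin finite_subset[of "B - A" "{..<n}"] by auto
  from lproc_step[OF BV Suc.prems(1)] show ?case
  proof (elim disjE exE conjE)
    assume "A' = B" "W = V"
    then show ?thesis using Suc.IH[OF BV] Suc.prems by simp
  next
    fix e assume e: "e < n" "e \<notin> B" "A' = insert e B" "W = V + w e" "light e" "cls Q e"
      "\<forall>x<n. x \<notin> B \<longrightarrow> light x \<longrightarrow> cls Q x \<longrightarrow>
       (if Q = Q then l x else marg B h x) * w e \<le> (if Q = Q then l e else marg B h e) * w x"
    have IH: "sum l {e\<in>A. light e \<and> cls Q e \<and> e \<notin> S} * w x + l x * sum w (A \<inter> S) + l x * V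
       \<le> sum l {e\<in>B. light e \<and> cls Q e \<and> e \<notin> S} * w x + l x * sum w (B \<inter> S)"
      using Suc.IH[OF BV] Suc.prems e(3) by auto
    have "l x * w e \<le> l e * w x" using e(7) x Suc.prems(2) e(3) by auto
    moreover have "{e\<in>A'. light e \<and> cls Q e \<and> e \<notin> S} = (if e \<in> S then {e\<in>B. light e \<and> cls Q e \<and> e \<notin> S} else insert e {e\<in>B. light e \<and> cls Q e \<and> e \<notin> S})"
      using e by auto
    moreover have "A' \<inter> S = (if e \<in> S then insert e (B \<inter> S) else B \<inter> S)"
      using e by auto
    ultimately show ?thesis using IH e(2,4) finB by (auto simp: algebra_simps)
  qed
qed simp

end

section \<open>One row of the procedure against the trimmed optimum\<close>

locale knapsack_opt = knapsack g n l w z k Q t T Bt lam c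
  for g n l w z k Q t T Bt lam c +
  fixes own :: "nat \<Rightarrow> nat" and p :: nat and Ls :: "nat set"
  assumes p_le: "p \<le> k" and own_inj: "inj_on own {..<p}"
    and own: "j < p \<Longrightarrow> own j < n \<and> heavy (own j)"
    and lam_own: "j < p \<Longrightarrow> real (lam j) * unit_heavy \<le> l (own j)"
    and lam_own_tight: "j < p \<Longrightarrow> l (own j) \<le> (real (lam j) + 1) * unit_heavy"
    and lam_idle: "p \<le> j \<Longrightarrow> j < k \<Longrightarrow> e < n \<Longrightarrow> l e < real (lam j) * unit_heavy"
    and Ls: "Ls \<subseteq> {..<n}" "e \<in> Ls \<Longrightarrow> light e"
    and c_ge: "q < Q + 2 \<Longrightarrow> sum w {e\<in>Ls. cls q e} \<le> real (c q) * unit_weight"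
    and Bt_ge: "sum w Ls \<le> Bt"
begin

text \<open>The right guess: the gain of the optimal item rounded down to units. Then
  \<open>own j\<close> itself passes the threshold, and any other item that passes is worse by at
  most one unit.\<close>

definition policy :: "nat \<Rightarrow> nat \<Rightarrow> nat set \<Rightarrow> (nat \<Rightarrow> nat \<Rightarrow> nat) \<Rightarrow> nat" where
  "policy i j A h = nat \<lfloor>marg A h (own j) / (unit_heavy * real z ^ k)\<rfloor>"

abbreviation "hrw \<equiv> hrow policy"

text \<open>The items that may replace \<open>own j\<close> in the final set: no heavier, and with
  the same guarantee for the linear value. The gain of \<open>g\<close> is absent because it is
  accounted for by the average over row choices.\<close>

definition good :: "nat \<Rightarrow> nat \<Rightarrow> bool" where
  "good j e \<longleftrightarrow> e < n \<and> heavy e \<and> w e \<le> w (own j) \<and> real (lam j) * unit_heavy \<le> l e"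

lemma finite_Ls: "finite Ls"
  using Ls finite_subset by auto

lemma zk_pos: "0 < real z ^ k"
  using z_pos by simp

lemma policy_bounds:
  shows "real (policy i j A h) * unit_heavy * real z ^ k \<le> marg A h (own j)"
    and "marg A h (own j) \<le> real (policy i j A h) * unit_heavy * real z ^ k + unit_heavy * real z ^ k"
proof -
  let ?x = "marg A h (own j) / (unit_heavy * real z ^ k)"
  have pos: "0 < unit_heavy * real z ^ k" using unit_heavy_pos zk_pos by simp
  have "0 \<le> ?x" using marg_nonneg pos by simp
  then have "real (policy i j A h) = of_int \<lfloor>?x\<rfloor>" by (simp add: policy_def)
  then have "real (policy i j A h) \<le> ?x" "?x \<le> real (policy i j A h) + 1" by linarith+
  then show "real (policy i j A h) * unit_heavy * real z ^ k \<le> marg A h (own j)"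
    and "marg A h (own j) \<le> real (policy i j A h) * unit_heavy * real z ^ k + unit_heavy * real z ^ k"
    using pos by (simp_all add: pos_le_divide_eq pos_divide_le_eq algebra_simps)
qed

text \<open>A marginal gain is at most \<open>T\<close> per choice, which is \<open>k * z\<close>
  units. This keeps the guesses in a range that depends on \<open>z\<close> only.\<close>

lemma policy_le: "j < p \<Longrightarrow> g {own j} \<le> T \<Longrightarrow> policy i j A h \<le> k * z"
proof -
  assume "j < p" and gT: "g {own j} \<le> T"
  have "real (policy i j A h) * unit_heavy * real z ^ k \<le> T * real z ^ k"
    using policy_bounds(1)[of i j A h] marg_le[of A h "own j"] mult_right_mono[OF gT, of "real z ^ k"] zk_pos
    by linarith
  then have "real (policy i j A h) * unit_heavy \<le> T" using zk_pos by simp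
  then have "real (policy i j A h) \<le> real (k * z)"
    using T_pos z_pos k_pos by (simp add: unit_heavy_def field_simps)
  then show ?thesis by linarith
qed

lemma hpick_cases:
  "(hpick v i j A h = n \<and> (\<forall>e<n. \<not> helig v i j A h e)) \<or>
   (hpick v i j A h < n \<and> helig v i j A h (hpick v i j A h) \<and>
     (\<forall>e<n. helig v i j A h e \<longrightarrow> - w e \<le> - w (hpick v i j A h)))"
  unfolding hpick_def using scan_cases[of n n "helig v i j A h" "\<lambda>e. - w e"] by blast

lemma hpick_optimal:
  assumes "j < p" "if i < z then real v * unit_heavy * real z ^ k \<le> marg A h (own j) else own j \<notin> pool h"
  shows "good j (hpick v i j A h)" and "helig v i j A h (hpick v i j A h)"
proof -
  have el: "helig v i j A h (own j)" "own j < n"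
    using own lam_own assms unfolding helig_def by simp_all
  then have "hpick v i j A h \<noteq> n" using hpick_cases[of v i j A h] by auto
  then have *: "hpick v i j A h < n" "helig v i j A h (hpick v i j A h)" "w (hpick v i j A h) \<le> w (own j)"
    using hpick_cases[of v i j A h] el by auto
  show "helig v i j A h (hpick v i j A h)" by (rule *(2))
  show "good j (hpick v i j A h)" using * unfolding good_def helig_def by simp
qed

text \<open>\<open>own j\<close> is eligible under the rounded threshold, so a lightest eligible
  item weighs no more, and the threshold itself secures the gain.\<close>

lemma hpick_busy:
  assumes "i < z" "j < p"
  shows "good j (hpick (policy i j A h) i j A h)"
    and "marg A h (own j) - unit_heavy * real z ^ k \<le> marg A h (hpick (policy i j A h) i j A h)"
proof -
  have **: "real (policy i j A h) * unit_heavy * real z ^ k \<le> marg A h (own j)"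
    by (rule policy_bounds)
  then have c: "if i < z then real (policy i j A h) * unit_heavy * real z ^ k \<le> marg A h (own j) else own j \<notin> pool h"
    using assms(1) by simp
  note * = hpick_optimal[OF assms(2) c]
  show "good j (hpick (policy i j A h) i j A h)" by (rule *(1))
  have "real (policy i j A h) * unit_heavy * real z ^ k \<le> marg A h (hpick (policy i j A h) i j A h)"
    using *(2) assms(1) by (simp add: helig_def)
  then show "marg A h (own j) - unit_heavy * real z ^ k \<le> marg A h (hpick (policy i j A h) i j A h)"
    using policy_bounds(2)[of A h j i] by linarith
qed

text \<open>Slots without an optimal item are switched off by a linear threshold that no item
  reaches.\<close>

lemma hpick_idle:
  assumes "p \<le> j" "j < k"
  shows "hpick v i j A h = n"
proof (rule ccontr)
  assume "hpick v i j A h \<noteq> n"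
  then have "hpick v i j A h < n" "helig v i j A h (hpick v i j A h)"
    using hpick_cases[of v i j A h] by auto
  then show False using lam_idle[OF assms] by (fastforce simp: helig_def)
qed

lemma hrow_Suc_at: "hrow V i A h (Suc j) i j = hpick (V i j A (hrow V i A h j)) i j A (hrow V i A h j)"
  by (simp add: Let_def)

lemma hrow_idle:
  assumes "\<And>j. h i j = n" "p \<le> j'" "j \<le> k"
  shows "hrow V i A h j i j' = n"
  using assms(3)
proof (induction j)
  case (Suc j)
  then show ?case using assms hpick_idle[of j] by (auto simp: Let_def)
qed (use assms in simp)

lemma hrow_good:
  assumes "i < z" "j' < p" "j' < j"
  shows "good j' (hrw i A h j i j')"
  using assms(3)
proof (induction j)
  case (Suc j)
  then show ?case using hpick_busy(1)[OF assms(1,2)]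
    by (cases "j' = j") (auto simp: Let_def)
qed simp

lemma hrow_hext:
  assumes "\<And>j. h i j = n" "j \<le> j'"
  shows "hext (hrow V i A h j) (hrow V i A h j')"
  using assms(2)
proof (induction j' rule: dec_induct)
  case (step m)
  have "hrow V i A h m i m = n" using hrow_untouched(2)[of m m V i A h] assms(1) by simp
  then have "hext (hrow V i A h m) (hrow V i A h (Suc m))"
    by (auto simp: hext_def Let_def)
  then show ?case using step.IH hext_trans by blast
qed (rule hext_refl)

text \<open>The gains refer to one later state \<open>A2\<close>, \<open>h2\<close>, common to all
  slots and light classes of the row. That is legitimate because marginal gains only shrink, and it
  lets the contributions be added up against the whole optimum.\<close>

lemma hrow_gain:
  assumes i: "i < z" and h: "\<And>j. h i j = n" and j: "j \<le> k"
    and later: "A \<subseteq> A2" "hext (hrw i A h j) h2"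
  shows "(\<Sum>m\<in>{..<j} \<inter> {..<p}. marg A2 h2 (own m) - unit_heavy * real z ^ k)
    \<le> real z * (val A (hrw i A h j) - val A h)"
  using j later(2)
proof (induction j)
  case (Suc j)
  let ?h = "hrw i A h j" and ?h' = "hrw i A h (Suc j)"
  have ext: "hext ?h ?h'" using hrow_hext[of h i j "Suc j" policy A] h by simp
  have e2: "hext ?h h2" by (rule hext_trans[OF ext Suc.prems(2)])
  have IH: "(\<Sum>m\<in>{..<j} \<inter> {..<p}. marg A2 h2 (own m) - unit_heavy * real z ^ k)
    \<le> real z * (val A ?h - val A h)"
    using Suc.IH[OF _ e2] Suc.prems(1) by simp
  have "{..<Suc j} \<inter> {..<p} = (if j < p then insert j ({..<j} \<inter> {..<p}) else {..<j} \<inter> {..<p})"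
    by (auto simp: less_Suc_eq)
  moreover have "real z * (val A ?h' - val A ?h) \<ge>
      (if j < p then marg A2 h2 (own j) - unit_heavy * real z ^ k else 0)"
  proof (cases "j < p")
    case True
    have "?h i j = n" using hrow_untouched(2)[of j j policy i A h] h by simp
    then have "marg A ?h (hpick (policy i j A ?h) i j A ?h) / real z \<le> val A ?h' - val A ?h"
      using heavy_gain[of ?h i j A] i Suc.prems by (simp add: Let_def)
    moreover have "marg A2 h2 (own j) \<le> marg A ?h (own j)"
      by (rule marg_antimono[OF later(1) e2])
    moreover have "0 < real z" using z_pos by simp
    ultimately show ?thesis using hpick_busy(2)[OF i True, of A ?h] True
      by (simp only: pos_divide_le_eq if_True mult.commute[of "real z"])
  next
    case False
    then show ?thesis using val_mono[OF order_refl ext] by simp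
  qed
  moreover have "real z * (val A ?h' - val A h) = real z * (val A ?h - val A h) + real z * (val A ?h' - val A ?h)"
    by (simp add: right_diff_distrib)
  ultimately show ?case using IH by (cases "j < p") (simp_all only: if_True if_False, simp_all)
qed simp

lemma lrow_mono: "m \<le> m' \<Longrightarrow> lrow h A m \<subseteq> lrow h A m'"
proof (induction m' rule: dec_induct)
  case (step m')
  obtain A' W where AW: "lproc m' h (lrow h A m') n = (A', W)" by fastforce
  show ?case using step lproc_gets(1)[OF AW] AW by auto
qed simp

lemma lrow_light: "lrow h A m - A \<subseteq> {e. e < n \<and> light e}"
proof (induction m)
  case (Suc m)
  obtain A' W where AW: "lproc m h (lrow h A m) n = (A', W)" by fastforce
  show ?case using Suc lproc_gets(2)[OF AW] AW by auto
qed simp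

lemma lrow_sub: "A \<subseteq> {..<n} \<Longrightarrow> lrow h A m \<subseteq> {..<n}"
  using lrow_light[of h A m] by auto

lemma lrow_weight:
  assumes "A \<subseteq> {..<n}"
  shows "sum w (lrow h A m) \<le> sum w A + (\<Sum>q<m. real (c q) * unit_weight / real z + w t)"
proof (induction m)
  case (Suc m)
  obtain A' W where AW: "lproc m h (lrow h A m) n = (A', W)" by fastforce
  have "finite (lrow h A m)" by (rule finite_subset[OF lrow_sub[OF assms]]) simp
  then show ?case using Suc lproc_gets(3,5)[OF AW] AW by simp
qed simp

text \<open>Class \<open>Q\<close> is left out since it is filled by linear density. The same items
  are served with respect to \<open>g\<close> as class \<open>Q + 1\<close>.\<close>

lemma lrow_gain:
  assumes A: "A \<subseteq> {..<n}" and later: "lrow h A m \<subseteq> A2" "hext h h2" and m: "m \<le> Q + 2"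
  shows "(\<Sum>q\<in>{..<m} - {Q}. \<Sum>x\<in>{e\<in>Ls. cls q e}. marg A2 h2 x) \<le> real z * (val (lrow h A m) h - val A h)"
  using later(1) m
proof (induction m)
  case (Suc m)
  obtain A' W where AW: "lproc m h (lrow h A m) n = (A', W)" by fastforce
  let ?B = "lrow h A m" and ?S = "{e\<in>Ls. cls m e}"
  have sub: "?B \<subseteq> A'" "A' \<subseteq> A2" using lproc_gets(1)[OF AW] Suc.prems(1) AW by auto
  have IH: "(\<Sum>q\<in>{..<m} - {Q}. \<Sum>x\<in>{e\<in>Ls. cls q e}. marg A2 h2 x) \<le> real z * (val ?B h - val A h)"
    using Suc sub by auto
  have up: "0 \<le> val A' h - val ?B h" using val_mono[OF sub(1) hext_refl, of h] by simp
  have new: "(\<Sum>x\<in>?S. marg A2 h2 x) \<le> real z * (val A' h - val ?B h)" if mQ: "m \<noteq> Q"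
  proof -
    have gain: "W * (\<Sum>x\<in>?S. marg A2 h2 x) \<le> sum w ?S * (val A' h - val ?B h)"
      by (rule lproc_gain[OF AW mQ _ _ sub(2) later(2)]) (use finite_Ls Ls in auto)
    from lproc_saturated[OF AW lrow_sub[OF A]] show ?thesis
    proof
      assume "real (c m) * unit_weight \<le> W * real z"
      then have wS: "sum w ?S \<le> W * real z" using c_ge[of m] Suc.prems by simp
      have W0: "0 \<le> W" using lproc_gets(4)[OF AW] .
      show ?thesis
      \<comment> \<open>Dividing by \<open>W\<close> requires a positive weight. If \<open>W\<close>
        is 0, the optimal items of the class weigh nothing, and since light items have positive
        weight there are none.\<close>
      proof (cases "W = 0")
        case True
        have "?S = {}"
        proof (rule ccontr)
          assume "?S \<noteq> {}"
          then have "0 < sum w ?S" using finite_Ls Ls(2)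
            by (intro sum_pos) (auto simp: light_def)
          then show False using wS True by simp
        qed
        then show ?thesis using up z_pos by (simp only: sum.empty) simp
      next
        case False
        have "W * (\<Sum>x\<in>?S. marg A2 h2 x) \<le> W * (real z * (val A' h - val ?B h))"
          using gain mult_right_mono[OF wS up] by (simp add: mult.assoc)
        then show ?thesis using False W0 by simp
      qed
    next
      assume "\<forall>e<n. light e \<longrightarrow> cls m e \<longrightarrow> e \<in> A'"
      then have "?S \<subseteq> A2" using Ls sub by auto
      then have "(\<Sum>x\<in>?S. marg A2 h2 x) = 0" using marg_in by (intro sum.neutral) auto
      then show ?thesis using up z_pos by simp
    qed
  qed
  show ?case
  proof (cases "m = Q")
    case True
    then have "{..<Suc m} - {Q} = {..<m} - {Q}" by auto
    then show ?thesis using IH up AW mult_nonneg_nonneg[OF _ up, of "real z"] by (simp add: algebra_simps)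
  next
    case False
    then have "{..<Suc m} - {Q} = insert m ({..<m} - {Q})" by auto
    then show ?thesis using IH new[OF False] AW by (simp add: algebra_simps)
  qed
qed simp

text \<open>For the classes below the top one, weight is all that matters: with nearly constant
  density, matching the weight of the optimal items matches their linear value.\<close>

lemma lrow_class_weight:
  assumes A: "A \<subseteq> {..<n}" and q: "q < m"
  shows "{e\<in>Ls. cls q e} \<subseteq> lrow h A m \<or>
    sum w {e\<in>A. light e \<and> cls q e} + real (c q) * unit_weight / real z
      \<le> sum w {e\<in>lrow h A m. light e \<and> cls q e}"
  using q
proof (induction m)
  case (Suc m)
  obtain A' W where AW: "lproc m h (lrow h A m) n = (A', W)" by fastforce
  let ?B = "lrow h A m"
  let ?F = "\<lambda>A. {e\<in>A. light e \<and> cls q e}"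
  have sub: "A \<subseteq> ?B" "?B \<subseteq> A'" using lproc_gets(1)[OF AW] lrow_mono[of 0 m h A] by auto
  have A'n: "A' \<subseteq> {..<n}" using lrow_sub[OF A, of h "Suc m"] AW by simp
  have finA': "finite A'" by (rule finite_subset[OF A'n]) simp
  have fin: "finite A'" "finite ?B" using finA' finite_subset[OF sub(2) finA'] by simp_all
  have mono: "sum w (?F X) \<le> sum w (?F Y)" if "X \<subseteq> Y" "finite Y" for X Y
  proof (rule sum_mono2)
    show "finite (?F Y)" using that(2) by simp
    show "?F X \<subseteq> ?F Y" using that(1) by blast
  qed (rule w_nonneg)
  show ?case
  proof (cases "q = m")
    case True
    from lproc_saturated[OF AW lrow_sub[OF A]] show ?thesis
    proof
      assume "real (c m) * unit_weight \<le> W * real z"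
      then have "real (c q) * unit_weight / real z \<le> W" using z_pos True by (simp add: field_simps)
      moreover have "W = sum w (A' - ?B)"
        using lproc_gets(3)[OF AW fin(2)] fin sub by (simp add: sum_diff)
      moreover have "sum w (?F A') = sum w (?F ?B) + sum w (A' - ?B)"
      proof -
        have "?F A' = ?F ?B \<union> (A' - ?B)" using lproc_gets(2)[OF AW] sub True by auto
        moreover have "sum w (?F ?B \<union> (A' - ?B)) = sum w (?F ?B) + sum w (A' - ?B)"
          by (rule sum.union_disjoint) (use fin in auto)
        ultimately show ?thesis by simp
      qed
      ultimately show ?thesis using mono[OF sub(1) fin(2)] AW by simp
    next
      assume "\<forall>e<n. light e \<longrightarrow> cls m e \<longrightarrow> e \<in> A'"
      then show ?thesis using Ls True AW by auto
    qed
  next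
    case False
    then show ?thesis using Suc sub mono[OF sub(2) fin(1)] AW by auto
  qed
qed simp

text \<open>A potential for an optimal top-class item \<open>x\<close> that has been left out:
  linear value of the picks outside the optimum, plus weight of the optimal picks at the density of
  \<open>x\<close>. Both parts are scaled by \<open>w x\<close> so that no density has to be
  formed.\<close>

definition top_gain :: "nat \<Rightarrow> nat set \<Rightarrow> real" where
  "top_gain x A = sum l {e\<in>A. light e \<and> cls Q e \<and> e \<notin> {e\<in>Ls. cls Q e}} * w x
     + l x * sum w (A \<inter> {e\<in>Ls. cls Q e})"

lemma top_gain_mono: "A \<subseteq> A' \<Longrightarrow> finite A' \<Longrightarrow> top_gain x A \<le> top_gain x A'"
  unfolding top_gain_def
  by (intro add_mono mult_right_mono mult_left_mono sum_mono2) (auto simp: w_nonneg l_nonneg)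

lemma lrow_top_gain:
  assumes A: "A \<subseteq> {..<n}" and q: "Q < m" and x: "x \<in> Ls" "cls Q x" "x \<notin> lrow h A m"
  shows "top_gain x A + l x * (real (c Q) * unit_weight / real z) \<le> top_gain x (lrow h A m)"
  using q x(3)
proof (induction m)
  case (Suc m)
  obtain A' W where AW: "lproc m h (lrow h A m) n = (A', W)" by fastforce
  let ?B = "lrow h A m"
  have sub: "A \<subseteq> ?B" "?B \<subseteq> A'" using lproc_gets(1)[OF AW] lrow_mono[of 0 m h A] by auto
  have A'n: "A' \<subseteq> {..<n}" using lrow_sub[OF A, of h "Suc m"] AW by simp
  have finA': "finite A'" by (rule finite_subset[OF A'n]) simp
  have fin: "finite A'" "finite ?B" using finA' finite_subset[OF sub(2) finA'] by simp_all
  have xn: "x < n" "light x" "x \<notin> A'" using x Ls Suc.prems AW by auto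
  show ?case
  proof (cases "m = Q")
    case True
    have "W * real z \<ge> real (c Q) * unit_weight"
      using lproc_saturated[OF AW lrow_sub[OF A]] xn x True by auto
    then have "l x * (real (c Q) * unit_weight / real z) \<le> l x * W"
      using z_pos l_nonneg by (intro mult_left_mono) (simp_all add: field_simps)
    moreover have "top_gain x ?B + l x * W \<le> top_gain x A'"
      unfolding top_gain_def
      using lproc_linear_gain[OF AW[unfolded True] fin(2)[unfolded True] xn(1,2) x(2) xn(3),
          of "{e\<in>Ls. cls Q e}"] by (simp only: True)
    ultimately show ?thesis using top_gain_mono[OF sub(1) fin(2), of x] AW by simp
  next
    case False
    have "x \<notin> ?B" using sub(2) xn(3) by auto
    then have "top_gain x A + l x * (real (c Q) * unit_weight / real z) \<le> top_gain x ?B"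
      using Suc.IH Suc.prems(1) False by simp
    then show ?thesis using top_gain_mono[OF sub(2) fin(1), of x] AW by simp
  qed
qed simp

end

section \<open>Linear and submodular value after all rows\<close>

context knapsack_opt
begin

definition Ar :: "nat \<Rightarrow> nat set" where "Ar i = fst (rows policy i)"
definition hr :: "nat \<Rightarrow> nat \<Rightarrow> nat \<Rightarrow> nat" where "hr i = snd (rows policy i)"

lemma Ar_hr_0: "Ar 0 = {e. e < n \<and> w e = 0}" "hr 0 = (\<lambda>_ _. n)"
  by (simp_all add: Ar_def hr_def)

lemma Ar_hr_Suc: "hr (Suc i) = hrw i (Ar i) (hr i) k" "Ar (Suc i) = lrow (hr (Suc i)) (Ar i) (Q + 2)"
  by (simp_all add: Ar_def hr_def Let_def split_beta)

lemma Ar_sub: "Ar i \<subseteq> {e. e < n \<and> (w e = 0 \<or> light e)}"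
proof (induction i)
  case (Suc i)
  show ?case using Suc lrow_light[of "hr (Suc i)" "Ar i" "Q + 2"] by (auto simp: Ar_hr_Suc(2))
qed (auto simp: Ar_hr_0)

lemma Ar_lt: "Ar i \<subseteq> {..<n}"
  using Ar_sub by auto

lemma finite_Ar: "finite (Ar i)"
  by (rule finite_subset[OF Ar_lt]) simp

lemma Ar_step: "Ar i \<subseteq> Ar (Suc i)"
  using lrow_mono[of 0 "Q + 2" "hr (Suc i)" "Ar i"] by (simp only: Ar_hr_Suc(2) lrow.simps(1))

lemma Ar_zero: "{e. e < n \<and> w e = 0} \<subseteq> Ar i"
  using Ar_step by (induction i) (auto simp: Ar_hr_0)

lemma hr_empty: "i \<le> i' \<Longrightarrow> hr i i' j = n"
  by (induction i) (simp_all add: Ar_hr_0 Ar_hr_Suc(1) hrow_untouched(1))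

lemma hr_good: "i \<le> z \<Longrightarrow> i' < i \<Longrightarrow> j < p \<Longrightarrow> good j (hr i i' j)"
proof (induction i)
  case (Suc i)
  show ?case
  proof (cases "i' = i")
    case True
    then show ?thesis using hrow_good[of i j k "Ar i" "hr i"] Suc.prems p_le by (simp add: Ar_hr_Suc(1))
  next
    case False
    then show ?thesis using Suc by (simp add: Ar_hr_Suc(1) hrow_untouched(1))
  qed
qed simp

lemma hr_idle: "p \<le> j \<Longrightarrow> hr i i' j = n"
proof (induction i arbitrary: i')
  case (Suc i)
  show ?case
  proof (cases "i' = i")
    case True
    then show ?thesis using hrow_idle[of "hr i" i j k policy "Ar i"] Suc.prems hr_empty[of i i]
      by (simp add: Ar_hr_Suc(1))
  next
    case False
    then show ?thesis using Suc by (simp add: Ar_hr_Suc(1) hrow_untouched(1))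
  qed
qed (simp add: Ar_hr_0)

lemma Ar_weight: "sum w (Ar i) \<le> real i * (\<Sum>q<Q + 2. real (c q) * unit_weight / real z + w t)"
proof (induction i)
  case (Suc i)
  have "sum w (Ar (Suc i)) \<le> sum w (Ar i) + (\<Sum>q<Q + 2. real (c q) * unit_weight / real z + w t)"
    unfolding Ar_hr_Suc(2) by (rule lrow_weight[OF Ar_lt])
  then show ?case using Suc by (simp only: of_nat_Suc distrib_right mult_1)
qed (simp add: Ar_hr_0)

lemma Ar_class_weight:
  assumes "q < Q"
  shows "{e\<in>Ls. cls q e} \<subseteq> Ar i \<or>
    real i * (real (c q) * unit_weight / real z) \<le> sum w {e\<in>Ar i. light e \<and> cls q e}"
proof (induction i)
  case 0
  then show ?case using w_nonneg by (simp add: sum_nonneg)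
next
  case (Suc i)
  have q: "q < Q + 2" using assms by simp
  from lrow_class_weight[OF Ar_lt q, of "hr (Suc i)" i] Suc Ar_step[of i]
  show ?case unfolding Ar_hr_Suc(2)[symmetric] of_nat_Suc distrib_right mult_1
    by (elim disjE) (blast, linarith, blast, linarith)
qed

lemma Ar_top_gain:
  assumes "x \<in> Ls" "cls Q x" "x \<notin> Ar i"
  shows "l x * (real i * (real (c Q) * unit_weight / real z)) \<le> top_gain x (Ar i)"
  using assms(3)
proof (induction i)
  case 0
  then show ?case by (simp add: top_gain_def l_nonneg w_nonneg sum_nonneg)
next
  case (Suc i)
  have "x \<notin> Ar i" using Suc.prems Ar_step by auto
  then show ?case
    using Suc lrow_top_gain[OF Ar_lt _ assms(1,2), of "Q + 2" "hr (Suc i)" i]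
    unfolding Ar_hr_Suc(2)[symmetric] of_nat_Suc distrib_right distrib_left mult_1 by simp
qed

text \<open>The class is the density in units of \<open>unit_light / Bt\<close>, rounded down and
  capped at \<open>Q\<close>.\<close>

lemma cls_exists: "light e \<Longrightarrow> \<exists>q\<le>Q. cls q e"
proof (cases "real Q * unit_light * w e \<le> l e * Bt")
  case False
  assume "light e"
  then have pos: "0 < unit_light * w e" using unit_light_pos by (simp add: light_def)
  define q where "q = nat \<lfloor>l e * Bt / (unit_light * w e)\<rfloor>"
  have "0 \<le> l e * Bt / (unit_light * w e)" using pos l_nonneg Bt_nonneg by simp
  then have "real q = of_int \<lfloor>l e * Bt / (unit_light * w e)\<rfloor>" by (simp add: q_def)
  then have q: "real q \<le> l e * Bt / (unit_light * w e)" "l e * Bt / (unit_light * w e) < real q + 1"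
    by linarith+
  then have q': "real q * (unit_light * w e) \<le> l e * Bt" "l e * Bt < (real q + 1) * (unit_light * w e)"
    using pos by (simp_all add: pos_le_divide_eq pos_divide_less_eq)
  have "real q * (unit_light * w e) < real Q * (unit_light * w e)" using q'(1) False by simp
  then have "real q < real Q" by (rule mult_right_less_imp_less) (use pos in simp)
  then have "q < Q" by simp
  then show ?thesis using q' by (intro exI[of _ q]) (simp add: cls_def mult.assoc)
qed (auto simp: cls_def)

lemma cls_unique:
  assumes "light e" "cls q e" "cls q' e" "q \<le> Q" "q' \<le> Q"
  shows "q = q'"
proof -
  have pos: "0 < unit_light * w e" using assms(1) unit_light_pos by (simp add: light_def)
  have "False" if qq: "a < b" "b \<le> Q" "cls a e" "cls b e" for a b
  proof -
    have "l e * Bt < (real a + 1) * (unit_light * w e)" "real b * (unit_light * w e) \<le> l e * Bt"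
      using qq by (auto simp: cls_def mult.assoc split: if_splits)
    then have "real b * (unit_light * w e) < (real a + 1) * (unit_light * w e)" by linarith
    then have "real b < real a + 1" by (rule mult_right_less_imp_less) (use pos in simp)
    then show False using qq(1) by linarith
  qed
  then show ?thesis using assms by (metis linorder_neqE_nat)
qed

lemma sum_cls:
  assumes "finite S" "\<And>e. e \<in> S \<Longrightarrow> light e"
  shows "(\<Sum>q\<le>Q. sum f {e\<in>S. cls q e}) = sum f S"
proof -
  define cl where "cl e = (THE q. q \<le> Q \<and> cls q e)" for e
  have cl: "cl e \<le> Q \<and> cls (cl e) e" if "e \<in> S" for e
  proof -
    have le: "light e" by (rule assms(2)[OF that])
    obtain q where q: "q \<le> Q" "cls q e" using cls_exists[OF le] by auto
    have "cl e = q" unfolding cl_def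
    proof (rule the_equality)
      fix q' assume "q' \<le> Q \<and> cls q' e"
      then show "q' = q" using cls_unique[OF le, of q' q] q by simp
    qed (use q in simp)
    then show ?thesis using q by simp
  qed
  have "{e\<in>S. cls q e} = {e\<in>S. cl e = q}" if "q \<le> Q" for q
  proof -
    have "cl e = q" if "e \<in> S" "cls q e" for e
      using cls_unique[OF assms(2)[OF that(1)], of "cl e" q] that \<open>q \<le> Q\<close> cl[OF that(1)] by simp
    then show ?thesis using cl by blast
  qed
  then have "(\<Sum>q\<le>Q. sum f {e\<in>S. cls q e}) = (\<Sum>q\<le>Q. sum f {e\<in>S. cl e = q})"
    by (intro sum.cong) auto
  also have "\<dots> = sum f S"
    using sum.group[OF assms(1), of "{..Q}" cl f] cl by auto
  finally show ?thesis .
qed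

text \<open>Below the top class the rows collect at least the weight of the optimal items, at a
  density lower by at most one unit. In the top class densities can differ arbitrarily, and the
  argument is an exchange: an optimal item that was left out is no denser than the items taken
  instead.\<close>

lemma class_value:
  assumes q: "q \<le> Q"
  shows "Bt * sum l {e\<in>Ls. cls q e} - unit_light * sum w {e\<in>Ls. cls q e}
     \<le> Bt * sum l {e\<in>Ar z. light e \<and> cls q e}"
proof -
  let ?O = "{e\<in>Ls. cls q e}" and ?A = "{e\<in>Ar z. light e \<and> cls q e}"
  have finO: "finite ?O" and finA: "finite ?A" using finite_Ls finite_Ar by simp_all
  have wO: "0 \<le> unit_light * sum w ?O"
    using unit_light_pos w_nonneg by (simp add: sum_nonneg)
  have cw: "sum w ?O \<le> real z * (real (c q) * unit_weight / real z)"
    using c_ge[of q] q z_pos by simp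
  show ?thesis
  proof (cases "?O \<subseteq> Ar z")
    case True
    then have "?O \<subseteq> ?A" using Ls(2) by auto
    then have "sum l ?O \<le> sum l ?A"
      by (intro sum_mono2 finA) (auto simp: l_nonneg)
    then show ?thesis using wO mult_left_mono[OF _ Bt_nonneg] by fastforce
  next
    case notsub: False
    show ?thesis
    proof (cases "q < Q")
      case True
      have "sum w ?O \<le> sum w ?A"
        using Ar_class_weight[OF True, of z] notsub cw by auto
      then have *: "real q * unit_light * sum w ?O \<le> real q * unit_light * sum w ?A"
        using unit_light_pos by (intro mult_left_mono) auto
      have "real q * unit_light * sum w ?A \<le> Bt * sum l ?A"
        unfolding sum_distrib_left
        by (rule sum_mono) (use True in \<open>auto simp: cls_def mult.commute\<close>)
      moreover have "Bt * sum l ?O \<le> (real q + 1) * unit_light * sum w ?O"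
        unfolding sum_distrib_left
        by (rule sum_mono) (use True in \<open>auto simp: cls_def mult.commute\<close>)
      ultimately show ?thesis using * by (simp add: algebra_simps)
    next
      case False
      then have qQ: "q = Q" using q by simp
      let ?N = "{e\<in>Ar z. light e \<and> cls Q e \<and> e \<notin> ?O}"
      have ex: "?O - Ar z \<noteq> {}" using notsub by auto
      have pos: "0 < sum w (?O - Ar z)"
        using ex finO Ls(2) by (intro sum_pos) (auto simp: light_def)
      have split: "sum f ?O = sum f (Ar z \<inter> ?O) + sum f (?O - Ar z)" for f :: "nat \<Rightarrow> real"
      proof -
        have eq: "(Ar z \<inter> ?O) \<union> (?O - Ar z) = ?O" by blast
        have "sum f ((Ar z \<inter> ?O) \<union> (?O - Ar z)) = sum f (Ar z \<inter> ?O) + sum f (?O - Ar z)"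
          by (rule sum.union_disjoint) (use finO in blast)+
        then show ?thesis unfolding eq .
      qed
      have "l x * sum w (?O - Ar z) \<le> sum l ?N * w x" if x: "x \<in> ?O - Ar z" for x
      proof -
        have "l x * sum w ?O \<le> l x * (real z * (real (c Q) * unit_weight / real z))"
          using cw qQ l_nonneg by (intro mult_left_mono) auto
        also have "\<dots> \<le> top_gain x (Ar z)"
          by (rule Ar_top_gain) (use x qQ in auto)
        also have "\<dots> = sum l ?N * w x + l x * sum w (Ar z \<inter> ?O)"
          by (simp add: top_gain_def qQ)
        finally show ?thesis using split[of w] by (simp add: algebra_simps)
      qed
      \<comment> \<open>Summation over the missing items produces the factor
        \<open>sum w (?O - Ar z)\<close> on both sides; it is positive and cancels.\<close>
      then have "(\<Sum>x\<in>?O - Ar z. l x * sum w (?O - Ar z)) \<le> (\<Sum>x\<in>?O - Ar z. sum l ?N * w x)"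
        by (rule sum_mono)
      then have "sum l (?O - Ar z) * sum w (?O - Ar z) \<le> sum l ?N * sum w (?O - Ar z)"
        by (simp only: sum_distrib_left[symmetric] sum_distrib_right[symmetric])
      then have "sum l (?O - Ar z) \<le> sum l ?N" using pos by simp
      moreover have "sum l ?A = sum l ?N + sum l (Ar z \<inter> ?O)"
      proof -
        have "?A = ?N \<union> (Ar z \<inter> ?O)" using Ls(2) qQ by auto
        moreover have "sum l (?N \<union> (Ar z \<inter> ?O)) = sum l ?N + sum l (Ar z \<inter> ?O)"
          by (rule sum.union_disjoint) (use finite_Ar in auto)
        ultimately show ?thesis by simp
      qed
      ultimately have "sum l ?O \<le> sum l ?A" using split[of l] by simp
      then show ?thesis using wO mult_left_mono[OF _ Bt_nonneg] by fastforce
    qed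
  qed
qed

text \<open>A class loses at most \<open>unit_light / Bt\<close> per unit of optimal weight, and the
  optimal weights of all classes add up to at most \<open>Bt\<close>. So the total loss is one
  \<open>unit_light\<close>, independent of the number of classes.\<close>

lemma light_value:
  "sum l {e. e < n \<and> w e = 0} + sum l Ls - unit_light \<le> sum l (Ar z)"
proof -
  let ?Z = "{e. e < n \<and> w e = 0}" and ?L = "{e\<in>Ar z. light e}"
  have finL: "finite ?L" using finite_Ar by simp
  have "Ar z = ?Z \<union> ?L" using Ar_sub[of z] Ar_zero[of z] by auto
  moreover have "sum l (?Z \<union> ?L) = sum l ?Z + sum l ?L"
    by (rule sum.union_disjoint) (use finL in \<open>auto simp: light_def\<close>)
  ultimately have A: "sum l (Ar z) = sum l ?Z + sum l ?L" by simp
  have "sum l Ls - unit_light \<le> sum l ?L"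
  proof (cases "Bt = 0")
    case True
    have "Ls = {}"
    proof (rule ccontr)
      assume "Ls \<noteq> {}"
      then have "0 < sum w Ls" using finite_Ls Ls(2) by (intro sum_pos) (auto simp: light_def)
      then show False using Bt_ge True by simp
    qed
    have "0 \<le> sum l ?L" by (rule sum_nonneg) (rule l_nonneg)
    then show ?thesis using \<open>Ls = {}\<close> unit_light_pos by simp
  next
    case False
    then have pos: "0 < Bt" using Bt_nonneg by simp
    have "(\<Sum>q\<le>Q. Bt * sum l {e\<in>Ls. cls q e} - unit_light * sum w {e\<in>Ls. cls q e})
      \<le> (\<Sum>q\<le>Q. Bt * sum l {e\<in>?L. cls q e})"
    proof (rule sum_mono)
      fix q assume "q \<in> {..Q}"
      then show "Bt * sum l {e\<in>Ls. cls q e} - unit_light * sum w {e\<in>Ls. cls q e}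
          \<le> Bt * sum l {e\<in>?L. cls q e}"
        using class_value[of q] by simp
    qed
    then have "Bt * sum l Ls - unit_light * sum w Ls \<le> Bt * sum l ?L"
      using sum_cls[OF finite_Ls Ls(2), of l] sum_cls[OF finite_Ls Ls(2), of w] sum_cls[OF finL, of l]
      by (simp add: sum_subtractf sum_distrib_left[symmetric])
    moreover have "unit_light * sum w Ls \<le> Bt * unit_light"
      using mult_left_mono[OF Bt_ge, of unit_light] unit_light_pos by (simp add: mult.commute)
    ultimately have "Bt * (sum l Ls - unit_light) \<le> Bt * sum l ?L"
      by (simp add: right_diff_distrib)
    then show ?thesis using pos by simp
  qed
  then show ?thesis using A by simp
qed

lemma cls_top: "cls (Suc Q) e \<longleftrightarrow> cls Q e"
  by (simp add: cls_def)

definition Opt' :: "nat set" where "Opt' = {e. e < n \<and> w e = 0} \<union> own ` {..<p} \<union> Ls"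

text \<open>The optimum exceeds the new value by at most the sum of the marginal gains at the new
  state, and these are bounded by \<open>z\<close> times the progress of the row plus the rounding
  errors. Measuring at the new state gives the contraction factor \<open>z / (z + 1)\<close> in
  place of \<open>1 - 1 / z\<close>. The errors are one heavy unit per slot, at most
  \<open>T / z\<close> per choice.\<close>

lemma row_gain:
  assumes "i < z"
  shows "(real z + 1) * (g Opt' * real z ^ k - val (Ar (Suc i)) (hr (Suc i)))
     \<le> real z * (g Opt' * real z ^ k - val (Ar i) (hr i)) + T / real z * real z ^ k"
proof -
  let ?A = "Ar (Suc i)" and ?h = "hr (Suc i)" and ?M = "unit_heavy * real z ^ k"
  let ?Z = "{e. e < n \<and> w e = 0}"
  have "{..<k} \<inter> {..<p} = {..<p}" using p_le by auto
  then have heavy_part: "(\<Sum>j<p. marg ?A ?h (own j) - ?M) \<le> real z * (val (Ar i) ?h - val (Ar i) (hr i))"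
    using hrow_gain[OF assms, of "hr i" k "Ar i" ?A ?h] hr_empty[of i i] Ar_step[of i]
    by (simp add: Ar_hr_Suc(1) hext_refl)
  have light_part: "(\<Sum>q\<in>{..<Q + 2} - {Q}. \<Sum>x\<in>{e\<in>Ls. cls q e}. marg ?A ?h x) \<le> real z * (val ?A ?h - val (Ar i) ?h)"
    unfolding Ar_hr_Suc(2)[of i] by (rule lrow_gain[OF Ar_lt order_refl hext_refl order_refl])
  \<comment> \<open>Class \<open>Q + 1\<close> takes the place of class \<open>Q\<close>, so that
    every light optimal item is counted exactly once.\<close>
  have "(\<Sum>q\<in>{..<Q + 2} - {Q}. \<Sum>x\<in>{e\<in>Ls. cls q e}. marg ?A ?h x) = (\<Sum>q\<le>Q. \<Sum>x\<in>{e\<in>Ls. cls q e}. marg ?A ?h x)"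
  proof -
    have "{..<Q + 2} - {Q} = insert (Suc Q) {..<Q}" "{..Q} = insert Q {..<Q}" by auto
    then show ?thesis by (simp add: cls_top)
  qed
  also have "\<dots> = (\<Sum>x\<in>Ls. marg ?A ?h x)" by (rule sum_cls[OF finite_Ls Ls(2)])
  finally have lp: "(\<Sum>x\<in>Ls. marg ?A ?h x) \<le> real z * (val ?A ?h - val (Ar i) ?h)"
    using light_part by simp
  have "g Opt' * real z ^ k - val ?A ?h \<le> (\<Sum>x\<in>Opt'. marg ?A ?h x)"
  proof -
    have finO: "finite Opt'" using finite_Ls by (simp add: Opt'_def)
    let ?R = "\<lambda>\<pi>. ?A \<union> (\<lambda>j. ?h (\<pi> j) j) ` {..<k}"
    have "(\<Sum>\<pi>\<in>PiE {..<k} (\<lambda>_. {..<z}). g Opt' - g (?R \<pi>))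
      \<le> (\<Sum>\<pi>\<in>PiE {..<k} (\<lambda>_. {..<z}). \<Sum>x\<in>Opt'. g (insert x (?R \<pi>)) - g (?R \<pi>))"
    proof (rule sum_mono)
      fix \<pi>
      have "g Opt' \<le> g (Opt' \<union> ?R \<pi>)" by (rule mono) auto
      then show "g Opt' - g (?R \<pi>) \<le> (\<Sum>x\<in>Opt'. g (insert x (?R \<pi>)) - g (?R \<pi>))"
        using gain_le_sum_marginals[OF finO, of "?R \<pi>"] by linarith
    qed
    also have "\<dots> = (\<Sum>x\<in>Opt'. marg ?A ?h x)"
      unfolding marg_sum by (rule sum.swap)
    finally show ?thesis
      by (simp add: sum_subtractf val_def card_choices mult.commute)
  qed
  also have "(\<Sum>x\<in>Opt'. marg ?A ?h x) \<le> (\<Sum>j<p. marg ?A ?h (own j)) + (\<Sum>x\<in>Ls. marg ?A ?h x)"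
  proof -
    have "(\<Sum>x\<in>Opt'. marg ?A ?h x) \<le> (\<Sum>x\<in>?Z. marg ?A ?h x) + (\<Sum>x\<in>own ` {..<p}. marg ?A ?h x) + (\<Sum>x\<in>Ls. marg ?A ?h x)"
    proof -
      have U: "sum f (X \<union> Y) \<le> sum f X + sum f Y" if "\<And>x. 0 \<le> f x" "finite X" "finite Y" for f :: "nat \<Rightarrow> real" and X Y
        using sum_Un[OF that(2,3), of f] sum_nonneg[of "X \<inter> Y" f] that(1) by simp
      have "(\<Sum>x\<in>Opt'. marg ?A ?h x) \<le> (\<Sum>x\<in>?Z \<union> own ` {..<p}. marg ?A ?h x) + (\<Sum>x\<in>Ls. marg ?A ?h x)"
        unfolding Opt'_def by (rule U) (auto simp: marg_nonneg finite_Ls)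
      moreover have "(\<Sum>x\<in>?Z \<union> own ` {..<p}. marg ?A ?h x) \<le> (\<Sum>x\<in>?Z. marg ?A ?h x) + (\<Sum>x\<in>own ` {..<p}. marg ?A ?h x)"
        by (rule U) (auto simp: marg_nonneg)
      ultimately show ?thesis by linarith
    qed
    moreover have "(\<Sum>x\<in>?Z. marg ?A ?h x) = 0"
      using Ar_zero[of "Suc i"] by (intro sum.neutral ballI marg_in) auto
    ultimately show ?thesis using sum.reindex[OF own_inj, of "marg ?A ?h"] by simp
  qed
  finally have "g Opt' * real z ^ k - val ?A ?h
      \<le> real z * (val ?A ?h - val (Ar i) (hr i)) + real p * ?M"
    using heavy_part lp by (simp add: sum_subtractf right_diff_distrib)
  moreover have "real p * ?M \<le> T / real z * real z ^ k"
  proof -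
    have "real p * unit_heavy \<le> real k * unit_heavy"
      using p_le unit_heavy_pos by (intro mult_right_mono) auto
    also have "\<dots> = T / real z" using k_pos by (simp add: unit_heavy_def)
    finally have *: "real p * unit_heavy \<le> T / real z" .
    show ?thesis using mult_right_mono[OF *, of "real z ^ k"] zk_pos by (simp add: mult.assoc)
  qed
  ultimately show ?thesis by (simp add: algebra_simps)
qed

text \<open>Raising \<open>exp (1 / (N + 1)) \<le> (N + 1) / N\<close> to the power
  \<open>N + 1\<close> gives \<open>exp 1\<close>, with one factor \<open>1 + 1 / N\<close> too
  many. This factor is the source of the error term.\<close>

lemma inverse_power_bound:
  assumes "0 < N"
  shows "(real N / (real N + 1)) ^ N \<le> 1 / exp 1 + 1 / real N"
proof -
  have "exp (1 / (real N + 1)) \<le> (real N + 1) / real N"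
  proof -
    have "1 - 1 / (real N + 1) \<le> exp (- (1 / (real N + 1)))"
      using exp_ge_add_one_self[of "- (1 / (real N + 1))"] by simp
    moreover have "1 - 1 / (real N + 1) = real N / (real N + 1)" using assms by (simp add: field_simps)
    ultimately have "real N / (real N + 1) \<le> 1 / exp (1 / (real N + 1))"
      by (simp add: exp_minus inverse_eq_divide)
    then show ?thesis using assms by (simp add: field_simps)
  qed
  then have "exp (1 / (real N + 1)) ^ (N + 1) \<le> ((real N + 1) / real N) ^ (N + 1)"
    by (rule power_mono) simp
  moreover have "exp (1 / (real N + 1)) ^ (N + 1) = exp 1"
    by (simp only: exp_of_nat_mult[symmetric]) (simp add: field_simps)
  ultimately have e: "exp 1 \<le> ((real N + 1) / real N) ^ (N + 1)" by simp
  have "(real N / (real N + 1)) ^ N * exp 1 \<le> (real N / (real N + 1)) ^ N * ((real N + 1) / real N) ^ (N + 1)"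
    by (rule mult_left_mono[OF e]) simp
  also have "\<dots> = ((real N / (real N + 1)) * ((real N + 1) / real N)) ^ N * ((real N + 1) / real N)"
    by (simp only: power_mult_distrib power_add power_one_right mult.assoc)
  also have "real N / (real N + 1) * ((real N + 1) / real N) = 1" using assms by simp
  also have "1 ^ N * ((real N + 1) / real N) = 1 + 1 / real N"
    using assms by (simp add: add_divide_distrib)
  finally have "(real N / (real N + 1)) ^ N \<le> (1 + 1 / real N) / exp 1"
    by (simp add: pos_le_divide_eq)
  also have "\<dots> = 1 / exp 1 + 1 / real N * (1 / exp 1)" by (simp add: add_divide_distrib)
  also have "1 / real N * (1 / exp 1) \<le> 1 / real N * 1"
    by (rule mult_left_mono) auto
  finally show ?thesis by simp
qed

text \<open>The error \<open>?e\<close> of a row enters divided by \<open>z + 1\<close> and is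
  damped by all later rows. As \<open>?e\<close> is a fixed point of the error recursion, the rows
  together lose it only once and not \<open>z\<close> times.\<close>

lemma submodular_value:
  "g Opt' * real z ^ k - val (Ar z) (hr z)
     \<le> ((1 / exp 1 + 1 / real z) * g Opt' + T / real z) * real z ^ k"
proof -
  let ?d = "\<lambda>i. g Opt' * real z ^ k - val (Ar i) (hr i)"
  let ?\<rho> = "real z / (real z + 1)" and ?e = "T / real z * real z ^ k"
  define s where "s = ?e"
  have z0: "0 < real z" using z_pos by simp
  have s0: "0 \<le> s" using T_pos zk_pos z0 by (simp add: s_def)
  have "?d i \<le> ?\<rho> ^ i * (g Opt' * real z ^ k) + s" if "i \<le> z" for i
    using that
  proof (induction i)
    case 0
    have "0 \<le> val (Ar 0) (hr 0)" using nonneg by (simp add: val_def sum_nonneg)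
    then show ?case using s0 by simp
  next
    case (Suc i)
    have "(real z + 1) * ?d (Suc i) \<le> real z * ?d i + s" using row_gain[of i] Suc.prems unfolding s_def by simp
    also have "real z * ?d i \<le> real z * (?\<rho> ^ i * (g Opt' * real z ^ k) + s)"
      using Suc z0 by (intro mult_left_mono) auto
    finally have "?d (Suc i) * (real z + 1) \<le> real z * (?\<rho> ^ i * (g Opt' * real z ^ k)) + s * (real z + 1)"
      by (simp add: algebra_simps)
    then have "?d (Suc i) \<le> (real z * (?\<rho> ^ i * (g Opt' * real z ^ k)) + s * (real z + 1)) / (real z + 1)"
      using z0 by (simp add: pos_le_divide_eq)
    also have "\<dots> = ?\<rho> ^ Suc i * (g Opt' * real z ^ k) + s"
      using z0 by (simp add: add_divide_distrib)
    finally show ?case .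
  qed
  from this[of z] have "?d z \<le> ?\<rho> ^ z * (g Opt' * real z ^ k) + s" by simp
  also have "?\<rho> ^ z * (g Opt' * real z ^ k) \<le> (1 / exp 1 + 1 / real z) * (g Opt' * real z ^ k)"
    using inverse_power_bound[OF z_pos] nonneg zk_pos by (intro mult_right_mono) auto
  finally show ?thesis unfolding s_def distrib_right by (simp only: mult.assoc)
qed

end

section \<open>Spare candidates and rounding\<close>

context knapsack_opt
begin

abbreviation "fil \<equiv> fillers policy"

lemma fillers_empty: "z + r \<le> i \<Longrightarrow> fil r i j = n"
proof (induction r)
  case 0
  then show ?case using hr_empty[of z i] by (simp add: hr_def)
qed (simp add: hrow_untouched(1))

lemma fillers_rows: "i < z \<Longrightarrow> fil r i j = hr z i j"
  by (induction r) (simp_all add: hr_def hrow_untouched(1))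

lemma fillers_hext:
  assumes "r \<le> r'"
  shows "hext (fil r) (fil r')"
  using assms
proof (induction r' rule: dec_induct)
  case (step m)
  have "hext (fil m) (fil (Suc m))"
    using hrow_hext[of "fil m" "z + m" 0 k policy "fst (rows policy z)"] fillers_empty[of m "z + m"]
    by simp
  then show ?case by (rule hext_trans[OF step.IH])
qed (rule hext_refl)

definition mid :: "nat \<Rightarrow> nat \<Rightarrow> nat \<Rightarrow> nat \<Rightarrow> nat" where
  "mid r j = hrw (z + r) (Ar z) (fil r) j"

lemma mid_k: "mid r k = fil (Suc r)"
  by (simp add: mid_def Ar_def)

lemma mid_hext:
  assumes "r < k" "j \<le> j'" "j' \<le> k"
  shows "hext (mid r j) (mid r j')" "hext (mid r j') (fil k)"
proof -
  have *: "hext (mid r j) (mid r j')" if "j \<le> j'" for j j'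
    unfolding mid_def using that by (intro hrow_hext fillers_empty) auto
  show "hext (mid r j) (mid r j')" using * assms by blast
  have "hext (mid r j') (fil (Suc r))" using *[OF assms(3)] by (simp add: mid_k)
  then show "hext (mid r j') (fil k)"
    by (rule hext_trans) (rule fillers_hext, use assms in simp)
qed

lemma pool_hext: "hext h h' \<Longrightarrow> pool h \<subseteq> insert n (pool h')"
  unfolding hext_def pool_def by (safe; metis)

lemma poolI: "i < z + k \<Longrightarrow> j < k \<Longrightarrow> h i j \<in> pool h"
  by (auto simp: pool_def)

text \<open>If \<open>own j\<close> is missing from the final pool, it is missing from every earlier
  one and hence eligible as a filler. So the pick is not empty, is at most as heavy, and was not in
  the table before.\<close>

lemma filler_pick:
  assumes r: "r < k" and j: "j < p" and out: "own j \<notin> pool (fil k)"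
  shows "good j (fil k (z + r) j)" and "fil k (z + r) j \<notin> pool (mid r j)"
proof -
  let ?e = "hpick (policy (z + r) j (Ar z) (mid r j)) (z + r) j (Ar z) (mid r j)"
  have jk: "Suc j \<le> k" using j p_le by simp
  have at: "mid r (Suc j) (z + r) j = ?e" unfolding mid_def by (rule hrow_Suc_at)
  have "pool (mid r j) \<subseteq> insert n (pool (fil k))"
    using pool_hext mid_hext(2)[of r j j] r jk by simp
  then have "own j \<notin> pool (mid r j)" using out own[OF j] by auto
  then have c: "if z + r < z then real (policy (z + r) j (Ar z) (mid r j)) * unit_heavy * real z ^ k \<le> marg (Ar z) (mid r j) (own j)
      else own j \<notin> pool (mid r j)" by simp
  note pick = hpick_optimal[OF j c]
  have "?e \<noteq> n" using pick(1) by (auto simp: good_def)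
  then have "fil k (z + r) j = ?e"
    using mid_hext(2)[OF r order_refl jk] at unfolding hext_def by metis
  then show "good j (fil k (z + r) j)" "fil k (z + r) j \<notin> pool (mid r j)"
    using pick by (simp_all add: helig_def)
qed

lemma finite_pool: "finite (pool h)"
proof -
  have "pool h = (\<lambda>(i, j). h i j) ` ({..<z + k} \<times> {..<k})" by (auto simp: pool_def)
  then show ?thesis by simp
qed

text \<open>Each of the \<open>k\<close> filler rows adds one good item for slot \<open>j\<close>,
  and these differ because a filler is new when picked. An optimal item that the table lacks thus
  has at least as many substitutes as there are slots, which is the condition of
  \<open>slot_assignment\<close>.\<close>

lemma filler_supply:
  assumes j: "j < p" and out: "own j \<notin> pool (fil k)"
  shows "\<exists>F\<subseteq>pool (fil k). k \<le> card F \<and> (\<forall>e\<in>F. good j e)"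
proof -
  let ?f = "\<lambda>r. fil k (z + r) j"
  have jk: "j < k" using j p_le by simp
  have ne: "?f r' \<noteq> ?f r" if "r' < r" "r < k" for r r'
  proof -
    have e1: "hext (fil (Suc r')) (mid r j)"
    proof (rule hext_trans)
      show "hext (fil (Suc r')) (mid r 0)"
        using fillers_hext[of "Suc r'" r] that by (simp add: mid_def)
      show "hext (mid r 0) (mid r j)" using mid_hext(1)[of r 0 j] that jk by simp
    qed
    have e2: "hext (fil (Suc r')) (fil k)" using fillers_hext[of "Suc r'" k] that by simp
    have "?f r' \<noteq> n" using filler_pick(1)[of r' j] that j out by (auto simp: good_def)
    \<comment> \<open>The entry is already there at the end of row \<open>r'\<close>; being
      nonempty, it stays unchanged in all later tables, in particular in the one from which row
      \<open>r\<close> excludes its pool.\<close>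
    have at: "fil (Suc r') (z + r') j \<noteq> n"
    proof -
      let ?e = "hpick (policy (z + r') j (Ar z) (mid r' j)) (z + r') j (Ar z) (mid r' j)"
      have r': "r' < k" using that by simp
      have jk': "Suc j \<le> k" using jk by simp
      have "pool (mid r' j) \<subseteq> insert n (pool (fil k))"
        using pool_hext mid_hext(2)[of r' j j] r' jk by simp
      then have "own j \<notin> pool (mid r' j)" using out own[OF j] by auto
      then have c: "if z + r' < z then real (policy (z + r') j (Ar z) (mid r' j)) * unit_heavy * real z ^ k \<le> marg (Ar z) (mid r' j) (own j)
          else own j \<notin> pool (mid r' j)" by simp
      have "?e \<noteq> n" using hpick_optimal(1)[OF j c] by (auto simp: good_def)
      moreover have "mid r' (Suc j) (z + r') j = ?e" unfolding mid_def by (rule hrow_Suc_at)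
      moreover have "hext (mid r' (Suc j)) (fil (Suc r'))"
        using mid_hext(1)[OF r' jk' order_refl] by (simp add: mid_k)
      ultimately show ?thesis unfolding hext_def by metis
    qed
    have "fil (Suc r') (z + r') j = mid r j (z + r') j" using e1 at unfolding hext_def by metis
    moreover have "fil (Suc r') (z + r') j = ?f r'" using e2 at unfolding hext_def by metis
    moreover have "mid r j (z + r') j \<in> pool (mid r j)" using that jk by (intro poolI) auto
    ultimately show ?thesis using filler_pick(2)[OF that(2) j out] by auto
  qed
  have "inj_on ?f {..<k}"
  proof (rule inj_onI)
    fix r r' assume "r \<in> {..<k}" "r' \<in> {..<k}" "?f r = ?f r'"
    then show "r = r'" using ne[of r r'] ne[of r' r] by (metis lessThan_iff linorder_neqE_nat)
  qed
  then have "card (?f ` {..<k}) = k" by (simp add: card_image)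
  moreover have "?f ` {..<k} \<subseteq> pool (fil k)" using jk poolI[of _ j "fil k"] by auto
  moreover have "\<forall>e\<in>?f ` {..<k}. good j e" using filler_pick(1) j out by auto
  ultimately show ?thesis by (intro exI[of _ "?f ` {..<k}"]) auto
qed

text \<open>One of the \<open>z^k\<close> choices is at least as good as their average.\<close>

lemma best_choice: "\<exists>\<pi>\<in>PiE {..<k} (\<lambda>_. {..<z}). val A h \<le> g (A \<union> (\<lambda>j. h (\<pi> j) j) ` {..<k}) * real z ^ k"
proof (rule ccontr)
  let ?P = "PiE {..<k} (\<lambda>_. {..<z})"
  assume "\<not> ?thesis"
  then have lt: "g (A \<union> (\<lambda>j. h (\<pi> j) j) ` {..<k}) < val A h / real z ^ k" if "\<pi> \<in> ?P" for \<pi>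
    using that zk_pos by (auto simp: pos_less_divide_eq not_le)
  have "?P \<noteq> {}" using z_pos by (auto simp: PiE_eq_empty_iff)
  then have "val A h < (\<Sum>\<pi>\<in>?P. val A h / real z ^ k)"
    unfolding val_def[of A h] by (intro sum_strict_mono finite_choices) (use lt val_def in auto)
  then show False using z_pos by (simp add: card_choices)
qed

text \<open>The light part \<open>Ar z\<close> is integral already; only the row of each slot has to
  be fixed. Items of the best choice may coincide between slots. The reassignment keeps all of them,
  which preserves the value of \<open>g\<close>, and gives the slots distinct good items, which
  secures weight and linear value slot by slot.\<close>

theorem rounding:
  assumes budget: "(\<Sum>j<p. w (own j)) + real z * (\<Sum>q<Q + 2. real (c q) * unit_weight / real z + w t) \<le> 1"
  shows "\<exists>R\<subseteq>pool (fil k). card R \<le> k \<and> R \<subseteq> {..<n} \<and> sum w (Ar z \<union> R) \<le> 1 \<and>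
    (1 - 1 / exp 1) * g Opt' + sum l Opt' - g Opt' / real z - 3 * (T / real z)
      \<le> g (Ar z \<union> R) + sum l (Ar z \<union> R)"
proof -
  obtain \<pi> where \<pi>: "\<pi> \<in> PiE {..<k} (\<lambda>_. {..<z})"
    "val (Ar z) (hr z) \<le> g (Ar z \<union> (\<lambda>j. hr z (\<pi> j) j) ` {..<k}) * real z ^ k"
    using best_choice by blast
  define x where "x j = hr z (\<pi> j) j" for j
  have \<pi>z: "\<pi> j < z" if "j < p" for j using \<pi>(1) that p_le by (auto simp: PiE_iff)
  have xg: "x j \<in> pool (fil k) \<and> good j (x j)" if "j \<in> {..<p}" for j
    using hr_good[of z "\<pi> j" j] \<pi>z[of j] that p_le fillers_rows[of "\<pi> j" k j]
    using poolI[of "\<pi> j" j "fil k"] by (simp add: x_def)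
  have og: "good j (own j)" if "j \<in> {..<p}" for j
    using that own lam_own by (simp add: good_def)
  have fill: "own j \<in> pool (fil k) \<or> (\<exists>F\<subseteq>pool (fil k). card {..<p} \<le> card F \<and> (\<forall>e\<in>F. good j e))"
    if jp: "j \<in> {..<p}" for j
  proof (cases "own j \<in> pool (fil k)")
    case False
    then obtain F where "F \<subseteq> pool (fil k)" "k \<le> card F" "\<forall>e\<in>F. good j e"
      using filler_supply[of j] jp by auto
    then show ?thesis using p_le by (intro disjI2 exI[of _ F]) auto
  qed simp
  obtain y where y: "inj_on y {..<p}" "x ` {..<p} \<subseteq> y ` {..<p}"
      "\<forall>j\<in>{..<p}. y j \<in> pool (fil k) \<and> good j (y j)"
    using slot_assignment[of "{..<p}" "pool (fil k)" own x good] own_inj finite_pool xg og fill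
    by auto
  define R where "R = y ` {..<p}"
  have yg: "y j \<in> pool (fil k)" "y j < n" "heavy (y j)" "w (y j) \<le> w (own j)"
      "real (lam j) * unit_heavy \<le> l (y j)" if "j < p" for j
    using y(3) that by (auto simp: good_def)
  have "y j \<notin> Ar z" if "j < p" for j
    using subsetD[OF Ar_sub, of "y j" z] yg(3)[OF that] by (auto simp: heavy_def)
  then have disj: "Ar z \<inter> R = {}" by (auto simp: R_def)
  have finR: "finite R" by (simp add: R_def)
  have sumU: "sum f (Ar z \<union> R) = sum f (Ar z) + (\<Sum>j<p. f (y j))" for f :: "nat \<Rightarrow> real"
    using sum.union_disjoint[OF finite_Ar finR disj, of f] sum.reindex[OF y(1), of f]
    by (simp add: R_def)
  have R1: "R \<subseteq> pool (fil k)" "R \<subseteq> {..<n}" using yg by (auto simp: R_def)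
  have R2: "card R \<le> k" using card_image_le[of "{..<p}" y] p_le by (simp add: R_def)
  have weight: "sum w (Ar z \<union> R) \<le> 1"
  proof -
    have "(\<Sum>j<p. w (y j)) \<le> (\<Sum>j<p. w (own j))" by (rule sum_mono) (use yg in auto)
    then show ?thesis using Ar_weight[of z] budget unfolding sumU by linarith
  qed
  have g_part: "(1 - 1 / exp 1) * g Opt' - g Opt' / real z - T / real z \<le> g (Ar z \<union> R)"
  proof -
    have "(\<lambda>j. hr z (\<pi> j) j) ` {..<k} \<subseteq> insert n (x ` {..<p})"
    proof
      fix e assume "e \<in> (\<lambda>j. hr z (\<pi> j) j) ` {..<k}"
      then obtain j where j: "j < k" "e = x j" by (auto simp: x_def)
      show "e \<in> insert n (x ` {..<p})"
        using j hr_idle[of j z "\<pi> j"] by (cases "j < p") (auto simp: x_def)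
    qed
    then have "Ar z \<union> (\<lambda>j. hr z (\<pi> j) j) ` {..<k} \<subseteq> insert n (Ar z \<union> R)"
      using y(2) by (auto simp: R_def)
    then have "g (Ar z \<union> (\<lambda>j. hr z (\<pi> j) j) ` {..<k}) \<le> g (Ar z \<union> R)"
      using mono[of _ "insert n (Ar z \<union> R)"] by (simp only: dummy)
    then have "val (Ar z) (hr z) \<le> g (Ar z \<union> R) * real z ^ k"
      by (rule order_trans[OF \<pi>(2) mult_right_mono]) (use zk_pos in simp)
    then have "g Opt' * real z ^ k
        \<le> (g (Ar z \<union> R) + ((1 / exp 1 + 1 / real z) * g Opt' + T / real z)) * real z ^ k"
      using submodular_value unfolding distrib_right[of "g (Ar z \<union> R)"] by linarith
    then have "g Opt' \<le> g (Ar z \<union> R) + ((1 / exp 1 + 1 / real z) * g Opt' + T / real z)"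
      using zk_pos by simp
    then show ?thesis by (simp add: algebra_simps)
  qed
  \<comment> \<open>One \<open>T / z\<close> is lost by rounding the linear thresholds down, at most
    \<open>k\<close> heavy units, and another one in the density bands of the light items.\<close>
  have l_part: "sum l Opt' - 2 * (T / real z) \<le> sum l (Ar z \<union> R)"
  proof -
    let ?Z = "{e. e < n \<and> w e = 0}"
    have "(\<Sum>j<p. l (own j)) \<le> (\<Sum>j<p. l (y j) + unit_heavy)"
    proof (rule sum_mono)
      fix j assume "j \<in> {..<p}"
      then show "l (own j) \<le> l (y j) + unit_heavy"
        using lam_own_tight[of j] yg(5)[of j] by (simp add: algebra_simps)
    qed
    also have "\<dots> = (\<Sum>j<p. l (y j)) + real p * unit_heavy" by (simp add: sum.distrib)
    also have "real p * unit_heavy \<le> T / real z"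
    proof -
      have "real p * unit_heavy \<le> real k * unit_heavy"
        using p_le unit_heavy_pos by (intro mult_right_mono) auto
      also have "\<dots> = T / real z" using k_pos by (simp add: unit_heavy_def)
      finally show ?thesis .
    qed
    finally have 1: "(\<Sum>j<p. l (own j)) \<le> (\<Sum>j<p. l (y j)) + T / real z" by simp
    have "sum l Opt' = sum l ?Z + sum l (own ` {..<p}) + sum l Ls"
    proof -
      have "sum l Opt' = sum l (?Z \<union> own ` {..<p}) + sum l Ls"
        unfolding Opt'_def
      proof (rule sum.union_disjoint)
        show "(?Z \<union> own ` {..<p}) \<inter> Ls = {}"
        proof -
          have "own j \<notin> Ls" if "j < p" for j using own[OF that] Ls(2) by (auto simp: heavy_def)
          moreover have "x \<notin> Ls" if "w x = 0" for x using Ls(2)[of x] that by (auto simp: light_def)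
          ultimately show ?thesis by auto
        qed
      qed (simp_all add: finite_Ls)
      also have "sum l (?Z \<union> own ` {..<p}) = sum l ?Z + sum l (own ` {..<p})"
      proof (rule sum.union_disjoint)
        show "?Z \<inter> own ` {..<p} = {}"
        proof -
          have "w (own j) \<noteq> 0" if "j < p" for j using own[OF that] by (simp add: heavy_def)
          then show ?thesis by auto
        qed
      qed simp_all
      finally show ?thesis .
    qed
    also have "sum l (own ` {..<p}) = (\<Sum>j<p. l (own j))"
      using sum.reindex[OF own_inj, of l] by simp
    finally show ?thesis
      using 1 light_value unfolding sumU unit_light_def by linarith
  qed
  show ?thesis
    by (intro exI[of _ R] conjI R1 R2 weight) (use g_part l_part in linarith)
qed

end

text \<open>Weights are capped at \<open>w t\<close> for the colouring, which makes it balanced up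
  to \<open>w t\<close>. The \<open>k = z * m\<close> heavy items then contribute
  \<open>k * w t\<close> to the capped total, so each class has at least a \<open>z\<close>-th of
  the light weight plus \<open>(m - 1) * w t\<close>. Deleting the class that costs least frees this
  room. If at most \<open>k\<close> items have positive weight, \<open>t = n\<close> makes them all
  heavy and nothing has to be deleted.\<close>

lemma (in mono_submod) trim_optimum:
  fixes w :: "nat \<Rightarrow> real" and n z k m :: nat
  assumes S: "S \<subseteq> {..<n}" "sum w S \<le> 1" and w: "\<And>e. 0 \<le> w e" "w n = 0"
    and z: "0 < z" and k: "k = z * m" "0 < m"
  shows "\<exists>t\<le>n. \<exists>S'\<subseteq>S. {e\<in>S. w e = 0} \<subseteq> S' \<and> card {e\<in>S'. knapsack_data.heavy w t e} \<le> k \<and>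
    sum w {e\<in>S'. 0 < w e} + sum w {e\<in>S'. knapsack_data.light w t e} / real z + (real m - 1) * w t \<le> 1 \<and>
    g S - g S' \<le> g S / real z"
proof -
  define P where "P = {e\<in>S. 0 < w e}"
  have finS: "finite S" using S(1) finite_subset by auto
  then have finP: "finite P" by (simp add: P_def)
  have wP: "sum w P = sum w S"
    using finS w(1) unfolding P_def by (intro sum.mono_neutral_left) (auto simp: order.order_iff_strict)
  show ?thesis
  proof (cases "card P \<le> k")
    case True
    have lt: "\<not> knapsack_data.light w n e" for e
      unfolding knapsack_data.light_def using w by auto
    have "card {e\<in>S. knapsack_data.heavy w n e} \<le> card P"
      by (rule card_mono[OF finP]) (auto simp: P_def knapsack_data.heavy_def)
    then show ?thesis using True S(2) wP lt w(2) z nonneg[of S]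
      by (intro exI[of _ n] conjI exI[of _ S]) (auto simp: P_def)
  next
    case False
    \<comment> \<open>The order behind \<open>light\<close>, turned into an injective rank to which
      \<open>kth_largest\<close> applies.\<close>
    define lt where "lt x e \<longleftrightarrow> w x < w e \<or> (w x = w e \<and> x < e)" for x e
    define rank where "rank e = card {x\<in>P. lt x e}" for e
    have rank_less: "rank e < rank t" if "e \<in> P" "lt e t" for e t
      unfolding rank_def
    proof (rule psubset_card_mono)
      show "{x\<in>P. lt x e} \<subset> {x\<in>P. lt x t}" using that by (auto simp: lt_def)
    qed (use finP in simp)
    have total: "e = t \<or> lt e t \<or> lt t e" for e t by (auto simp: lt_def)
    have inj: "inj_on rank P"
    proof (rule inj_onI)
      fix x y assume xy: "x \<in> P" "y \<in> P" "rank x = rank y"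
      then have "\<not> lt x y" "\<not> lt y x" using rank_less[of x y] rank_less[of y x] by auto
      then show "x = y" using total[of x y] by simp
    qed
    have rank_le: "rank t \<le> rank e \<longleftrightarrow> \<not> lt e t" if "e \<in> P" "t \<in> P" for e t
    proof (cases "lt e t")
      case True
      then show ?thesis using rank_less[OF that(1) True] by simp
    next
      case False
      then have "e = t \<or> lt t e" using total[of e t] by simp
      then have "rank t \<le> rank e" using rank_less[OF that(2), of e] by auto
      then show ?thesis using False by simp
    qed
    obtain t where t: "t \<in> P" "card {e\<in>P. rank t \<le> rank e} = k"
      using kth_largest[OF finP inj, of k] False z k by auto
    have light: "knapsack_data.light w t e \<longleftrightarrow> lt e t" if "e \<in> P" for e
      using that by (auto simp: knapsack_data.light_def lt_def P_def)
    have heavy: "knapsack_data.heavy w t e \<longleftrightarrow> \<not> lt e t" if "e \<in> P" for e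
      using light[OF that] that by (auto simp: knapsack_data.heavy_def P_def)
    have cardH: "card {e\<in>P. \<not> lt e t} = k"
    proof -
      have "{e\<in>P. \<not> lt e t} = {e\<in>P. rank t \<le> rank e}" using rank_le t(1) by auto
      then show ?thesis using t(2) by simp
    qed
    have wt: "0 < w t" using t by (simp add: P_def)
    define v where "v e = min (w e) (w t)" for e
    obtain c where c: "\<And>r. r < z \<Longrightarrow> (\<Sum>e\<in>P. v e) / real z - w t \<le> (\<Sum>e\<in>{e\<in>P. c e = (r::nat)}. v e)"
      using balanced_colouring[OF finP, of v "w t" z] w(1) wt z by (auto simp: v_def)
    define X where "X r = {e. e \<in> P \<and> c e = r}" for r
    define L where "L = {e\<in>P. lt e t}"
    have "(\<Sum>e\<in>P. v e) = (\<Sum>e\<in>L. v e) + (\<Sum>e\<in>{e\<in>P. \<not> lt e t}. v e)"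
    proof -
      have "P = L \<union> {e\<in>P. \<not> lt e t}" by (auto simp: L_def)
      moreover have "sum v (L \<union> {e\<in>P. \<not> lt e t}) = sum v L + sum v {e\<in>P. \<not> lt e t}"
        by (rule sum.union_disjoint) (use finP in \<open>auto simp: L_def\<close>)
      ultimately show ?thesis by simp
    qed
    also have "(\<Sum>e\<in>L. v e) = sum w L" by (intro sum.cong) (auto simp: L_def lt_def v_def)
    also have "(\<Sum>e\<in>{e\<in>P. \<not> lt e t}. v e) = (\<Sum>e\<in>{e\<in>P. \<not> lt e t}. w t)"
      by (intro sum.cong) (auto simp: lt_def v_def)
    also have "\<dots> = real k * w t" by (simp add: cardH)
    finally have sum_v: "(\<Sum>e\<in>P. v e) / real z = sum w L / real z + real m * w t"
      using z by (simp add: k add_divide_distrib)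
    have wX: "sum w L / real z + (real m - 1) * w t \<le> sum w (X r)" if "r < z" for r
    proof -
      have "(\<Sum>e\<in>X r. v e) \<le> sum w (X r)" by (rule sum_mono) (simp add: v_def)
      then show ?thesis using c[OF that] unfolding sum_v X_def by (simp add: algebra_simps)
    qed
    \<comment> \<open>The \<open>z\<close> losses add up to at most \<open>g S\<close>, so not all
      of them can exceed the average.\<close>
    have "\<exists>r<z. g S - g (S - X r) \<le> g S / real z"
    proof (rule ccontr)
      assume "\<not> ?thesis"
      then have "(\<Sum>r<z. g S / real z) < (\<Sum>r<z. g S - g (S - X r))"
        using z by (intro sum_strict_mono) auto
      then show False using removal_loss[where z = z and S = S and P = P and c = c] z by (simp add: X_def)
    qed
    then obtain r where r: "r < z" "g S - g (S - X r) \<le> g S / real z" by blast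
    define S' where "S' = S - X r"
    have XP: "X r \<subseteq> P" by (auto simp: X_def)
    have P': "{e\<in>S'. 0 < w e} = P - X r" by (auto simp: S'_def P_def)
    have "sum w {e\<in>S'. 0 < w e} = sum w P - sum w (X r)"
      unfolding P' using finP XP by (simp add: sum_diff)
    moreover have "sum w {e\<in>S'. knapsack_data.light w t e} \<le> sum w L"
    proof (rule sum_mono2)
      show "{e\<in>S'. knapsack_data.light w t e} \<subseteq> L"
        using light by (auto simp: L_def S'_def P_def knapsack_data.light_def)
    qed (use finP w in \<open>auto simp: L_def\<close>)
    then have "sum w {e\<in>S'. knapsack_data.light w t e} / real z \<le> sum w L / real z"
      by (rule divide_right_mono) simp
    ultimately have wt1: "sum w {e\<in>S'. 0 < w e} + sum w {e\<in>S'. knapsack_data.light w t e} / real z + (real m - 1) * w t \<le> 1"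
      using wX[OF r(1)] wP S(2) by linarith
    have "card {e\<in>S'. knapsack_data.heavy w t e} \<le> card {e\<in>P. \<not> lt e t}"
    proof (rule card_mono)
      show "{e\<in>S'. knapsack_data.heavy w t e} \<subseteq> {e\<in>P. \<not> lt e t}"
        using heavy by (auto simp: S'_def P_def knapsack_data.heavy_def)
    qed (use finP in simp)
    then have "card {e\<in>S'. knapsack_data.heavy w t e} \<le> k" by (simp add: cardH)
    moreover have "t \<le> n" using t S(1) by (auto simp: P_def)
    moreover have "{e\<in>S. w e = 0} \<subseteq> S'" by (auto simp: S'_def X_def P_def)
    ultimately show ?thesis using wt1 r(2)
      by (intro exI[of _ t] conjI exI[of _ S']) (auto simp: S'_def)
  qed
qed

text \<open>Turns the target \<open>(1 - 1 / exp 1) * g + l\<close> into one monotone submodular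
  function. Trimming is applied to it, so that a single deleted class is cheap for both summands
  together.\<close>

lemma mono_submod_combination:
  assumes "mono_submod g" "0 \<le> a" "\<And>e. 0 \<le> (l e :: real)"
  shows "mono_submod (\<lambda>S. a * g S + sum l (S \<inter> {..<n}))"
proof -
  interpret mono_submod g by fact
  show ?thesis
  proof
    fix S S' :: "nat set"
    show "a * g S + sum l (S \<inter> {..<n}) \<le> a * g S' + sum l (S' \<inter> {..<n})" if "S \<subseteq> S'"
      using that mono[OF that] assms by (intro add_mono mult_left_mono sum_mono2) auto
    show "0 \<le> a * g S + sum l (S \<inter> {..<n})"
      using nonneg assms by (simp add: sum_nonneg)
    have "sum l ((S \<union> S') \<inter> {..<n}) + sum l ((S \<inter> S') \<inter> {..<n}) = sum l (S \<inter> {..<n}) + sum l (S' \<inter> {..<n})"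
    proof -
      have "(S \<union> S') \<inter> {..<n} = (S \<inter> {..<n}) \<union> (S' \<inter> {..<n})"
        "(S \<inter> S') \<inter> {..<n} = (S \<inter> {..<n}) \<inter> (S' \<inter> {..<n})" by auto
      then show ?thesis using sum.union_inter[of "S \<inter> {..<n}" "S' \<inter> {..<n}" l] by simp
    qed
    moreover have "a * g (S \<union> S') + a * g (S \<inter> S') \<le> a * g S + a * g S'"
      using mult_left_mono[OF submod[of S S'] assms(2)] by (simp add: distrib_left)
    ultimately show "a * g (S \<union> S') + sum l ((S \<union> S') \<inter> {..<n}) + (a * g (S \<inter> S') + sum l (S \<inter> S' \<inter> {..<n}))
      \<le> a * g S + sum l (S \<inter> {..<n}) + (a * g S' + sum l (S' \<inter> {..<n}))"
      by linarith
  qed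
qed

section \<open>The adaptive policy as a finite guess vector\<close>

context knapsack_data
begin

lemma hrow_cong:
  assumes "\<And>j'. j' < j \<Longrightarrow> V' i j' A (hrow V i A h j') = V i j' A (hrow V i A h j')"
  shows "hrow V' i A h j = hrow V i A h j"
  using assms by (induction j) (simp_all add: Let_def)

text \<open>Policies that agree on the states actually reached have the same run. Hence a
  state-dependent policy can be replaced by the list of its values along its own run.\<close>

lemma rows_cong:
  assumes "\<And>i' j. i' < i \<Longrightarrow> j < k \<Longrightarrow>
    V' i' j (fst (rows V i')) (hrow V i' (fst (rows V i')) (snd (rows V i')) j)
      = V i' j (fst (rows V i')) (hrow V i' (fst (rows V i')) (snd (rows V i')) j)"
  shows "rows V' i = rows V i"
  using assms
proof (induction i)
  case (Suc i)
  have "hrow V' i (fst (rows V i)) (snd (rows V i)) k = hrow V i (fst (rows V i)) (snd (rows V i)) k"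
    by (rule hrow_cong) (use Suc.prems in auto)
  then show ?case using Suc by (simp add: split_beta)
qed simp

lemma helig_filler: "z \<le> i \<Longrightarrow> helig v i j A h = helig v' i j A h"
  by (rule ext) (simp add: helig_def)

lemma hrow_filler:
  assumes "z \<le> i"
  shows "hrow V' i A h j = hrow V i A h j"
proof (induction j)
  case (Suc j)
  let ?h = "hrow V i A h j"
  have "hpick (V' i j A ?h) i j A ?h = hpick (V i j A ?h) i j A ?h"
    unfolding hpick_def helig_filler[OF assms, of "V' i j A ?h" j A ?h "V i j A ?h"] ..
  then show ?case by (simp add: Let_def Suc)
qed simp

lemma fillers_cong: "rows V' z = rows V z \<Longrightarrow> fillers V' r = fillers V r"
  by (induction r) (simp_all add: hrow_filler[of _ V' _ _ _ V])

end

definition guess_policy :: "nat \<Rightarrow> (nat \<Rightarrow> nat) \<Rightarrow> nat \<Rightarrow> nat \<Rightarrow> nat set \<Rightarrow> (nat \<Rightarrow> nat \<Rightarrow> nat) \<Rightarrow> nat" where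
  "guess_policy k G i j A h = G (i * k + j)"

text \<open>The exponents come from the weight budget. \<open>Q = z^3\<close> makes the top class
  weigh at most \<open>Bt / z^2\<close>. The overshoot \<open>z * (Q + 2) = z^4 + 2 * z\<close>
  light items, one more for rounding \<open>Bt\<close>, and the factor \<open>z^5 - 1\<close> of the
  room left by trimming lead to \<open>k = z * z^5\<close>. Finally \<open>z^8\<close> bounds both
  the entries of the guess vector, at most \<open>k * z + 1\<close>, and its length
  \<open>(z + 1) * k + Q + 2\<close>. Of the five losses \<open>T / z\<close>, one is due to
  trimming, one to the error of \<open>1 / exp 1\<close>, and three to rounding.\<close>

lemma exists_good_guess:
  fixes g :: "nat set \<Rightarrow> real" and l w :: "nat \<Rightarrow> real" and n z :: nat and T :: real
  defines "Q \<equiv> z ^ 3" and "k \<equiv> z ^ 6"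
  assumes g: "mono_submod g" "\<And>S. g (insert n S) = g S"
    and w: "\<And>e. 0 \<le> w e" "w n = 0" and l: "\<And>e. 0 \<le> l e"
    and z: "2 \<le> z" and T: "0 < T"
    and T_ub: "\<And>S. S \<subseteq> {..<n} \<Longrightarrow> sum w S \<le> 1 \<Longrightarrow> g S + sum l S \<le> T"
    and w1: "\<And>e. e < n \<Longrightarrow> w e \<le> 1"
    and S: "S \<subseteq> {..<n}" "sum w S \<le> 1"
  shows "\<exists>t\<le>n. \<exists>bb\<le>n. \<exists>G. (\<forall>x. G x < z ^ 8) \<and> (\<forall>x\<ge>z ^ 8. G x = 0) \<and>
    (let Bt = real bb * w t; lam = (\<lambda>j. G (z * k + j)); c = (\<lambda>q. G ((z + 1) * k + q));
         rws = knapsack_data.rows g n l w z k Q t T Bt lam c (guess_policy k G);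
         fl = knapsack_data.fillers g n l w z k Q t T Bt lam c (guess_policy k G) k
     in \<exists>R\<subseteq>knapsack_data.pool z k fl. card R \<le> k \<and> R \<subseteq> {..<n} \<and> sum w (fst (rws z) \<union> R) \<le> 1 \<and>
       (1 - 1 / exp 1) * g S + sum l S - 5 * (T / real z) \<le> g (fst (rws z) \<union> R) + sum l (fst (rws z) \<union> R))"
proof -
  interpret g: mono_submod g by fact
  define \<phi> where "\<phi> S = (1 - 1 / exp 1) * g S + sum l (S \<inter> {..<n})" for S
  have a01: "0 \<le> 1 - 1 / exp (1::real)" by simp
  interpret \<phi>: mono_submod \<phi>
    unfolding \<phi>_def[abs_def] by (rule mono_submod_combination[OF g(1) a01 l])
  have zpos: "0 < z" using z by simp
  have km: "k = z * z ^ 5" "0 < z ^ 5" using zpos by (simp_all add: k_def eval_nat_numeral)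
  obtain t S' where t: "t \<le> n" and S': "S' \<subseteq> S" "{e\<in>S. w e = 0} \<subseteq> S'"
    and cardH: "card {e\<in>S'. knapsack_data.heavy w t e} \<le> k"
    and wS': "sum w {e\<in>S'. 0 < w e} + sum w {e\<in>S'. knapsack_data.light w t e} / real z + (real (z ^ 5) - 1) * w t \<le> 1"
    and \<phi>S': "\<phi> S - \<phi> S' \<le> \<phi> S / real z"
    using \<phi>.trim_optimum[OF S w zpos km] by blast
  define H where "H = {e\<in>S'. knapsack_data.heavy w t e}"
  define Ls where "Ls = {e\<in>S'. knapsack_data.light w t e}"
  have S'n: "S' \<subseteq> {..<n}" using S S' by auto
  have finS': "finite S'" using S'n finite_subset by auto
  have finH: "finite H" and finL: "finite Ls" using finS' by (simp_all add: H_def Ls_def)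
  define p where "p = card H"
  obtain f where f: "bij_betw f {0..<p} H" using ex_bij_betw_nat_finite[OF finH] p_def by auto
  \<comment> \<open>Beyond \<open>p\<close> the dummy item stands in; its marginal gain is 0, so the
    policy takes bounded values at idle slots too.\<close>
  define own where "own j = (if j < p then f j else n)" for j
  have own_bij: "bij_betw own {..<p} H"
    using f by (subst bij_betw_cong[of "{..<p}" own f]) (auto simp: own_def lessThan_atLeast0)
  have light_wt: "w e \<le> w t" "0 < w e" if "e \<in> Ls" for e
    using that by (auto simp: Ls_def knapsack_data.light_def)
  have wt0: "0 < w t" if "Ls \<noteq> {}" using that light_wt by fastforce
  have wL_n: "sum w Ls \<le> real n * w t"
  proof -
    have "sum w Ls \<le> real (card Ls) * w t" using light_wt by (intro sum_bounded_above) auto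
    also have "card Ls \<le> n" using card_mono[of "{..<n}" Ls] S'n by (auto simp: Ls_def)
    then have "real (card Ls) * w t \<le> real n * w t" using w by (intro mult_right_mono) auto
    finally show ?thesis .
  qed
  \<comment> \<open>The light weight is guessed up to one \<open>w t\<close>, and at most
    \<open>n\<close> light items weigh at most \<open>n * w t\<close>. If \<open>w t = 0\<close>,
    the division yields \<open>bb = 0\<close>, which is correct because \<open>Ls\<close> is then
    empty.\<close>
  define bb where "bb = nat \<lceil>sum w Ls / w t\<rceil>"
  have sL0: "0 \<le> sum w Ls" using w by (simp add: sum_nonneg)
  have bb: "bb \<le> n" "sum w Ls \<le> real bb * w t" "real bb * w t \<le> sum w Ls + w t"
  proof -
    have q0: "0 \<le> sum w Ls / w t" using sL0 w by simp
    have r: "real bb = of_int \<lceil>sum w Ls / w t\<rceil>" using q0 by (simp add: bb_def)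
    show "bb \<le> n"
    proof (cases "w t = 0")
      case False
      then have "0 < w t" using w(1)[of t] by (simp add: order.order_iff_strict)
      then have "sum w Ls / w t \<le> real n" using wL_n by (simp add: pos_divide_le_eq)
      then show ?thesis unfolding bb_def by (simp add: nat_le_iff ceiling_le_iff)
    qed (simp add: bb_def)
    show "sum w Ls \<le> real bb * w t" "real bb * w t \<le> sum w Ls + w t"
    proof (atomize(full), cases "Ls = {}")
      case True
      then show "sum w Ls \<le> real bb * w t \<and> real bb * w t \<le> sum w Ls + w t"
        using w by (simp add: bb_def)
    next
      case False
      have "sum w Ls / w t \<le> real bb" "real bb \<le> sum w Ls / w t + 1" unfolding r by linarith+
      then show "sum w Ls \<le> real bb * w t \<and> real bb * w t \<le> sum w Ls + w t"
        using wt0[OF False] by (simp add: pos_divide_le_eq field_simps)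
    qed
  qed
  define Bt where "Bt = real bb * w t"
  define uh where "uh = T / (real k * real z)"
  define mu where "mu = Bt / (2 * real z * (real Q + 2))"
  define cs where "cs q = {e\<in>Ls. knapsack_data.cls l w z Q T Bt q e}" for q
  define c where "c q = (if q < Q + 2 then nat \<lceil>sum w (cs q) / mu\<rceil> else 0)" for q
  \<comment> \<open>\<open>k * z\<close> units make up \<open>T\<close>, so \<open>k * z + 1\<close>
    units exceed every linear value and switch the slot off. From index \<open>k\<close> on,
    \<open>lam\<close> continues with the class budgets to match the layout of the guess
    vector.\<close>
  define lam where "lam j = (if j < p then nat \<lfloor>l (own j) / uh\<rfloor> else if j < k then k * z + 1 else c (j - k))" for j
  have kpos: "0 < k" "0 < Q" using zpos by (simp_all add: k_def Q_def)
  have uh: "0 < uh" using T zpos kpos by (simp add: uh_def)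
  have Bt0: "0 \<le> Bt" using w by (simp add: Bt_def)
  have mu0: "0 \<le> mu" using Bt0 by (simp add: mu_def)
  have single: "g {e} + l e \<le> T" if "e < n" for e
    using T_ub[of "{e}"] that w1 by simp
  have lT: "l e \<le> T" "g {e} \<le> T" if "e < n" for e
    using single[OF that] g.nonneg[of "{e}"] l[of e] by linarith+
  have cs_le: "sum w (cs q) \<le> Bt" for q
  proof -
    have "sum w (cs q) \<le> sum w Ls" by (rule sum_mono2) (use finL w in \<open>auto simp: cs_def\<close>)
    then show ?thesis using bb(2) by (simp add: Bt_def)
  qed
  have cs0: "0 \<le> sum w (cs q)" for q using w by (simp add: sum_nonneg)
  have c_mu: "sum w (cs q) \<le> real (c q) * mu" "real (c q) * mu \<le> sum w (cs q) + mu" if "q < Q + 2" for q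
  proof (atomize(full), cases "mu = 0")
    case True
    then have "Bt = 0" using zpos by (simp add: mu_def)
    then have "sum w (cs q) = 0" using cs_le[of q] cs0[of q] by simp
    then show "sum w (cs q) \<le> real (c q) * mu \<and> real (c q) * mu \<le> sum w (cs q) + mu"
      using True by simp
  next
    case False
    then have mp: "0 < mu" using mu0 by simp
    then have "0 \<le> sum w (cs q) / mu" using cs0 by simp
    then have "real (c q) = of_int \<lceil>sum w (cs q) / mu\<rceil>" using that by (simp add: c_def)
    then have "sum w (cs q) / mu \<le> real (c q)" "real (c q) \<le> sum w (cs q) / mu + 1" by linarith+
    then show "sum w (cs q) \<le> real (c q) * mu \<and> real (c q) * mu \<le> sum w (cs q) + mu"
      using mp by (simp add: pos_divide_le_eq field_simps)
  qed
  have c_le: "c q \<le> 2 * z * (Q + 2)" for q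
  proof -
    have "sum w (cs q) / mu \<le> real (2 * z * (Q + 2))"
    proof (cases "mu = 0")
      case False
      then have mp: "0 < mu" using mu0 by simp
      have nz: "2 * real z * (real Q + 2) \<noteq> 0" using zpos by simp
      have "real (2 * z * (Q + 2)) = 2 * real z * (real Q + 2)" by (simp add: algebra_simps)
      then have "real (2 * z * (Q + 2)) * mu = Bt"
        unfolding mu_def by (simp only: times_divide_eq_right nonzero_mult_div_cancel_left[OF nz])
      then show ?thesis using cs_le[of q] mp by (simp add: pos_divide_le_eq)
    qed simp
    then show ?thesis by (simp add: c_def nat_le_iff ceiling_le_iff)
  qed
  have lam: "real (lam j) * uh \<le> l (own j)" "l (own j) \<le> (real (lam j) + 1) * uh" if "j < p" for j
  proof -
    have "0 \<le> l (own j) / uh" using l uh by simp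
    then have "real (lam j) = of_int \<lfloor>l (own j) / uh\<rfloor>" using that by (simp add: lam_def)
    then have "real (lam j) \<le> l (own j) / uh" "l (own j) / uh \<le> real (lam j) + 1" by linarith+
    then show "real (lam j) * uh \<le> l (own j)" "l (own j) \<le> (real (lam j) + 1) * uh"
      using uh by (simp_all add: pos_le_divide_eq pos_divide_le_eq)
  qed
  have kzuh: "real (k * z) * uh = T" using kpos zpos by (simp add: uh_def)
  have own_n: "own j < n" "knapsack_data.heavy w t (own j)" "own j \<in> S'" if "j < p" for j
    using own_bij that S'n by (auto simp: bij_betw_def H_def)
  interpret knapsack g n l w z k Q t T Bt lam c
    by unfold_locales (use g w l zpos kpos T Bt0 in auto)
  have uh_eq: "unit_heavy = uh" "unit_weight = mu"
    by (simp_all add: unit_heavy_def uh_def unit_weight_def mu_def)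
  interpret knapsack_opt g n l w z k Q t T Bt lam c own p Ls
  proof unfold_locales
    show "p \<le> k" using cardH by (simp add: p_def H_def)
    show "inj_on own {..<p}" using own_bij by (simp add: bij_betw_def)
    show "own j < n \<and> heavy (own j)" if "j < p" for j using own_n that by simp
    show "real (lam j) * unit_heavy \<le> l (own j)" if "j < p" for j using lam(1)[OF that] by (simp add: uh_eq)
    show "l (own j) \<le> (real (lam j) + 1) * unit_heavy" if "j < p" for j using lam(2)[OF that] by (simp add: uh_eq)
    show "l e < real (lam j) * unit_heavy" if "p \<le> j" "j < k" "e < n" for j e
    proof -
      have "real (lam j) * uh = T + uh" using that kzuh by (simp add: lam_def distrib_right)
      then show ?thesis using lT(1)[OF that(3)] uh by (simp add: uh_eq)
    qed
    show "Ls \<subseteq> {..<n}" using S'n by (auto simp: Ls_def)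
    show "light e" if "e \<in> Ls" for e using that by (simp add: Ls_def)
    show "sum w {e\<in>Ls. cls q e} \<le> real (c q) * unit_weight" if "q < Q + 2" for q
      using c_mu(1)[OF that] by (simp add: uh_eq cs_def)
    show "sum w Ls \<le> Bt" using bb by (simp add: Bt_def)
  qed
  have lLs: "sum l Ls \<le> T"
  proof -
    have "finite S" by (rule finite_subset[OF S(1)]) simp
    moreover have "Ls \<subseteq> S" using S'(1) by (auto simp: Ls_def)
    ultimately have "sum w Ls \<le> sum w S" using w(1) by (intro sum_mono2) auto
    moreover have "Ls \<subseteq> {..<n}" using S'n by (auto simp: Ls_def)
    ultimately have "g Ls + sum l Ls \<le> T" using S(2) by (intro T_ub) auto
    then show ?thesis using g.nonneg[of Ls] by linarith
  qed
  have z_r: "(2::real) \<le> real z" using z by simp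
  have zr0: "0 < real z" using zpos by simp
  \<comment> \<open>The density of these items is at least \<open>Q * unit_light / Bt\<close> and
    their linear value at most \<open>T\<close>. So \<open>z^2\<close> times their weight is at most
    \<open>Bt\<close>, and \<open>z \<ge> 2\<close> leaves the half of \<open>Bt / z\<close> set
    aside for the duplicate class.\<close>
  have top: "sum w (cs Q) \<le> Bt / (2 * real z)"
  proof -
    have "real Q * unit_light * sum w (cs Q) \<le> Bt * sum l (cs Q)"
      unfolding sum_distrib_left
      by (rule sum_mono) (auto simp: cs_def cls_def mult.commute)
    also have "\<dots> \<le> Bt * T"
    proof (rule mult_left_mono[OF _ Bt0])
      have "sum l (cs Q) \<le> sum l Ls" by (rule sum_mono2) (use finL l in \<open>auto simp: cs_def\<close>)
      then show "sum l (cs Q) \<le> T" using lLs by simp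
    qed
    finally have "real z ^ 2 * sum w (cs Q) * T \<le> Bt * T"
      using zr0 by (simp add: unit_light_def Q_def power2_eq_square power3_eq_cube mult_ac)
    then have "real z ^ 2 * sum w (cs Q) \<le> Bt" using T by simp
    moreover have "2 * real z * sum w (cs Q) \<le> real z ^ 2 * sum w (cs Q)"
      using z_r cs0 unfolding power2_eq_square by (intro mult_right_mono) auto
    ultimately show ?thesis using zr0 by (simp add: pos_le_divide_eq mult.commute)
  qed
  \<comment> \<open>Trimming left the room \<open>sum w Ls / z + (z^5 - 1) * w t\<close>. It pays
    \<open>Bt / z\<close>, half for rounding up the class budgets and half for the duplicate class,
    and the overshoots; one \<open>w t\<close> is spent because \<open>Bt\<close> may exceed
    \<open>sum w Ls\<close>.\<close>
  have budget: "(\<Sum>j<p. w (own j)) + real z * (\<Sum>q<Q + 2. real (c q) * unit_weight / real z + w t) \<le> 1"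
  proof -
    have own_H: "(\<Sum>j<p. w (own j)) = sum w H"
      using sum.reindex_bij_betw[OF own_bij, of w] by simp
    have "real z * (\<Sum>q<Q + 2. real (c q) * mu / real z + w t)
        = (\<Sum>q<Q + 2. real (c q) * mu) + real z * (real Q + 2) * w t"
    proof -
      define X where "X = (\<Sum>q<Q + 2. real (c q) * mu)"
      have X: "(\<Sum>q<Q + 2. real (c q) * mu / real z + w t) = X / real z + real (Q + 2) * w t"
        unfolding X_def by (simp only: sum.distrib sum_divide_distrib sum_constant card_lessThan)
      have "real z * (X / real z + real (Q + 2) * w t) = X + real z * (real Q + 2) * w t"
        using zr0 by (simp add: field_simps)
      then show ?thesis unfolding X X_def .
    qed
    also have "(\<Sum>q<Q + 2. real (c q) * mu) \<le> (\<Sum>q<Q + 2. sum w (cs q) + mu)"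
      by (rule sum_mono) (use c_mu(2) in auto)
    also have "(\<Sum>q<Q + 2. sum w (cs q) + mu) = (\<Sum>q\<le>Q. sum w (cs q)) + sum w (cs Q) + (real Q + 2) * mu"
    proof -
      have "cs (Suc Q) = cs Q" by (simp add: cs_def cls_top)
      then show ?thesis by (simp add: sum.distrib lessThan_Suc_atMost[symmetric] algebra_simps)
    qed
    also have "(\<Sum>q\<le>Q. sum w (cs q)) = sum w Ls"
      unfolding cs_def by (rule sum_cls[OF finL]) (simp add: Ls_def)
    also have "(real Q + 2) * mu = Bt / (2 * real z)"
    proof -
      define y where "y = real Q + 2"
      have "y \<noteq> 0" unfolding y_def by linarith
      then show ?thesis unfolding mu_def y_def[symmetric] by simp
    qed
    finally have "real z * (\<Sum>q<Q + 2. real (c q) * mu / real z + w t)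
        \<le> sum w Ls + (Bt / (2 * real z) + Bt / (2 * real z)) + real z * (real Q + 2) * w t"
      using top by linarith
    also have "Bt / (2 * real z) + Bt / (2 * real z) = Bt / real z" by simp
    also have "Bt / real z \<le> sum w Ls / real z + w t"
    proof -
      have "Bt / real z \<le> (sum w Ls + w t) / real z"
        using bb(3) zr0 by (intro divide_right_mono) (auto simp: Bt_def)
      also have "\<dots> = sum w Ls / real z + w t / real z" by (rule add_divide_distrib)
      also have "w t / real z \<le> w t" using w(1)[of t] z_r mult_left_mono[of 1 "real z" "w t"]
        by (simp add: pos_divide_le_eq[OF zr0])
      finally show ?thesis by simp
    qed
    also have "real z * (real Q + 2) * w t \<le> (real (z ^ 5) - 2) * w t"
    proof (rule mult_right_mono[OF _ w(1)])
      have q4: "real z ^ 5 = real z * real z ^ 4" "real z ^ 4 = real z * real z ^ 3" "real z ^ 3 = real z * real z ^ 2"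
        by (simp_all add: eval_nat_numeral)
      have z2: "2 * real z \<le> real z ^ 2" using z_r by (simp add: power2_eq_square)
      have z3: "2 * real z ^ 2 \<le> real z ^ 3" unfolding q4(3) using z_r by (intro mult_right_mono) auto
      have z4: "2 * real z ^ 3 \<le> real z ^ 4" unfolding q4(2) using z_r by (intro mult_right_mono) auto
      have z5: "2 * real z ^ 4 \<le> real z ^ 5" unfolding q4(1) using z_r by (intro mult_right_mono) auto
      have "real z * (real Q + 2) = real z ^ 4 + 2 * real z"
        by (simp add: Q_def q4(2) distrib_left)
      then show "real z * (real Q + 2) \<le> real (z ^ 5) - 2"
        using z_r z2 z3 z4 z5 by simp
    qed
    finally have "real z * (\<Sum>q<Q + 2. real (c q) * mu / real z + w t)
        \<le> sum w Ls + sum w Ls / real z + (real (z ^ 5) - 1) * w t"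
      by (simp add: left_diff_distrib)
    moreover have "sum w H + sum w Ls = sum w {e\<in>S'. 0 < w e}"
    proof -
      have "{e\<in>S'. 0 < w e} = H \<union> Ls" by (auto simp: H_def Ls_def heavy_def light_def)
      moreover have "sum w (H \<union> Ls) = sum w H + sum w Ls"
        by (rule sum.union_disjoint[OF finH finL]) (auto simp: H_def Ls_def heavy_def)
      ultimately show ?thesis by simp
    qed
    ultimately show ?thesis using wS' unfolding own_H uh_eq Ls_def[symmetric] by linarith
  qed
  from rounding[OF budget] obtain R where R: "R \<subseteq> pool (fil k)" "card R \<le> k" "R \<subseteq> {..<n}"
    "sum w (Ar z \<union> R) \<le> 1"
    "(1 - 1 / exp 1) * g Opt' + sum l Opt' - g Opt' / real z - 3 * (T / real z) \<le> g (Ar z \<union> R) + sum l (Ar z \<union> R)"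
    by blast
  have own_img: "own ` {..<p} = H" using own_bij by (simp add: bij_betw_def)
  have Opt'_n: "Opt' \<subseteq> {..<n}" 
  proof -
    have "Ls \<subseteq> {..<n}" using S'n by (auto simp: Ls_def)
    then show ?thesis unfolding Opt'_def using own_n(1) by auto
  qed
  have S'_Opt: "S' \<subseteq> Opt'"
  proof
    fix e assume e: "e \<in> S'"
    have "w e = 0 \<or> heavy e \<or> light e" using w(1)[of e] by (auto simp: heavy_def order.order_iff_strict)
    then show "e \<in> Opt'" using e S'n unfolding Opt'_def own_img by (auto simp: H_def Ls_def)
  qed
  have "sum w Opt' \<le> sum w S'"
  proof -
    have "sum w Opt' = sum w {e\<in>Opt'. w e \<noteq> 0}"
      using Opt'_n finite_subset by (intro sum.mono_neutral_right) auto
    also have "\<dots> \<le> sum w S'"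
    proof (rule sum_mono2[OF finS'])
      have "Ls \<subseteq> S'" "H \<subseteq> S'" by (auto simp: Ls_def H_def)
      then show "{e\<in>Opt'. w e \<noteq> 0} \<subseteq> S'" unfolding Opt'_def own_img by auto
    qed (rule w(1))
    finally show ?thesis .
  qed
  also have "\<dots> \<le> sum w S"
    by (rule sum_mono2) (use S'(1) w(1) finite_subset[OF S(1)] in auto)
  finally have "g Opt' + sum l Opt' \<le> T" using T_ub[OF Opt'_n] S(2) by simp
  moreover have "0 \<le> sum l Opt'" using l by (simp add: sum_nonneg)
  ultimately have gOpt: "g Opt' / real z \<le> T / real z"
    using zr0 by (intro divide_right_mono) auto
  have "\<phi> S \<le> T"
  proof -
    have "(1 - 1 / exp 1) * g S \<le> 1 * g S"
      using g.nonneg[of S] by (intro mult_right_mono) auto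
    then show ?thesis using T_ub[OF S] S(1) by (simp add: \<phi>_def Int_absorb2)
  qed
  then have "\<phi> S / real z \<le> T / real z" using zr0 by (intro divide_right_mono) auto
  then have "\<phi> S - T / real z \<le> \<phi> Opt'" using \<phi>S' \<phi>.mono[OF S'_Opt] by linarith
  then have final_value: "(1 - 1 / exp 1) * g S + sum l S - 5 * (T / real z) \<le> g (Ar z \<union> R) + sum l (Ar z \<union> R)"
    using R(5) gOpt S(1) Opt'_n by (simp add: \<phi>_def Int_absorb2)
  \<comment> \<open>The first \<open>z * k\<close> entries record the policy along its own run,
    addressed by row and slot.\<close>
  define G where "G x = (if x < z * k then
      policy (x div k) (x mod k) (Ar (x div k)) (hrw (x div k) (Ar (x div k)) (hr (x div k)) (x mod k))
    else lam (x - z * k))" for x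
  have pow: "z ^ 8 = z * (z * k)" "z ^ 8 = z ^ 2 * k" by (simp_all add: k_def eval_nat_numeral)
  have kz: "k * z + 1 < z ^ 8"
  proof -
    have "2 * 1 \<le> z * k" using kpos by (intro mult_le_mono z) simp
    then have "k * z + 1 < 2 * (z * k)" unfolding mult.commute[of k z] by linarith
    also have "\<dots> \<le> z * (z * k)" using z by (intro mult_right_mono) auto
    finally show ?thesis by (simp add: pow)
  qed
  have zQ: "Q + 2 + 2 * z * (Q + 2) \<le> k * z"
  proof -
    have Q8: "8 \<le> Q" using power_mono[OF z, of 3] by (simp add: Q_def)
    have k_eq: "k = Q * Q" by (simp add: k_def Q_def flip: power_add)
    have "Q + 2 + 2 * z * (Q + 2) \<le> z * (Q + 2) + 2 * z * (Q + 2)"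
    proof -
      have "1 * (Q + 2) \<le> z * (Q + 2)" using zpos by (intro mult_le_mono) auto
      from add_right_mono[OF this, of "2 * z * (Q + 2)"] show ?thesis by (simp only: mult_1)
    qed
    also have "\<dots> = z * (3 * (Q + 2))" by (simp add: algebra_simps)
    also have "3 * (Q + 2) \<le> 8 * Q" using Q8 by simp
    also have "8 * Q \<le> Q * Q" using Q8 by (rule mult_right_mono) simp
    finally show ?thesis by (simp add: k_eq mult.commute)
  qed
  have lam_le: "lam j \<le> k * z + 1" for j
  proof (cases "j < p")
    case True
    have "real (lam j) * uh \<le> real (k * z) * uh"
      using lam(1)[OF True] lT(1)[OF own_n(1)[OF True]] kzuh by linarith
    then have "real (lam j) \<le> real (k * z)" using uh by simp
    then have "lam j \<le> k * z" by (simp only: of_nat_le_iff)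
    then show ?thesis by simp
  next
    case False
    then show ?thesis using c_le[of "j - k"] zQ by (auto simp: lam_def)
  qed
  have pol_le: "policy i j A h \<le> k * z" for i j A h
  proof (cases "j < p")
    case True
    then show ?thesis using policy_le lT(2) own_n(1) by blast
  next
    case False
    then have "own j = n" by (simp add: own_def)
    moreover have "marg A h n = 0" by (simp add: marg_def val_def dummy)
    ultimately show ?thesis by (simp add: policy_def)
  qed
  have Gb: "G x < z ^ 8" for x
  proof (cases "x < z * k")
    case True
    then have "G x \<le> k * z" unfolding G_def using pol_le by simp
    then show ?thesis using kz by linarith
  next
    case False
    then have "G x \<le> k * z + 1" unfolding G_def using lam_le by simp
    then show ?thesis using kz by linarith
  qed
  \<comment> \<open>A guess is a function on all naturals. Vanishing beyond the vector makes it the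
    decoding of a single number.\<close>
  have G0: "G x = 0" if x: "z ^ 8 \<le> x" for x
  proof -
    have Q8: "8 \<le> Q" using power_mono[OF z, of 3] by (simp add: Q_def)
    have "k = Q * Q" by (simp add: k_def Q_def flip: power_add)
    moreover have "8 * Q \<le> Q * Q" using Q8 by (rule mult_right_mono) simp
    ultimately have Qk: "Q + 2 \<le> k" using Q8 by linarith
    have "(z + 1) * k + (Q + 2) \<le> (z + 2) * k" using Qk by (simp add: algebra_simps)
    also have "z + 2 \<le> z * z" using mult_le_mono1[OF z, of z] z by linarith
    then have "(z + 2) * k \<le> (z * z) * k" by (rule mult_right_mono) simp
    finally have "(z + 1) * k + (Q + 2) \<le> x" using x by (simp add: pow power2_eq_square)
    then have "z * k + k + (Q + 2) \<le> x" by simp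
    then show ?thesis using p_le by (simp add: G_def lam_def c_def)
  qed
  have Glam: "(\<lambda>j. G (z * k + j)) = lam"
    by (simp add: G_def fun_eq_iff)
  have Gc: "(\<lambda>q. G ((z + 1) * k + q)) = c"
  proof
    fix q
    have "(z + 1) * k + q = z * k + (k + q)" by simp
    then show "G ((z + 1) * k + q) = c q" using p_le by (simp add: G_def lam_def)
  qed
  have Gpol: "G (i * k + j) = policy i j (Ar i) (hrw i (Ar i) (hr i) j)" if "i < z" "j < k" for i j
  proof -
    have "i * k + j < (i + 1) * k" using that by simp
    also have "\<dots> \<le> z * k" using that by (intro mult_right_mono) auto
    finally show ?thesis using that by (simp add: G_def)
  qed
  have rows_eq: "rows (guess_policy k G) z = rows policy z"
    by (rule rows_cong) (use Gpol in \<open>auto simp: guess_policy_def Ar_def hr_def\<close>)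
  note fil_eq = fillers_cong[OF rows_eq, of k]
  show ?thesis
  proof (rule exI[of _ t], rule conjI[OF t], rule exI[of _ bb], rule conjI[OF bb(1)],
      rule exI[of _ G], intro conjI allI impI Gb G0)
    show "let Bt = real bb * w t; lam = (\<lambda>j. G (z * k + j)); c = (\<lambda>q. G ((z + 1) * k + q));
         rws = knapsack_data.rows g n l w z k Q t T Bt lam c (guess_policy k G);
         fl = knapsack_data.fillers g n l w z k Q t T Bt lam c (guess_policy k G) k
     in \<exists>R\<subseteq>knapsack_data.pool z k fl. card R \<le> k \<and> R \<subseteq> {..<n} \<and> sum w (fst (rws z) \<union> R) \<le> 1 \<and>
       (1 - 1 / exp 1) * g S + sum l S - 5 * (T / real z) \<le> g (fst (rws z) \<union> R) + sum l (fst (rws z) \<union> R)"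
      unfolding Let_def Glam Gc Bt_def[symmetric] rows_eq fil_eq Ar_def[symmetric]
      using R(1-4) final_value by blast
  qed
qed

section \<open>Running time of programs\<close>

lemma run_add: "run n g cfg (s + t) = bind_pmf (run n g cfg s) (\<lambda>c. run n g c t)"
  by (induction t) (simp_all add: bind_assoc_pmf bind_return_pmf')

lemma run_Suc_first: "run n g cfg (Suc t) = bind_pmf (step n g cfg) (\<lambda>c. run n g c t)"
  using run_add[of n g cfg 1 t] by (simp add: bind_return_pmf)

text \<open>Quantifying over the remaining stack \<open>cs\<close> makes runs composable. The demand
  for a point mass fits a program without coin tosses.\<close>

definition ev :: "nat \<Rightarrow> (nat set \<Rightarrow> real) \<Rightarrow> com \<Rightarrow> memory \<Rightarrow> memory \<Rightarrow> nat \<Rightarrow> bool" where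
  "ev n g c m m' t \<longleftrightarrow> (\<exists>s\<le>t. \<forall>cs. run n g (c # cs, m) s = return_pmf (cs, m'))"

definition ht :: "nat \<Rightarrow> (nat set \<Rightarrow> real) \<Rightarrow> (memory \<Rightarrow> bool) \<Rightarrow> com \<Rightarrow> (memory \<Rightarrow> bool) \<Rightarrow> nat \<Rightarrow> bool" where
  "ht n g P c Q K \<longleftrightarrow> (\<forall>m. P m \<longrightarrow> (\<exists>m'. ev n g c m m' K \<and> Q m'))"

lemma ev_mono: "ev n g c m m' t \<Longrightarrow> t \<le> t' \<Longrightarrow> ev n g c m m' t'"
  unfolding ev_def using order_trans by blast

lemma ev_Seq:
  assumes "ev n g c m m' s" "ev n g d m' m'' t"
  shows "ev n g (Seq c d) m m'' (s + t + 1)"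
proof -
  obtain a b where a: "a \<le> s" "\<And>cs. run n g (c # cs, m) a = return_pmf (cs, m')"
    and b: "b \<le> t" "\<And>cs. run n g (d # cs, m') b = return_pmf (cs, m'')"
    using assms unfolding ev_def by blast
  have "run n g (Seq c d # cs, m) (Suc (a + b)) = return_pmf (cs, m'')" for cs
    unfolding run_Suc_first by (simp add: bind_return_pmf run_add a b)
  then show ?thesis using a b unfolding ev_def by (intro exI[of _ "Suc (a + b)"]) auto
qed

lemma ht_conseq:
  assumes "ht n g P c Q K" "\<And>m. P' m \<Longrightarrow> P m" "\<And>m. Q m \<Longrightarrow> Q' m" "K \<le> K'"
  shows "ht n g P' c Q' K'"
  using assms unfolding ht_def by (meson ev_mono)

lemma ht_Seq:
  assumes "ht n g P c R K" "ht n g R d Q L"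
  shows "ht n g P (Seq c d) Q (K + L + 1)"
  using assms unfolding ht_def by (meson ev_Seq)

lemma ht_pre: "(\<And>m0. P m0 \<Longrightarrow> ht n g (\<lambda>m. m = m0) c Q K) \<Longrightarrow> ht n g P c Q K"
  unfolding ht_def by blast

lemma ht_Cond:
  assumes "ht n g (\<lambda>m. P m \<and> bval m b) c Q K" "ht n g (\<lambda>m. P m \<and> \<not> bval m b) d Q K"
  shows "ht n g P (Cond b c d) Q (K + 1)"
  unfolding ht_def
proof (intro allI impI)
  fix m assume P: "P m"
  let ?c = "if bval m b then c else d"
  have "\<exists>m'. ev n g ?c m m' K \<and> Q m'" using assms P unfolding ht_def by auto
  then obtain m' s where m': "Q m'" "s \<le> K" "\<And>cs. run n g (?c # cs, m) s = return_pmf (cs, m')"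
    unfolding ev_def by blast
  then have "run n g (Cond b c d # cs, m) (Suc s) = return_pmf (cs, m')" for cs
    unfolding run_Suc_first by (simp add: bind_return_pmf)
  then show "\<exists>m'. ev n g (Cond b c d) m m' (K + 1) \<and> Q m'"
    using m' unfolding ev_def by (intro exI[of _ m'] conjI exI[of _ "Suc s"]) auto
qed

text \<open>The invariant is indexed by the iteration and decides the loop condition, so the number
  of rounds is known and termination comes with the time bound.\<close>

lemma ht_While:
  assumes body: "\<And>j. j < J \<Longrightarrow> ht n g (I j) c (I (Suc j)) K"
    and cond: "\<And>j m. j \<le> J \<Longrightarrow> I j m \<Longrightarrow> bval m b \<longleftrightarrow> j < J"
  shows "ht n g (I 0) (While b c) (I J) (J * (K + 1) + 1)"
proof -
  have "ht n g (I (J - r)) (While b c) (I J) (r * (K + 1) + 1)" if "r \<le> J" for r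
    using that
  proof (induction r)
    case 0
    have "ev n g (While b c) m m 1" if "I J m" for m
    proof -
      have "run n g (While b c # cs, m) 1 = return_pmf (cs, m)" for cs
        using cond[of J m] that by (simp add: bind_return_pmf)
      then show ?thesis unfolding ev_def by blast
    qed
    then show ?case unfolding ht_def by auto
  next
    case (Suc r)
    show ?case
      unfolding ht_def
    proof (intro allI impI)
      fix m assume Im: "I (J - Suc r) m"
      have lt: "J - Suc r < J" "Suc (J - Suc r) = J - r" using Suc.prems by auto
      obtain m1 where m1: "ev n g c m m1 K" "I (J - r) m1"
        using body[OF lt(1)] Im lt(2) unfolding ht_def by auto
      obtain m2 where m2: "ev n g (While b c) m1 m2 (r * (K + 1) + 1)" "I J m2"
        using Suc m1(2) unfolding ht_def by fastforce
      obtain s1 s2 where s: "s1 \<le> K" "\<And>cs. run n g (c # cs, m) s1 = return_pmf (cs, m1)"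
        "s2 \<le> r * (K + 1) + 1" "\<And>cs. run n g (While b c # cs, m1) s2 = return_pmf (cs, m2)"
        using m1(1) m2(1) unfolding ev_def by blast
      have "bval m b" using cond[OF _ Im] lt by simp
      then have "run n g (While b c # cs, m) (Suc (s1 + s2)) = return_pmf (cs, m2)" for cs
        unfolding run_Suc_first by (simp add: bind_return_pmf run_add s)
      then have "ev n g (While b c) m m2 (Suc r * (K + 1) + 1)"
        using s unfolding ev_def by (intro exI[of _ "Suc (s1 + s2)"]) auto
      then show "\<exists>m'. ev n g (While b c) m m' (Suc r * (K + 1) + 1) \<and> I J m'" using m2 by blast
    qed
  qed
  from this[of J] show ?thesis by simp
qed

section \<open>Loop-free programs, frame conditions and counting loops\<close>

fun loopfree :: "com \<Rightarrow> bool" where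
  "loopfree (Flip a i p) = False"
| "loopfree (While b c) = False"
| "loopfree (Seq c d) = (loopfree c \<and> loopfree d)"
| "loopfree (Cond b c d) = (loopfree c \<and> loopfree d)"
| "loopfree _ = True"

text \<open>Symbolic execution: for pieces without loops and coin tosses, simplification computes
  the final memory.\<close>

fun sexec :: "nat \<Rightarrow> (nat set \<Rightarrow> real) \<Rightarrow> com \<Rightarrow> memory \<Rightarrow> memory" where
  "sexec n g (NAssign a i x) m = nwrite a (nval m i) (nval m x) m"
| "sexec n g (RAssign a i x) m = rwrite a (nval m i) (rval m x) m"
| "sexec n g (Query a i b) m = rwrite a (nval m i) (g (stored_set n b m)) m"
| "sexec n g (Seq c d) m = sexec n g d (sexec n g c m)"
| "sexec n g (Cond b c d) m = (if bval m b then sexec n g c m else sexec n g d m)"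
| "sexec n g _ m = m"

text \<open>Both branches of a conditional are charged, which makes the bound independent of the
  memory.\<close>

fun scost :: "com \<Rightarrow> nat" where
  "scost (Seq c d) = scost c + scost d + 1"
| "scost (Cond b c d) = scost c + scost d + 1"
| "scost _ = 1"

lemma ev_simple: "loopfree c \<Longrightarrow> ev n g c m (sexec n g c m) (scost c)"
proof (induction c arbitrary: m)
  case (Seq c d)
  then have "ev n g c m (sexec n g c m) (scost c)"
    "ev n g d (sexec n g c m) (sexec n g d (sexec n g c m)) (scost d)" by simp_all
  from ev_Seq[OF this] show ?case by simp
next
  case (Cond b c d)
  have "ht n g (\<lambda>x. x = m) (Cond b c d) (\<lambda>x. x = sexec n g (Cond b c d) m) (scost c + scost d + 1)"
  proof (rule ht_Cond)
    show "ht n g (\<lambda>x. x = m \<and> bval x b) c (\<lambda>x. x = sexec n g (Cond b c d) m) (scost c + scost d)"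
      using ev_mono[OF Cond.IH(1)[of m], of "scost c + scost d"] Cond.prems by (auto simp: ht_def)
    show "ht n g (\<lambda>x. x = m \<and> \<not> bval x b) d (\<lambda>x. x = sexec n g (Cond b c d) m) (scost c + scost d)"
      using ev_mono[OF Cond.IH(2)[of m], of "scost c + scost d"] Cond.prems by (auto simp: ht_def)
  qed
  then show ?case by (simp add: ht_def)
qed (auto simp: ev_def bind_return_pmf intro!: exI[of _ 1])

lemma ht_simple:
  assumes "loopfree c" "\<And>m. P m \<Longrightarrow> Q (sexec n g c m)" "scost c \<le> K"
  shows "ht n g P c Q K"
  unfolding ht_def using assms ev_simple ev_mono by blast

lemma narr_nwrite [simp]: "narr (nwrite a i v m) = (narr m)(a := (narr m a)(i := v))"
  and rarr_nwrite [simp]: "rarr (nwrite a i v m) = rarr m"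
  and narr_rwrite [simp]: "narr (rwrite a i x m) = narr m"
  and rarr_rwrite [simp]: "rarr (rwrite a i x m) = (rarr m)(a := (rarr m a)(i := x))"
  by (simp_all add: nwrite_def rwrite_def)

text \<open>The frame condition: \<open>X\<close> and \<open>Y\<close> are the arrays a program may
  write. It transports the inputs and the state of outer loops through inner ones.\<close>

definition keep :: "nat set \<Rightarrow> nat set \<Rightarrow> memory \<Rightarrow> memory \<Rightarrow> bool" where
  "keep X Y m m' \<longleftrightarrow> (\<forall>a. a \<notin> X \<longrightarrow> narr m' a = narr m a) \<and> (\<forall>a. a \<notin> Y \<longrightarrow> rarr m' a = rarr m a)"

lemma keep_refl [simp]: "keep X Y m m"
  by (simp add: keep_def)

lemma keep_nwrite [simp]: "a \<in> X \<Longrightarrow> keep X Y m0 (nwrite a i v m) \<longleftrightarrow> keep X Y m0 m"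
  by (auto simp: keep_def)

lemma keep_rwrite [simp]: "a \<in> Y \<Longrightarrow> keep X Y m0 (rwrite a i v m) \<longleftrightarrow> keep X Y m0 m"
  by (auto simp: keep_def)

lemma keep_mono: "keep X Y m m' \<Longrightarrow> X \<subseteq> X' \<Longrightarrow> Y \<subseteq> Y' \<Longrightarrow> keep X' Y' m m'"
  by (auto simp: keep_def)

lemma keepD:
  assumes "keep X Y m m'"
  shows "a \<notin> X \<Longrightarrow> narr m' a = narr m a" "a \<notin> Y \<Longrightarrow> rarr m' a = rarr m a"
  using assms by (auto simp: keep_def)

lemma keep_trans:
  assumes "keep X Y m m'" "keep X' Y' m' m''" "X \<union> X' \<subseteq> X''" "Y \<union> Y' \<subseteq> Y''"
  shows "keep X'' Y'' m m''"
proof -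
  have "narr m'' a = narr m a" if "a \<notin> X''" for a
  proof -
    have "a \<notin> X" "a \<notin> X'" using that assms(3) by auto
    then show ?thesis using assms(1,2) by (simp add: keep_def)
  qed
  moreover have "rarr m'' a = rarr m a" if "a \<notin> Y''" for a
  proof -
    have "a \<notin> Y" "a \<notin> Y'" using that assms(4) by auto
    then show ?thesis using assms(1,2) by (simp add: keep_def)
  qed
  ultimately show ?thesis by (simp add: keep_def)
qed

abbreviation NV :: "nat \<Rightarrow> nexp" where "NV v \<equiv> NRead v (NConst 0)"
abbreviation RV :: "nat \<Rightarrow> rexp" where "RV v \<equiv> RRead v (NConst 0)"

definition For :: "nat \<Rightarrow> nexp \<Rightarrow> com \<Rightarrow> com" where
  "For v bnd c = Seq (NAssign v (NConst 0) (NConst 0))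
     (While (NLess (NV v) bnd) (Seq c (NAssign v (NConst 0) (NAdd (NV v) (NConst 1)))))"

text \<open>The body has to establish the invariant for the memory in which the counter is already
  advanced. This spares a separate proof that the invariant survives that assignment.\<close>

lemma ht_For:
  assumes init: "\<And>m. P m \<Longrightarrow> I 0 (nwrite v 0 0 m)"
    and body: "\<And>j. j < N \<Longrightarrow> ht n g (\<lambda>m. I j m \<and> narr m v 0 = j) c
                 (\<lambda>m. I (Suc j) (nwrite v 0 (Suc j) m) \<and> narr m v 0 = j) K"
    and bnd: "\<And>j m. j \<le> N \<Longrightarrow> I j m \<Longrightarrow> narr m v 0 = j \<Longrightarrow> nval m bnd = N"
    and time: "N * (K + 3) + 3 \<le> L"
  shows "ht n g P (For v bnd c) (\<lambda>m. I N m \<and> narr m v 0 = N) L"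
proof -
  have "ht n g P (NAssign v (NConst 0) (NConst 0)) (\<lambda>m. I 0 m \<and> narr m v 0 = 0) 1"
    by (rule ht_simple) (auto simp: init)
  moreover have "ht n g (\<lambda>m. I 0 m \<and> narr m v 0 = 0)
    (While (NLess (NV v) bnd) (Seq c (NAssign v (NConst 0) (NAdd (NV v) (NConst 1)))))
    (\<lambda>m. I N m \<and> narr m v 0 = N) (N * (K + 2 + 1) + 1)"
  proof (rule ht_While[where I = "\<lambda>j m. I j m \<and> narr m v 0 = j"])
    fix j assume j: "j < N"
    have "ht n g (\<lambda>m. I (Suc j) (nwrite v 0 (Suc j) m) \<and> narr m v 0 = j)
      (NAssign v (NConst 0) (NAdd (NV v) (NConst 1))) (\<lambda>m. I (Suc j) m \<and> narr m v 0 = Suc j) 1"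
      by (rule ht_simple) auto
    from ht_Seq[OF body[OF j] this]
    show "ht n g (\<lambda>m. I j m \<and> narr m v 0 = j) (Seq c (NAssign v (NConst 0) (NAdd (NV v) (NConst 1))))
        (\<lambda>m. I (Suc j) m \<and> narr m v 0 = Suc j) (K + 2)" by simp
  qed (use bnd in auto)
  ultimately have "ht n g P (For v bnd c) (\<lambda>m. I N m \<and> narr m v 0 = N) (1 + (N * (K + 2 + 1) + 1) + 1)"
    unfolding For_def by (rule ht_Seq)
  then show ?thesis by (rule ht_conseq) (use time in \<open>simp_all add: algebra_simps\<close>)
qed

section \<open>Digit vectors and their enumeration\<close>

definition dig :: "nat \<Rightarrow> nat \<Rightarrow> nat \<Rightarrow> nat" where
  "dig B j y = j div B ^ y mod B"

lemma dig_less: "0 < B \<Longrightarrow> dig B j y < B"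
  by (simp add: dig_def)

lemma dig_Suc: "dig B j (Suc y) = dig B (j div B) y"
  by (simp add: dig_def div_mult2_eq)

lemma all_top_digits:
  assumes "0 < B" "\<And>y. y < c \<Longrightarrow> dig B j y = B - 1"
  shows "\<exists>q. j + 1 = (q + 1) * B ^ c \<and> j div B ^ c = q"
  using assms(2)
proof (induction c arbitrary: j)
  case (Suc c)
  have "dig B (j div B) y = B - 1" if "y < c" for y
    using Suc.prems[of "Suc y"] that by (simp add: dig_Suc)
  then obtain q where q: "j div B + 1 = (q + 1) * B ^ c" "j div B div B ^ c = q"
    using Suc.IH by blast
  have "j mod B = B - 1" using Suc.prems[of 0] by (simp add: dig_def)
  then have "j + 1 = (j div B + 1) * B" using div_mult_mod_eq[of j B] assms(1) by simp
  then have "j + 1 = (q + 1) * B ^ c * B" by (simp only: q(1))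
  moreover have "j div B ^ Suc c = q" using q(2) by (simp add: div_mult2_eq)
  ultimately show ?case by (intro exI[of _ q]) (simp add: mult_ac)
qed simp

text \<open>The carry rule. That the lowest \<open>c\<close> digits are all maximal means
  \<open>j + 1 = (q + 1) * B ^ c\<close>, so the increment acts on the quotient \<open>q\<close>
  alone, and there without a carry.\<close>

lemma dig_increment:
  assumes B: "0 < B" and low: "\<And>y. y < c \<Longrightarrow> dig B j y = B - 1" and c: "dig B j c + 1 < B"
  shows "dig B (Suc j) y = (if y < c then 0 else if y = c then dig B j c + 1 else dig B j y)"
proof -
  obtain q where q: "j + 1 = (q + 1) * B ^ c" "j div B ^ c = q"
    using all_top_digits[OF B low] by blast
  have qB: "q mod B + 1 < B" using c q by (simp add: dig_def)
  have step: "(q + 1) mod B = q mod B + 1" "(q + 1) div B = q div B"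
    using qB by (simp_all add: mod_Suc div_Suc)
  show ?thesis
  proof (cases "y < c")
    case True
    then obtain d where d: "c = y + Suc d" using less_imp_Suc_add by fastforce
    have "Suc j = ((q + 1) * B ^ d * B) * B ^ y" proof -
      have "j + 1 = (q + 1) * (B ^ y * (B * B ^ d))" using q(1) by (simp only: d power_add power_Suc)
      then show ?thesis by (simp only: Suc_eq_plus1 mult_ac)
    qed
    then have "Suc j div B ^ y = (q + 1) * B ^ d * B" using B by simp
    then show ?thesis using True by (simp add: dig_def)
  next
    case False
    then obtain d where d: "y = c + d" using le_iff_add not_less by metis
    have "Suc j div B ^ y = (q + 1) div B ^ d" "j div B ^ y = q div B ^ d"
      using q B by (simp_all add: d power_add div_mult2_eq)
    then have *: "dig B (Suc j) y = (q + 1) div B ^ d mod B" "dig B j y = q div B ^ d mod B"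
      by (simp_all add: dig_def)
    show ?thesis
    proof (cases d)
      case 0
      then show ?thesis using * step d by simp
    next
      case (Suc d')
      then have "(q + 1) div B ^ d = q div B ^ d" using step(2) by (simp add: div_mult2_eq)
      then show ?thesis using * Suc d by simp
    qed
  qed
qed

lemma dig_inj:
  assumes "0 < B" "j < B ^ L" "j' < B ^ L" "\<And>y. y < L \<Longrightarrow> dig B j y = dig B j' y"
  shows "j = j'"
  using assms(2-4)
proof (induction L arbitrary: j j')
  case (Suc L)
  have "j div B = j' div B"
  proof (rule Suc.IH)
    show "j div B < B ^ L" "j' div B < B ^ L"
      using Suc.prems(1,2) by (simp_all add: less_mult_imp_div_less mult.commute)
    show "dig B (j div B) y = dig B (j' div B) y" if "y < L" for y
      using Suc.prems(3)[of "Suc y"] that by (simp add: dig_Suc)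
  qed
  moreover have "j mod B = j' mod B" using Suc.prems(3)[of 0] by (simp add: dig_def)
  ultimately show ?case by (metis div_mult_mod_eq)
qed simp

text \<open>Injectivity is enough, as both sides have \<open>B ^ L\<close> elements.\<close>

lemma dig_bij:
  assumes "0 < B"
  shows "bij_betw (\<lambda>j. restrict (dig B j) {..<L}) {..<B ^ L} (PiE {..<L} (\<lambda>_. {..<B}))"
proof -
  let ?f = "\<lambda>j. restrict (dig B j) {..<L}"
  have inj: "inj_on ?f {..<B ^ L}"
  proof (rule inj_onI)
    fix j j' assume j: "j \<in> {..<B ^ L}" "j' \<in> {..<B ^ L}" "?f j = ?f j'"
    have "dig B j y = dig B j' y" if "y < L" for y
      using fun_cong[OF j(3), of y] that by simp
    then show "j = j'" using dig_inj[OF assms] j by simp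
  qed
  have "?f ` {..<B ^ L} \<subseteq> PiE {..<L} (\<lambda>_. {..<B})" using dig_less[OF assms]
    by (auto simp: restrict_PiE_iff image_subset_iff simp del: restrict_apply)
  moreover have "card (?f ` {..<B ^ L}) = card (PiE {..<L} (\<lambda>_. {..<B}))"
    using card_image[OF inj] by (simp add: card_PiE)
  ultimately have "?f ` {..<B ^ L} = PiE {..<L} (\<lambda>_. {..<B})"
    by (intro card_subset_eq) (auto intro: finite_PiE)
  then show ?thesis using inj by (simp add: bij_betw_def)
qed

lemma dig_surj:
  assumes "0 < B" "\<And>y. y < L \<Longrightarrow> f y < B"
  shows "\<exists>j<B ^ L. \<forall>y<L. dig B j y = f y"
proof -
  have "restrict f {..<L} \<in> PiE {..<L} (\<lambda>_. {..<B})" using assms(2) by (simp add: restrict_PiE_iff)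
  then have "restrict f {..<L} \<in> (\<lambda>j. restrict (dig B j) {..<L}) ` {..<B ^ L}"
    using bij_betw_imp_surj_on[OF dig_bij[OF assms(1), of L]] by simp
  then obtain j where j: "j < B ^ L" "restrict (dig B j) {..<L} = restrict f {..<L}"
    by (elim imageE) simp
  have "dig B j y = f y" if "y < L" for y using fun_cong[OF j(2), of y] that by simp
  then show ?thesis using j(1) by blast
qed

text \<open>An odometer: after each call of \<open>c\<close> the digits in array \<open>p\<close>
  advance with carry, and a carry out of the last digit raises the flag \<open>f\<close>. Thus the
  number \<open>B ^ L\<close> of rounds never has to be computed.\<close>

definition Enum :: "nat \<Rightarrow> nat \<Rightarrow> nat \<Rightarrow> nexp \<Rightarrow> nexp \<Rightarrow> com \<Rightarrow> com" where
  "Enum p x f len base c = Seq (For x len (NAssign p (NV x) (NConst 0)))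
     (Seq (NAssign f (NConst 0) (NConst 0))
       (While (NLess (NV f) (NConst 1))
         (Seq c (Seq (NAssign x (NConst 0) (NConst 0))
           (Seq (While (Conj (NLess (NV x) len) (Neg (NLess (NAdd (NRead p (NV x)) (NConst 1)) base)))
                  (Seq (NAssign p (NV x) (NConst 0)) (NAssign x (NConst 0) (NAdd (NV x) (NConst 1)))))
             (Cond (NLess (NV x) len) (NAssign p (NV x) (NAdd (NRead p (NV x)) (NConst 1)))
               (NAssign f (NConst 0) (NConst 1))))))))"

text \<open>The premise \<open>stable\<close> frees the invariant from the three arrays of the
  odometer. The time is not amortised: each round is charged a full carry chain of \<open>L\<close>
  digits.\<close>

lemma ht_Enum:
  assumes stable: "\<And>j m m'. I j m \<Longrightarrow> keep {p, x, f} {} m m' \<Longrightarrow> I j m'"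
    and bnd: "\<And>j m. I j m \<Longrightarrow> nval m len = L \<and> nval m base = B"
    and body: "\<And>j. j < B ^ L \<Longrightarrow> ht n g (\<lambda>m. I j m \<and> (\<forall>y<L. narr m p y = dig B j y) \<and> narr m f 0 = 0) c
       (\<lambda>m. I (Suc j) m \<and> (\<forall>y<L. narr m p y = dig B j y) \<and> narr m f 0 = 0) K"
    and B: "0 < B" and distinct: "p \<noteq> x" "p \<noteq> f" "x \<noteq> f"
    and time: "B ^ L * (K + 4 * L + 12) + 4 * L + 8 \<le> M"
  shows "ht n g (I 0) (Enum p x f len base c) (I (B ^ L)) M"
proof -
  let ?carry = "While (Conj (NLess (NV x) len) (Neg (NLess (NAdd (NRead p (NV x)) (NConst 1)) base)))
      (Seq (NAssign p (NV x) (NConst 0)) (NAssign x (NConst 0) (NAdd (NV x) (NConst 1))))"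
  let ?last = "Cond (NLess (NV x) len) (NAssign p (NV x) (NAdd (NRead p (NV x)) (NConst 1)))
      (NAssign f (NConst 0) (NConst 1))"
  \<comment> \<open>The digits are specified only before the overflow; in the final state the flag
    carries all the information.\<close>
  define S where "S j m \<longleftrightarrow> I j m \<and> (j < B ^ L \<longrightarrow> (\<forall>y<L. narr m p y = dig B j y)) \<and>
     narr m f 0 = (if j < B ^ L then 0 else 1)" for j m
  have zero: "ht n g (I 0) (For x len (NAssign p (NV x) (NConst 0))) (\<lambda>m. (I 0 m \<and> (\<forall>y<L. narr m p y = 0)) \<and> narr m x 0 = L) (4 * L + 3)"
  proof (rule ht_For[where K = 1 and N = L and I = "\<lambda>i m. I 0 m \<and> (\<forall>y<i. narr m p y = 0)"])
    show "I 0 (nwrite x 0 0 m) \<and> (\<forall>y<0. narr (nwrite x 0 0 m) p y = 0)" if "I 0 m" for m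
      using stable[OF that] by (simp add: keep_def)
    fix i assume "i < L"
    show "ht n g (\<lambda>m. (I 0 m \<and> (\<forall>y<i. narr m p y = 0)) \<and> narr m x 0 = i)
      (NAssign p (NV x) (NConst 0))
      (\<lambda>m. (I 0 (nwrite x 0 (Suc i) m) \<and> (\<forall>y<Suc i. narr (nwrite x 0 (Suc i) m) p y = 0)) \<and> narr m x 0 = i) 1"
    proof (rule ht_simple)
      fix m assume m: "(I 0 m \<and> (\<forall>y<i. narr m p y = 0)) \<and> narr m x 0 = i"
      have "I 0 (nwrite x 0 (Suc i) (nwrite p i 0 m))"
        by (rule stable[of 0 m]) (use m in \<open>auto simp: keep_def\<close>)
      then show "(I 0 (nwrite x 0 (Suc i) (sexec n g (NAssign p (NV x) (NConst 0)) m)) \<and>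
          (\<forall>y<Suc i. narr (nwrite x 0 (Suc i) (sexec n g (NAssign p (NV x) (NConst 0)) m)) p y = 0)) \<and>
          narr (sexec n g (NAssign p (NV x) (NConst 0)) m) x 0 = i"
        using m distinct by (auto simp: less_Suc_eq)
    qed auto
  qed (use bnd in auto)
  have flag: "ht n g (\<lambda>m. (I 0 m \<and> (\<forall>y<L. narr m p y = 0)) \<and> narr m x 0 = L) (NAssign f (NConst 0) (NConst 0)) (S 0) 1"
  proof (rule ht_simple)
    fix m assume m: "(I 0 m \<and> (\<forall>y<L. narr m p y = 0)) \<and> narr m x 0 = L"
    have "I 0 (nwrite f 0 0 m)"
      by (rule stable[of 0 m]) (use m in \<open>auto simp: keep_def\<close>)
    then show "S 0 (sexec n g (NAssign f (NConst 0) (NConst 0)) m)"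
      using m B distinct by (simp add: S_def dig_def)
  qed auto
  have loop: "ht n g (S 0) (While (NLess (NV f) (NConst 1))
      (Seq c (Seq (NAssign x (NConst 0) (NConst 0)) (Seq ?carry ?last)))) (S (B ^ L)) (B ^ L * (K + 4 * L + 11 + 1) + 1)"
  proof (rule ht_While[where I = S])
    fix j assume j: "j < B ^ L"
    define R where "R m \<longleftrightarrow> I (Suc j) m \<and> (\<forall>y<L. narr m p y = dig B j y) \<and> narr m f 0 = 0" for m
    \<comment> \<open>The position where the carry stops, or \<open>L\<close> if all digits are
      maximal and the enumeration ends.\<close>
    define c0 where "c0 = (LEAST y. y = L \<or> dig B j y + 1 < B)"
    have c0: "c0 = L \<or> dig B j c0 + 1 < B" unfolding c0_def by (rule LeastI[of _ L]) simp
    have c0_le: "c0 \<le> L" unfolding c0_def by (rule Least_le) simp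
    have low: "dig B j y = B - 1" if "y < c0" for y
    proof -
      have "\<not> dig B j y + 1 < B"
        using not_less_Least[of y "\<lambda>y. y = L \<or> dig B j y + 1 < B"] that unfolding c0_def by blast
      then show ?thesis using dig_less[OF B, of j y] by linarith
    qed
    define X where "X i m \<longleftrightarrow> I (Suc j) m \<and> (\<forall>y<L. narr m p y = (if y < i then 0 else dig B j y)) \<and> narr m f 0 = 0 \<and> narr m x 0 = i" for i m
    have b: "ht n g (S j) c R K"
      by (rule ht_conseq[OF body[OF j]]) (use j in \<open>auto simp: S_def R_def\<close>)
    have x0: "ht n g R (NAssign x (NConst 0) (NConst 0)) (X 0) 1"
    proof (rule ht_simple)
      fix m assume m: "R m"
      have "I (Suc j) (nwrite x 0 0 m)"
        by (rule stable[of "Suc j" m]) (use m in \<open>auto simp: keep_def R_def\<close>)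
      then show "X 0 (sexec n g (NAssign x (NConst 0) (NConst 0)) m)"
        using m distinct by (simp add: X_def R_def)
    qed auto
    have carry: "ht n g (X 0) ?carry (X c0) (c0 * (3 + 1) + 1)"
    proof (rule ht_While[where I = X])
      fix i assume i: "i < c0"
      show "ht n g (X i) (Seq (NAssign p (NV x) (NConst 0)) (NAssign x (NConst 0) (NAdd (NV x) (NConst 1)))) (X (Suc i)) 3"
      proof (rule ht_simple)
        fix m assume m: "X i m"
        have "I (Suc j) (nwrite x 0 (Suc i) (nwrite p i 0 m))"
          by (rule stable[of "Suc j" m]) (use m in \<open>auto simp: keep_def X_def\<close>)
        then show "X (Suc i) (sexec n g (Seq (NAssign p (NV x) (NConst 0)) (NAssign x (NConst 0) (NAdd (NV x) (NConst 1)))) m)"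
          using m distinct by (auto simp: X_def less_Suc_eq)
      qed auto
    next
      fix i m assume i: "i \<le> c0" "X i m"
      have nl: "nval m len = L" "nval m base = B" using bnd i(2) by (auto simp: X_def)
      have xi: "narr m x 0 = i" using i(2) by (simp add: X_def)
      have pi: "narr m p i = dig B j i" if "i < L" using i(2) that by (simp add: X_def)
      have "(i < L \<and> \<not> narr m p i + 1 < B) \<longleftrightarrow> i < c0"
      proof (cases "i < c0")
        case True
        then have "i < L" "dig B j i = B - 1" using c0_le low by auto
        then show ?thesis using True pi by simp
      next
        case False
        then have "i = c0" using i(1) by simp
        then show ?thesis using c0 pi by auto
      qed
      then show "bval m (Conj (NLess (NV x) len) (Neg (NLess (NAdd (NRead p (NV x)) (NConst 1)) base))) \<longleftrightarrow> i < c0"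
        by (simp add: nl xi)
    qed
    have last: "ht n g (X c0) ?last (S (Suc j)) 3"
    proof (rule ht_simple)
      fix m assume m: "X c0 m"
      have nl: "nval m len = L" using bnd m by (auto simp: X_def)
      show "S (Suc j) (sexec n g ?last m)"
      proof (cases "c0 < L")
        case True
        then have d: "dig B j c0 + 1 < B" using c0 by simp
        have sl: "Suc j < B ^ L"
        proof (rule ccontr)
          assume "\<not> Suc j < B ^ L"
          then have "Suc j = B ^ L" using j by simp
          moreover have "dig B (B ^ L) c0 = 0"
          proof -
            obtain e where "L = c0 + Suc e" using True less_imp_Suc_add by fastforce
            then have "B ^ L div B ^ c0 = B * B ^ e" using B by (simp add: power_add)
            then show ?thesis by (simp add: dig_def)
          qed
          ultimately show False using dig_increment[OF B low d, of c0] by simp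
        qed
        have "I (Suc j) (nwrite p c0 (narr m p c0 + 1) m)"
          by (rule stable[of "Suc j" m]) (use m in \<open>auto simp: keep_def X_def\<close>)
        then show ?thesis
          using m True distinct nl sl dig_increment[OF B low d] by (auto simp: S_def X_def)
      next
        case False
        then have c0L: "c0 = L" using c0_le by simp
        obtain q where q: "j + 1 = (q + 1) * B ^ L" "j div B ^ L = q"
          using all_top_digits[OF B low] c0L by blast
        then have "Suc j = B ^ L" using j by simp
        moreover have "I (Suc j) (nwrite f 0 1 m)"
          by (rule stable[of "Suc j" m]) (use m in \<open>auto simp: keep_def X_def\<close>)
        ultimately show ?thesis using m c0L nl by (auto simp: S_def X_def)
      qed
    qed auto
    have "ht n g (S j) (Seq c (Seq (NAssign x (NConst 0) (NConst 0)) (Seq ?carry ?last))) (S (Suc j))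
        (K + (1 + (c0 * (3 + 1) + 1 + 3 + 1) + 1) + 1)"
      by (intro ht_Seq[OF b] ht_Seq[OF x0] ht_Seq[OF carry] last)
    then show "ht n g (S j) (Seq c (Seq (NAssign x (NConst 0) (NConst 0)) (Seq ?carry ?last))) (S (Suc j)) (K + 4 * L + 11)"
      by (rule ht_conseq) (use c0_le in auto)
  qed (auto simp: S_def)
  have "ht n g (I 0) (Enum p x f len base c) (S (B ^ L)) (4 * L + 3 + (1 + (B ^ L * (K + 4 * L + 11 + 1) + 1) + 1) + 1)"
    unfolding Enum_def by (intro ht_Seq[OF zero] ht_Seq[OF flag] loop)
  then show ?thesis by (rule ht_conseq) (use time in \<open>auto simp: S_def algebra_simps\<close>)
qed

section \<open>Evaluating the average over row choices\<close>

lemma keep_restore: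
  assumes "keep (insert a X) Y m0 m" "(narr m a)(i := v) = narr m0 a"
  shows "keep X Y m0 (nwrite a i v m)"
  unfolding keep_def
proof (intro conjI allI impI)
  fix b assume "b \<notin> X"
  then show "narr (nwrite a i v m) b = narr m0 b"
    using assms by (cases "b = a") (simp_all add: keep_def)
qed (use assms in \<open>simp add: keep_def\<close>)

lemma card_upto_Suc:
  "card {i. i < Suc j \<and> hh i = x} = card {i. i < j \<and> hh i = x} + (if hh j = x then 1 else 0)"
proof -
  have "{i. i < Suc j \<and> hh i = x} = (if hh j = x then insert j {i. i < j \<and> hh i = x} else {i. i < j \<and> hh i = x})"
    by (auto simp: less_Suc_eq)
  then show ?thesis by simp
qed

lemma card_from_Suc:
  assumes "j < L"
  shows "card {i. j \<le> i \<and> i < L \<and> hh i = x} = card {i. Suc j \<le> i \<and> i < L \<and> hh i = x} + (if hh j = x then 1 else 0)"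
proof -
  have "{i. j \<le> i \<and> i < L \<and> hh i = x} = (if hh j = x then insert j {i. Suc j \<le> i \<and> i < L \<and> hh i = x} else {i. Suc j \<le> i \<and> i < L \<and> hh i = x})"
    using assms by (auto simp: Suc_le_eq order.order_iff_strict)
  then show ?thesis by simp
qed

text \<open>Array 20 holds multiplicities in place of bits. So items can be added and removed again
  exactly, even if they repeat or already belong to \<open>A\<close>.\<close>

definition Bump :: "nat \<Rightarrow> nexp \<Rightarrow> nexp \<Rightarrow> com" where
  "Bump y len idx = For y len (NAssign 20 idx (NAdd (NRead 20 idx) (NConst 1)))"

definition Unbump :: "nat \<Rightarrow> nexp \<Rightarrow> nexp \<Rightarrow> com" where
  "Unbump y len idx = For y len (NAssign 20 idx (NSub (NRead 20 idx) (NConst 1)))"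

lemma ht_Bump:
  assumes idx: "\<And>m j. keep {20, y} {} m0 m \<Longrightarrow> narr m y 0 = j \<Longrightarrow> j < L \<Longrightarrow> nval m idx = hh j"
    and len: "\<And>m. keep {20, y} {} m0 m \<Longrightarrow> nval m len = L" and y: "y \<noteq> 20"
  shows "ht n g (\<lambda>m. m = m0) (Bump y len idx)
    (\<lambda>m. keep {20, y} {} m0 m \<and> narr m 20 = (\<lambda>x. narr m0 20 x + card {i. i < L \<and> hh i = x})) (4 * L + 3)"
  unfolding Bump_def
proof (rule ht_conseq[OF ht_For])
  let ?I = "\<lambda>j m. keep {20, y} {} m0 m \<and> narr m 20 = (\<lambda>x. narr m0 20 x + card {i. i < j \<and> hh i = x})"
  show "?I 0 (nwrite y 0 0 m)" if "m = m0" for m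
    using that y by (simp add: keep_def)
  show "ht n g (\<lambda>m. ?I j m \<and> narr m y 0 = j) (NAssign 20 idx (NAdd (NRead 20 idx) (NConst 1)))
    (\<lambda>m. ?I (Suc j) (nwrite y 0 (Suc j) m) \<and> narr m y 0 = j) 1" if j: "j < L" for j
  proof (rule ht_simple)
    fix m assume m: "?I j m \<and> narr m y 0 = j"
    then have i: "nval m idx = hh j" using idx j by blast
    show "?I (Suc j) (nwrite y 0 (Suc j) (sexec n g (NAssign 20 idx (NAdd (NRead 20 idx) (NConst 1))) m)) \<and>
        narr (sexec n g (NAssign 20 idx (NAdd (NRead 20 idx) (NConst 1))) m) y 0 = j"
      using m y i by (auto simp: keep_def card_upto_Suc)
  qed auto
  show "nval m len = L" if "?I j m" for j m using len that by blast
qed (auto)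

lemma ht_Unbump:
  assumes idx: "\<And>m j. keep {20, y} {} m0 m \<Longrightarrow> narr m y 0 = j \<Longrightarrow> j < L \<Longrightarrow> nval m idx = hh j"
    and len: "\<And>m. keep {20, y} {} m0 m \<Longrightarrow> nval m len = L" and y: "y \<noteq> 20"
    and C: "narr m0 20 = (\<lambda>x. C x + card {i. i < L \<and> hh i = x})"
  shows "ht n g (\<lambda>m. m = m0) (Unbump y len idx)
    (\<lambda>m. keep {20, y} {} m0 m \<and> narr m 20 = C) (4 * L + 3)"
  unfolding Unbump_def
proof (rule ht_conseq[OF ht_For])
  let ?I = "\<lambda>j m. keep {20, y} {} m0 m \<and> narr m 20 = (\<lambda>x. C x + card {i. j \<le> i \<and> i < L \<and> hh i = x})"
  show "?I 0 (nwrite y 0 0 m)" if "m = m0" for m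
    using that y C by (simp add: keep_def)
  show "ht n g (\<lambda>m. ?I j m \<and> narr m y 0 = j) (NAssign 20 idx (NSub (NRead 20 idx) (NConst 1)))
    (\<lambda>m. ?I (Suc j) (nwrite y 0 (Suc j) m) \<and> narr m y 0 = j) 1" if j: "j < L" for j
  proof (rule ht_simple)
    fix m assume m: "?I j m \<and> narr m y 0 = j"
    then have i: "nval m idx = hh j" using idx j by blast
    show "?I (Suc j) (nwrite y 0 (Suc j) (sexec n g (NAssign 20 idx (NSub (NRead 20 idx) (NConst 1))) m)) \<and>
        narr (sexec n g (NAssign 20 idx (NSub (NRead 20 idx) (NConst 1))) m) y 0 = j"
      using m y i by (auto simp: keep_def card_from_Suc[OF j])
  qed auto
  show "nval m len = L" if "?I j m" for j m using len that by blast
  fix m assume "?I L m \<and> narr m y 0 = L"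
  moreover have "{i. L \<le> i \<and> i < L \<and> hh i = x} = {}" for x by auto
  ultimately show "keep {20, y} {} m0 m \<and> narr m 20 = C" by simp
qed auto

definition row_entry :: nexp where
  "row_entry = NRead 21 (NAdd (NRead 6 (NRead 40 (NV 43))) (NV 43))"

text \<open>Besides summing up \<open>g\<close>, each round adds 1 to real cell 22. In the end this
  cell holds \<open>z ^ k\<close>, the factor in the gain thresholds, without any
  exponentiation.\<close>

definition EvalBody :: com where
  "EvalBody = Seq (Bump 43 (NV 4) row_entry)
     (Seq (Seq (Query 23 (NConst 0) 20)
         (Seq (RAssign 21 (NConst 0) (RAdd (RV 21) (RV 23)))
           (RAssign 22 (NConst 0) (RAdd (RV 22) (ROfNat (NConst 1))))))
       (Unbump 43 (NV 4) row_entry))"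

text \<open>
  \<open>Eval\<close> sums the values of \<open>g\<close> over all choices of one row per slot, for the set stored in
  array 20 together with the item in cell 29.
\<close>
definition Eval :: com where
  "Eval = Seq (Seq (RAssign 21 (NConst 0) (ROfNat (NConst 0)))
       (Seq (RAssign 22 (NConst 0) (ROfNat (NConst 0)))
         (NAssign 20 (NV 29) (NAdd (NRead 20 (NV 29)) (NConst 1)))))
     (Seq (Enum 40 41 42 (NV 4) (NV 2) EvalBody)
       (NAssign 20 (NV 29) (NSub (NRead 20 (NV 29)) (NConst 1))))"

definition eval_time :: "nat \<Rightarrow> nat \<Rightarrow> nat" where
  "eval_time z k = z ^ k * (12 * k + 25) + 4 * k + 20"

lemma ht_Eval:
  assumes z: "narr m0 2 0 = z" "0 < z" and k: "narr m0 4 0 = k"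
    and off: "\<And>i. i < z \<Longrightarrow> narr m0 6 i = i * k"
    and h: "\<And>i j. i < z \<Longrightarrow> j < k \<Longrightarrow> narr m0 21 (i * k + j) = h i j"
    and e: "narr m0 29 0 = e"
  shows "ht n g (\<lambda>m. m = m0) Eval (\<lambda>m. keep {40, 41, 42, 43} {21, 22, 23} m0 m \<and>
      rarr m 21 0 = (\<Sum>\<pi>\<in>PiE {..<k} (\<lambda>_. {..<z}).
        g ({..<n} \<inter> (insert e ({x. narr m0 20 x \<noteq> 0}) \<union> (\<lambda>j. h (\<pi> j) j) ` {..<k}))) \<and>
      rarr m 22 0 = real z ^ k) (eval_time z k)"
proof -
  define C0 where "C0 = narr m0 20"
  define C1 where "C1 = C0(e := C0 e + 1)"
  define F where "F d = g ({..<n} \<inter> (insert e {x. C0 x \<noteq> 0} \<union> (\<lambda>j. h (d j) j) ` {..<k}))" for d :: "nat \<Rightarrow> nat"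
  define I where "I j m \<longleftrightarrow> keep {20, 40, 41, 42, 43} {21, 22, 23} m0 m \<and> narr m 20 = C1 \<and>
      rarr m 21 0 = (\<Sum>i<j. F (dig z i)) \<and> rarr m 22 0 = real j" for j m
  have pre: "ht n g (\<lambda>m. m = m0) (Seq (RAssign 21 (NConst 0) (ROfNat (NConst 0)))
       (Seq (RAssign 22 (NConst 0) (ROfNat (NConst 0)))
         (NAssign 20 (NV 29) (NAdd (NRead 20 (NV 29)) (NConst 1))))) (I 0) 5"
    by (rule ht_simple) (auto simp: I_def keep_def C1_def C0_def e)
  have enum: "ht n g (I 0) (Enum 40 41 42 (NV 4) (NV 2) EvalBody) (I (z ^ k)) (z ^ k * (12 * k + 25) + 4 * k + 8)"
  proof (rule ht_Enum[where L = k and B = z and K = "8 * k + 13"])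
    show "I j m'" if "I j m" "keep {40, 41, 42} {} m m'" for j m m'
      using that unfolding I_def by (auto simp: keep_def)
    show "nval m (NV 4) = k \<and> nval m (NV 2) = z" if "I j m" for j m
      using that z k by (simp add: I_def keep_def)
    fix j assume j: "j < z ^ k"
    show "ht n g (\<lambda>m. I j m \<and> (\<forall>y<k. narr m 40 y = dig z j y) \<and> narr m 42 0 = 0) EvalBody
       (\<lambda>m. I (Suc j) m \<and> (\<forall>y<k. narr m 40 y = dig z j y) \<and> narr m 42 0 = 0) (8 * k + 13)"
    proof (rule ht_pre)
      fix m1 assume m1: "I j m1 \<and> (\<forall>y<k. narr m1 40 y = dig z j y) \<and> narr m1 42 0 = 0"
      define hh where "hh i = h (dig z j i) i" for i
      have idx: "nval m row_entry = hh i" if "keep {20, 43} {} m1 m" "narr m 43 0 = i" "i < k" for m i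
      proof -
        have "narr m 40 i = dig z j i" "narr m 6 = narr m0 6" "narr m 21 = narr m0 21"
          using that m1 by (simp_all add: I_def keep_def)
        then show ?thesis
          using that(2,3) off[of "dig z j i"] h[of "dig z j i" i] dig_less[OF z(2)] by (simp add: row_entry_def hh_def)
      qed
      have len: "nval m (NV 4) = k" if "keep {20, 43} {} m1 m" for m
        using that m1 k by (simp add: I_def keep_def)
      have c1: "narr m1 20 = C1" using m1 by (simp add: I_def)
      let ?B = "\<lambda>x. C1 x + card {i. i < k \<and> hh i = x}"
      have set_eq: "{x. x < n \<and> ?B x \<noteq> 0} = {..<n} \<inter> (insert e {x. C0 x \<noteq> 0} \<union> (\<lambda>i. hh i) ` {..<k})"
      proof -
        have "card {i. i < k \<and> hh i = x} \<noteq> 0 \<longleftrightarrow> x \<in> hh ` {..<k}" for x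
          by (auto simp: card_eq_0_iff)
        then show ?thesis by (auto simp: C1_def)
      qed
      define mid where "mid m \<longleftrightarrow> keep {20, 43} {21, 22, 23} m1 m \<and> narr m 20 = ?B \<and>
        rarr m 21 0 = (\<Sum>i<Suc j. F (dig z i)) \<and> rarr m 22 0 = real (Suc j)" for m
      have s1: "ht n g (\<lambda>m. m = m1) (Bump 43 (NV 4) row_entry)
          (\<lambda>m. keep {20, 43} {} m1 m \<and> narr m 20 = (\<lambda>x. narr m1 20 x + card {i. i < k \<and> hh i = x})) (4 * k + 3)"
        by (rule ht_Bump[OF idx len]) auto
      have s2: "ht n g (\<lambda>m. keep {20, 43} {} m1 m \<and> narr m 20 = (\<lambda>x. narr m1 20 x + card {i. i < k \<and> hh i = x}))
         (Seq (Query 23 (NConst 0) 20)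
         (Seq (RAssign 21 (NConst 0) (RAdd (RV 21) (RV 23)))
           (RAssign 22 (NConst 0) (RAdd (RV 22) (ROfNat (NConst 1)))))) mid 5"
      proof (rule ht_simple)
        fix m assume m: "keep {20, 43} {} m1 m \<and> narr m 20 = (\<lambda>x. narr m1 20 x + card {i. i < k \<and> hh i = x})"
        have C: "narr m 20 = ?B" using m c1 by simp
        have "stored_set n 20 m = {..<n} \<inter> (insert e {x. C0 x \<noteq> 0} \<union> (\<lambda>i. hh i) ` {..<k})"
          unfolding stored_set_def C by (rule set_eq)
        then have "g (stored_set n 20 m) = F (dig z j)" by (simp only: F_def hh_def)
        then show "mid (sexec n g (Seq (Query 23 (NConst 0) 20)
         (Seq (RAssign 21 (NConst 0) (RAdd (RV 21) (RV 23)))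
           (RAssign 22 (NConst 0) (RAdd (RV 22) (ROfNat (NConst 1)))))) m)"
        proof -
          have kp: "keep {20, 43} {} m1 m" using m by blast
          have "keep {20, 43} {21, 22, 23} m1 m" by (rule keep_mono[OF kp]) auto
          moreover have "rarr m 21 0 = (\<Sum>i<j. F (dig z i))" "rarr m 22 0 = real j"
            using m1 keepD(2)[OF kp, of 21] keepD(2)[OF kp, of 22] by (simp_all add: I_def)
          ultimately show ?thesis
            using C \<open>g (stored_set n 20 m) = F (dig z j)\<close> by (simp add: mid_def)
        qed
      qed auto
      have s3: "ht n g mid (Unbump 43 (NV 4) row_entry)
         (\<lambda>m. I (Suc j) m \<and> (\<forall>y<k. narr m 40 y = dig z j y) \<and> narr m 42 0 = 0) (4 * k + 3)"
      proof (rule ht_pre)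
        fix m2 assume m2: "mid m2"
        have idx2: "nval m row_entry = hh i" if "keep {20, 43} {} m2 m" "narr m 43 0 = i" "i < k" for m i
        proof -
          have "narr m 40 i = dig z j i" "narr m 6 = narr m0 6" "narr m 21 = narr m0 21"
            using that m1 m2 by (simp_all add: I_def mid_def keep_def)
          then show ?thesis
            using that(2,3) off[of "dig z j i"] h[of "dig z j i" i] dig_less[OF z(2)] by (simp add: row_entry_def hh_def)
        qed
        have len2: "nval m (NV 4) = k" if "keep {20, 43} {} m2 m" for m
          using that m1 m2 k by (simp add: I_def mid_def keep_def)
        have "ht n g (\<lambda>m. m = m2) (Unbump 43 (NV 4) row_entry)
            (\<lambda>m. keep {20, 43} {} m2 m \<and> narr m 20 = C1) (4 * k + 3)"
          by (rule ht_Unbump[OF idx2 len2]) (use m2 in \<open>auto simp: mid_def\<close>)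
        then show "ht n g (\<lambda>m. m = m2) (Unbump 43 (NV 4) row_entry)
            (\<lambda>m. I (Suc j) m \<and> (\<forall>y<k. narr m 40 y = dig z j y) \<and> narr m 42 0 = 0) (4 * k + 3)"
          by (rule ht_conseq) (use m1 m2 in \<open>auto simp: I_def mid_def keep_def\<close>)
      qed
      show "ht n g (\<lambda>m. m = m1) EvalBody
        (\<lambda>m. I (Suc j) m \<and> (\<forall>y<k. narr m 40 y = dig z j y) \<and> narr m 42 0 = 0) (8 * k + 13)"
        unfolding EvalBody_def
        by (rule ht_conseq[OF ht_Seq[OF s1 ht_Seq[OF s2 s3]]]) auto
    qed
  qed (use z in auto)
  have post: "ht n g (I (z ^ k)) (NAssign 20 (NV 29) (NSub (NRead 20 (NV 29)) (NConst 1)))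
     (\<lambda>m. keep {40, 41, 42, 43} {21, 22, 23} m0 m \<and> rarr m 21 0 = (\<Sum>i<z ^ k. F (dig z i)) \<and> rarr m 22 0 = real z ^ k) 1"
  proof (rule ht_simple)
    fix m assume m: "I (z ^ k) m"
    have "narr m 29 0 = e" using m e by (simp add: I_def keep_def)
    moreover have "C1(e := C1 e - 1) = narr m0 20" by (simp add: C1_def C0_def)
    moreover have mI: "keep (insert 20 {40, 41, 42, 43}) {21, 22, 23} m0 m" "narr m 20 = C1"
      "rarr m 21 0 = (\<Sum>i<z ^ k. F (dig z i))" "rarr m 22 0 = real z ^ k"
      using m by (simp_all add: I_def)
    ultimately have "keep {40, 41, 42, 43} {21, 22, 23} m0 (nwrite 20 e (C1 e - 1) m)"
      by (intro keep_restore) simp_all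
    then show "keep {40, 41, 42, 43} {21, 22, 23} m0 (sexec n g (NAssign 20 (NV 29) (NSub (NRead 20 (NV 29)) (NConst 1))) m) \<and>
      rarr (sexec n g (NAssign 20 (NV 29) (NSub (NRead 20 (NV 29)) (NConst 1))) m) 21 0 = (\<Sum>i<z ^ k. F (dig z i)) \<and>
      rarr (sexec n g (NAssign 20 (NV 29) (NSub (NRead 20 (NV 29)) (NConst 1))) m) 22 0 = real z ^ k"
      using mI \<open>narr m 29 0 = e\<close> by simp
  qed auto
  \<comment> \<open>The enumeration runs over numbers, the average over functions that are undefined
    outside \<open>{..<k}\<close>. The sets evaluated use digits below \<open>k\<close> only, so
    both sums agree.\<close>
  have "(\<Sum>\<pi>\<in>PiE {..<k} (\<lambda>_. {..<z}). F \<pi>) = (\<Sum>i<z ^ k. F (restrict (dig z i) {..<k}))"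
    by (rule sum.reindex_bij_betw[OF dig_bij[OF z(2)], symmetric])
  also have "\<dots> = (\<Sum>i<z ^ k. F (dig z i))"
  proof (rule sum.cong)
    fix i
    have "(\<lambda>j. h (restrict (dig z i) {..<k} j) j) ` {..<k} = (\<lambda>j. h (dig z i j) j) ` {..<k}"
      by (rule image_cong) auto
    then show "F (restrict (dig z i) {..<k}) = F (dig z i)" by (simp only: F_def)
  qed simp
  finally have "(\<Sum>i<z ^ k. F (dig z i)) = (\<Sum>\<pi>\<in>PiE {..<k} (\<lambda>_. {..<z}). F \<pi>)" ..
  then show ?thesis unfolding Eval_def
    by (intro ht_conseq[OF ht_Seq[OF pre ht_Seq[OF enum post]]])
       (auto simp: F_def C0_def eval_time_def)
qed

section \<open>Implementation\<close>

text \<open>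
  Memory layout (a scalar is cell 0 of its array). Naturals: 0 is \<open>n\<close>, 1 the best set so far, 2 to 5
  are \<open>z\<close>, \<open>Q\<close>, \<open>k\<close>, \<open>z ^ 8\<close>, 6 holds the row offsets \<open>i * k\<close> (the language has no multiplication
  of naturals), 8 is \<open>t\<close>, 9 the factor \<open>bb\<close> of \<open>Bt = bb * w t\<close>, 10 the guess vector, 20 the set \<open>A\<close>
  as multiplicities, 21 the table \<open>h\<close> and 22 its pool. Reals: 1 is \<open>w\<close>, 2 is \<open>l\<close>, 3 the best value,
  4 the guess \<open>T\<close> of the optimum. The table entry \<open>n\<close> stands for an empty slot.
\<close>

definition bLight :: "nexp \<Rightarrow> bexp" where
  "bLight x = Conj (RLess (ROfNat (NConst 0)) (RRead 1 x))
     (Conj (Neg (RLess (RRead 1 (NV 8)) (RRead 1 x)))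
       (Neg (Conj (Neg (RLess (RRead 1 x) (RRead 1 (NV 8)))) (Neg (NLess x (NV 8))))))"

definition bHeavy :: "nexp \<Rightarrow> bexp" where
  "bHeavy x = Conj (RLess (ROfNat (NConst 0)) (RRead 1 x)) (Neg (bLight x))"

definition eUnitHeavy :: rexp where
  "eUnitHeavy = RDiv (RV 4) (RMul (ROfNat (NV 4)) (ROfNat (NV 2)))"

definition eUnitLight :: rexp where
  "eUnitLight = RDiv (RV 4) (ROfNat (NV 2))"

definition eBt :: rexp where
  "eBt = RMul (ROfNat (NV 9)) (RRead 1 (NV 8))"

definition eUnitWeight :: rexp where
  "eUnitWeight = RDiv eBt (RMul (RMul (ROfNat (NConst 2)) (ROfNat (NV 2))) (RAdd (ROfNat (NV 3)) (ROfNat (NConst 2))))"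

definition eCell :: nexp where
  "eCell = NAdd (NRead 6 (NV 23)) (NV 24)"

definition bHelig :: bexp where
  "bHelig = Conj (bHeavy (NV 27))
     (Conj (Neg (RLess (RRead 2 (NV 27)) (RMul (ROfNat (NRead 10 (NAdd (NRead 6 (NV 2)) (NV 24)))) eUnitHeavy)))
     (Conj (Neg (Conj (NLess (NV 23) (NV 2))
             (RLess (RSub (RV 21) (RV 20)) (RMul (RMul (ROfNat (NRead 10 eCell)) eUnitHeavy) (RV 22)))))
           (Neg (Conj (Neg (NLess (NV 23) (NV 2))) (NLess (NConst 0) (NRead 22 (NV 27)))))))"

definition bCls :: bexp where
  "bCls = Conj
     (Neg (Conj (NLess (NV 25) (NV 3))
        (Neg (Conj (Neg (RLess (RMul (RRead 2 (NV 27)) eBt) (RMul (RMul (ROfNat (NV 25)) eUnitLight) (RRead 1 (NV 27)))))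
            (RLess (RMul (RRead 2 (NV 27)) eBt) (RMul (RMul (RAdd (ROfNat (NV 25)) (ROfNat (NConst 1))) eUnitLight) (RRead 1 (NV 27))))))))
     (Neg (Conj (Neg (NLess (NV 25) (NV 3)))
        (RLess (RMul (RRead 2 (NV 27)) eBt) (RMul (RMul (ROfNat (NV 3)) eUnitLight) (RRead 1 (NV 27))))))"

text \<open>Item \<open>n\<close> is worthless, so evaluating with it gives the value of
  \<open>A\<close> itself, the reference for all marginal gains of the scan. The same
  \<open>n\<close> starts the scan as the mark for an empty result.\<close>

definition Prep :: com where
  "Prep = Seq (NAssign 29 (NConst 0) (NV 0)) (Seq Eval
     (Seq (RAssign 20 (NConst 0) (RV 21)) (NAssign 28 (NConst 0) (NV 0))))"

definition EvalItem :: com where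
  "EvalItem = Seq (NAssign 29 (NConst 0) (NV 27)) Eval"

definition bHUpd :: bexp where
  "bHUpd = Conj bHelig (Neg (Conj (NLess (NV 28) (NV 0)) (Neg (RLess (RRead 1 (NV 27)) (RRead 1 (NV 28))))))"

definition HUpd :: com where
  "HUpd = Cond bHUpd
     (NAssign 28 (NConst 0) (NV 27)) Skip"

definition HPick :: com where
  "HPick = Seq Prep (Seq (For 27 (NV 0) (Seq EvalItem HUpd))
     (Seq (NAssign 21 eCell (NV 28)) (NAssign 22 (NV 28) (NConst 1))))"

definition LKey :: com where
  "LKey = Cond (Conj (Neg (NLess (NV 25) (NV 3))) (Neg (NLess (NV 3) (NV 25))))
     (RAssign 26 (NConst 0) (RDiv (RRead 2 (NV 27)) (RRead 1 (NV 27))))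
     (RAssign 26 (NConst 0) (RDiv (RSub (RV 21) (RV 20)) (RRead 1 (NV 27))))"

definition bLUpd :: bexp where
  "bLUpd = Conj (Neg (NLess (NConst 0) (NRead 20 (NV 27)))) (Conj (bLight (NV 27)) (Conj bCls
       (Neg (Conj (NLess (NV 28) (NV 0)) (Neg (RLess (RV 25) (RV 26)))))))"

definition LUpd :: com where
  "LUpd = Cond bLUpd (Seq (NAssign 28 (NConst 0) (NV 27)) (RAssign 25 (NConst 0) (RV 26))) Skip"

definition LPut :: com where
  "LPut = Cond (NLess (NV 28) (NV 0))
     (Seq (NAssign 20 (NV 28) (NConst 1)) (RAssign 24 (NConst 0) (RAdd (RV 24) (RRead 1 (NV 28))))) Skip"

definition LPick :: com where
  "LPick = Cond (RLess (RMul (RV 24) (ROfNat (NV 2)))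
         (RMul (ROfNat (NRead 10 (NAdd (NRead 6 (NAdd (NV 2) (NConst 1))) (NV 25)))) eUnitWeight))
     (Seq Prep (Seq (For 27 (NV 0) (Seq EvalItem (Seq LKey LUpd))) LPut)) Skip"

text \<open>The oracle \<open>gq\<close> matters on subsets of \<open>{..<n}\<close> only. The
  analysis uses its extension that ignores all indices from \<open>n\<close> on, which makes
  \<open>n\<close> a dummy item.\<close>

locale prog_data = knapsack_data "\<lambda>S. gq ({..<n} \<inter> S)" n l w z k Q t T Bt lam c
  for gq n l w z k Q t T Bt lam c +
  fixes bb :: nat
  assumes z_pos': "0 < z" and k_pos': "0 < k" and Bt_def: "Bt = real bb * w t"
begin

definition env :: "(nat \<Rightarrow> nat) \<Rightarrow> memory \<Rightarrow> bool" where
  "env G m \<longleftrightarrow> narr m 0 0 = n \<and> narr m 2 0 = z \<and> narr m 3 0 = Q \<and> narr m 4 0 = k \<and>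
     (\<forall>i\<le>z + k. narr m 6 i = i * k) \<and> narr m 8 0 = t \<and> narr m 9 0 = bb \<and>
     (\<forall>i<z. \<forall>j<k. narr m 10 (i * k + j) = G (i * k + j)) \<and>
     (\<forall>j<k. narr m 10 (z * k + j) = lam j) \<and>
     (\<forall>q<Q + 2. narr m 10 ((z + 1) * k + q) = c q) \<and>
     rarr m 1 = w \<and> rarr m 2 = l \<and> rarr m 4 0 = T"

lemma env_keep:
  assumes "env G m0" "keep X Y m0 m" "X \<inter> {0, 2, 3, 4, 6, 8, 9, 10} = {}" "Y \<inter> {1, 2, 4} = {}"
  shows "env G m"
proof -
  have "narr m a = narr m0 a" if "a \<in> {0, 2, 3, 4, 6, 8, 9, 10}" for a
    using that assms(2,3) by (intro keepD(1)) auto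
  moreover have "rarr m a = rarr m0 a" if "a \<in> {1, 2, 4}" for a
    using that assms(2,4) by (intro keepD(2)) auto
  ultimately show ?thesis using assms(1) unfolding env_def by simp
qed

lemma envD:
  assumes "env G m"
  shows "narr m 0 0 = n" "narr m 2 0 = z" "narr m 3 0 = Q" "narr m 4 0 = k"
    "i \<le> z + k \<Longrightarrow> narr m 6 i = i * k" "narr m 8 0 = t" "narr m 9 0 = bb"
    "i < z \<Longrightarrow> j < k \<Longrightarrow> narr m 10 (i * k + j) = G (i * k + j)"
    "j < k \<Longrightarrow> narr m 10 (z * k + j) = lam j"
    "q < Q + 2 \<Longrightarrow> narr m 10 (k + z * k + q) = c q"
    "rarr m 1 = w" "rarr m 2 = l" "rarr m 4 0 = T"
  using assms by (auto simp: env_def)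

text \<open>The cell just behind the table holds \<open>n\<close>: in the final search an address
  can point there to leave a position of the tuple empty.\<close>

definition srep :: "nat set \<Rightarrow> (nat \<Rightarrow> nat \<Rightarrow> nat) \<Rightarrow> memory \<Rightarrow> bool" where
  "srep A h m \<longleftrightarrow> (\<forall>x<n. narr m 20 x \<noteq> 0 \<longleftrightarrow> x \<in> A) \<and>
     (\<forall>i<z + k. \<forall>j<k. narr m 21 (i * k + j) = h i j) \<and> narr m 21 ((z + k) * k) = n \<and>
     (\<forall>x<n. narr m 22 x \<noteq> 0 \<longleftrightarrow> x \<in> pool h)"

lemma srep_keep:
  assumes "srep A h m0" "keep X Y m0 m" "X \<inter> {20, 21, 22} = {}"
  shows "srep A h m"
proof -
  have "narr m a = narr m0 a" if "a \<in> {20, 21, 22}" for a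
    using that assms(2,3) by (intro keepD(1)) auto
  then show ?thesis using assms(1) unfolding srep_def by simp
qed

lemma bLight: "env G m \<Longrightarrow> bval m (bLight x) = light (nval m x)"
  using envD[of G m] by (auto simp: bLight_def light_def)

lemma bHeavy: "env G m \<Longrightarrow> bval m (bHeavy x) = heavy (nval m x)"
  using envD[of G m] by (auto simp: bHeavy_def heavy_def bLight)

lemma eUnits:
  assumes "env G m"
  shows "rval m eUnitHeavy = unit_heavy" "rval m eUnitLight = unit_light" "rval m eBt = Bt"
    "rval m eUnitWeight = unit_weight"
  unfolding unit_heavy_def unit_light_def unit_weight_def using envD[OF assms]
  by (simp_all add: eUnitHeavy_def eUnitLight_def eBt_def Bt_def eUnitWeight_def)

lemma bCls: "env G m \<Longrightarrow> narr m 25 0 = q \<Longrightarrow> narr m 27 0 = e \<Longrightarrow> bval m bCls = cls q e"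
  using envD[of G m] by (auto simp: bCls_def cls_def eUnits)

lemma val_insert_n: "val (insert n A) h = val A h"
  unfolding val_def by (intro sum.cong arg_cong[where f = gq]) auto

lemma ht_EvalAt:
  assumes env: "env G m0" and s: "srep A h m0" and e: "narr m0 29 0 = e"
  shows "ht n gq (\<lambda>m. m = m0) Eval (\<lambda>m. keep {40, 41, 42, 43} {21, 22, 23} m0 m \<and>
      rarr m 21 0 = val (insert e A) h \<and> rarr m 22 0 = real z ^ k) (eval_time z k)"
proof -
  have set_eq: "{..<n} \<inter> (insert e {x. narr m0 20 x \<noteq> 0} \<union> X) = {..<n} \<inter> (insert e A \<union> X)" for X
    using s unfolding srep_def by auto
  have h: "narr m0 21 (i * k + j) = h i j" if "i < z" "j < k" for i j
    using s that unfolding srep_def by simp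
  have off: "narr m0 6 i = i * k" if "i < z" for i using envD(5)[OF env, of i] that by simp
  show ?thesis
    using ht_Eval[OF envD(2)[OF env] z_pos' envD(4)[OF env] off h e, of n gq]
    unfolding set_eq val_def .
qed

lemma ht_EvalItem:
  assumes env: "env G m0" and s: "srep A h m0" and e: "narr m0 27 0 = e"
  shows "ht n gq (\<lambda>m. m = m0) EvalItem (\<lambda>m. keep {29, 40, 41, 42, 43} {21, 22, 23} m0 m \<and>
      rarr m 21 0 = val (insert e A) h \<and> rarr m 22 0 = real z ^ k) (eval_time z k + 2)"
proof -
  have 1: "ht n gq (\<lambda>m. m = m0) (NAssign 29 (NConst 0) (NV 27)) (\<lambda>m. m = nwrite 29 0 e m0) 1"
    by (rule ht_simple) (auto simp: e)
  have 2: "ht n gq (\<lambda>m. m = nwrite 29 0 e m0) Eval (\<lambda>m. keep {29, 40, 41, 42, 43} {21, 22, 23} m0 m \<and>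
      rarr m 21 0 = val (insert e A) h \<and> rarr m 22 0 = real z ^ k) (eval_time z k)"
  proof (rule ht_conseq[OF ht_EvalAt])
    have kp: "keep {29} {} m0 (nwrite 29 0 e m0)" by simp
    show "env G (nwrite 29 0 e m0)" by (rule env_keep[OF env kp]) auto
    show "srep A h (nwrite 29 0 e m0)" by (rule srep_keep[OF s kp]) auto
    show "keep {29, 40, 41, 42, 43} {21, 22, 23} m0 m \<and> rarr m 21 0 = val (insert e A) h \<and> rarr m 22 0 = real z ^ k"
      if "keep {40, 41, 42, 43} {21, 22, 23} (nwrite 29 0 e m0) m \<and> rarr m 21 0 = val (insert e A) h \<and> rarr m 22 0 = real z ^ k" for m
      using keep_trans[OF kp, of "{40, 41, 42, 43}" "{21, 22, 23}" m] that by auto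
  qed auto
  show ?thesis unfolding EvalItem_def by (rule ht_conseq[OF ht_Seq[OF 1 2]]) auto
qed

lemma ht_Prep:
  assumes env: "env G m0" and s: "srep A h m0"
  shows "ht n gq (\<lambda>m. m = m0) Prep (\<lambda>m. keep {28, 29, 40, 41, 42, 43} {20, 21, 22, 23} m0 m \<and>
      rarr m 20 0 = val A h \<and> rarr m 22 0 = real z ^ k \<and> narr m 28 0 = n) (eval_time z k + 6)"
proof -
  have 1: "ht n gq (\<lambda>m. m = m0) (NAssign 29 (NConst 0) (NV 0)) (\<lambda>m. m = nwrite 29 0 n m0) 1"
    by (rule ht_simple) (auto simp: envD(1)[OF env])
  have kp: "keep {29} {} m0 (nwrite 29 0 n m0)" by simp
  have 2: "ht n gq (\<lambda>m. m = nwrite 29 0 n m0) Eval (\<lambda>m. keep {29, 40, 41, 42, 43} {21, 22, 23} m0 m \<and>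
      rarr m 21 0 = val A h \<and> rarr m 22 0 = real z ^ k) (eval_time z k)"
  proof (rule ht_conseq[OF ht_EvalAt])
    show "env G (nwrite 29 0 n m0)" by (rule env_keep[OF env kp]) auto
    show "srep A h (nwrite 29 0 n m0)" by (rule srep_keep[OF s kp]) auto
    show "keep {29, 40, 41, 42, 43} {21, 22, 23} m0 m \<and> rarr m 21 0 = val A h \<and> rarr m 22 0 = real z ^ k"
      if "keep {40, 41, 42, 43} {21, 22, 23} (nwrite 29 0 n m0) m \<and> rarr m 21 0 = val (insert n A) h \<and> rarr m 22 0 = real z ^ k" for m
      using keep_trans[OF kp, of "{40, 41, 42, 43}" "{21, 22, 23}" m] that val_insert_n by auto
  qed auto
  have 3: "ht n gq (\<lambda>m. keep {29, 40, 41, 42, 43} {21, 22, 23} m0 m \<and>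
      rarr m 21 0 = val A h \<and> rarr m 22 0 = real z ^ k)
    (Seq (RAssign 20 (NConst 0) (RV 21)) (NAssign 28 (NConst 0) (NV 0)))
    (\<lambda>m. keep {28, 29, 40, 41, 42, 43} {20, 21, 22, 23} m0 m \<and>
      rarr m 20 0 = val A h \<and> rarr m 22 0 = real z ^ k \<and> narr m 28 0 = n) 3"
  proof (rule ht_simple)
    fix m assume m: "keep {29, 40, 41, 42, 43} {21, 22, 23} m0 m \<and>
      rarr m 21 0 = val A h \<and> rarr m 22 0 = real z ^ k"
    have "keep {28, 29, 40, 41, 42, 43} {20, 21, 22, 23} m0 m"
      by (rule keep_mono[OF conjunct1[OF m]]) auto
    moreover have "narr m 0 = narr m0 0" using keepD(1)[OF conjunct1[OF m]] by simp
    ultimately show "keep {28, 29, 40, 41, 42, 43} {20, 21, 22, 23} m0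
       (sexec n gq (Seq (RAssign 20 (NConst 0) (RV 21)) (NAssign 28 (NConst 0) (NV 0))) m) \<and>
      rarr (sexec n gq (Seq (RAssign 20 (NConst 0) (RV 21)) (NAssign 28 (NConst 0) (NV 0))) m) 20 0 = val A h \<and>
      rarr (sexec n gq (Seq (RAssign 20 (NConst 0) (RV 21)) (NAssign 28 (NConst 0) (NV 0))) m) 22 0 = real z ^ k \<and>
      narr (sexec n gq (Seq (RAssign 20 (NConst 0) (RV 21)) (NAssign 28 (NConst 0) (NV 0))) m) 28 0 = n"
      using m envD(1)[OF env] by simp
  qed auto
  show ?thesis unfolding Prep_def
    by (rule ht_conseq[OF ht_Seq[OF 1 ht_Seq[OF 2 3]]]) auto
qed

lemma scan_le: "scan n el sc e \<le> n" if "e \<le> n"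
  using scan_cases[OF that, of el sc] that by auto

text \<open>The cell must be empty beforehand. Then writing it removes nothing from the pool, and
  marking the new item in array 22 keeps that array exact.\<close>

lemma ht_HPick:
  assumes env: "env G m0" and s: "srep A h m0" and i: "narr m0 23 0 = i" "i < z + k"
    and j: "narr m0 24 0 = j" "j < k" and v: "narr m0 10 (i * k + j) = v" and hn: "h i j = n"
  shows "ht n gq (\<lambda>m. m = m0) HPick
     (\<lambda>m. keep {21, 22, 27, 28, 29, 40, 41, 42, 43} {20, 21, 22, 23} m0 m \<and>
        srep A (h(i := (h i)(j := hpick v i j A h))) m) (n * (eval_time z k + 10) + eval_time z k + 20)"
proof -
  let ?X = "{27, 28, 29, 40, 41, 42, 43} :: nat set" and ?Y = "{20, 21, 22, 23} :: nat set"
  let ?sc = "scan n (helig v i j A h) (\<lambda>e. - w e)"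
  \<comment> \<open>Cell 28 follows \<open>scan\<close> prefix by prefix, hence one round of the
    loop is one unfolding of the recursion.\<close>
  define I where "I e m \<longleftrightarrow> keep ?X ?Y m0 m \<and> rarr m 20 0 = val A h \<and> narr m 28 0 = ?sc e" for e m
  have envI: "env G m" if "keep ?X ?Y m0 m" for m by (rule env_keep[OF env that]) auto
  have srepI: "srep A h m" if "keep ?X ?Y m0 m" for m by (rule srep_keep[OF s that]) auto
  have loop: "ht n gq (\<lambda>m. keep {28, 29, 40, 41, 42, 43} ?Y m0 m \<and>
      rarr m 20 0 = val A h \<and> rarr m 22 0 = real z ^ k \<and> narr m 28 0 = n)
     (For 27 (NV 0) (Seq EvalItem HUpd)) (\<lambda>m. I n m \<and> narr m 27 0 = n) (n * (eval_time z k + 10) + 3)"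
  proof (rule ht_For[where K = "eval_time z k + 6"])
    show "I 0 (nwrite 27 0 0 m)" if "keep {28, 29, 40, 41, 42, 43} ?Y m0 m \<and>
      rarr m 20 0 = val A h \<and> rarr m 22 0 = real z ^ k \<and> narr m 28 0 = n" for m
    proof -
      have "keep ?X ?Y m0 m" by (rule keep_mono[OF conjunct1[OF that]]) auto
      then show ?thesis using that by (simp add: I_def)
    qed
    fix e assume e: "e < n"
    show "ht n gq (\<lambda>m. I e m \<and> narr m 27 0 = e) (Seq EvalItem HUpd)
       (\<lambda>m. I (Suc e) (nwrite 27 0 (Suc e) m) \<and> narr m 27 0 = e) (eval_time z k + 6)"
    proof (rule ht_pre)
      fix m1 assume m1: "I e m1 \<and> narr m1 27 0 = e"
      have k1: "keep ?X ?Y m0 m1" using m1 by (simp add: I_def)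
      have ei: "ht n gq (\<lambda>m. m = m1) EvalItem (\<lambda>m. keep {29, 40, 41, 42, 43} {21, 22, 23} m1 m \<and>
          rarr m 21 0 = val (insert e A) h \<and> rarr m 22 0 = real z ^ k) (eval_time z k + 2)"
        by (rule ht_EvalItem[OF envI[OF k1] srepI[OF k1]]) (use m1 in simp)
      have upd: "ht n gq (\<lambda>m. keep {29, 40, 41, 42, 43} {21, 22, 23} m1 m \<and>
          rarr m 21 0 = val (insert e A) h \<and> rarr m 22 0 = real z ^ k) HUpd
          (\<lambda>m. I (Suc e) (nwrite 27 0 (Suc e) m) \<and> narr m 27 0 = e) 3"
      proof (rule ht_conseq[OF ht_simple])
        fix m assume m: "keep {29, 40, 41, 42, 43} {21, 22, 23} m1 m \<and>
          rarr m 21 0 = val (insert e A) h \<and> rarr m 22 0 = real z ^ k"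
        note k2 = conjunct1[OF m]
        have k02: "keep ?X ?Y m0 m" by (rule keep_trans[OF k1 k2]) auto
        note E = envI[OF k02] and Sr = srepI[OF k02]
        have c: "narr m 27 0 = e" "narr m 28 0 = ?sc e" "rarr m 20 0 = val A h"
          using m1 keepD[OF k2] by (simp_all add: I_def)
        have c': "narr m 23 0 = i" "narr m 24 0 = j" "narr m 10 (i * k + j) = v"
          using i(1) j(1) v keepD(1)[OF k02] by simp_all
        have cell: "nval m eCell = i * k + j" using c' envD(5)[OF E, of i] i(2) by (simp add: eCell_def)
        have el: "bval m bHelig = helig v i j A h e"
          using m c c' cell envD[OF E] eUnits[OF E] bHeavy[OF E] j(2) Sr e
          by (auto simp: bHelig_def helig_def marg_def srep_def not_less)
        have best: "?sc e < n \<longleftrightarrow> ?sc e \<noteq> n" using scan_le[of e "helig v i j A h" "\<lambda>e. - w e"] e by auto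
        have cond: "bval m bHUpd \<longleftrightarrow> helig v i j A h e \<and> (?sc e = n \<or> - w (?sc e) < - w e)"
          using el c envD[OF E] best by (auto simp: bHUpd_def)
        have "sexec n gq HUpd m = (if bval m bHUpd then nwrite 28 0 e m else m)"
          using c(1) by (simp add: HUpd_def)
        then have "narr (sexec n gq HUpd m) 28 0 = ?sc (Suc e)" "narr (sexec n gq HUpd m) 27 0 = e"
          "rarr (sexec n gq HUpd m) 20 0 = val A h" "keep ?X ?Y m0 (sexec n gq HUpd m)"
          using cond c k02 by (auto simp: Let_def)
        then show "I (Suc e) (nwrite 27 0 (Suc e) (sexec n gq HUpd m)) \<and> narr (sexec n gq HUpd m) 27 0 = e"
          unfolding I_def by simp
      qed (auto simp: HUpd_def)
      show "ht n gq (\<lambda>m. m = m1) (Seq EvalItem HUpd)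
          (\<lambda>m. I (Suc e) (nwrite 27 0 (Suc e) m) \<and> narr m 27 0 = e) (eval_time z k + 6)"
        by (rule ht_conseq[OF ht_Seq[OF ei upd]]) auto
    qed
  next
    show "nval m (NV 0) = n" if "I e m" for e m
    proof -
      have "keep ?X ?Y m0 m" using that by (simp add: I_def)
      from envD(1)[OF envI[OF this]] show ?thesis by simp
    qed
  qed (simp add: algebra_simps)
  have put: "ht n gq (\<lambda>m. I n m \<and> narr m 27 0 = n) (Seq (NAssign 21 eCell (NV 28)) (NAssign 22 (NV 28) (NConst 1)))
     (\<lambda>m. keep {21, 22, 27, 28, 29, 40, 41, 42, 43} ?Y m0 m \<and>
        srep A (h(i := (h i)(j := hpick v i j A h))) m) 3"
  proof (rule ht_simple)
    fix m assume m: "I n m \<and> narr m 27 0 = n"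
    have k1: "keep ?X ?Y m0 m" using m by (simp add: I_def)
    have k2: "keep {21, 22, 27, 28, 29, 40, 41, 42, 43} ?Y m0 m" by (rule keep_mono[OF k1]) auto
    note E = envI[OF k1] and Sr = srepI[OF k1]
    have "narr m 23 0 = i" "narr m 24 0 = j" using i j keepD(1)[OF k1] by simp_all
    then have cell: "nval m eCell = i * k + j" using envD(5)[OF E, of i] i(2) by (simp add: eCell_def)
    define e where "e = hpick v i j A h"
    have b: "narr m 28 0 = e" using m by (simp add: I_def e_def hpick_def)
    let ?h = "h(i := (h i)(j := e))"
    have idx: "i' * k + j' = i * k + j \<longleftrightarrow> i' = i \<and> j' = j" if "j' < k" for i' j'
    proof
      assume eq: "i' * k + j' = i * k + j"
      have "(i' * k + j') div k = i'" "(i' * k + j') mod k = j'" using that by simp_all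
      moreover have "(i * k + j) div k = i" "(i * k + j) mod k = j" using j(2) by simp_all
      ultimately show "i' = i \<and> j' = j" using eq by metis
    qed simp
    have pool_eq: "x \<in> pool ?h \<longleftrightarrow> x \<in> pool h \<or> x = e" if "x < n" for x
    proof
      assume "x \<in> pool ?h"
      then show "x \<in> pool h \<or> x = e" by (auto simp: pool_def split: if_splits)
    next
      assume "x \<in> pool h \<or> x = e"
      then show "x \<in> pool ?h"
      proof
        assume "x \<in> pool h"
        then obtain i' j' where ij: "x = h i' j'" "i' < z + k" "j' < k" by (auto simp: pool_def)
        then have "?h i' j' = x" using hn that by auto
        then show ?thesis using ij(2,3) unfolding pool_def by blast
      next
        assume "x = e"
        then have "?h i j = x" by simp
        then show ?thesis using i(2) j(2) unfolding pool_def by blast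
      qed
    qed
    have "srep A ?h (nwrite 22 e 1 (nwrite 21 (i * k + j) e m))"
    proof -
      have "i * k + j < (i + 1) * k" using j(2) by simp
      also have "\<dots> \<le> (z + k) * k" using i(2) by (intro mult_le_mono1) simp
      finally have "(z + k) * k \<noteq> i * k + j" by simp
      then show ?thesis using Sr pool_eq idx unfolding srep_def by auto
    qed
    then show "keep {21, 22, 27, 28, 29, 40, 41, 42, 43} ?Y m0
        (sexec n gq (Seq (NAssign 21 eCell (NV 28)) (NAssign 22 (NV 28) (NConst 1))) m) \<and>
       srep A (h(i := (h i)(j := hpick v i j A h)))
        (sexec n gq (Seq (NAssign 21 eCell (NV 28)) (NAssign 22 (NV 28) (NConst 1))) m)"
      using k2 cell b by (simp add: e_def)
  qed auto
  show ?thesis unfolding HPick_def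
    by (rule ht_conseq[OF ht_Seq[OF ht_Prep[OF env s] ht_Seq[OF loop put]]]) auto
qed

text \<open>The premise \<open>new\<close> is one step of \<open>lproc\<close>, so the enclosing
  loop follows its recursion. Real cell 25 caches the key of the best item so far and is meaningful
  only once such an item exists.\<close>

lemma ht_LPick:
  assumes env: "env G m0" and s: "srep A h m0" and q: "narr m0 25 0 = q" "q < Q + 2"
    and W: "rarr m0 24 0 = W"
    and new: "(A', W') = (if W * real z < real (c q) * unit_weight \<and> lpick q h A < n
       then (insert (lpick q h A) A, W + w (lpick q h A)) else (A, W))"
  shows "ht n gq (\<lambda>m. m = m0) LPick
     (\<lambda>m. keep {20, 27, 28, 29, 40, 41, 42, 43} {20, 21, 22, 23, 24, 25, 26} m0 m \<and>
        srep A' h m \<and> rarr m 24 0 = W') (n * (eval_time z k + 16) + eval_time z k + 24)"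
proof -
  let ?X = "{27, 28, 29, 40, 41, 42, 43} :: nat set" and ?Y = "{20, 21, 22, 23, 25, 26} :: nat set"
  let ?key = "\<lambda>e. (if q = Q then l e else marg A h e) / w e"
  let ?el = "\<lambda>e. e \<notin> A \<and> light e \<and> cls q e"
  let ?sc = "scan n ?el ?key"
  let ?post = "\<lambda>m. keep {20, 27, 28, 29, 40, 41, 42, 43} {20, 21, 22, 23, 24, 25, 26} m0 m \<and>
        srep A' h m \<and> rarr m 24 0 = W'"
  define I where "I e m \<longleftrightarrow> keep ?X ?Y m0 m \<and> rarr m 20 0 = val A h \<and> narr m 28 0 = ?sc e \<and>
      (?sc e < n \<longrightarrow> rarr m 25 0 = ?key (?sc e))" for e m
  have envI: "env G m" if "keep ?X ?Y m0 m" for m by (rule env_keep[OF env that]) auto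
  have srepI: "srep A h m" if "keep ?X ?Y m0 m" for m by (rule srep_keep[OF s that]) auto
  have loop: "ht n gq (\<lambda>m. keep {28, 29, 40, 41, 42, 43} {20, 21, 22, 23} m0 m \<and>
      rarr m 20 0 = val A h \<and> rarr m 22 0 = real z ^ k \<and> narr m 28 0 = n)
     (For 27 (NV 0) (Seq EvalItem (Seq LKey LUpd))) (\<lambda>m. I n m \<and> narr m 27 0 = n) (n * (eval_time z k + 16) + 3)"
  proof (rule ht_For[where K = "eval_time z k + 13"])
    show "I 0 (nwrite 27 0 0 m)" if "keep {28, 29, 40, 41, 42, 43} {20, 21, 22, 23} m0 m \<and>
      rarr m 20 0 = val A h \<and> rarr m 22 0 = real z ^ k \<and> narr m 28 0 = n" for m
    proof -
      have "keep ?X ?Y m0 m" by (rule keep_mono[OF conjunct1[OF that]]) auto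
      then show ?thesis using that by (simp add: I_def)
    qed
    fix e assume e: "e < n"
    show "ht n gq (\<lambda>m. I e m \<and> narr m 27 0 = e) (Seq EvalItem (Seq LKey LUpd))
       (\<lambda>m. I (Suc e) (nwrite 27 0 (Suc e) m) \<and> narr m 27 0 = e) (eval_time z k + 13)"
    proof (rule ht_pre)
      fix m1 assume m1: "I e m1 \<and> narr m1 27 0 = e"
      have k1: "keep ?X ?Y m0 m1" using m1 by (simp add: I_def)
      have ei: "ht n gq (\<lambda>m. m = m1) EvalItem (\<lambda>m. keep {29, 40, 41, 42, 43} {21, 22, 23} m1 m \<and>
          rarr m 21 0 = val (insert e A) h \<and> rarr m 22 0 = real z ^ k) (eval_time z k + 2)"
        by (rule ht_EvalItem[OF envI[OF k1] srepI[OF k1]]) (use m1 in simp)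
      have upd: "ht n gq (\<lambda>m. keep {29, 40, 41, 42, 43} {21, 22, 23} m1 m \<and>
          rarr m 21 0 = val (insert e A) h \<and> rarr m 22 0 = real z ^ k) (Seq LKey LUpd)
          (\<lambda>m. I (Suc e) (nwrite 27 0 (Suc e) m) \<and> narr m 27 0 = e) 10"
      proof (rule ht_simple)
        fix m assume m: "keep {29, 40, 41, 42, 43} {21, 22, 23} m1 m \<and>
          rarr m 21 0 = val (insert e A) h \<and> rarr m 22 0 = real z ^ k"
        note k2 = conjunct1[OF m]
        have k02: "keep ?X ?Y m0 m" by (rule keep_trans[OF k1 k2]) auto
        have c: "narr m 27 0 = e" "narr m 28 0 = ?sc e" "rarr m 20 0 = val A h" "?sc e < n \<longrightarrow> rarr m 25 0 = ?key (?sc e)"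
          using m1 keepD[OF k2] by (simp_all add: I_def)
        have c': "narr m 25 0 = q" using q(1) keepD(1)[OF k02] by simp
        define m3 where "m3 = rwrite 26 0 (?key e) m"
        have key: "sexec n gq LKey m = m3"
          using c c' m envD[OF envI[OF k02]] by (auto simp: LKey_def m3_def marg_def)
        have k03: "keep ?X ?Y m0 m3" using k02 by (simp add: m3_def)
        note E = envI[OF k03] and Sr = srepI[OF k03]
        have d: "narr m3 27 0 = e" "narr m3 28 0 = ?sc e" "rarr m3 20 0 = val A h" "?sc e < n \<longrightarrow> rarr m3 25 0 = ?key (?sc e)"
          "rarr m3 26 0 = ?key e" "narr m3 25 0 = q"
          using c c' by (simp_all add: m3_def)
        have inA: "narr m3 20 e \<noteq> 0 \<longleftrightarrow> e \<in> A" using Sr e by (simp add: srep_def)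
        have best: "?sc e < n \<longleftrightarrow> ?sc e \<noteq> n" using scan_le[of e ?el ?key] e by linarith
        have cond: "bval m3 bLUpd \<longleftrightarrow> ?el e \<and> (?sc e = n \<or> ?key (?sc e) < ?key e)"
          unfolding bLUpd_def bval.simps bLight[OF E] bCls[OF E d(6) d(1)]
          using d inA envD(1)[OF E] best by auto
        define m4 where "m4 = sexec n gq LUpd m3"
        have m4: "m4 = (if bval m3 bLUpd then rwrite 25 0 (?key e) (nwrite 28 0 e m3) else m3)"
          using d(1,5) by (simp add: LUpd_def m4_def)
        have "keep ?X ?Y m0 m4" "rarr m4 20 0 = val A h" "narr m4 27 0 = e"
          using k03 d(1,3) unfolding m4 by simp_all
        moreover have "narr m4 28 0 = ?sc (Suc e)"
          using d(2) unfolding m4 cond by (auto simp: Let_def)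
        moreover have "?sc (Suc e) < n \<longrightarrow> rarr m4 25 0 = ?key (?sc (Suc e))"
          using d(4) unfolding m4 cond by (auto simp: Let_def)
        ultimately show "I (Suc e) (nwrite 27 0 (Suc e) (sexec n gq (Seq LKey LUpd) m)) \<and> narr (sexec n gq (Seq LKey LUpd) m) 27 0 = e"
          unfolding sexec.simps key m4_def[symmetric] I_def by simp
      qed (simp_all add: LKey_def LUpd_def)
      show "ht n gq (\<lambda>m. m = m1) (Seq EvalItem (Seq LKey LUpd))
          (\<lambda>m. I (Suc e) (nwrite 27 0 (Suc e) m) \<and> narr m 27 0 = e) (eval_time z k + 13)"
        by (rule ht_conseq[OF ht_Seq[OF ei upd]]) auto
    qed
  next
    show "nval m (NV 0) = n" if "I e m" for e m
    proof -
      have "keep ?X ?Y m0 m" using that by (simp add: I_def)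
      from envD(1)[OF envI[OF this]] show ?thesis by simp
    qed
  qed (simp add: algebra_simps)
  let ?cond = "RLess (RMul (RV 24) (ROfNat (NV 2)))
         (RMul (ROfNat (NRead 10 (NAdd (NRead 6 (NAdd (NV 2) (NConst 1))) (NV 25)))) eUnitWeight)"
  have cond: "bval m0 ?cond \<longleftrightarrow> W * real z < real (c q) * unit_weight"
    using envD[OF env] eUnits[OF env] q W k_pos' envD(5)[OF env, of "Suc z"] by (simp add: add.assoc)
  have kX: "keep {20, 27, 28, 29, 40, 41, 42, 43} {20, 21, 22, 23, 24, 25, 26} m0 m" if "keep ?X ?Y m0 m" for m
    by (rule keep_mono[OF that]) auto
  have put: "ht n gq (\<lambda>m. I n m \<and> narr m 27 0 = n) LPut ?post 5" if "W * real z < real (c q) * unit_weight"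
  proof (rule ht_simple)
    fix m assume m: "I n m \<and> narr m 27 0 = n"
    have k1: "keep ?X ?Y m0 m" using m by (simp add: I_def)
    note E = envI[OF k1] and Sr = srepI[OF k1]
    have b: "narr m 28 0 = lpick q h A" using m by (simp add: I_def lpick_def)
    have W1: "rarr m 24 0 = W" using keepD(2)[OF k1] W by simp
    show "?post (sexec n gq LPut m)"
    proof (cases "lpick q h A < n")
      case True
      then have eq: "A' = insert (lpick q h A) A" "W' = W + w (lpick q h A)" using new that by auto
      have "srep A' h (rwrite 24 0 W' (nwrite 20 (lpick q h A) 1 m))"
        using Sr unfolding srep_def eq by auto
      then show ?thesis using kX[OF k1] True b W1 envD[OF E] by (simp add: LPut_def eq)
    next
      case False
      then have "A' = A" "W' = W" using new by auto
      then show ?thesis using kX[OF k1] False b W1 envD[OF E] Sr by (simp add: LPut_def)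
    qed
  qed (auto simp: LPut_def)
  show ?thesis
  proof (cases "W * real z < real (c q) * unit_weight")
    case True
    have "ht n gq (\<lambda>m. m = m0 \<and> bval m ?cond)
        (Seq Prep (Seq (For 27 (NV 0) (Seq EvalItem (Seq LKey LUpd))) LPut)) ?post
        (n * (eval_time z k + 16) + eval_time z k + 23)"
      by (rule ht_conseq[OF ht_Seq[OF ht_Prep[OF env s] ht_Seq[OF loop put[OF True]]]]) auto
    moreover have "ht n gq (\<lambda>m. m = m0 \<and> \<not> bval m ?cond) Skip ?post
        (n * (eval_time z k + 16) + eval_time z k + 23)"
      using cond True by (auto simp: ht_def)
    ultimately show ?thesis unfolding LPick_def by (rule ht_conseq[OF ht_Cond]) auto
  next
    case False
    then have "A' = A" "W' = W" using new by auto
    then have skip: "ht n gq (\<lambda>m. m = m0 \<and> \<not> bval m ?cond) Skip ?post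
        (n * (eval_time z k + 16) + eval_time z k + 23)"
      by (intro ht_simple) (use s W in auto)
    have "ht n gq (\<lambda>m. m = m0 \<and> bval m ?cond)
        (Seq Prep (Seq (For 27 (NV 0) (Seq EvalItem (Seq LKey LUpd))) LPut)) ?post
        (n * (eval_time z k + 16) + eval_time z k + 23)"
      using cond False by (auto simp: ht_def)
    from this skip show ?thesis unfolding LPick_def by (rule ht_conseq[OF ht_Cond]) auto
  qed
qed

end

context knapsack_data
begin

lemma rows_untouched: "i \<le> i' \<Longrightarrow> snd (rows V i) i' j = n"
  by (induction i) (simp_all add: split_beta Let_def hrow_untouched(1))

lemma fillers_untouched: "z + r \<le> i \<Longrightarrow> fillers V r i j = n"
  by (induction r) (simp_all add: rows_untouched hrow_untouched(1))

end

section \<open>Building the table for one guess\<close>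

definition HRow :: com where
  "HRow = For 24 (NV 4) HPick"

definition LProc :: com where
  "LProc = Seq (RAssign 24 (NConst 0) (ROfNat (NConst 0))) (For 26 (NV 0) LPick)"

definition LRow :: com where
  "LRow = For 25 (NAdd (NV 3) (NConst 2)) LProc"

definition InitItem :: com where
  "InitItem = Seq (NAssign 22 (NV 27) (NConst 0))
     (Cond (RLess (ROfNat (NConst 0)) (RRead 1 (NV 27))) (NAssign 20 (NV 27) (NConst 0)) (NAssign 20 (NV 27) (NConst 1)))"

definition InitState :: com where
  "InitState = Seq (For 27 (NV 0) InitItem)
     (For 27 (NAdd (NRead 6 (NAdd (NV 2) (NV 4))) (NConst 1)) (NAssign 21 (NV 27) (NV 0)))"

definition Build :: com where
  "Build = Seq InitState (Seq (For 23 (NV 2) (Seq HRow LRow))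
     (For 30 (NV 4) (Seq (NAssign 23 (NConst 0) (NAdd (NV 2) (NV 30))) HRow)))"

context prog_data
begin

definition pick_time :: nat where
  "pick_time = n * (eval_time z k + 16) + eval_time z k + 24"

lemma ht_HRow:
  assumes env: "env G m0" and s: "srep A h m0" and i: "narr m0 23 0 = i" "i < z + k"
    and hn: "\<And>j. h i j = n"
  shows "ht n gq (\<lambda>m. m = m0) HRow
     (\<lambda>m. keep {21, 22, 24, 27, 28, 29, 40, 41, 42, 43} {20, 21, 22, 23} m0 m \<and>
        srep A (hrow (guess_policy k G) i A h k) m) (k * (pick_time + 3) + 3)"
proof -
  let ?X = "{21, 22, 24, 27, 28, 29, 40, 41, 42, 43} :: nat set" and ?Y = "{20, 21, 22, 23} :: nat set"
  \<comment> \<open>For a filler row these addresses lie beyond the gain thresholds and hold other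
    data. By \<open>hrow_filler\<close> the picks of such a row do not depend on the value
    read.\<close>
  define V where "V i j A h = narr m0 10 (i * k + j)" for i j and A :: "nat set" and h :: "nat \<Rightarrow> nat \<Rightarrow> nat"
  have "hrow V i A h k = hrow (guess_policy k G) i A h k"
  proof (cases "i < z")
    case True
    show ?thesis
      by (rule hrow_cong) (use envD(8)[OF env True] in \<open>simp add: V_def guess_policy_def\<close>)
  next
    case False
    then show ?thesis by (intro hrow_filler) simp
  qed
  moreover have "ht n gq (\<lambda>m. m = m0) HRow (\<lambda>m. (keep ?X ?Y m0 m \<and> srep A (hrow V i A h k) m) \<and> narr m 24 0 = k)
      (k * (pick_time + 3) + 3)"
    unfolding HRow_def
  proof (rule ht_For[where K = pick_time and I = "\<lambda>j m. keep ?X ?Y m0 m \<and> srep A (hrow V i A h j) m"])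
    show "keep ?X ?Y m0 (nwrite 24 0 0 m) \<and> srep A (hrow V i A h 0) (nwrite 24 0 0 m)" if "m = m0" for m
      using s that by (simp add: srep_def)
    fix j assume j: "j < k"
    show "ht n gq (\<lambda>m. (keep ?X ?Y m0 m \<and> srep A (hrow V i A h j) m) \<and> narr m 24 0 = j) HPick
      (\<lambda>m. (keep ?X ?Y m0 (nwrite 24 0 (Suc j) m) \<and> srep A (hrow V i A h (Suc j)) (nwrite 24 0 (Suc j) m)) \<and> narr m 24 0 = j) pick_time"
    proof (rule ht_pre)
      fix m1 assume m1: "(keep ?X ?Y m0 m1 \<and> srep A (hrow V i A h j) m1) \<and> narr m1 24 0 = j"
      have k1: "keep ?X ?Y m0 m1" and s1: "srep A (hrow V i A h j) m1" and j1: "narr m1 24 0 = j"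
        using m1 by auto
      have e1: "env G m1" by (rule env_keep[OF env k1]) auto
      have i1: "narr m1 23 0 = i" using keepD(1)[OF k1] i by simp
      have v1: "narr m1 10 (i * k + j) = V i j A (hrow V i A h j)" using keepD(1)[OF k1] by (simp add: V_def)
      have n1: "hrow V i A h j i j = n" using hrow_untouched(2)[of j j V i A h] hn by simp
      show "ht n gq (\<lambda>m. m = m1) HPick
        (\<lambda>m. (keep ?X ?Y m0 (nwrite 24 0 (Suc j) m) \<and> srep A (hrow V i A h (Suc j)) (nwrite 24 0 (Suc j) m)) \<and> narr m 24 0 = j) pick_time"
      proof (rule ht_conseq[OF ht_HPick[OF e1 s1 i1 i(2) j1 j v1 n1]])
        fix m assume m: "keep {21, 22, 27, 28, 29, 40, 41, 42, 43} {20, 21, 22, 23} m1 m \<and>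
          srep A ((hrow V i A h j)(i := (hrow V i A h j i)(j := hpick (V i j A (hrow V i A h j)) i j A (hrow V i A h j)))) m"
        have "keep ?X ?Y m0 m" by (rule keep_trans[OF k1 conjunct1[OF m]]) auto
        moreover have "narr m 24 0 = j" using keepD(1)[OF conjunct1[OF m]] j1 by simp
        moreover have "srep A (hrow V i A h (Suc j)) (nwrite 24 0 (Suc j) m)"
          using m by (simp add: Let_def srep_def)
        ultimately show "(keep ?X ?Y m0 (nwrite 24 0 (Suc j) m) \<and> srep A (hrow V i A h (Suc j)) (nwrite 24 0 (Suc j) m)) \<and> narr m 24 0 = j"
          by simp
      qed (auto simp: pick_time_def algebra_simps)
    qed
  next
    show "nval m (NV 4) = k" if "keep ?X ?Y m0 m \<and> srep A (hrow V i A h j) m" for j m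
      using keepD(1)[OF conjunct1[OF that], of 4] envD(4)[OF env] by simp
  qed simp
  ultimately show ?thesis by (auto intro: ht_conseq)
qed

lemma ht_LProc:
  assumes env: "env G m0" and s: "srep A h m0" and q: "narr m0 25 0 = q" "q < Q + 2"
  shows "ht n gq (\<lambda>m. m = m0) LProc
     (\<lambda>m. keep {20, 26, 27, 28, 29, 40, 41, 42, 43} {20, 21, 22, 23, 24, 25, 26} m0 m \<and>
        srep (fst (lproc q h A n)) h m) (n * (pick_time + 3) + 5)"
proof -
  let ?X = "{20, 26, 27, 28, 29, 40, 41, 42, 43} :: nat set" and ?Y = "{20, 21, 22, 23, 24, 25, 26} :: nat set"
  let ?I = "\<lambda>r m. keep ?X ?Y m0 m \<and> srep (fst (lproc q h A r)) h m \<and> rarr m 24 0 = snd (lproc q h A r)"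
  have 1: "ht n gq (\<lambda>m. m = m0) (RAssign 24 (NConst 0) (ROfNat (NConst 0))) (?I 0) 1"
    by (rule ht_simple) (use s in \<open>auto simp: srep_def\<close>)
  have 2: "ht n gq (?I 0) (For 26 (NV 0) LPick) (\<lambda>m. ?I n m \<and> narr m 26 0 = n) (n * (pick_time + 3) + 3)"
  proof (rule ht_For[where K = pick_time and I = ?I])
    show "?I 0 (nwrite 26 0 0 m)" if "?I 0 m" for m
      using that by (simp add: srep_def)
    fix r
    show "ht n gq (\<lambda>m. ?I r m \<and> narr m 26 0 = r) LPick (\<lambda>m. ?I (Suc r) (nwrite 26 0 (Suc r) m) \<and> narr m 26 0 = r) pick_time"
    proof (rule ht_pre)
      fix m1 assume m1: "?I r m1 \<and> narr m1 26 0 = r"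
      obtain B V where BV: "lproc q h A r = (B, V)" by (cases "lproc q h A r")
      obtain B' V' where BV': "lproc q h A (Suc r) = (B', V')" by (cases "lproc q h A (Suc r)")
      have k1: "keep ?X ?Y m0 m1" and s1: "srep B h m1" and V1: "rarr m1 24 0 = V" and r1: "narr m1 26 0 = r"
        using m1 BV by auto
      have e1: "env G m1" by (rule env_keep[OF env k1]) auto
      have q1: "narr m1 25 0 = q" using keepD(1)[OF k1] q by simp
      have new: "(B', V') = (if V * real z < real (c q) * unit_weight \<and> lpick q h B < n
         then (insert (lpick q h B) B, V + w (lpick q h B)) else (B, V))"
        using BV BV' by simp
      show "ht n gq (\<lambda>m. m = m1) LPick (\<lambda>m. ?I (Suc r) (nwrite 26 0 (Suc r) m) \<and> narr m 26 0 = r) pick_time"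
      proof (rule ht_conseq[OF ht_LPick[OF e1 s1 q1 q(2) V1 new]])
        fix m assume m: "keep {20, 27, 28, 29, 40, 41, 42, 43} {20, 21, 22, 23, 24, 25, 26} m1 m \<and>
          srep B' h m \<and> rarr m 24 0 = V'"
        have "keep ?X ?Y m0 m" by (rule keep_trans[OF k1 conjunct1[OF m]]) auto
        moreover have "narr m 26 0 = r" using keepD(1)[OF conjunct1[OF m]] r1 by simp
        moreover have "srep B' h (nwrite 26 0 (Suc r) m)" using m by (simp add: srep_def)
        ultimately show "?I (Suc r) (nwrite 26 0 (Suc r) m) \<and> narr m 26 0 = r"
          using m unfolding BV' by simp
      qed (auto simp: pick_time_def)
    qed
  next
    show "nval m (NV 0) = n" if "?I r m" for r m
      using keepD(1)[OF conjunct1[OF that], of 0] envD(1)[OF env] by simp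
  qed simp
  show ?thesis unfolding LProc_def
    by (rule ht_conseq[OF ht_Seq[OF 1 2]]) auto
qed

lemma ht_LRow:
  assumes env: "env G m0" and s: "srep A h m0"
  shows "ht n gq (\<lambda>m. m = m0) LRow
     (\<lambda>m. keep {20, 25, 26, 27, 28, 29, 40, 41, 42, 43} {20, 21, 22, 23, 24, 25, 26} m0 m \<and>
        srep (lrow h A (Q + 2)) h m) ((Q + 2) * (n * (pick_time + 3) + 8) + 3)"
proof -
  let ?X = "{20, 25, 26, 27, 28, 29, 40, 41, 42, 43} :: nat set" and ?Y = "{20, 21, 22, 23, 24, 25, 26} :: nat set"
  let ?I = "\<lambda>q m. keep ?X ?Y m0 m \<and> srep (lrow h A q) h m"
  have "ht n gq (\<lambda>m. m = m0) LRow (\<lambda>m. ?I (Q + 2) m \<and> narr m 25 0 = Q + 2) ((Q + 2) * (n * (pick_time + 3) + 8) + 3)"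
    unfolding LRow_def
  proof (rule ht_For[where K = "n * (pick_time + 3) + 5" and I = ?I])
    show "?I 0 (nwrite 25 0 0 m)" if "m = m0" for m
      using s that by (simp add: srep_def)
    fix q assume q: "q < Q + 2"
    show "ht n gq (\<lambda>m. ?I q m \<and> narr m 25 0 = q) LProc (\<lambda>m. ?I (Suc q) (nwrite 25 0 (Suc q) m) \<and> narr m 25 0 = q) (n * (pick_time + 3) + 5)"
    proof (rule ht_pre)
      fix m1 assume m1: "?I q m1 \<and> narr m1 25 0 = q"
      have k1: "keep ?X ?Y m0 m1" and s1: "srep (lrow h A q) h m1" and q1: "narr m1 25 0 = q"
        using m1 by auto
      have e1: "env G m1" by (rule env_keep[OF env k1]) auto
      show "ht n gq (\<lambda>m. m = m1) LProc (\<lambda>m. ?I (Suc q) (nwrite 25 0 (Suc q) m) \<and> narr m 25 0 = q) (n * (pick_time + 3) + 5)"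
      proof (rule ht_conseq[OF ht_LProc[OF e1 s1 q1 q]])
        fix m assume m: "keep {20, 26, 27, 28, 29, 40, 41, 42, 43} {20, 21, 22, 23, 24, 25, 26} m1 m \<and>
           srep (fst (lproc q h (lrow h A q) n)) h m"
        have "keep ?X ?Y m0 m" by (rule keep_trans[OF k1 conjunct1[OF m]]) auto
        moreover have "narr m 25 0 = q" using keepD(1)[OF conjunct1[OF m]] q1 by simp
        moreover have "srep (lrow h A (Suc q)) h (nwrite 25 0 (Suc q) m)" using m by (simp add: srep_def)
        ultimately show "?I (Suc q) (nwrite 25 0 (Suc q) m) \<and> narr m 25 0 = q" by simp
      qed auto
    qed
  next
    show "nval m (NAdd (NV 3) (NConst 2)) = Q + 2" if "?I q m" for q m
      using keepD(1)[OF conjunct1[OF that], of 3] envD(3)[OF env] by simp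
  qed simp
  then show ?thesis by (rule ht_conseq) auto
qed

lemma ht_InitState:
  assumes env: "env G m0" and w: "\<And>e. 0 \<le> w e"
  shows "ht n gq (\<lambda>m. m = m0) InitState
     (\<lambda>m. keep {20, 21, 22, 27} {} m0 m \<and> srep {e. e < n \<and> w e = 0} (\<lambda>_ _. n) m)
     (n * 8 + ((z + k) * k + 1) * 4 + 10)"
proof -
  let ?I = "\<lambda>e m. keep {20, 22, 27} {} m0 m \<and> (\<forall>x<e. (narr m 20 x \<noteq> 0 \<longleftrightarrow> w x = 0) \<and> narr m 22 x = 0)"
  have 1: "ht n gq (\<lambda>m. m = m0) (For 27 (NV 0) InitItem) (\<lambda>m. ?I n m \<and> narr m 27 0 = n) (n * 8 + 3)"
  proof (rule ht_For[where K = 5 and I = ?I])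
    show "?I 0 (nwrite 27 0 0 m)" if "m = m0" for m using that by simp
    fix e
    show "ht n gq (\<lambda>m. ?I e m \<and> narr m 27 0 = e) InitItem (\<lambda>m. ?I (Suc e) (nwrite 27 0 (Suc e) m) \<and> narr m 27 0 = e) 5"
    proof (rule ht_simple)
      fix m assume m: "?I e m \<and> narr m 27 0 = e"
      have "rarr m 1 e = w e" using keepD(2)[OF conjunct1[OF conjunct1[OF m]], of 1] envD(11)[OF env] by simp
      then have "sexec n gq InitItem m = nwrite 20 e (if 0 < w e then 0 else 1) (nwrite 22 e 0 m)"
        using m by (simp add: InitItem_def)
      moreover have "(if 0 < w e then 0 else (1::nat)) \<noteq> 0 \<longleftrightarrow> w e = 0" using w[of e] by auto
      ultimately show "?I (Suc e) (nwrite 27 0 (Suc e) (sexec n gq InitItem m)) \<and> narr (sexec n gq InitItem m) 27 0 = e"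
        using m by (auto simp: less_Suc_eq)
    qed (auto simp: InitItem_def)
  next
    show "nval m (NV 0) = n" if "?I e m" for e m
      using keepD(1)[OF conjunct1[OF that], of 0] envD(1)[OF env] by simp
  qed simp
  let ?J = "\<lambda>x m. keep {20, 21, 22, 27} {} m0 m \<and> (\<forall>x<n. (narr m 20 x \<noteq> 0 \<longleftrightarrow> w x = 0) \<and> narr m 22 x = 0) \<and>
     (\<forall>y<x. narr m 21 y = n)"
  have 2: "ht n gq (\<lambda>m. ?I n m \<and> narr m 27 0 = n)
     (For 27 (NAdd (NRead 6 (NAdd (NV 2) (NV 4))) (NConst 1)) (NAssign 21 (NV 27) (NV 0)))
     (\<lambda>m. ?J ((z + k) * k + 1) m \<and> narr m 27 0 = (z + k) * k + 1) (((z + k) * k + 1) * 4 + 3)"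
  proof (rule ht_For[where K = 1 and I = ?J])
    show "?J 0 (nwrite 27 0 0 m)" if m: "?I n m \<and> narr m 27 0 = n" for m
    proof -
      have "keep {20, 21, 22, 27} {} m0 m" by (rule keep_mono[of "{20, 22, 27}" "{}"]) (use m in auto)
      then show ?thesis using m by simp
    qed
    fix x
    show "ht n gq (\<lambda>m. ?J x m \<and> narr m 27 0 = x) (NAssign 21 (NV 27) (NV 0)) (\<lambda>m. ?J (Suc x) (nwrite 27 0 (Suc x) m) \<and> narr m 27 0 = x) 1"
    proof (rule ht_simple)
      fix m assume m: "?J x m \<and> narr m 27 0 = x"
      have "narr m 0 0 = n" using keepD(1)[OF conjunct1[OF conjunct1[OF m]], of 0] envD(1)[OF env] by simp
      then show "?J (Suc x) (nwrite 27 0 (Suc x) (sexec n gq (NAssign 21 (NV 27) (NV 0)) m)) \<and>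
          narr (sexec n gq (NAssign 21 (NV 27) (NV 0)) m) 27 0 = x"
        using m by (auto simp: less_Suc_eq)
    qed auto
  next
    show "nval m (NAdd (NRead 6 (NAdd (NV 2) (NV 4))) (NConst 1)) = (z + k) * k + 1" if "?J x m" for x m
    proof -
      have "env G m" by (rule env_keep[OF env conjunct1[OF that]]) auto
      then show ?thesis using envD(5)[of G m "z + k"] envD(2,4)[of G m] by simp
    qed
  qed simp
  have fin: "srep {e. e < n \<and> w e = 0} (\<lambda>_ _. n) m" if m: "?J ((z + k) * k + 1) m" for m
  proof -
    have "i * k + j < (z + k) * k + 1" if "i < z + k" "j < k" for i j
    proof -
      have "i * k + j < (i + 1) * k" using that by simp
      also have "\<dots> \<le> (z + k) * k" using that by (intro mult_le_mono1) simp
      finally show ?thesis by simp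
    qed
    moreover have "x \<notin> pool (\<lambda>_ _. n)" if "x < n" for x using that by (auto simp: pool_def)
    ultimately show ?thesis using m unfolding srep_def by auto
  qed
  show ?thesis unfolding InitState_def
    by (rule ht_conseq[OF ht_Seq[OF 1 2]]) (use fin in auto)
qed

definition build_time :: nat where
  "build_time = (z + k) * (k * (pick_time + 3) + 10) + z * ((Q + 2) * (n * (pick_time + 3) + 8) + 10)
     + n * 8 + ((z + k) * k + 1) * 4 + 20"

lemma ht_Build:
  assumes env: "env G m0" and w: "\<And>e. 0 \<le> w e"
  shows "ht n gq (\<lambda>m. m = m0) Build
     (\<lambda>m. keep {20, 21, 22, 23, 24, 25, 26, 27, 28, 29, 30, 40, 41, 42, 43} {20, 21, 22, 23, 24, 25, 26} m0 m \<and>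
        srep (fst (rows (guess_policy k G) z)) (fillers (guess_policy k G) k) m) build_time"
proof -
  let ?X = "{20, 21, 22, 23, 24, 25, 26, 27, 28, 29, 30, 40, 41, 42, 43} :: nat set"
  let ?Y = "{20, 21, 22, 23, 24, 25, 26} :: nat set"
  let ?V = "guess_policy k G"
  let ?TH = "k * (pick_time + 3) + 3" and ?TL = "(Q + 2) * (n * (pick_time + 3) + 8) + 3"
  have envI: "env G m" if "keep ?X ?Y m0 m" for m by (rule env_keep[OF env that]) auto
  let ?I = "\<lambda>i m. keep ?X ?Y m0 m \<and> srep (fst (rows ?V i)) (snd (rows ?V i)) m"
  let ?J = "\<lambda>r m. keep ?X ?Y m0 m \<and> srep (fst (rows ?V z)) (fillers ?V r) m"
  have 1: "ht n gq (\<lambda>m. m = m0) InitState (?I 0) (n * 8 + ((z + k) * k + 1) * 4 + 10)"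
  proof (rule ht_conseq[OF ht_InitState[OF env w]])
    fix m assume m: "keep {20, 21, 22, 27} {} m0 m \<and> srep {e. e < n \<and> w e = 0} (\<lambda>_ _. n) m"
    have "keep ?X ?Y m0 m" by (rule keep_mono[OF conjunct1[OF m]]) auto
    then show "?I 0 m" using m by simp
  qed auto
  have 2: "ht n gq (?I 0) (For 23 (NV 2) (Seq HRow LRow)) (\<lambda>m. ?I z m \<and> narr m 23 0 = z) (z * (?TH + ?TL + 4) + 3)"
  proof (rule ht_For[where K = "?TH + ?TL + 1" and I = ?I])
    show "?I 0 (nwrite 23 0 0 m)" if "?I 0 m" for m using that by (simp add: srep_def)
    fix i assume i: "i < z"
    obtain A h where Ah: "rows ?V i = (A, h)" by (cases "rows ?V i")
    define h' where "h' = hrow ?V i A h k"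
    have next_row: "rows ?V (Suc i) = (lrow h' A (Q + 2), h')"
      by (simp only: rows.simps Ah prod.case Let_def h'_def)
    show "ht n gq (\<lambda>m. ?I i m \<and> narr m 23 0 = i) (Seq HRow LRow) (\<lambda>m. ?I (Suc i) (nwrite 23 0 (Suc i) m) \<and> narr m 23 0 = i) (?TH + ?TL + 1)"
    proof (rule ht_pre)
      fix m1 assume m1: "?I i m1 \<and> narr m1 23 0 = i"
      have k1: "keep ?X ?Y m0 m1" and s1: "srep A h m1" and i1: "narr m1 23 0 = i" using m1 Ah by auto
      have hn: "h i j = n" for j using rows_untouched[of i i ?V j] Ah by simp
      have a: "ht n gq (\<lambda>m. m = m1) HRow
         (\<lambda>m. keep {21, 22, 24, 27, 28, 29, 40, 41, 42, 43} {20, 21, 22, 23} m1 m \<and> srep A h' m) ?TH"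
        unfolding h'_def by (rule ht_HRow[OF envI[OF k1] s1 i1 _ hn]) (use i in simp)
      have b: "ht n gq (\<lambda>m. keep {21, 22, 24, 27, 28, 29, 40, 41, 42, 43} {20, 21, 22, 23} m1 m \<and> srep A h' m) LRow
         (\<lambda>m. ?I (Suc i) (nwrite 23 0 (Suc i) m) \<and> narr m 23 0 = i) ?TL"
      proof (rule ht_pre)
        fix m2 assume m2: "keep {21, 22, 24, 27, 28, 29, 40, 41, 42, 43} {20, 21, 22, 23} m1 m2 \<and> srep A h' m2"
        have k2: "keep ?X ?Y m0 m2" by (rule keep_trans[OF k1 conjunct1[OF m2]]) auto
        show "ht n gq (\<lambda>m. m = m2) LRow (\<lambda>m. ?I (Suc i) (nwrite 23 0 (Suc i) m) \<and> narr m 23 0 = i) ?TL"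
        proof (rule ht_conseq[OF ht_LRow[OF envI[OF k2] conjunct2[OF m2]]])
          fix m assume m: "keep {20, 25, 26, 27, 28, 29, 40, 41, 42, 43} {20, 21, 22, 23, 24, 25, 26} m2 m \<and>
             srep (lrow h' A (Q + 2)) h' m"
          have "keep ?X ?Y m0 m" by (rule keep_trans[OF k2 conjunct1[OF m]]) auto
          moreover have "narr m 23 0 = i"
            using keepD(1)[OF conjunct1[OF m], of 23] keepD(1)[OF conjunct1[OF m2], of 23] i1 by simp
          moreover have "srep (fst (rows ?V (Suc i))) (snd (rows ?V (Suc i))) (nwrite 23 0 (Suc i) m)"
            unfolding next_row using m by (simp add: srep_def)
          ultimately show "?I (Suc i) (nwrite 23 0 (Suc i) m) \<and> narr m 23 0 = i" by simp
        qed auto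
      qed
      show "ht n gq (\<lambda>m. m = m1) (Seq HRow LRow) (\<lambda>m. ?I (Suc i) (nwrite 23 0 (Suc i) m) \<and> narr m 23 0 = i) (?TH + ?TL + 1)"
        by (rule ht_conseq[OF ht_Seq[OF a b]]) auto
    qed
  next
    show "nval m (NV 2) = z" if "?I i m" for i m
      using envD(2)[OF envI[OF conjunct1[OF that]]] by simp
  qed simp
  have 3: "ht n gq (\<lambda>m. ?I z m \<and> narr m 23 0 = z)
      (For 30 (NV 4) (Seq (NAssign 23 (NConst 0) (NAdd (NV 2) (NV 30))) HRow)) (\<lambda>m. ?J k m \<and> narr m 30 0 = k) (k * (?TH + 5) + 3)"
  proof (rule ht_For[where K = "?TH + 2" and I = ?J])
    show "?J 0 (nwrite 30 0 0 m)" if "?I z m \<and> narr m 23 0 = z" for m using that by (simp add: srep_def)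
    fix r assume r: "r < k"
    let ?A = "fst (rows ?V z)" and ?h = "fillers ?V r"
    show "ht n gq (\<lambda>m. ?J r m \<and> narr m 30 0 = r) (Seq (NAssign 23 (NConst 0) (NAdd (NV 2) (NV 30))) HRow)
       (\<lambda>m. ?J (Suc r) (nwrite 30 0 (Suc r) m) \<and> narr m 30 0 = r) (?TH + 2)"
    proof -
      have a: "ht n gq (\<lambda>m. ?J r m \<and> narr m 30 0 = r) (NAssign 23 (NConst 0) (NAdd (NV 2) (NV 30)))
         (\<lambda>m. ?J r m \<and> narr m 30 0 = r \<and> narr m 23 0 = z + r) 1"
      proof (rule ht_simple)
        fix m assume m: "?J r m \<and> narr m 30 0 = r"
        have "narr m 2 0 = z" using envD(2)[OF envI] m by blast
        then show "?J r (sexec n gq (NAssign 23 (NConst 0) (NAdd (NV 2) (NV 30))) m) \<and>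
            narr (sexec n gq (NAssign 23 (NConst 0) (NAdd (NV 2) (NV 30))) m) 30 0 = r \<and>
            narr (sexec n gq (NAssign 23 (NConst 0) (NAdd (NV 2) (NV 30))) m) 23 0 = z + r"
          using m by (simp add: srep_def)
      qed auto
      have b: "ht n gq (\<lambda>m. ?J r m \<and> narr m 30 0 = r \<and> narr m 23 0 = z + r) HRow
         (\<lambda>m. ?J (Suc r) (nwrite 30 0 (Suc r) m) \<and> narr m 30 0 = r) ?TH"
      proof (rule ht_pre)
        fix m1 assume m1: "?J r m1 \<and> narr m1 30 0 = r \<and> narr m1 23 0 = z + r"
        have k1: "keep ?X ?Y m0 m1" and s1: "srep ?A ?h m1" and i1: "narr m1 23 0 = z + r" using m1 by auto
        have hn: "?h (z + r) j = n" for j by (rule fillers_untouched) simp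
        have zr: "z + r < z + k" using r by simp
        show "ht n gq (\<lambda>m. m = m1) HRow (\<lambda>m. ?J (Suc r) (nwrite 30 0 (Suc r) m) \<and> narr m 30 0 = r) ?TH"
        proof (rule ht_conseq[OF ht_HRow[where h = "?h", OF envI[OF k1] s1 i1 zr hn]])
          fix m assume m: "keep {21, 22, 24, 27, 28, 29, 40, 41, 42, 43} {20, 21, 22, 23} m1 m \<and>
            srep ?A (hrow ?V (z + r) ?A ?h k) m"
          have "keep ?X ?Y m0 m" by (rule keep_trans[OF k1 conjunct1[OF m]]) auto
          moreover have "narr m 30 0 = r" using keepD(1)[OF conjunct1[OF m], of 30] m1 by simp
          ultimately show "?J (Suc r) (nwrite 30 0 (Suc r) m) \<and> narr m 30 0 = r"
            using m by (simp add: srep_def)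
        qed auto
      qed
      show ?thesis by (rule ht_conseq[OF ht_Seq[OF a b]]) auto
    qed
  next
    show "nval m (NV 4) = k" if "?J r m" for r m
      using envD(4)[OF envI[OF conjunct1[OF that]]] by simp
  qed simp
  show ?thesis unfolding Build_def
    by (rule ht_conseq[OF ht_Seq[OF 1 ht_Seq[OF 2 3]]]) (auto simp: build_time_def algebra_simps)
qed

end

section \<open>Searching the roundings of one table\<close>

definition eTuple :: nexp where
  "eTuple = NRead 21 (NRead 50 (NV 53))"

definition SumUp :: com where
  "SumUp = Cond (NLess (NConst 0) (NRead 20 (NV 54)))
     (Seq (RAssign 50 (NConst 0) (RAdd (RV 50) (RRead 1 (NV 54))))
       (RAssign 51 (NConst 0) (RAdd (RV 51) (RRead 2 (NV 54))))) Skip"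

definition bBetter :: bexp where
  "bBetter = Conj (Neg (RLess (ROfNat (NConst 1)) (RV 50))) (RLess (RV 3) (RAdd (RV 52) (RV 51)))"

definition Record :: com where
  "Record = Seq (RAssign 3 (NConst 0) (RAdd (RV 52) (RV 51)))
     (For 54 (NV 0) (NAssign 1 (NV 54) (NRead 20 (NV 54))))"

definition Measure :: com where
  "Measure = Seq (Seq (RAssign 50 (NConst 0) (ROfNat (NConst 0))) (RAssign 51 (NConst 0) (ROfNat (NConst 0))))
     (Seq (For 54 (NV 0) SumUp) (Query 52 (NConst 0) 20))"

definition Check :: com where
  "Check = Seq Measure (Cond bBetter Record Skip)"

text \<open>All \<open>k\<close>-tuples of addresses are tried. The base counts one address beyond
  the table, the one that holds \<open>n\<close>, so smaller sets occur as padded tuples; repeated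
  items do no harm since array 20 counts multiplicities.\<close>

definition Final :: com where
  "Final = Enum 50 51 52 (NV 4) (NAdd (NRead 6 (NAdd (NV 2) (NV 4))) (NConst 1))
     (Seq (Bump 53 (NV 4) eTuple) (Seq Check (Unbump 53 (NV 4) eTuple)))"

context prog_data
begin

definition obj :: "nat set \<Rightarrow> real" where "obj S = gq S + sum l S"

text \<open>An invariant over all guesses, right or wrong: only feasible sets are recorded, so wrong
  guesses cost time but never correctness.\<close>

definition outok :: "memory \<Rightarrow> bool" where
  "outok m \<longleftrightarrow> sum w (stored_set n 1 m) \<le> 1 \<and> rarr m 3 0 = obj (stored_set n 1 m)"

lemma stored_set_cong: "narr m b = narr m' b \<Longrightarrow> stored_set n b m = stored_set n b m'"
  by (simp add: stored_set_def)

lemma outok_keep: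
  assumes "outok m0" "keep X Y m0 m" "1 \<notin> X" "3 \<notin> Y"
  shows "outok m"
proof -
  have "narr m 1 = narr m0 1" "rarr m 3 = rarr m0 3" using keepD[OF assms(2)] assms(3,4) by auto
  then show ?thesis using assms(1) stored_set_cong[of m 1 m0] by (simp add: outok_def)
qed

lemma stored_Suc: "{x. x < Suc e \<and> P x} = (if P e then insert e {x. x < e \<and> P x} else {x. x < (e::nat) \<and> P x})"
  by (auto simp: less_Suc_eq)

lemma ht_Measure:
  assumes env: "env G m0"
  shows "ht n gq (\<lambda>m. m = m0) Measure
     (\<lambda>m. keep {54} {50, 51, 52} m0 m \<and> rarr m 50 0 = sum w (stored_set n 20 m0) \<and>
        rarr m 51 0 = sum l (stored_set n 20 m0) \<and> rarr m 52 0 = gq (stored_set n 20 m0)) (n * 8 + 10)"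
proof -
  let ?S = "\<lambda>e. {x. x < e \<and> narr m0 20 x \<noteq> 0}"
  let ?I = "\<lambda>e m. keep {54} {50, 51} m0 m \<and> rarr m 50 0 = sum w (?S e) \<and> rarr m 51 0 = sum l (?S e)"
  have 1: "ht n gq (\<lambda>m. m = m0) (Seq (RAssign 50 (NConst 0) (ROfNat (NConst 0))) (RAssign 51 (NConst 0) (ROfNat (NConst 0))))
      (?I 0) 3"
    by (rule ht_simple) auto
  have 2: "ht n gq (?I 0) (For 54 (NV 0) SumUp) (\<lambda>m. ?I n m \<and> narr m 54 0 = n) (n * 8 + 3)"
  proof (rule ht_For[where K = 5 and I = ?I])
    show "?I 0 (nwrite 54 0 0 m)" if "?I 0 m" for m using that by simp
    fix e
    show "ht n gq (\<lambda>m. ?I e m \<and> narr m 54 0 = e) SumUp (\<lambda>m. ?I (Suc e) (nwrite 54 0 (Suc e) m) \<and> narr m 54 0 = e) 5"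
    proof (rule ht_simple)
      fix m assume m: "?I e m \<and> narr m 54 0 = e"
      have k: "narr m 20 = narr m0 20" "rarr m 1 = w" "rarr m 2 = l"
        using keepD[OF conjunct1[OF conjunct1[OF m]]] envD(11,12)[OF env] by simp_all
      have fin: "finite (?S e)" "e \<notin> ?S e" by auto
      have exec: "sexec n gq SumUp m = (if narr m0 20 e \<noteq> 0
          then rwrite 51 0 (rarr m 51 0 + l e) (rwrite 50 0 (rarr m 50 0 + w e) m) else m)"
        using m k by (simp add: SumUp_def)
      show "?I (Suc e) (nwrite 54 0 (Suc e) (sexec n gq SumUp m)) \<and> narr (sexec n gq SumUp m) 54 0 = e"
        using m fin unfolding exec stored_Suc by (simp add: add.commute)
    qed (auto simp: SumUp_def)
  next
    show "nval m (NV 0) = n" if "?I e m" for e m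
      using keepD(1)[OF conjunct1[OF that], of 0] envD(1)[OF env] by simp
  qed simp
  have 3: "ht n gq (\<lambda>m. ?I n m \<and> narr m 54 0 = n) (Query 52 (NConst 0) 20)
     (\<lambda>m. keep {54} {50, 51, 52} m0 m \<and> rarr m 50 0 = sum w (stored_set n 20 m0) \<and>
        rarr m 51 0 = sum l (stored_set n 20 m0) \<and> rarr m 52 0 = gq (stored_set n 20 m0)) 1"
  proof (rule ht_simple)
    fix m assume m: "?I n m \<and> narr m 54 0 = n"
    have "keep {54} {50, 51, 52} m0 m" by (rule keep_mono[OF conjunct1[OF conjunct1[OF m]]]) auto
    moreover have "stored_set n 20 m = stored_set n 20 m0"
      using keepD(1)[OF conjunct1[OF conjunct1[OF m]], of 20] by (intro stored_set_cong) simp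
    ultimately show "keep {54} {50, 51, 52} m0 (sexec n gq (Query 52 (NConst 0) 20) m) \<and>
        rarr (sexec n gq (Query 52 (NConst 0) 20) m) 50 0 = sum w (stored_set n 20 m0) \<and>
        rarr (sexec n gq (Query 52 (NConst 0) 20) m) 51 0 = sum l (stored_set n 20 m0) \<and>
        rarr (sexec n gq (Query 52 (NConst 0) 20) m) 52 0 = gq (stored_set n 20 m0)"
      using m by (simp add: stored_set_def)
  qed auto
  show ?thesis unfolding Measure_def
    by (rule ht_conseq[OF ht_Seq[OF 1 ht_Seq[OF 2 3]]]) auto
qed

lemma ht_Record:
  assumes env: "env G m0" and v: "rarr m0 52 0 + rarr m0 51 0 = v"
  shows "ht n gq (\<lambda>m. m = m0) Record
     (\<lambda>m. keep {1, 54} {3} m0 m \<and> rarr m 3 0 = v \<and> stored_set n 1 m = stored_set n 20 m0) (n * 4 + 5)"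
proof -
  let ?I = "\<lambda>e m. keep {1, 54} {3} m0 m \<and> rarr m 3 0 = v \<and> (\<forall>x<e. narr m 1 x = narr m0 20 x)"
  have 1: "ht n gq (\<lambda>m. m = m0) (RAssign 3 (NConst 0) (RAdd (RV 52) (RV 51))) (?I 0) 1"
    by (rule ht_simple) (use v in auto)
  have 2: "ht n gq (?I 0) (For 54 (NV 0) (NAssign 1 (NV 54) (NRead 20 (NV 54)))) (\<lambda>m. ?I n m \<and> narr m 54 0 = n) (n * 4 + 3)"
  proof (rule ht_For[where K = 1 and I = ?I])
    show "?I 0 (nwrite 54 0 0 m)" if "?I 0 m" for m using that by simp
    fix e
    show "ht n gq (\<lambda>m. ?I e m \<and> narr m 54 0 = e) (NAssign 1 (NV 54) (NRead 20 (NV 54)))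
       (\<lambda>m. ?I (Suc e) (nwrite 54 0 (Suc e) m) \<and> narr m 54 0 = e) 1"
    proof (rule ht_simple)
      fix m assume m: "?I e m \<and> narr m 54 0 = e"
      have "narr m 20 = narr m0 20" using keepD(1)[OF conjunct1[OF conjunct1[OF m]], of 20] by simp
      then show "?I (Suc e) (nwrite 54 0 (Suc e) (sexec n gq (NAssign 1 (NV 54) (NRead 20 (NV 54))) m)) \<and>
         narr (sexec n gq (NAssign 1 (NV 54) (NRead 20 (NV 54))) m) 54 0 = e"
        using m by (auto simp: less_Suc_eq)
    qed auto
  next
    show "nval m (NV 0) = n" if "?I e m" for e m
      using keepD(1)[OF conjunct1[OF that], of 0] envD(1)[OF env] by simp
  qed simp
  show ?thesis unfolding Record_def
    by (rule ht_conseq[OF ht_Seq[OF 1 2]]) (auto simp: stored_set_def)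
qed

lemma ht_Check:
  assumes env: "env G m0" and ok: "outok m0"
  defines "S \<equiv> stored_set n 20 m0"
  shows "ht n gq (\<lambda>m. m = m0) Check
     (\<lambda>m. keep {1, 54} {3, 50, 51, 52} m0 m \<and> outok m \<and> rarr m0 3 0 \<le> rarr m 3 0 \<and>
        (sum w S \<le> 1 \<longrightarrow> obj S \<le> rarr m 3 0)) (n * 12 + 20)"
proof -
  let ?P = "\<lambda>m. keep {54} {50, 51, 52} m0 m \<and> rarr m 50 0 = sum w S \<and>
        rarr m 51 0 = sum l S \<and> rarr m 52 0 = gq S"
  let ?Q = "\<lambda>m. keep {1, 54} {3, 50, 51, 52} m0 m \<and> outok m \<and> rarr m0 3 0 \<le> rarr m 3 0 \<and>
        (sum w S \<le> 1 \<longrightarrow> obj S \<le> rarr m 3 0)"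
  have 1: "ht n gq (\<lambda>m. m = m0) Measure ?P (n * 8 + 10)"
    using ht_Measure[OF env] by (simp add: S_def)
  have better: "bval m bBetter \<longleftrightarrow> sum w S \<le> 1 \<and> rarr m0 3 0 < obj S" if "?P m" for m
    using that keepD(2)[OF conjunct1[OF that], of 3] by (simp add: bBetter_def obj_def not_less)
  have 2: "ht n gq ?P (Cond bBetter Record Skip) ?Q (n * 4 + 6)"
  proof (rule ht_conseq[OF ht_Cond[where P = ?P and Q = ?Q and K = "n * 4 + 5"]])
    show "ht n gq (\<lambda>m. ?P m \<and> bval m bBetter) Record ?Q (n * 4 + 5)"
    proof (rule ht_pre)
      fix m1 assume m1: "?P m1 \<and> bval m1 bBetter"
      have b: "sum w S \<le> 1" "rarr m0 3 0 < obj S" using better m1 by blast+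
      have k1: "keep {54} {50, 51, 52} m0 m1" using m1 by blast
      have e1: "env G m1" by (rule env_keep[OF env k1]) auto
      have v: "rarr m1 52 0 + rarr m1 51 0 = obj S" using m1 by (simp add: obj_def)
      have S1: "stored_set n 20 m1 = S"
        unfolding S_def using keepD(1)[OF k1, of 20] by (intro stored_set_cong) simp
      show "ht n gq (\<lambda>m. m = m1) Record ?Q (n * 4 + 5)"
      proof (rule ht_conseq[OF ht_Record[OF e1 v]])
        fix m assume m: "keep {1, 54} {3} m1 m \<and> rarr m 3 0 = obj S \<and> stored_set n 1 m = stored_set n 20 m1"
        have "keep {1, 54} {3, 50, 51, 52} m0 m" by (rule keep_trans[OF k1 conjunct1[OF m]]) auto
        then show "?Q m" using m b S1 by (simp add: outok_def)
      qed auto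
    qed
    show "ht n gq (\<lambda>m. ?P m \<and> \<not> bval m bBetter) Skip ?Q (n * 4 + 5)"
    proof (rule ht_simple)
      fix m assume m: "?P m \<and> \<not> bval m bBetter"
      have k1: "keep {54} {50, 51, 52} m0 m" using m by blast
      have "outok m" by (rule outok_keep[OF ok k1]) auto
      moreover have "rarr m 3 = rarr m0 3" using keepD(2)[OF k1, of 3] by simp
      moreover have "\<not> (sum w S \<le> 1 \<and> rarr m0 3 0 < obj S)" using better m by blast
      moreover have "keep {1, 54} {3, 50, 51, 52} m0 m" by (rule keep_mono[OF k1]) auto
      ultimately show "?Q (sexec n gq Skip m)" by auto
    qed auto
  qed auto
  show ?thesis unfolding Check_def
    by (rule ht_conseq[OF ht_Seq[OF 1 2]]) auto
qed

definition final_time :: nat where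
  "final_time = ((z + k) * k + 1) ^ k * (n * 12 + 12 * k + 50) + 4 * k + 8"

lemma ht_Final:
  assumes env: "env G m0" and s: "srep A h m0" and ok: "outok m0"
  shows "ht n gq (\<lambda>m. m = m0) Final
     (\<lambda>m. keep {1, 20, 50, 51, 52, 53, 54} {3, 50, 51, 52} m0 m \<and> outok m \<and> rarr m0 3 0 \<le> rarr m 3 0 \<and>
        (\<forall>R\<subseteq>pool h. card R \<le> k \<longrightarrow> sum w ({..<n} \<inter> (A \<union> R)) \<le> 1 \<longrightarrow> obj ({..<n} \<inter> (A \<union> R)) \<le> rarr m 3 0)) final_time"
proof -
  let ?X = "{1, 20, 50, 51, 52, 53, 54} :: nat set" and ?Y = "{3, 50, 51, 52} :: nat set"
  define B where "B = (z + k) * k + 1"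
  define C0 where "C0 = narr m0 20"
  define S where "S d = {x. x < n \<and> (C0 x \<noteq> 0 \<or> x \<in> (\<lambda>y. narr m0 21 (d y)) ` {..<k})}" for d :: "nat \<Rightarrow> nat"
  define I where "I j m \<longleftrightarrow> keep ?X ?Y m0 m \<and> narr m 20 = C0 \<and> outok m \<and> rarr m0 3 0 \<le> rarr m 3 0 \<and>
      (\<forall>i<j. sum w (S (dig B i)) \<le> 1 \<longrightarrow> obj (S (dig B i)) \<le> rarr m 3 0)" for j m
  have envI: "env G m" if "keep ?X ?Y m0 m" for m by (rule env_keep[OF env that]) auto
  have "ht n gq (I 0) Final (I (B ^ k)) final_time"
    unfolding Final_def
  proof (rule ht_Enum[where L = k and B = B and K = "n * 12 + 8 * k + 30"])
    show "I j m'" if "I j m" "keep {50, 51, 52} {} m m'" for j m m'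
    proof -
      have "keep ?X ?Y m0 m'" by (rule keep_trans[of ?X ?Y m0 m, OF _ that(2)]) (use that(1) in \<open>auto simp: I_def\<close>)
      moreover have "outok m'" by (rule outok_keep[OF _ that(2)]) (use that(1) in \<open>auto simp: I_def\<close>)
      ultimately show ?thesis using that(1) keepD[OF that(2)] by (simp add: I_def)
    qed
    show "nval m (NV 4) = k \<and> nval m (NAdd (NRead 6 (NAdd (NV 2) (NV 4))) (NConst 1)) = B" if "I j m" for j m
    proof -
      have "env G m" using that by (intro envI) (simp add: I_def)
      then show ?thesis using envD(5)[of G m "z + k"] envD(2,4)[of G m] by (simp add: B_def)
    qed
    fix j assume j: "j < B ^ k"
    let ?post = "\<lambda>m. I (Suc j) m \<and> (\<forall>y<k. narr m 50 y = dig B j y) \<and> narr m 52 0 = 0"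
    show "ht n gq (\<lambda>m. I j m \<and> (\<forall>y<k. narr m 50 y = dig B j y) \<and> narr m 52 0 = 0)
      (Seq (Bump 53 (NV 4) eTuple) (Seq Check (Unbump 53 (NV 4) eTuple))) ?post (n * 12 + 8 * k + 30)"
    proof (rule ht_pre)
      fix m1 assume m1: "I j m1 \<and> (\<forall>y<k. narr m1 50 y = dig B j y) \<and> narr m1 52 0 = 0"
      have k1: "keep ?X ?Y m0 m1" and c1: "narr m1 20 = C0" and ok1: "outok m1" and v1: "rarr m0 3 0 \<le> rarr m1 3 0"
        and all1: "\<forall>i<j. sum w (S (dig B i)) \<le> 1 \<longrightarrow> obj (S (dig B i)) \<le> rarr m1 3 0"
        and t1: "\<forall>y<k. narr m1 50 y = dig B j y" and f1: "narr m1 52 0 = 0"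
        using m1 by (auto simp: I_def)
      define hh where "hh y = narr m0 21 (dig B j y)" for y
      let ?B = "\<lambda>x. C0 x + card {i. i < k \<and> hh i = x}"
      have idx: "nval m eTuple = hh y" if "keep X' Y' m1 m" "X' \<inter> {21, 50} = {}" "narr m 53 0 = y" "y < k" for X' Y' m y
      proof -
        have "narr m 50 = narr m1 50" "narr m 21 = narr m1 21" using keepD(1)[OF that(1)] that(2) by auto
        then show ?thesis using that(3,4) t1 keepD(1)[OF k1, of 21] by (simp add: eTuple_def hh_def)
      qed
      have a: "ht n gq (\<lambda>m. m = m1) (Bump 53 (NV 4) eTuple)
          (\<lambda>m. keep {20, 53} {} m1 m \<and> narr m 20 = (\<lambda>x. narr m1 20 x + card {i. i < k \<and> hh i = x})) (4 * k + 3)"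
      proof (rule ht_Bump)
        show "nval m eTuple = hh y" if "keep {20, 53} {} m1 m" "narr m 53 0 = y" "y < k" for m y
          by (rule idx[OF that(1) _ that(2,3)]) auto
        show "nval m (NV 4) = k" if "keep {20, 53} {} m1 m" for m
          using keepD(1)[OF that, of 4] envD(4)[OF envI[OF k1]] by simp
      qed auto
      let ?mid = "\<lambda>m. keep {1, 20, 53, 54} ?Y m1 m \<and> narr m 20 = ?B \<and> outok m \<and> rarr m1 3 0 \<le> rarr m 3 0 \<and>
         (sum w (S (dig B j)) \<le> 1 \<longrightarrow> obj (S (dig B j)) \<le> rarr m 3 0)"
      have b: "ht n gq (\<lambda>m. keep {20, 53} {} m1 m \<and> narr m 20 = (\<lambda>x. narr m1 20 x + card {i. i < k \<and> hh i = x})) Check ?mid (n * 12 + 20)"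
      proof (rule ht_pre)
        fix m2 assume m2: "keep {20, 53} {} m1 m2 \<and> narr m2 20 = (\<lambda>x. narr m1 20 x + card {i. i < k \<and> hh i = x})"
        have k2: "keep ?X ?Y m0 m2" by (rule keep_trans[OF k1 conjunct1[OF m2]]) auto
        have ok2: "outok m2" by (rule outok_keep[OF ok1 conjunct1[OF m2]]) auto
        have "card {i. i < k \<and> hh i = x} \<noteq> 0 \<longleftrightarrow> x \<in> (\<lambda>y. narr m0 21 (dig B j y)) ` {..<k}" for x
          by (auto simp: card_eq_0_iff hh_def)
        moreover have c2: "narr m2 20 = ?B" using m2 c1 by simp
        ultimately have S2: "stored_set n 20 m2 = S (dig B j)"
          unfolding stored_set_def S_def c2 by auto
        show "ht n gq (\<lambda>m. m = m2) Check ?mid (n * 12 + 20)"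
        proof (rule ht_conseq[OF ht_Check[OF envI[OF k2] ok2]])
          fix m assume m: "keep {1, 54} {3, 50, 51, 52} m2 m \<and> outok m \<and> rarr m2 3 0 \<le> rarr m 3 0 \<and>
            (sum w (stored_set n 20 m2) \<le> 1 \<longrightarrow> obj (stored_set n 20 m2) \<le> rarr m 3 0)"
          have "keep {1, 20, 53, 54} ?Y m1 m" by (rule keep_trans[OF conjunct1[OF m2] conjunct1[OF m]]) auto
          moreover have "narr m 20 = ?B" using keepD(1)[OF conjunct1[OF m], of 20] c2 by simp
          moreover have "rarr m2 3 = rarr m1 3" using keepD(2)[OF conjunct1[OF m2], of 3] by simp
          ultimately show "?mid m" using m unfolding S2 by simp
        qed auto
      qed
      have c: "ht n gq ?mid (Unbump 53 (NV 4) eTuple) ?post (4 * k + 3)"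
      proof (rule ht_pre)
        fix m3 assume m3: "?mid m3"
        have k3: "keep {1, 20, 53, 54} ?Y m1 m3" and ok3: "outok m3" using m3 by auto
        have "ht n gq (\<lambda>m. m = m3) (Unbump 53 (NV 4) eTuple) (\<lambda>m. keep {20, 53} {} m3 m \<and> narr m 20 = C0) (4 * k + 3)"
        proof (rule ht_Unbump)
          have k13: "keep {1, 20, 53, 54} ?Y m1 m" if "keep {20, 53} {} m3 m" for m
            by (rule keep_trans[OF k3 that]) auto
          show "nval m eTuple = hh y" if "keep {20, 53} {} m3 m" "narr m 53 0 = y" "y < k" for m y
            by (rule idx[OF k13[OF that(1)] _ that(2,3)]) auto
          show "nval m (NV 4) = k" if "keep {20, 53} {} m3 m" for m
            using keepD(1)[OF k13[OF that], of 4] envD(4)[OF envI[OF k1]] by simp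
          show "narr m3 20 = ?B" using m3 by simp
        qed simp
        then show "ht n gq (\<lambda>m. m = m3) (Unbump 53 (NV 4) eTuple) ?post (4 * k + 3)"
        proof (rule ht_conseq)
          fix m assume m: "keep {20, 53} {} m3 m \<and> narr m 20 = C0"
          note k4 = conjunct1[OF m]
          have k14: "keep {1, 20, 53, 54} ?Y m1 m" by (rule keep_trans[OF k3 k4]) auto
          have "keep ?X ?Y m0 m" by (rule keep_trans[OF k1 k14]) auto
          moreover have "outok m" by (rule outok_keep[OF ok3 k4]) auto
          moreover have r3: "rarr m 3 = rarr m3 3" using keepD(2)[OF k4, of 3] by simp
          moreover have "rarr m1 3 0 \<le> rarr m3 3 0" using m3 by simp
          moreover have "\<forall>i<Suc j. sum w (S (dig B i)) \<le> 1 \<longrightarrow> obj (S (dig B i)) \<le> rarr m3 3 0"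
            using all1 m3 by (auto simp: less_Suc_eq intro: order_trans)
          ultimately have "I (Suc j) m" using m v1 by (simp add: I_def)
          moreover have "narr m 50 = narr m1 50" "narr m 52 = narr m1 52"
            using keepD(1)[OF k14] by simp_all
          ultimately show "?post m" using t1 f1 by simp
        qed auto
      qed
      show "ht n gq (\<lambda>m. m = m1) (Seq (Bump 53 (NV 4) eTuple) (Seq Check (Unbump 53 (NV 4) eTuple))) ?post (n * 12 + 8 * k + 30)"
        by (rule ht_conseq[OF ht_Seq[OF a ht_Seq[OF b c]]]) auto
    qed
  qed (auto simp: B_def final_time_def algebra_simps)
  then show ?thesis
  proof (rule ht_conseq)
    show "I 0 m" if "m = m0" for m using that ok by (simp add: I_def C0_def)
    fix m assume m: "I (B ^ k) m"
    have all: "obj ({..<n} \<inter> (A \<union> R)) \<le> rarr m 3 0"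
      if R: "R \<subseteq> pool h" "card R \<le> k" "sum w ({..<n} \<inter> (A \<union> R)) \<le> 1" for R
    proof -
      have "pool h = (\<lambda>(i, j). h i j) ` ({..<z + k} \<times> {..<k})" by (auto simp: pool_def)
      then have "finite (pool h)" by simp
      with R(1) have finR: "finite R" by (rule finite_subset)
      obtain f where f: "bij_betw f {0..<card R} R" using ex_bij_betw_nat_finite[OF finR] by blast
      have "\<exists>x<B. narr m0 21 x = f y" if "y < card R" for y
      proof -
        have "f y \<in> pool h" using f that R(1) by (auto simp: bij_betw_def)
        then obtain i j where ij: "f y = h i j" "i < z + k" "j < k" by (auto simp: pool_def)
        have "i * k + j < (i + 1) * k" using ij by simp
        also have "\<dots> \<le> (z + k) * k" using ij by (intro mult_le_mono1) simp
        finally show ?thesis using s ij by (intro exI[of _ "i * k + j"]) (simp add: srep_def B_def)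
      qed
      then obtain x where x: "\<And>y. y < card R \<Longrightarrow> x y < B \<and> narr m0 21 (x y) = f y" by metis
      \<comment> \<open>The positions from \<open>card R\<close> on point to the padding
        cell.\<close>
      define d where "d y = (if y < card R then x y else (z + k) * k)" for y
      have "d y < B" for y using x by (simp add: d_def B_def)
      then obtain i where i: "i < B ^ k" "\<forall>y<k. dig B i y = d y"
        using dig_surj[of B k d] by (auto simp: B_def)
      have img: "{..<n} \<inter> (\<lambda>y. narr m0 21 (dig B i y)) ` {..<k} = {..<n} \<inter> R"
      proof -
        have "(\<lambda>y. narr m0 21 (dig B i y)) ` {..<k} = (\<lambda>y. if y < card R then f y else n) ` {..<k}"
          using i(2) x s by (intro image_cong) (auto simp: d_def srep_def)
        moreover have Rimg: "f ` {0..<card R} = R" using f by (simp add: bij_betw_def)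
        then have img2: "{..<n} \<inter> (\<lambda>y. if y < card R then f y else n) ` {..<k} = {..<n} \<inter> R"
        proof (intro equalityI subsetI)
          fix x assume "x \<in> {..<n} \<inter> R"
          then have "x \<in> f ` {0..<card R}" "x < n" unfolding Rimg by simp_all
          then obtain y where y: "y < card R" "x = f y" "x < n" by auto
          then show "x \<in> {..<n} \<inter> (\<lambda>y. if y < card R then f y else n) ` {..<k}"
            using R(2) by (auto intro!: image_eqI[of _ _ y])
        next
          fix x assume "x \<in> {..<n} \<inter> (\<lambda>y. if y < card R then f y else n) ` {..<k}"
          then obtain y where y: "x < n" "x = (if y < card R then f y else n)" by blast
          then have "y < card R" "x = f y" by (auto split: if_splits)
          then have "x \<in> f ` {0..<card R}" by auto
          then show "x \<in> {..<n} \<inter> R" using y(1) unfolding Rimg by simp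
        qed
        ultimately show ?thesis by simp
      qed
      have "S (dig B i) = {..<n} \<inter> {x. C0 x \<noteq> 0} \<union> {..<n} \<inter> (\<lambda>y. narr m0 21 (dig B i y)) ` {..<k}"
        by (auto simp: S_def)
      also have "{..<n} \<inter> {x. C0 x \<noteq> 0} = {..<n} \<inter> A" using s by (auto simp: srep_def C0_def)
      finally have "S (dig B i) = {..<n} \<inter> (A \<union> R)" unfolding img by blast
      then show ?thesis using m i(1) R(3) by (auto simp: I_def)
    qed
    show "keep ?X ?Y m0 m \<and> outok m \<and> rarr m0 3 0 \<le> rarr m 3 0 \<and>
        (\<forall>R\<subseteq>pool h. card R \<le> k \<longrightarrow> sum w ({..<n} \<inter> (A \<union> R)) \<le> 1 \<longrightarrow> obj ({..<n} \<inter> (A \<union> R)) \<le> rarr m 3 0)"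
      using m all by (simp add: I_def)
  qed simp
qed

end

text \<open>What the search achieves for one guess, phrased through the recorded value only. Being
  monotone in \<open>v\<close>, it survives all later guesses, which can only raise the
  record.\<close>

definition found :: "(nat set \<Rightarrow> real) \<Rightarrow> nat \<Rightarrow> (nat \<Rightarrow> real) \<Rightarrow> (nat \<Rightarrow> real) \<Rightarrow> nat \<Rightarrow> nat \<Rightarrow> nat \<Rightarrow>
    real \<Rightarrow> nat \<Rightarrow> nat \<Rightarrow> (nat \<Rightarrow> nat) \<Rightarrow> real \<Rightarrow> bool" where
  "found gq n l w z k Q T t bb G v \<longleftrightarrow>
    (let Bt = real bb * w t; lam = (\<lambda>j. G (z * k + j)); c = (\<lambda>q. G ((z + 1) * k + q));
         A = fst (knapsack_data.rows (\<lambda>S. gq ({..<n} \<inter> S)) n l w z k Q t T Bt lam c (guess_policy k G) z);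
         h = knapsack_data.fillers (\<lambda>S. gq ({..<n} \<inter> S)) n l w z k Q t T Bt lam c (guess_policy k G) k
     in \<forall>R\<subseteq>knapsack_data.pool z k h. card R \<le> k \<longrightarrow> sum w ({..<n} \<inter> (A \<union> R)) \<le> 1 \<longrightarrow>
       prog_data.obj gq l ({..<n} \<inter> (A \<union> R)) \<le> v)"

lemma found_mono: "found gq n l w z k Q T t bb G v \<Longrightarrow> v \<le> v' \<Longrightarrow> found gq n l w z k Q T t bb G v'"
  unfolding found_def Let_def by (meson order_trans)

section \<open>Loops over the guesses\<close>

definition Guesses :: com where
  "Guesses = Enum 10 13 14 (NV 5) (NV 5) (Seq Build Final)"

definition GuessScale :: com where
  "GuessScale = For 8 (NAdd (NV 0) (NConst 1)) (For 9 (NAdd (NV 0) (NConst 1)) Guesses)"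

text \<open>By \<open>len\<close> the gain thresholds, linear thresholds and class budgets fit into
  the \<open>z^8\<close> cells that are enumerated.\<close>

locale outer =
  fixes gq :: "nat set \<Rightarrow> real" and n :: nat and l w :: "nat \<Rightarrow> real" and z k Q :: nat
  assumes z_pos: "0 < z" and k_pos: "0 < k" and w_nonneg: "\<And>e. 0 \<le> w e"
    and len: "(z + 1) * k + (Q + 2) \<le> z ^ 8"
begin

abbreviation "fnd \<equiv> found gq n l w z k Q"
abbreviation "ok \<equiv> prog_data.outok gq n l w"

definition benv :: "real \<Rightarrow> memory \<Rightarrow> bool" where
  "benv T m \<longleftrightarrow> narr m 0 0 = n \<and> narr m 2 0 = z \<and> narr m 3 0 = Q \<and> narr m 4 0 = k \<and> narr m 5 0 = z ^ 8 \<and>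
     (\<forall>i\<le>z + k. narr m 6 i = i * k) \<and> rarr m 1 = w \<and> rarr m 2 = l \<and> rarr m 4 0 = T"

lemma benv_keep:
  assumes "benv T m0" "keep X Y m0 m" "X \<inter> {0, 2, 3, 4, 5, 6} = {}" "Y \<inter> {1, 2, 4} = {}"
  shows "benv T m"
proof -
  have "narr m a = narr m0 a" if "a \<in> {0, 2, 3, 4, 5, 6}" for a
    using that assms(2,3) by (intro keepD(1)) auto
  moreover have "rarr m a = rarr m0 a" if "a \<in> {1, 2, 4}" for a
    using that assms(2,4) by (intro keepD(2)) auto
  ultimately show ?thesis using assms(1) unfolding benv_def by simp
qed

definition guess_of :: "nat \<Rightarrow> nat \<Rightarrow> nat" where
  "guess_of i x = (if x < z ^ 8 then dig (z ^ 8) i x else 0)"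

definition try_time :: nat where
  "try_time = prog_data.build_time n z k Q + prog_data.final_time n z k + 1"

abbreviation (input) "WX \<equiv> {1, 20, 21, 22, 23, 24, 25, 26, 27, 28, 29, 30, 40, 41, 42, 43, 50, 51, 52, 53, 54} :: nat set"
abbreviation (input) "WY \<equiv> {3, 20, 21, 22, 23, 24, 25, 26, 50, 51, 52} :: nat set"

lemma ht_try:
  assumes b: "benv T m0" and t: "narr m0 8 0 = t" and bb: "narr m0 9 0 = bb"
    and G: "\<And>x. x < z ^ 8 \<Longrightarrow> narr m0 10 x = G x" and o: "ok m0"
  shows "ht n gq (\<lambda>m. m = m0) (Seq Build Final)
     (\<lambda>m. keep WX WY m0 m \<and> ok m \<and> rarr m0 3 0 \<le> rarr m 3 0 \<and> fnd T t bb G (rarr m 3 0)) try_time"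
proof -
  define lam where "lam j = G (z * k + j)" for j
  define c where "c q = G ((z + 1) * k + q)" for q
  define Bt where "Bt = real bb * w t"
  interpret prog_data gq n l w z k Q t T Bt lam c bb
    by unfold_locales (simp_all add: z_pos k_pos Bt_def)
  have i1: "i * k + j < z ^ 8" if "i < z" "j < k" for i j
  proof -
    have "i * k + j < (i + 1) * k" using that by simp
    also have "\<dots> \<le> (z + 1) * k" using that by (intro mult_le_mono1) simp
    finally show ?thesis using len by simp
  qed
  have i2: "z * k + j < z ^ 8" if "j < k" for j using that len by simp
  have i3: "(z + 1) * k + q < z ^ 8" if "q < Q + 2" for q using that len by simp
  have env: "env G m0"
    using b t bb G[OF i1] G[OF i2] G[OF i3] unfolding env_def benv_def lam_def c_def by blast
  let ?A = "fst (rows (guess_policy k G) z)" and ?h = "fillers (guess_policy k G) k"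
  let ?Q = "\<lambda>m. keep WX WY m0 m \<and> ok m \<and> rarr m0 3 0 \<le> rarr m 3 0 \<and> fnd T t bb G (rarr m 3 0)"
  have 2: "ht n gq (\<lambda>m. keep {20, 21, 22, 23, 24, 25, 26, 27, 28, 29, 30, 40, 41, 42, 43} {20, 21, 22, 23, 24, 25, 26} m0 m \<and>
        srep ?A ?h m) Final ?Q final_time"
  proof (rule ht_pre)
    fix m1 assume m1: "keep {20, 21, 22, 23, 24, 25, 26, 27, 28, 29, 30, 40, 41, 42, 43} {20, 21, 22, 23, 24, 25, 26} m0 m1 \<and>
        srep ?A ?h m1"
    note k1 = conjunct1[OF m1]
    have e1: "env G m1" by (rule env_keep[OF env k1]) auto
    have o1: "outok m1" by (rule outok_keep[OF o k1]) auto
    show "ht n gq (\<lambda>m. m = m1) Final ?Q final_time"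
    proof (rule ht_conseq[OF ht_Final[OF e1 conjunct2[OF m1] o1]])
      fix m assume m: "keep {1, 20, 50, 51, 52, 53, 54} {3, 50, 51, 52} m1 m \<and> outok m \<and> rarr m1 3 0 \<le> rarr m 3 0 \<and>
        (\<forall>R\<subseteq>pool ?h. card R \<le> k \<longrightarrow> sum w ({..<n} \<inter> (?A \<union> R)) \<le> 1 \<longrightarrow> obj ({..<n} \<inter> (?A \<union> R)) \<le> rarr m 3 0)"
      have "keep WX WY m0 m" by (rule keep_trans[OF k1 conjunct1[OF m]]) auto
      moreover have "rarr m1 3 = rarr m0 3" using keepD(2)[OF k1, of 3] by simp
      moreover have "fnd T t bb G (rarr m 3 0)"
        unfolding found_def Let_def Bt_def[symmetric] lam_def[abs_def, symmetric] c_def[abs_def, symmetric]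
        using m by blast
      ultimately show "?Q m" using m by simp
    qed auto
  qed
  show ?thesis
    by (rule ht_conseq[OF ht_Seq[OF ht_Build[OF env w_nonneg] 2]]) (auto simp: try_time_def)
qed

definition guesses_time :: nat where
  "guesses_time = (z ^ 8) ^ (z ^ 8) * (try_time + 4 * z ^ 8 + 12) + 4 * z ^ 8 + 8"

lemma ht_Guesses:
  assumes b: "benv T m0" and t: "narr m0 8 0 = t" and bb: "narr m0 9 0 = bb" and o: "ok m0"
  shows "ht n gq (\<lambda>m. m = m0) Guesses
     (\<lambda>m. keep ({10, 13, 14} \<union> WX) WY m0 m \<and> ok m \<and> rarr m0 3 0 \<le> rarr m 3 0 \<and>
       (\<forall>i<(z ^ 8) ^ (z ^ 8). fnd T t bb (guess_of i) (rarr m 3 0))) guesses_time"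
proof -
  let ?X = "{10, 13, 14} \<union> WX"
  \<comment> \<open>\<open>outok\<close> depends on neither the scale nor the guess, so any
    parameters give access to its rules; the product form of the seventh numerical argument meets
    the locale's condition on \<open>Bt\<close>.\<close>
  interpret P: prog_data gq n l w z k Q 0 T "real 0 * w 0" "\<lambda>_. 0" "\<lambda>_. 0" 0
    by unfold_locales (simp_all add: z_pos k_pos)
  define I where "I j m \<longleftrightarrow> keep ?X WY m0 m \<and> ok m \<and> rarr m0 3 0 \<le> rarr m 3 0 \<and>
       (\<forall>i<j. fnd T t bb (guess_of i) (rarr m 3 0))" for j m
  have "ht n gq (I 0) Guesses (I ((z ^ 8) ^ (z ^ 8))) guesses_time"
    unfolding Guesses_def
  proof (rule ht_Enum[where L = "z ^ 8" and B = "z ^ 8" and K = try_time])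
    show "I j m'" if I: "I j m" and kp: "keep {10, 13, 14} {} m m'" for j m m'
    proof -
      have "keep ?X WY m0 m'" by (rule keep_trans[of ?X WY m0 m, OF _ kp]) (use I in \<open>auto simp: I_def\<close>)
      moreover have "ok m'" by (rule P.outok_keep[OF _ kp]) (use I in \<open>auto simp: I_def\<close>)
      ultimately show ?thesis using I keepD(2)[OF kp] by (simp add: I_def)
    qed
    show "nval m (NV 5) = z ^ 8 \<and> nval m (NV 5) = z ^ 8" if "I j m" for j m
    proof -
      have kp: "keep ?X WY m0 m" using that by (simp add: I_def)
      have "benv T m" by (rule benv_keep[OF b kp]) auto
      then show ?thesis by (simp add: benv_def)
    qed
    fix j assume j: "j < (z ^ 8) ^ (z ^ 8)"
    let ?D = "\<lambda>m. (\<forall>y<z ^ 8. narr m 10 y = dig (z ^ 8) j y) \<and> narr m 14 0 = 0"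
    show "ht n gq (\<lambda>m. I j m \<and> ?D m) (Seq Build Final) (\<lambda>m. I (Suc j) m \<and> ?D m) try_time"
    proof (rule ht_pre)
      fix m1 assume m1: "I j m1 \<and> ?D m1"
      have k1: "keep ?X WY m0 m1" and o1: "ok m1" using m1 by (simp_all add: I_def)
      have b1: "benv T m1" by (rule benv_keep[OF b k1]) auto
      have t1: "narr m1 8 0 = t" "narr m1 9 0 = bb" using keepD(1)[OF k1] t bb by simp_all
      have G1: "narr m1 10 x = guess_of j x" if "x < z ^ 8" for x
        using m1 that by (simp add: guess_of_def)
      show "ht n gq (\<lambda>m. m = m1) (Seq Build Final) (\<lambda>m. I (Suc j) m \<and> ?D m) try_time"
      proof (rule ht_conseq[OF ht_try[OF b1 t1 G1 o1]])
        fix m assume m: "keep WX WY m1 m \<and> ok m \<and> rarr m1 3 0 \<le> rarr m 3 0 \<and> fnd T t bb (guess_of j) (rarr m 3 0)"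
        note k2 = conjunct1[OF m]
        have "keep ?X WY m0 m" by (rule keep_trans[OF k1 k2]) auto
        moreover have "narr m 10 = narr m1 10" "narr m 14 = narr m1 14" using keepD(1)[OF k2] by simp_all
        moreover have "fnd T t bb (guess_of i) (rarr m 3 0)" if "i < Suc j" for i
        proof (cases "i = j")
          case False
          then have "fnd T t bb (guess_of i) (rarr m1 3 0)" using m1 that by (simp add: I_def)
          then show ?thesis by (rule found_mono) (use m in simp)
        qed (use m in simp)
        ultimately show "I (Suc j) m \<and> ?D m" using m m1 by (simp add: I_def)
      qed auto
    qed
  qed (use z_pos in \<open>auto simp: guesses_time_def\<close>)
  then show ?thesis by (rule ht_conseq) (use o in \<open>auto simp: I_def\<close>)
qed

definition scale_time :: nat where
  "scale_time = (n + 1) * ((n + 1) * (guesses_time + 3) + 6) + 3"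

lemma ht_GuessScale:
  assumes b: "benv T m0" and o: "ok m0"
  shows "ht n gq (\<lambda>m. m = m0) GuessScale
     (\<lambda>m. keep ({8, 9, 10, 13, 14} \<union> WX) WY m0 m \<and> ok m \<and> rarr m0 3 0 \<le> rarr m 3 0 \<and>
       (\<forall>t\<le>n. \<forall>bb\<le>n. \<forall>i<(z ^ 8) ^ (z ^ 8). fnd T t bb (guess_of i) (rarr m 3 0))) scale_time"
proof -
  let ?X = "{8, 9, 10, 13, 14} \<union> WX"
  let ?all = "\<lambda>t bb v. \<forall>i<(z ^ 8) ^ (z ^ 8). fnd T t bb (guess_of i) v"
  interpret P: prog_data gq n l w z k Q 0 T "real 0 * w 0" "\<lambda>_. 0" "\<lambda>_. 0" 0
    by unfold_locales (simp_all add: z_pos k_pos)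
  define I where "I t m \<longleftrightarrow> keep ?X WY m0 m \<and> ok m \<and> rarr m0 3 0 \<le> rarr m 3 0 \<and>
       (\<forall>t'<t. \<forall>bb<n + 1. ?all t' bb (rarr m 3 0))" for t m
  define J where "J t b m \<longleftrightarrow> I t m \<and> narr m 8 0 = t \<and> (\<forall>bb<b. ?all t bb (rarr m 3 0))" for t b m
  have all_mono: "?all t bb v'" if "?all t bb v" "v \<le> v'" for t bb v v'
    using that found_mono by blast
  have ok_w: "ok (nwrite a i v m) = ok m" if "a \<noteq> 1" for a i v m
    using that by (simp add: P.outok_def stored_set_def)
  have I_w: "I t (nwrite a i v m) = I t m" if "a \<in> {8, 9}" for a i v t m
    using that by (auto simp: I_def ok_w)
  have nI: "nval m (NAdd (NV 0) (NConst 1)) = n + 1" if "I t m" for t m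
  proof -
    have kp: "keep ?X WY m0 m" using that by (simp add: I_def)
    have "benv T m" by (rule benv_keep[OF b kp]) auto
    then show ?thesis by (simp add: benv_def)
  qed
  have inner: "ht n gq (\<lambda>m. I t m \<and> narr m 8 0 = t) (For 9 (NAdd (NV 0) (NConst 1)) Guesses)
     (\<lambda>m. J t (n + 1) m \<and> narr m 9 0 = n + 1) ((n + 1) * (guesses_time + 3) + 3)" for t
  proof (rule ht_For[where K = guesses_time and I = "J t"])
    show "J t 0 (nwrite 9 0 0 m)" if "I t m \<and> narr m 8 0 = t" for m
      using that I_w by (simp add: J_def)
    fix bb
    show "ht n gq (\<lambda>m. J t bb m \<and> narr m 9 0 = bb) Guesses (\<lambda>m. J t (Suc bb) (nwrite 9 0 (Suc bb) m) \<and> narr m 9 0 = bb) guesses_time"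
    proof (rule ht_pre)
      fix m1 assume m1: "J t bb m1 \<and> narr m1 9 0 = bb"
      have k1: "keep ?X WY m0 m1" and o1: "ok m1" and t1: "narr m1 8 0 = t" and bb1: "narr m1 9 0 = bb"
        using m1 by (auto simp: I_def J_def)
      have b1: "benv T m1" by (rule benv_keep[OF b k1]) auto
      show "ht n gq (\<lambda>m. m = m1) Guesses (\<lambda>m. J t (Suc bb) (nwrite 9 0 (Suc bb) m) \<and> narr m 9 0 = bb) guesses_time"
      proof (rule ht_conseq[OF ht_Guesses[OF b1 t1 bb1 o1]])
        fix m assume m: "keep ({10, 13, 14} \<union> WX) WY m1 m \<and> ok m \<and> rarr m1 3 0 \<le> rarr m 3 0 \<and> ?all t bb (rarr m 3 0)"
        note k2 = conjunct1[OF m]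
        have v: "rarr m1 3 0 \<le> rarr m 3 0" using m by blast
        have kk: "keep ?X WY m0 m" by (rule keep_trans[OF k1 k2]) auto
        have n89: "narr m 8 = narr m1 8" "narr m 9 = narr m1 9" using keepD(1)[OF k2] by simp_all
        have old: "?all t' bb' (rarr m 3 0)" if "t' < t" "bb' < n + 1" for t' bb'
          by (rule all_mono[OF _ v]) (use m1 that in \<open>simp add: I_def J_def\<close>)
        have "?all t bb' (rarr m 3 0)" if "bb' < Suc bb" for bb'
        proof (cases "bb' = bb")
          case False
          then show ?thesis by (intro all_mono[OF _ v]) (use m1 that in \<open>simp add: J_def\<close>)
        qed (use m in simp)
        moreover have "I t m"
          using kk m v old m1 unfolding I_def J_def by auto
        ultimately have "J t (Suc bb) m" using n89 t1 by (simp add: J_def)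
        then have "J t (Suc bb) (nwrite 9 0 (Suc bb) m)" using I_w by (simp add: J_def)
        then show "J t (Suc bb) (nwrite 9 0 (Suc bb) m) \<and> narr m 9 0 = bb" using n89 bb1 by simp
      qed auto
    qed
  next
    show "nval m (NAdd (NV 0) (NConst 1)) = n + 1" if "J t b m" for b m
      by (rule nI[of t]) (use that in \<open>simp add: J_def\<close>)
  qed simp
  have "ht n gq (\<lambda>m. m = m0) GuessScale (\<lambda>m. I (n + 1) m \<and> narr m 8 0 = n + 1) scale_time"
    unfolding GuessScale_def
  proof (rule ht_For[where K = "(n + 1) * (guesses_time + 3) + 3" and I = I])
    show "I 0 (nwrite 8 0 0 m)" if "m = m0" for m using that o by (simp add: I_def ok_w)
    fix t
    show "ht n gq (\<lambda>m. I t m \<and> narr m 8 0 = t) (For 9 (NAdd (NV 0) (NConst 1)) Guesses)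
       (\<lambda>m. I (Suc t) (nwrite 8 0 (Suc t) m) \<and> narr m 8 0 = t) ((n + 1) * (guesses_time + 3) + 3)"
    proof (rule ht_conseq[OF inner[of t]])
      fix m assume m: "J t (n + 1) m \<and> narr m 9 0 = n + 1"
      then have "I (Suc t) m" unfolding J_def I_def by (auto simp: less_Suc_eq)
      then show "I (Suc t) (nwrite 8 0 (Suc t) m) \<and> narr m 8 0 = t" using I_w m by (simp add: J_def)
    qed auto
  next
    show "nval m (NAdd (NV 0) (NConst 1)) = n + 1" if "I t m" for t m using nI that .
  qed (simp add: scale_time_def)
  then show ?thesis by (rule ht_conseq) (auto simp: I_def less_Suc_eq_le)
qed

end

section \<open>The complete algorithm\<close>

text \<open>The machine cannot round, so the ceiling is found by counting. The time is linear in the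
  result, which is a power of \<open>z\<close> in all its uses and hence depends on
  \<open>\<epsilon>\<close> only.\<close>

definition Ceil :: "nat \<Rightarrow> rexp \<Rightarrow> com" where
  "Ceil v e = Seq (NAssign v (NConst 0) (NConst 0))
     (While (RLess (ROfNat (NV v)) e) (NAssign v (NConst 0) (NAdd (NV v) (NConst 1))))"

lemma ht_Ceil:
  assumes r: "\<And>m. keep {v} {} m0 m \<Longrightarrow> rval m e = r"
  shows "ht n g (\<lambda>m. m = m0) (Ceil v e) (\<lambda>m. keep {v} {} m0 m \<and> narr m v 0 = nat \<lceil>r\<rceil>) (nat \<lceil>r\<rceil> * 2 + 3)"
proof -
  let ?I = "\<lambda>j m. keep {v} {} m0 m \<and> narr m v 0 = j"
  have 1: "ht n g (\<lambda>m. m = m0) (NAssign v (NConst 0) (NConst 0)) (?I 0) 1"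
    by (rule ht_simple) auto
  have 2: "ht n g (?I 0) (While (RLess (ROfNat (NV v)) e) (NAssign v (NConst 0) (NAdd (NV v) (NConst 1))))
     (?I (nat \<lceil>r\<rceil>)) (nat \<lceil>r\<rceil> * (1 + 1) + 1)"
  proof (rule ht_While[where I = ?I])
    show "ht n g (?I j) (NAssign v (NConst 0) (NAdd (NV v) (NConst 1))) (?I (Suc j)) 1" for j
      by (rule ht_simple) auto
    show "bval m (RLess (ROfNat (NV v)) e) \<longleftrightarrow> j < nat \<lceil>r\<rceil>" if "?I j m" for j m
      using r[OF conjunct1[OF that]] that by (simp add: zless_nat_eq_int_zless less_ceiling_iff)
  qed
  show ?thesis unfolding Ceil_def by (rule ht_conseq[OF ht_Seq[OF 1 2]]) auto
qed

text \<open>Naturals cannot be multiplied; the powers of \<open>z\<close> are products of reals that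
  are turned back into naturals by counting.\<close>

definition Sizes :: com where
  "Sizes = Seq (Ceil 2 (RDiv (ROfNat (NConst 10)) (RV 0)))
     (Seq (Ceil 3 (RMul (RMul (ROfNat (NV 2)) (ROfNat (NV 2))) (ROfNat (NV 2))))
     (Seq (Ceil 4 (RMul (ROfNat (NV 3)) (ROfNat (NV 3))))
       (Ceil 5 (RMul (RMul (ROfNat (NV 4)) (ROfNat (NV 2))) (ROfNat (NV 2))))))"

definition Offsets :: com where
  "Offsets = For 15 (NAdd (NV 2) (NV 4)) (NAssign 6 (NAdd (NV 15) (NConst 1)) (NAdd (NRead 6 (NV 15)) (NV 4)))"

text \<open>Singletons are feasible because weights are at most 1. Their best value fixes the
  optimum up to a factor \<open>n\<close>.\<close>

definition Single :: com where
  "Single = Seq (NAssign 20 (NV 15) (NConst 1)) (Seq (Query 5 (NConst 0) 20) (Seq (NAssign 20 (NV 15) (NConst 0))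
     (Cond (RLess (RV 4) (RAdd (RV 5) (RRead 2 (NV 15)))) (RAssign 4 (NConst 0) (RAdd (RV 5) (RRead 2 (NV 15)))) Skip)))"

text \<open>A nonempty optimum lies between the best singleton value \<open>M\<close> and
  \<open>n * M\<close>. Doubling while the factor is below \<open>2 * n\<close> meets a
  \<open>T\<close> between the optimum and its double.\<close>

definition Scales :: com where
  "Scales = While (NLess (NV 7) (NAdd (NV 0) (NV 0)))
     (Seq GuessScale (Seq (RAssign 4 (NConst 0) (RAdd (RV 4) (RV 4))) (NAssign 7 (NConst 0) (NAdd (NV 7) (NV 7)))))"

definition Algorithm :: com where
  "Algorithm = Seq Sizes (Seq Offsets (Seq (Query 3 (NConst 0) 1) (Seq (For 15 (NV 0) Single)
     (Seq (NAssign 7 (NConst 0) (NConst 1)) Scales))))"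

lemma ht_Sizes:
  assumes z: "z = nat \<lceil>10 / rarr m0 0 0\<rceil>"
  shows "ht n g (\<lambda>m. m = m0) Sizes (\<lambda>m. keep {2, 3, 4, 5} {} m0 m \<and> narr m 2 0 = z \<and> narr m 3 0 = z ^ 3 \<and>
     narr m 4 0 = z ^ 6 \<and> narr m 5 0 = z ^ 8) (2 * z + 2 * z ^ 3 + 2 * z ^ 6 + 2 * z ^ 8 + 15)"
proof -
  have 1: "ht n g (\<lambda>m. m = m0) (Ceil 2 (RDiv (ROfNat (NConst 10)) (RV 0)))
     (\<lambda>m. keep {2} {} m0 m \<and> narr m 2 0 = z) (2 * z + 3)"
    by (rule ht_conseq[OF ht_Ceil[where r = "10 / rarr m0 0 0"]]) (use z in \<open>auto simp: keep_def\<close>)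
  have 2: "ht n g (\<lambda>m. keep {2} {} m0 m \<and> narr m 2 0 = z)
     (Ceil 3 (RMul (RMul (ROfNat (NV 2)) (ROfNat (NV 2))) (ROfNat (NV 2))))
     (\<lambda>m. keep {2, 3} {} m0 m \<and> narr m 2 0 = z \<and> narr m 3 0 = z ^ 3) (2 * z ^ 3 + 3)"
  proof (rule ht_pre)
    fix m1 assume m1: "keep {2} {} m0 m1 \<and> narr m1 2 0 = z"
    have "real z * real z * real z = real (z ^ 3)" by (simp add: power3_eq_cube)
    then have c: "nat \<lceil>real z * real z * real z\<rceil> = z ^ 3" by (simp only: ceiling_of_nat nat_int)
    show "ht n g (\<lambda>m. m = m1) (Ceil 3 (RMul (RMul (ROfNat (NV 2)) (ROfNat (NV 2))) (ROfNat (NV 2))))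
       (\<lambda>m. keep {2, 3} {} m0 m \<and> narr m 2 0 = z \<and> narr m 3 0 = z ^ 3) (2 * z ^ 3 + 3)"
    proof (rule ht_conseq[OF ht_Ceil[where r = "real z * real z * real z"]])
      show "rval m (RMul (RMul (ROfNat (NV 2)) (ROfNat (NV 2))) (ROfNat (NV 2))) = real z * real z * real z"
        if "keep {3} {} m1 m" for m
        using keepD(1)[OF that, of 2] m1 by simp
      fix m assume m: "keep {3} {} m1 m \<and> narr m 3 0 = nat \<lceil>real z * real z * real z\<rceil>"
      have "keep {2, 3} {} m0 m" by (rule keep_trans[OF conjunct1[OF m1] conjunct1[OF m]]) auto
      then show "keep {2, 3} {} m0 m \<and> narr m 2 0 = z \<and> narr m 3 0 = z ^ 3"
        using keepD(1)[OF conjunct1[OF m], of 2] m m1 unfolding c by simp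
    qed (auto simp: c)
  qed
  have 3: "ht n g (\<lambda>m. keep {2, 3} {} m0 m \<and> narr m 2 0 = z \<and> narr m 3 0 = z ^ 3)
     (Ceil 4 (RMul (ROfNat (NV 3)) (ROfNat (NV 3))))
     (\<lambda>m. keep {2, 3, 4} {} m0 m \<and> narr m 2 0 = z \<and> narr m 3 0 = z ^ 3 \<and> narr m 4 0 = z ^ 6) (2 * z ^ 6 + 3)"
  proof (rule ht_pre)
    fix m1 assume m1: "keep {2, 3} {} m0 m1 \<and> narr m1 2 0 = z \<and> narr m1 3 0 = z ^ 3"
    have "real (z ^ 3) * real (z ^ 3) = real (z ^ 6)" by (simp flip: power_add)
    then have c: "nat \<lceil>real (z ^ 3) * real (z ^ 3)\<rceil> = z ^ 6" by (simp only: ceiling_of_nat nat_int)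
    show "ht n g (\<lambda>m. m = m1) (Ceil 4 (RMul (ROfNat (NV 3)) (ROfNat (NV 3))))
       (\<lambda>m. keep {2, 3, 4} {} m0 m \<and> narr m 2 0 = z \<and> narr m 3 0 = z ^ 3 \<and> narr m 4 0 = z ^ 6) (2 * z ^ 6 + 3)"
    proof (rule ht_conseq[OF ht_Ceil[where r = "real (z ^ 3) * real (z ^ 3)"]])
      show "rval m (RMul (ROfNat (NV 3)) (ROfNat (NV 3))) = real (z ^ 3) * real (z ^ 3)"
        if "keep {4} {} m1 m" for m
        using keepD(1)[OF that, of 3] m1 by simp
      fix m assume m: "keep {4} {} m1 m \<and> narr m 4 0 = nat \<lceil>real (z ^ 3) * real (z ^ 3)\<rceil>"
      have "keep {2, 3, 4} {} m0 m" by (rule keep_trans[OF conjunct1[OF m1] conjunct1[OF m]]) auto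
      then show "keep {2, 3, 4} {} m0 m \<and> narr m 2 0 = z \<and> narr m 3 0 = z ^ 3 \<and> narr m 4 0 = z ^ 6"
        using keepD(1)[OF conjunct1[OF m], of 2] keepD(1)[OF conjunct1[OF m], of 3] m m1 unfolding c by simp
    next
      show "nat \<lceil>real (z ^ 3) * real (z ^ 3)\<rceil> * 2 + 3 \<le> 2 * z ^ 6 + 3" unfolding c by simp
    qed simp
  qed
  have 4: "ht n g (\<lambda>m. keep {2, 3, 4} {} m0 m \<and> narr m 2 0 = z \<and> narr m 3 0 = z ^ 3 \<and> narr m 4 0 = z ^ 6)
     (Ceil 5 (RMul (RMul (ROfNat (NV 4)) (ROfNat (NV 2))) (ROfNat (NV 2))))
     (\<lambda>m. keep {2, 3, 4, 5} {} m0 m \<and> narr m 2 0 = z \<and> narr m 3 0 = z ^ 3 \<and> narr m 4 0 = z ^ 6 \<and> narr m 5 0 = z ^ 8) (2 * z ^ 8 + 3)"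
  proof (rule ht_pre)
    fix m1 assume m1: "keep {2, 3, 4} {} m0 m1 \<and> narr m1 2 0 = z \<and> narr m1 3 0 = z ^ 3 \<and> narr m1 4 0 = z ^ 6"
    have "real (z ^ 6) * real z * real z = real (z ^ 8)" by (simp add: eval_nat_numeral)
    then have c: "nat \<lceil>real (z ^ 6) * real z * real z\<rceil> = z ^ 8" by (simp only: ceiling_of_nat nat_int)
    show "ht n g (\<lambda>m. m = m1) (Ceil 5 (RMul (RMul (ROfNat (NV 4)) (ROfNat (NV 2))) (ROfNat (NV 2))))
       (\<lambda>m. keep {2, 3, 4, 5} {} m0 m \<and> narr m 2 0 = z \<and> narr m 3 0 = z ^ 3 \<and> narr m 4 0 = z ^ 6 \<and> narr m 5 0 = z ^ 8) (2 * z ^ 8 + 3)"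
    proof (rule ht_conseq[OF ht_Ceil[where r = "real (z ^ 6) * real z * real z"]])
      show "rval m (RMul (RMul (ROfNat (NV 4)) (ROfNat (NV 2))) (ROfNat (NV 2))) = real (z ^ 6) * real z * real z"
        if "keep {5} {} m1 m" for m
        using keepD(1)[OF that, of 2] keepD(1)[OF that, of 4] m1 by simp
      fix m assume m: "keep {5} {} m1 m \<and> narr m 5 0 = nat \<lceil>real (z ^ 6) * real z * real z\<rceil>"
      have "keep {2, 3, 4, 5} {} m0 m" by (rule keep_trans[OF conjunct1[OF m1] conjunct1[OF m]]) auto
      then show "keep {2, 3, 4, 5} {} m0 m \<and> narr m 2 0 = z \<and> narr m 3 0 = z ^ 3 \<and> narr m 4 0 = z ^ 6 \<and> narr m 5 0 = z ^ 8"
        using keepD(1)[OF conjunct1[OF m], of 2] keepD(1)[OF conjunct1[OF m], of 3] keepD(1)[OF conjunct1[OF m], of 4] m m1 unfolding c by simp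
    next
      show "nat \<lceil>real (z ^ 6) * real z * real z\<rceil> * 2 + 3 \<le> 2 * z ^ 8 + 3" unfolding c by simp
    qed simp
  qed
  show ?thesis unfolding Sizes_def
    by (rule ht_conseq[OF ht_Seq[OF 1 ht_Seq[OF 2 ht_Seq[OF 3 4]]]]) auto
qed

lemma ht_Offsets:
  assumes "narr m0 2 0 = z" "narr m0 4 0 = k" "narr m0 6 0 = 0"
  shows "ht n g (\<lambda>m. m = m0) Offsets (\<lambda>m. keep {6, 15} {} m0 m \<and> (\<forall>i\<le>z + k. narr m 6 i = i * k)) ((z + k) * 4 + 3)"
proof -
  let ?I = "\<lambda>x m. keep {6, 15} {} m0 m \<and> (\<forall>i\<le>x. narr m 6 i = i * k)"
  have "ht n g (\<lambda>m. m = m0) Offsets (\<lambda>m. ?I (z + k) m \<and> narr m 15 0 = z + k) ((z + k) * 4 + 3)"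
    unfolding Offsets_def
  proof (rule ht_For[where K = 1 and I = ?I])
    show "?I 0 (nwrite 15 0 0 m)" if "m = m0" for m using that assms(3) by simp
    fix x
    show "ht n g (\<lambda>m. ?I x m \<and> narr m 15 0 = x) (NAssign 6 (NAdd (NV 15) (NConst 1)) (NAdd (NRead 6 (NV 15)) (NV 4)))
      (\<lambda>m. ?I (Suc x) (nwrite 15 0 (Suc x) m) \<and> narr m 15 0 = x) 1"
    proof (rule ht_simple)
      fix m assume m: "?I x m \<and> narr m 15 0 = x"
      have "narr m 4 0 = k" using keepD(1)[OF conjunct1[OF conjunct1[OF m]], of 4] assms(2) by simp
      then show "?I (Suc x) (nwrite 15 0 (Suc x) (sexec n g (NAssign 6 (NAdd (NV 15) (NConst 1)) (NAdd (NRead 6 (NV 15)) (NV 4))) m)) \<and>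
          narr (sexec n g (NAssign 6 (NAdd (NV 15) (NConst 1)) (NAdd (NRead 6 (NV 15)) (NV 4))) m) 15 0 = x"
        using m by (auto simp: le_Suc_eq)
    qed auto
  next
    show "nval m (NAdd (NV 2) (NV 4)) = z + k" if "?I x m" for x m
      using keepD(1)[OF conjunct1[OF that], of 2] keepD(1)[OF conjunct1[OF that], of 4] assms by simp
  qed simp
  then show ?thesis by (rule ht_conseq) auto
qed

lemma ht_Singles:
  assumes n: "narr m0 0 0 = n" and l: "rarr m0 2 = l" and C: "narr m0 20 = (\<lambda>_. 0)" and M: "rarr m0 4 0 = 0"
  shows "ht n g (\<lambda>m. m = m0) (For 15 (NV 0) Single)
     (\<lambda>m. keep {15, 20} {4, 5} m0 m \<and> (\<forall>e<n. g {e} + l e \<le> rarr m 4 0) \<and> 0 \<le> rarr m 4 0 \<and>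
       (rarr m 4 0 = 0 \<or> (\<exists>e<n. rarr m 4 0 = g {e} + l e))) (n * 15 + 3)"
proof -
  let ?I = "\<lambda>x m. keep {15, 20} {4, 5} m0 m \<and> narr m 20 = (\<lambda>_. 0) \<and> (\<forall>e<x. g {e} + l e \<le> rarr m 4 0) \<and> 0 \<le> rarr m 4 0 \<and>
       (rarr m 4 0 = 0 \<or> (\<exists>e<x. rarr m 4 0 = g {e} + l e))"
  have "ht n g (\<lambda>m. m = m0) (For 15 (NV 0) Single) (\<lambda>m. ?I n m \<and> narr m 15 0 = n) (n * 15 + 3)"
  proof (rule ht_For[where K = 12 and I = ?I])
    show "?I 0 (nwrite 15 0 0 m)" if "m = m0" for m using that C M by simp
    fix e assume e: "e < n"
    show "ht n g (\<lambda>m. ?I e m \<and> narr m 15 0 = e) Single (\<lambda>m. ?I (Suc e) (nwrite 15 0 (Suc e) m) \<and> narr m 15 0 = e) 12"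
    proof (rule ht_simple)
      fix m assume m: "?I e m \<and> narr m 15 0 = e"
      let ?v = "g {e} + l e"
      have le: "rarr m 2 e = l e" using keepD(2)[OF conjunct1[OF conjunct1[OF m]], of 2] l by simp
      have S: "stored_set n 20 (nwrite 20 e 1 m) = {e}" using m e by (auto simp: stored_set_def)
      define m2 where "m2 = nwrite 20 e 0 (rwrite 5 0 (g {e}) (nwrite 20 e 1 m))"
      have ex: "sexec n g Single m = (if rarr m 4 0 < ?v then rwrite 4 0 ?v m2 else m2)"
        using m le S by (simp add: Single_def m2_def)
      have m2: "keep {15, 20} {4, 5} m0 m2" "narr m2 20 = (\<lambda>_. 0)" "rarr m2 4 0 = rarr m 4 0" "narr m2 15 0 = e"
        using m by (auto simp: m2_def)
      show "?I (Suc e) (nwrite 15 0 (Suc e) (sexec n g Single m)) \<and> narr (sexec n g Single m) 15 0 = e"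
      proof (cases "rarr m 4 0 < ?v")
        case True
        then have "\<forall>x<Suc e. g {x} + l x \<le> ?v" using m by (auto simp: less_Suc_eq intro: order_trans less_imp_le)
        moreover have "0 \<le> ?v" using m True by linarith
        ultimately show ?thesis using m2 True unfolding ex by auto
      next
        case False
        then have "\<forall>x<Suc e. g {x} + l x \<le> rarr m 4 0" using m by (auto simp: less_Suc_eq)
        moreover have "rarr m 4 0 = 0 \<or> (\<exists>x<Suc e. rarr m 4 0 = g {x} + l x)" using m less_SucI by blast
        ultimately show ?thesis using m2 False m unfolding ex by simp
      qed
    qed (auto simp: Single_def)
  next
    show "nval m (NV 0) = n" if "?I e m" for e m
      using keepD(1)[OF conjunct1[OF that], of 0] n by simp
  qed simp
  then show ?thesis by (rule ht_conseq) auto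
qed

context outer
begin

definition scales :: nat where "scales = (LEAST p. 2 * n \<le> 2 ^ p)"

lemma scales: "p < scales \<longleftrightarrow> 2 ^ p < 2 * n"
proof -
  have "2 * n \<le> 2 ^ (2 * n)" using less_exp[of "2 * n"] by simp
  then have top: "2 * n \<le> 2 ^ scales" unfolding scales_def by (rule LeastI)
  show ?thesis
  proof
    assume "p < scales"
    then show "2 ^ p < 2 * n" using not_less_Least[of p "\<lambda>p. 2 * n \<le> 2 ^ p"] by (simp add: scales_def)
  next
    assume "2 ^ p < 2 * n"
    then have "(2::nat) ^ p < 2 ^ scales" using top by linarith
    then show "p < scales" by (simp add: power_strict_increasing_iff)
  qed
qed

lemma ht_Scales:
  assumes b: "benv M m0" and o: "ok m0" and c: "narr m0 7 0 = 1"
  shows "ht n gq (\<lambda>m. m = m0) Scales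
     (\<lambda>m. ok m \<and> rarr m0 3 0 \<le> rarr m 3 0 \<and>
       (\<forall>p. 2 ^ p < 2 * n \<longrightarrow> (\<forall>t\<le>n. \<forall>bb\<le>n. \<forall>i<(z ^ 8) ^ (z ^ 8). fnd (2 ^ p * M) t bb (guess_of i) (rarr m 3 0))))
     (scales * (scale_time + 5) + 1)"
proof -
  interpret P: prog_data gq n l w z k Q 0 T "real 0 * w 0" "\<lambda>_. 0" "\<lambda>_. 0" 0 for T
    by unfold_locales (simp_all add: z_pos k_pos)
  let ?all = "\<lambda>p v. \<forall>t\<le>n. \<forall>bb\<le>n. \<forall>i<(z ^ 8) ^ (z ^ 8). fnd (2 ^ p * M) t bb (guess_of i) v"
  define I where "I p m \<longleftrightarrow> benv (2 ^ p * M) m \<and> narr m 7 0 = 2 ^ p \<and> ok m \<and> rarr m0 3 0 \<le> rarr m 3 0 \<and>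
     (\<forall>p'<p. ?all p' (rarr m 3 0))" for p m
  have all_mono: "?all p v'" if "?all p v" "v \<le> v'" for p v v'
  proof (intro allI impI)
    fix t bb i assume a: "t \<le> n" "bb \<le> n" "i < (z ^ 8) ^ (z ^ 8)"
    show "fnd (2 ^ p * M) t bb (guess_of i) v'"
      by (rule found_mono[OF that(1)[rule_format, OF a] that(2)])
  qed
  have step: "ht n gq (I p) (Seq GuessScale (Seq (RAssign 4 (NConst 0) (RAdd (RV 4) (RV 4))) (NAssign 7 (NConst 0) (NAdd (NV 7) (NV 7)))))
     (I (Suc p)) (scale_time + 4)" for p
  proof (rule ht_pre)
    fix m1 assume m1: "I p m1"
    have b1: "benv (2 ^ p * M) m1" and o1: "ok m1" and c1: "narr m1 7 0 = 2 ^ p" using m1 by (simp_all add: I_def)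
    let ?P = "\<lambda>m. keep ({8, 9, 10, 13, 14} \<union> WX) WY m1 m \<and> ok m \<and> rarr m1 3 0 \<le> rarr m 3 0 \<and> ?all p (rarr m 3 0)"
    have 2: "ht n gq ?P (Seq (RAssign 4 (NConst 0) (RAdd (RV 4) (RV 4))) (NAssign 7 (NConst 0) (NAdd (NV 7) (NV 7)))) (I (Suc p)) 3"
    proof (rule ht_simple)
      fix m assume m: "?P m"
      note kp = conjunct1[OF m]
      have b2: "benv (2 ^ p * M) m" by (rule benv_keep[OF b1 kp]) auto
      have c2: "narr m 7 0 = 2 ^ p" using keepD(1)[OF kp, of 7] c1 by simp
      have r4: "rarr m 4 0 = 2 ^ p * M" using b2 by (simp add: benv_def)
      let ?m = "nwrite 7 0 (2 ^ p + 2 ^ p) (rwrite 4 0 (2 ^ p * M + 2 ^ p * M) m)"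
      have ex: "sexec n gq (Seq (RAssign 4 (NConst 0) (RAdd (RV 4) (RV 4))) (NAssign 7 (NConst 0) (NAdd (NV 7) (NV 7)))) m = ?m"
        using c2 r4 by simp
      have "benv (2 ^ Suc p * M) ?m" using b2 by (simp add: benv_def)
      moreover have "ok ?m" using m by (simp add: P.outok_def stored_set_def)
      moreover have "?all p' (rarr m 3 0)" if "p' < Suc p" for p'
      proof (cases "p' = p")
        case True
        then show ?thesis using m by blast
      next
        case False
        then have "?all p' (rarr m1 3 0)" using m1 that by (simp add: I_def)
        then show ?thesis by (rule all_mono) (use m in blast)
      qed
      moreover have "rarr m0 3 0 \<le> rarr m 3 0" using m m1 by (simp add: I_def)
      ultimately show "I (Suc p) (sexec n gq (Seq (RAssign 4 (NConst 0) (RAdd (RV 4) (RV 4))) (NAssign 7 (NConst 0) (NAdd (NV 7) (NV 7)))) m)"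
        unfolding ex I_def by simp
    qed auto
    show "ht n gq (\<lambda>m. m = m1) (Seq GuessScale (Seq (RAssign 4 (NConst 0) (RAdd (RV 4) (RV 4))) (NAssign 7 (NConst 0) (NAdd (NV 7) (NV 7)))))
     (I (Suc p)) (scale_time + 4)"
      by (rule ht_conseq[OF ht_Seq[OF ht_GuessScale[OF b1 o1] 2]]) auto
  qed
  have "ht n gq (I 0) Scales (I scales) (scales * (scale_time + 4 + 1) + 1)"
    unfolding Scales_def
  proof (rule ht_While[where I = I])
    show "bval m (NLess (NV 7) (NAdd (NV 0) (NV 0))) \<longleftrightarrow> p < scales" if "I p m" for p m
      using that scales[of p, unfolded mult_2] by (simp add: I_def benv_def)
  qed (rule step)
  then show ?thesis
  proof (rule ht_conseq)
    show "I 0 m" if "m = m0" for m using that b o c by (simp add: I_def)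
    show "ok m \<and> rarr m0 3 0 \<le> rarr m 3 0 \<and> (\<forall>p. 2 ^ p < 2 * n \<longrightarrow> ?all p (rarr m 3 0))" if "I scales m" for m
      using that scales by (simp add: I_def)
  qed simp
qed

definition total_time :: nat where
  "total_time = scales * (scale_time + 5) + 2 * z + 2 * z ^ 3 + 2 * z ^ 6 + 2 * z ^ 8 + (z + k) * 4 + n * 15 + 40"

text \<open>The record starts with the value of the empty set. Keeping \<open>gq {}\<close> as a
  lower bound settles the case of an empty or worthless optimum, where the scales give
  nothing.\<close>

lemma ht_Algorithm:
  assumes k: "k = z ^ 6" and Q: "Q = z ^ 3" and z: "z = nat \<lceil>10 / rarr m0 0 0\<rceil>"
    and m0: "narr m0 = (\<lambda>a i. if a = 0 \<and> i = 0 then n else 0)" "rarr m0 1 = w" "rarr m0 2 = l" "rarr m0 4 0 = 0"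
  shows "ht n gq (\<lambda>m. m = m0) Algorithm (\<lambda>m. ok m \<and> gq {} \<le> rarr m 3 0 \<and>
     (\<exists>M. (\<forall>e<n. gq {e} + l e \<le> M) \<and> 0 \<le> M \<and> (M = 0 \<or> (\<exists>e<n. M = gq {e} + l e)) \<and>
       (\<forall>p. 2 ^ p < 2 * n \<longrightarrow> (\<forall>t\<le>n. \<forall>bb\<le>n. \<forall>i<(z ^ 8) ^ (z ^ 8). fnd (2 ^ p * M) t bb (guess_of i) (rarr m 3 0)))))
     total_time"
proof -
  interpret P: prog_data gq n l w z k Q 0 T "real 0 * w 0" "\<lambda>_. 0" "\<lambda>_. 0" 0 for T
    by unfold_locales (simp_all add: z_pos k_pos)
  let ?sz = "\<lambda>m. narr m 2 0 = z \<and> narr m 3 0 = Q \<and> narr m 4 0 = k \<and> narr m 5 0 = z ^ 8"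
  have 1: "ht n gq (\<lambda>m. m = m0) Sizes (\<lambda>m. keep {2, 3, 4, 5} {} m0 m \<and> ?sz m) (2 * z + 2 * z ^ 3 + 2 * z ^ 6 + 2 * z ^ 8 + 15)"
    by (rule ht_conseq[OF ht_Sizes[OF z]]) (auto simp: k Q)
  let ?of = "\<lambda>m. keep {2, 3, 4, 5, 6, 15} {} m0 m \<and> ?sz m \<and> (\<forall>i\<le>z + k. narr m 6 i = i * k)"
  have 2: "ht n gq (\<lambda>m. keep {2, 3, 4, 5} {} m0 m \<and> ?sz m) Offsets ?of ((z + k) * 4 + 3)"
  proof (rule ht_pre)
    fix m1 assume m1: "keep {2, 3, 4, 5} {} m0 m1 \<and> ?sz m1"
    have "narr m1 6 0 = 0" using keepD(1)[OF conjunct1[OF m1], of 6] m0(1) by simp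
    then show "ht n gq (\<lambda>m. m = m1) Offsets ?of ((z + k) * 4 + 3)"
    proof (intro ht_conseq[OF ht_Offsets[of m1 z k]])
      fix m assume m: "keep {6, 15} {} m1 m \<and> (\<forall>i\<le>z + k. narr m 6 i = i * k)"
      have "keep {2, 3, 4, 5, 6, 15} {} m0 m" by (rule keep_trans[OF conjunct1[OF m1] conjunct1[OF m]]) auto
      then show "?of m" using keepD(1)[OF conjunct1[OF m]] m m1 by simp
    qed (use m1 in auto)
  qed
  let ?q = "\<lambda>m. keep {2, 3, 4, 5, 6, 15} {3} m0 m \<and> ?sz m \<and> (\<forall>i\<le>z + k. narr m 6 i = i * k) \<and> rarr m 3 0 = gq {}"
  have 3: "ht n gq ?of (Query 3 (NConst 0) 1) ?q 1"
  proof (rule ht_simple)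
    fix m assume m: "?of m"
    have "narr m 1 = (\<lambda>_. 0)" using keepD(1)[OF conjunct1[OF m], of 1] m0(1) by (simp add: fun_eq_iff)
    then have "stored_set n 1 m = {}" by (simp add: stored_set_def)
    moreover have "keep {2, 3, 4, 5, 6, 15} {3} m0 m" by (rule keep_mono[OF conjunct1[OF m]]) auto
    ultimately show "?q (sexec n gq (Query 3 (NConst 0) 1) m)" using m by simp
  qed auto
  let ?mx = "\<lambda>M. (\<forall>e<n. gq {e} + l e \<le> M) \<and> 0 \<le> M \<and> (M = 0 \<or> (\<exists>e<n. M = gq {e} + l e))"
  let ?s = "\<lambda>m. benv (rarr m 4 0) m \<and> ok m \<and> rarr m 3 0 = gq {} \<and> ?mx (rarr m 4 0)"
  have 4: "ht n gq ?q (For 15 (NV 0) Single) ?s (n * 15 + 3)"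
  proof (rule ht_pre)
    fix m1 assume m1: "?q m1"
    note k1 = conjunct1[OF m1]
    have a: "narr m1 0 0 = n" "rarr m1 2 = l" "narr m1 20 = (\<lambda>_. 0)" "rarr m1 4 0 = 0" "rarr m1 1 = w" "narr m1 1 = (\<lambda>_. 0)"
      using keepD[OF k1] m0 by (simp_all add: fun_eq_iff)
    show "ht n gq (\<lambda>m. m = m1) (For 15 (NV 0) Single) ?s (n * 15 + 3)"
    proof (rule ht_conseq[OF ht_Singles[OF a(1-4)]])
      fix m assume m: "keep {15, 20} {4, 5} m1 m \<and> (\<forall>e<n. gq {e} + l e \<le> rarr m 4 0) \<and> 0 \<le> rarr m 4 0 \<and>
       (rarr m 4 0 = 0 \<or> (\<exists>e<n. rarr m 4 0 = gq {e} + l e))"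
      note k2 = conjunct1[OF m]
      have "benv (rarr m 4 0) m" using keepD[OF k2] a m1 by (simp add: benv_def)
      moreover have "stored_set n 1 m = {}" using keepD(1)[OF k2, of 1] a(6) by (simp add: stored_set_def)
      moreover have "rarr m 3 0 = gq {}" using keepD(2)[OF k2, of 3] m1 by simp
      ultimately show "?s m" using m by (simp add: P.outok_def P.obj_def)
    qed auto
  qed
  have 5: "ht n gq ?s (NAssign 7 (NConst 0) (NConst 1)) (\<lambda>m. ?s m \<and> narr m 7 0 = 1) 1"
    by (rule ht_simple) (auto simp: benv_def P.outok_def stored_set_def)
  let ?fin = "\<lambda>m. ok m \<and> gq {} \<le> rarr m 3 0 \<and>
     (\<exists>M. ?mx M \<and> (\<forall>p. 2 ^ p < 2 * n \<longrightarrow> (\<forall>t\<le>n. \<forall>bb\<le>n. \<forall>i<(z ^ 8) ^ (z ^ 8). fnd (2 ^ p * M) t bb (guess_of i) (rarr m 3 0))))"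
  have 6: "ht n gq (\<lambda>m. ?s m \<and> narr m 7 0 = 1) Scales ?fin (scales * (scale_time + 5) + 1)"
  proof (rule ht_pre)
    fix m1 assume m1: "?s m1 \<and> narr m1 7 0 = 1"
    then have a: "benv (rarr m1 4 0) m1" "ok m1" "narr m1 7 0 = 1" by blast+
    show "ht n gq (\<lambda>m. m = m1) Scales ?fin (scales * (scale_time + 5) + 1)"
    proof (rule ht_conseq[OF ht_Scales[OF a]])
      fix m assume m: "ok m \<and> rarr m1 3 0 \<le> rarr m 3 0 \<and>
       (\<forall>p. 2 ^ p < 2 * n \<longrightarrow> (\<forall>t\<le>n. \<forall>bb\<le>n. \<forall>i<(z ^ 8) ^ (z ^ 8). fnd (2 ^ p * rarr m1 4 0) t bb (guess_of i) (rarr m 3 0)))"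
      have "gq {} \<le> rarr m 3 0" "?mx (rarr m1 4 0)" using m m1 by auto
      then show "?fin m" using m by blast
    qed auto
  qed
  have "ht n gq (\<lambda>m. m = m0) Algorithm ?fin total_time"
    unfolding Algorithm_def
    by (rule ht_conseq[OF ht_Seq[OF 1 ht_Seq[OF 2 ht_Seq[OF 3 ht_Seq[OF 4 ht_Seq[OF 5 6]]]]]]) (auto simp: total_time_def)
  then show ?thesis by (rule ht_conseq) blast+
qed

end

lemma ht_exD: "ht n g (\<lambda>m. m = m0) c Q K \<Longrightarrow> \<exists>m'. ev n g c m0 m' K \<and> Q m'"
  by (simp add: ht_def)

context knapsack_data
begin

lemma lproc_subset: "A \<subseteq> {..<n} \<Longrightarrow> fst (lproc q h A r) \<subseteq> {..<n}"
  by (induction r) (simp_all add: split_beta)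

lemma lrow_subset: "A \<subseteq> {..<n} \<Longrightarrow> lrow h A q \<subseteq> {..<n}"
  by (induction q) (simp_all add: lproc_subset)

lemma rows_subset: "fst (rows V i) \<subseteq> {..<n}"
proof (induction i)
  case (Suc i)
  then show ?case by (simp only: rows.simps split_beta Let_def fst_conv lrow_subset)
qed auto

end

section \<open>Counting the running time\<close>

context outer
begin

text \<open>The number \<open>z^(8 * z^8)\<close> of guess vectors dominates \<open>z^k\<close>, the
  number of address tuples and every power of \<open>z\<close> involved. Of its five factors, one
  counts the guess vectors, two bound an evaluation, and two bound the rows and the slots or classes
  of a row. The factors \<open>n\<close> come from \<open>t\<close>, from \<open>bb\<close>, from
  the scan over the items and from the \<open>n\<close> rounds of \<open>lproc\<close>.\<close>

lemma total_time_bound: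
  assumes k: "k = z ^ 6" and Q: "Q = z ^ 3" and z2: "2 \<le> z" and n1: "1 \<le> n"
  shows "total_time \<le> 5000 * (scales + 1) * (n ^ 4 * (z ^ (8 * z ^ 8)) ^ 5)"
proof -
  define c where "c = z ^ (8 * z ^ 8)"
  have pw: "z ^ a \<le> z ^ b" if "a \<le> b" for a b using power_increasing[OF that, of z] z2 by simp
  have z8: "z ^ 2 * z ^ 6 = z ^ 8" by (simp flip: power_add)
  have four: "4 \<le> z ^ 2" using power_mono[OF z2, of 2] by simp
  \<comment> \<open>The largest exponent to be absorbed is \<open>14 * z^6\<close>, from the address
    tuples.\<close>
  have big: "32 * z ^ 6 \<le> 8 * z ^ 8"
    unfolding z8[symmetric] using mult_le_mono1[OF four, of "z ^ 6"] by simp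
  have z6: "1 \<le> z ^ 6" using z2 by simp
  have c1: "1 \<le> c" using z2 by (simp add: c_def)
  have e8: "8 \<le> 8 * z ^ 8" using z2 by simp
  have zc: "z \<le> c" using pw[of 1 "8 * z ^ 8"] e8 by (simp add: c_def)
  have z3c: "z ^ 3 \<le> c" unfolding c_def by (rule pw) (use e8 in linarith)
  have z6c: "z ^ 6 \<le> c" unfolding c_def by (rule pw) (use e8 in linarith)
  have z8c: "z ^ 8 \<le> c" unfolding c_def by (rule pw) (use e8 in linarith)
  have kc: "k \<le> c" "Q \<le> c" using z6c z3c k Q by simp_all
  have zkc: "z ^ k \<le> c" unfolding c_def k by (rule pw) (use big in linarith)
  have tup: "((z + k) * k + 1) ^ k \<le> c"
  proof -
    have "z + k \<le> 2 * z ^ 6" using pw[of 1 6] by (simp add: k)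
    also have "\<dots> \<le> z * z ^ 6" using z2 by (rule mult_le_mono1)
    finally have "(z + k) * k \<le> z * z ^ 6 * z ^ 6" unfolding k by (rule mult_le_mono1)
    also have "\<dots> = z ^ 13" by (simp add: eval_nat_numeral)
    finally have "(z + k) * k + 1 \<le> 2 * z ^ 13" using z2 one_le_power[of z 13] by linarith
    also have "\<dots> \<le> z * z ^ 13" using z2 by (rule mult_le_mono1)
    also have "\<dots> = z ^ 14" by (simp add: eval_nat_numeral)
    finally have "((z + k) * k + 1) ^ k \<le> (z ^ 14) ^ k" by (rule power_mono) simp
    also have "\<dots> = z ^ (14 * z ^ 6)" by (simp add: power_mult[symmetric] k)
    also have "\<dots> \<le> c" unfolding c_def by (rule pw) (use big in linarith)
    finally show ?thesis .
  qed
  have guess: "(z ^ 8) ^ (z ^ 8) = c" by (simp add: c_def power_mult[symmetric])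
  have cc: "c \<le> c * c" using c1 by simp
  define E where "E = eval_time z k"
  have E: "E \<le> 61 * (c * c)"
  proof -
    have "E \<le> c * (12 * c + 25) + 4 * c + 20"
      unfolding E_def eval_time_def by (intro add_mono mult_le_mono zkc) (use kc in auto)
    also have "\<dots> = 12 * (c * c) + 29 * c + 20" by (simp add: algebra_simps)
    also have "\<dots> \<le> 61 * (c * c)" using cc c1 by linarith
    finally show ?thesis .
  qed
  define p where "p = n * (c * c)"
  have ccp: "c * c \<le> p" using n1 by (simp add: p_def)
  have np: "n \<le> p" using c1 by (simp add: p_def)
  have cp: "c \<le> p" "1 \<le> p" using ccp cc c1 by linarith+
  define pk where "pk = prog_data.pick_time n z k"
  interpret P: prog_data gq n l w z k Q 0 0 "real 0 * w 0" "\<lambda>_. 0" "\<lambda>_. 0" 0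
    by unfold_locales (simp_all add: z_pos k_pos)
  have pk: "pk + 3 \<le> 165 * p"
  proof -
    have "n * (E + 16) \<le> n * (77 * (c * c))" using E cc c1 by (intro mult_le_mono) linarith+
    also have "\<dots> = 77 * p" by (simp add: p_def)
    finally show ?thesis unfolding pk_def P.pick_time_def E_def[symmetric] using E ccp cp by linarith
  qed
  define y where "y = c * (c * (n * p))"
  have np1: "1 \<le> n * p" "p \<le> n * p" using n1 cp by simp_all
  have cnp: "n * p \<le> c * (n * p)" "c * (n * p) \<le> y" using c1 by (simp_all add: y_def)
  have y1: "1 \<le> y" using np1 cnp by linarith
  have cy: "c * c \<le> y" "c \<le> y" using cnp np1 ccp cp by linarith+
  have ny: "n \<le> y" using np np1 cnp by linarith
  have build: "P.build_time \<le> 919 * y"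
  proof -
    have a: "(z + k) * (k * (pk + 3) + 10) \<le> 350 * y"
    proof -
      have "k * (pk + 3) \<le> c * (165 * p)" by (intro mult_le_mono kc pk)
      moreover have "c * (165 * p) = 165 * (c * p)" "1 \<le> c * p" using c1 cp by simp_all
      ultimately have "k * (pk + 3) + 10 \<le> 175 * (c * p)" by linarith
      moreover have "z + k \<le> 2 * c" using zc kc by linarith
      ultimately have "(z + k) * (k * (pk + 3) + 10) \<le> (2 * c) * (175 * (c * p))" by (rule mult_le_mono[rotated])
      also have "\<dots> = 350 * (c * (c * p))" by simp
      also have "c * (c * p) \<le> y" unfolding y_def by (intro mult_le_mono order_refl np1)
      finally show ?thesis by simp
    qed
    have b: "z * ((Q + 2) * (n * (pk + 3) + 8) + 10) \<le> 529 * y"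
    proof -
      have "n * (pk + 3) \<le> n * (165 * p)" by (intro mult_le_mono order_refl pk)
      moreover have "n * (165 * p) = 165 * (n * p)" by simp
      ultimately have "n * (pk + 3) + 8 \<le> 173 * (n * p)" using np1 by linarith
      moreover have "Q + 2 \<le> 3 * c" using kc c1 by linarith
      ultimately have "(Q + 2) * (n * (pk + 3) + 8) \<le> (3 * c) * (173 * (n * p))" by (rule mult_le_mono[rotated])
      moreover have "(3 * c) * (173 * (n * p)) = 519 * (c * (n * p))" by simp
      ultimately have "(Q + 2) * (n * (pk + 3) + 8) + 10 \<le> 529 * (c * (n * p))" using cnp np1 by linarith
      then have "z * ((Q + 2) * (n * (pk + 3) + 8) + 10) \<le> c * (529 * (c * (n * p)))" by (intro mult_le_mono zc)
      then show ?thesis by (simp add: y_def)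
    qed
    have "(z + k) * k \<le> (2 * c) * c" using zc kc by (intro mult_le_mono) linarith+
    then have d: "(z + k) * k \<le> 2 * (c * c)" by simp
    define X1 where "X1 = (z + k) * (k * (pk + 3) + 10)"
    define X2 where "X2 = z * ((Q + 2) * (n * (pk + 3) + 8) + 10)"
    define X3 where "X3 = (z + k) * k"
    have X3: "X3 \<le> 2 * y" using d[folded X3_def] cy by linarith
    have "X1 + X2 \<le> 350 * y + 529 * y"
      unfolding X1_def X2_def by (rule add_mono[OF a b])
    then have "X1 + X2 + n * 8 \<le> 350 * y + 529 * y + y * 8"
      by (rule add_mono) (use ny in simp)
    then have "X1 + X2 + n * 8 + (X3 + 1) * 4 \<le> 350 * y + 529 * y + y * 8 + (2 * y + 1) * 4"
      by (rule add_mono) (use X3 in simp)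
    then have "X1 + X2 + n * 8 + (X3 + 1) * 4 + 20 \<le> 350 * y + 529 * y + y * 8 + (2 * y + 1) * 4 + 20 * y"
      by (rule add_mono) (use y1 in simp)
    also have "\<dots> \<le> 919 * y" using y1 by simp
    finally show ?thesis
      unfolding P.build_time_def pk_def[symmetric] X1_def X2_def X3_def .
  qed
  have nc: "n * 1 \<le> n * c" "1 * c \<le> n * c" using n1 c1 by (intro mult_le_mono; simp)+
  have final: "P.final_time \<le> 86 * y"
  proof -
    have "12 * n + 12 * c + 50 \<le> 74 * (n * c)" using nc n1 by linarith
    then have "((z + k) * k + 1) ^ k * (n * 12 + 12 * k + 50) \<le> c * (74 * (n * c))"
      using kc by (intro mult_le_mono tup) linarith
    also have "c * (74 * (n * c)) = 74 * p" by (simp add: p_def)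
    finally show ?thesis unfolding P.final_time_def using np1 cnp cp kc by linarith
  qed
  have try_le: "try_time \<le> 1006 * y" unfolding try_time_def using build final y1 by linarith
  define Y where "Y = n * (n * (c * y))"
  have cyy: "y \<le> c * y" "c * y \<le> n * (c * y)" "n * (c * y) \<le> Y" using c1 n1 by (simp_all add: Y_def)
  have guesses: "guesses_time \<le> 1034 * (c * y)"
  proof -
    have "try_time + 4 * z ^ 8 + 12 \<le> 1022 * y" using try_le z8c cy y1 by linarith
    then have "c * (try_time + 4 * z ^ 8 + 12) \<le> c * (1022 * y)" by (rule mult_le_mono2)
    then have "c * (try_time + 4 * z ^ 8 + 12) \<le> 1022 * (c * y)" by simp
    then show ?thesis unfolding guesses_time_def guess using z8c cy y1 cyy by linarith
  qed
  have scale: "scale_time \<le> 4163 * Y"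
  proof -
    have n2: "n + 1 \<le> 2 * n" using n1 by simp
    have "guesses_time + 3 \<le> 1037 * (c * y)" using guesses cyy y1 by linarith
    with n2 have "(n + 1) * (guesses_time + 3) \<le> (2 * n) * (1037 * (c * y))" by (rule mult_le_mono)
    then have "(n + 1) * (guesses_time + 3) \<le> 2074 * (n * (c * y))" by simp
    then have "(n + 1) * (guesses_time + 3) + 6 \<le> 2080 * (n * (c * y))" using cyy y1 by linarith
    with n2 have "(n + 1) * ((n + 1) * (guesses_time + 3) + 6) \<le> (2 * n) * (2080 * (n * (c * y)))" by (rule mult_le_mono)
    then have "(n + 1) * ((n + 1) * (guesses_time + 3) + 6) \<le> 4160 * Y" by (simp add: Y_def)
    then show ?thesis unfolding scale_time_def using cyy y1 by linarith
  qed
  have "scale_time + 5 \<le> 5000 * Y" using scale cyy y1 by linarith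
  then have "scales * (scale_time + 5) \<le> scales * (5000 * Y)" by (rule mult_le_mono2)
  moreover have "2 * z + 2 * z ^ 3 + 2 * z ^ 6 + 2 * z ^ 8 + (z + k) * 4 + n * 15 + 40 \<le> 5000 * Y"
  proof -
    have yY: "y \<le> Y" using cyy by (meson order_trans)
    then have "c \<le> Y" "n \<le> Y" "1 \<le> Y" using cy(2) ny y1 by (meson order_trans)+
    moreover have "2 * z + 2 * z ^ 3 + 2 * z ^ 6 + 2 * z ^ 8 + (z + k) * 4 + n * 15 + 40
        \<le> 2 * c + 2 * c + 2 * c + 2 * c + (c + c) * 4 + n * 15 + 40"
      by (intro add_mono mult_le_mono order_refl zc z3c z6c z8c kc)
    ultimately show ?thesis by simp
  qed
  ultimately have "total_time \<le> scales * (5000 * Y) + 5000 * Y" unfolding total_time_def by linarith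
  also have "\<dots> = 5000 * (scales + 1) * Y" by (simp add: algebra_simps)
  also have "Y = n ^ 4 * c ^ 5" by (simp add: Y_def y_def p_def eval_nat_numeral)
  finally show ?thesis by (simp add: c_def)
qed

text \<open>Minimality gives \<open>2 ^ (scales - 1) < 2 * n\<close>; the estimate
  \<open>ln 2 \<ge> 1 / 2\<close> turns the binary logarithm into at most
  \<open>2 * ln n\<close>.\<close>

lemma scales_bound: "1 \<le> n \<Longrightarrow> real (scales + 1) \<le> 3 + 2 * ln (real n)"
proof -
  assume n: "1 \<le> n"
  show ?thesis
  proof (cases "scales = 0")
    case True
    then show ?thesis using ln_ge_zero[of "real n"] n by simp
  next
    case False
    then have "2 ^ (scales - 1) < 2 * n" using scales[of "scales - 1"] by simp
    then have "(2::real) ^ (scales - 1) \<le> 2 * real n" by (metis less_imp_le of_nat_le_iff of_nat_mult of_nat_numeral of_nat_power)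
    then have "ln ((2::real) ^ (scales - 1)) \<le> ln (2 * real n)" using n by (intro ln_mono) auto
    then have le: "real (scales - 1) * ln 2 \<le> ln 2 + ln (real n)" using n by (simp add: ln_realpow ln_mult)
    have ln2: "1 / 2 \<le> ln (2::real)"
    proof -
      have "exp (1 / 2 :: real) ^ 2 = exp 1" by (simp add: exp_of_nat_mult[symmetric])
      also have "\<dots> \<le> 2 ^ 2" using exp_le by simp
      finally have "exp (1 / 2 :: real) \<le> 2" by (rule power2_le_imp_le) simp
      then show ?thesis by (subst ln_ge_iff) simp_all
    qed
    have ln0: "0 \<le> ln (real n)" using n by simp
    have "(real (scales - 1) - 1) * ln 2 \<le> ln (real n)" using le by (simp add: left_diff_distrib)
    then have "real (scales - 1) - 1 \<le> 2 * ln (real n)"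
    proof (cases "1 \<le> real (scales - 1)")
      case True
      have "(real (scales - 1) - 1) * (1 / 2) \<le> (real (scales - 1) - 1) * ln 2"
        using True ln2 by (intro mult_left_mono) auto
      also have "\<dots> \<le> ln (real n)" by fact
      finally show ?thesis by (simp add: mult_ac)
    qed (use ln0 in linarith)
    then show ?thesis using False by simp
  qed
qed

end

text \<open>The curvature is nonnegative, since the minimum is at most the ratio of item 0. That
  ratio is 1 by convention or at most 1 by submodularity.\<close>

lemma curvature_le_1:
  fixes g :: "nat set \<Rightarrow> real"
  assumes "nonneg_on {..<n} g" "submodular {..<n} g" "1 \<le> n"
  shows "1 - curvature {..<n} g \<le> 1"
proof -
  let ?r = "\<lambda>e::nat. if g {e} = 0 then 1 else marginal g ({..<n} - {e}) {e} / g {e}"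
  have "?r 0 \<le> 1"
  proof (cases "g {0} = 0")
    case False
    have zero: "0 \<in> {..<n}" using assms(3) by simp
    have nn: "0 \<le> g {0}" "0 \<le> g {}" using assms(1) zero by (auto simp: nonneg_on_def)
    have "g (({..<n} - {0}) \<union> {0}) + g (({..<n} - {0}) \<inter> {0}) \<le> g ({..<n} - {0}) + g {0}"
      using assms(2) zero unfolding submodular_def by (metis Diff_subset empty_subsetI insert_subset)
    then have "marginal g ({..<n} - {0}) {0} \<le> g {0}" using nn by (simp add: marginal_def)
    moreover have "0 < g {0}" using False nn by simp
    ultimately show ?thesis by simp
  qed simp
  moreover have "Min (?r ` {..<n}) \<le> ?r 0" using assms(3) by (intro Min_le imageI) auto
  ultimately show ?thesis by (simp add: curvature_def)
qed

lemma bounded_initially: "\<exists>C\<ge>1. \<forall>z\<le>N. f z \<le> (C :: real)" for f :: "nat \<Rightarrow> real"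
proof (intro exI[of _ "max 1 (Max (f ` {..N}))"] conjI allI impI)
  fix z assume "z \<le> N"
  then have "f z \<le> Max (f ` {..N})" by (intro Max_ge) auto
  then show "f z \<le> max 1 (Max (f ` {..N}))" by simp
qed simp

text \<open>Put \<open>x = 1 / \<epsilon>\<close>, so that \<open>z \<le> 11 * x\<close>. Bounding
  \<open>z\<close> by a power of \<open>x\<close> requires \<open>x\<close> to stay away from 1: for
  \<open>x > 2\<close> one has \<open>11 * x \<le> x^5\<close>, which turns the exponent
  \<open>40 * z^8\<close> into \<open>200 * z^8 \<le> 200 * 11^8 * x^8\<close>. For
  \<open>x \<le> 2\<close> there are only finitely many values \<open>z \<le> 21\<close>, absorbed
  by the constant.\<close>

lemma epsilon_cost:
  "\<exists>C\<ge>1. \<forall>\<epsilon>. 0 < \<epsilon> \<and> \<epsilon> < 1 \<longrightarrow> (\<forall>z. z = nat \<lceil>10 / \<epsilon>\<rceil> \<longrightarrow>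
     real ((z ^ (8 * z ^ 8)) ^ 5) \<le> C * (1 / \<epsilon>) powr (200 * 11 ^ 8 * (1 / \<epsilon>) ^ 8))"
proof -
  obtain C where C: "1 \<le> C" "\<And>z. z \<le> 21 \<Longrightarrow> real ((z ^ (8 * z ^ 8)) ^ 5) \<le> C"
    using bounded_initially[of 21 "\<lambda>z. real ((z ^ (8 * z ^ 8)) ^ 5)"] by blast
  have "real ((z ^ (8 * z ^ 8)) ^ 5) \<le> C * (1 / \<epsilon>) powr (200 * 11 ^ 8 * (1 / \<epsilon>) ^ 8)"
    if e: "0 < \<epsilon>" "\<epsilon> < 1" and z: "z = nat \<lceil>10 / \<epsilon>\<rceil>" for \<epsilon> :: real and z
  proof -
    define x where "x = 1 / \<epsilon>"
    define K where "K = (11::real) ^ 8"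
    have K0: "0 \<le> K" by (simp add: K_def)
    have x1: "1 < x" using e by (simp add: x_def)
    have "real z = of_int \<lceil>10 * x\<rceil>" using e by (simp add: z x_def)
    then have zx: "real z \<le> 11 * x" "real z \<le> 10 * x + 1" using x1 by linarith+
    have p1: "1 \<le> x powr (200 * K * x ^ 8)" using x1 K0 by (intro ge_one_powr_ge_zero) auto
    show ?thesis
    proof (cases "x \<le> 2")
      case True
      then have "z \<le> 21" using zx by linarith
      then have "real ((z ^ (8 * z ^ 8)) ^ 5) \<le> C * 1" using C(2) by simp
      also have "\<dots> \<le> C * x powr (200 * K * x ^ 8)" using p1 C(1) by (intro mult_left_mono) auto
      finally show ?thesis by (simp add: x_def K_def)
    next
      case False
      have "2 ^ 4 \<le> x ^ 4" using False by (intro power_mono) auto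
      then have "11 * x \<le> x ^ 4 * x" using x1 by (intro mult_right_mono) auto
      then have "real z \<le> x ^ 5" using zx by (simp add: eval_nat_numeral)
      have "real ((z ^ (8 * z ^ 8)) ^ 5) = real z ^ (40 * z ^ 8)"
        by (simp add: power_mult[symmetric] mult.commute)
      also have "\<dots> \<le> (x ^ 5) ^ (40 * z ^ 8)" by (rule power_mono[OF \<open>real z \<le> x ^ 5\<close>]) simp
      also have "\<dots> = x ^ (200 * z ^ 8)" by (simp add: power_mult[symmetric])
      also have "\<dots> = x powr real (200 * z ^ 8)" using x1 by (subst powr_realpow) auto
      also have "\<dots> \<le> x powr (200 * K * x ^ 8)"
      proof (rule powr_mono)
        have "real z ^ 8 \<le> (11 * x) ^ 8" by (rule power_mono[OF zx(1)]) simp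
        also have "\<dots> = K * x ^ 8" unfolding K_def by (rule power_mult_distrib)
        finally show "real (200 * z ^ 8) \<le> 200 * K * x ^ 8" by simp
      qed (use x1 in simp)
      also have "\<dots> \<le> C * x powr (200 * K * x ^ 8)" using C(1) by (simp add: mult_le_cancel_right1)
      finally show ?thesis by (simp add: x_def K_def)
    qed
  qed
  then show ?thesis using C(1) by blast
qed

text \<open>For a nonempty optimum of value \<open>F > 0\<close> some scale satisfies
  \<open>F \<le> T \<le> 2 * F\<close>, so the loss \<open>5 * T / z\<close> of a right guess is at
  most \<open>10 * F / z\<close>. This is where \<open>z \<ge> 10 / \<epsilon>\<close> comes
  from.\<close>

lemma algorithm_correct:
  fixes n :: nat and g l :: "nat set \<Rightarrow> real" and w :: "nat \<Rightarrow> real" and \<epsilon> :: real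
  assumes g: "nonneg_on {..<n} g" "monotone_setfun {..<n} g" "submodular {..<n} g"
    and l: "nonneg_on {..<n} l" "linear_setfun {..<n} l"
    and w: "\<forall>e\<in>{..<n}. 0 \<le> w e \<and> w e \<le> 1" and \<epsilon>: "0 < \<epsilon>" "\<epsilon> < 1"
  defines "z \<equiv> nat \<lceil>10 / \<epsilon>\<rceil>"
  obtains m' where "ev n g Algorithm (init_memory n l w \<epsilon>) m' (outer.total_time n z (z ^ 6) (z ^ 3))"
    "(\<Sum>e\<in>stored_set n 1 m'. w e) \<le> 1"
    "\<forall>Opt. is_arg_max (\<lambda>T. g T + l T) (\<lambda>T. T \<subseteq> {..<n} \<and> (\<Sum>e\<in>T. w e) \<le> 1) Opt \<longrightarrow>
       (1 - 1 / exp 1) * g Opt + l Opt - \<epsilon> * (g Opt + l Opt) \<le> g (stored_set n 1 m') + l (stored_set n 1 m')"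
    "2 \<le> z" "outer (\<lambda>_. 0) z (z ^ 6) (z ^ 3)"
proof -
  \<comment> \<open>Outside \<open>{..<n}\<close> the given functions are arbitrary, whereas the
    initial memory stores 0. The analysis works with the stored versions.\<close>
  define w' where "w' = (\<lambda>i. if i < n then w i else 0)"
  define l' where "l' = (\<lambda>i. if i < n then l {i} else 0)"
  define gg where "gg S = g ({..<n} \<inter> S)" for S
  define k where "k = z ^ 6"
  define Q where "Q = z ^ 3"
  have zr: "10 / \<epsilon> \<le> real z" using \<epsilon> by (simp add: z_def)
  have "10 < 10 / \<epsilon>" using \<epsilon> by (simp add: field_simps)
  then have z10: "10 < real z" using zr by linarith
  then have z2: "2 \<le> z" by linarith
  have z0: "0 < z" using z2 by simp
  have w'0: "0 \<le> w' e" for e using w by (simp add: w'_def)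
  have w'1: "w' e \<le> 1" if "e < n" for e using w that by (simp add: w'_def)
  have l'0: "0 \<le> l' e" for e using l(1) by (simp add: l'_def nonneg_on_def)
  have sw: "sum w' S = sum w S" if "S \<subseteq> {..<n}" for S
    using that by (intro sum.cong) (auto simp: w'_def)
  have sl: "sum l' S = l S" if "S \<subseteq> {..<n}" for S
  proof -
    have "l S = (\<Sum>e\<in>S. l {e})" using l(2) that by (simp add: linear_setfun_def)
    also have "\<dots> = sum l' S" using that by (intro sum.cong) (auto simp: l'_def)
    finally show ?thesis ..
  qed
  have gS: "gg S = g S" if "S \<subseteq> {..<n}" for S using that by (simp add: gg_def Int_absorb1)
  have ms: "mono_submod gg"
  proof
    show "gg S \<le> gg S'" if "S \<subseteq> S'" for S S'
    proof -
      have "{..<n} \<inter> S \<subseteq> {..<n} \<inter> S'" "{..<n} \<inter> S' \<subseteq> {..<n}" using that by auto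
      then show ?thesis using g(2) unfolding monotone_setfun_def gg_def by blast
    qed
    show "gg (S \<union> S') + gg (S \<inter> S') \<le> gg S + gg S'" for S S'
    proof -
      have "{..<n} \<inter> (S \<union> S') = ({..<n} \<inter> S) \<union> ({..<n} \<inter> S')"
        "{..<n} \<inter> (S \<inter> S') = ({..<n} \<inter> S) \<inter> ({..<n} \<inter> S')" by auto
      moreover have "{..<n} \<inter> S \<subseteq> {..<n}" "{..<n} \<inter> S' \<subseteq> {..<n}" by auto
      ultimately show ?thesis using g(3) unfolding submodular_def gg_def by simp
    qed
    show "0 \<le> gg S" for S using g(1) by (simp add: nonneg_on_def gg_def)
  qed
  interpret gg: mono_submod gg by (rule ms)
  have len: "(z + 1) * k + (Q + 2) \<le> z ^ 8"
  proof -
    have "8 \<le> Q" using power_mono[OF z2, of 3] by (simp add: Q_def)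
    moreover have "k = Q * Q" by (simp add: k_def Q_def flip: power_add)
    moreover have "8 * Q \<le> Q * Q" using calculation(1) by (rule mult_le_mono1)
    ultimately have "Q + 2 \<le> k" by linarith
    then have "(z + 1) * k + (Q + 2) \<le> (z + 2) * k" by (simp add: algebra_simps)
    also have "z + 2 \<le> z * z" using mult_le_mono1[OF z2, of z] z2 by linarith
    then have "(z + 2) * k \<le> (z * z) * k" by (rule mult_le_mono1)
    also have "\<dots> = z ^ 8" by (simp add: k_def eval_nat_numeral)
    finally show ?thesis .
  qed
  interpret outer g n l' w' z k Q
    by unfold_locales (use z0 w'0 len in \<open>auto simp: k_def\<close>)
  interpret P: prog_data g n l' w' z k Q 0 T "real 0 * w' 0" "\<lambda>_. 0" "\<lambda>_. 0" 0 for T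
    by unfold_locales (simp_all add: z0 k_def)
  let ?m0 = "init_memory n l w \<epsilon>"
  have m0: "narr ?m0 = (\<lambda>a i. if a = 0 \<and> i = 0 then n else 0)" "rarr ?m0 1 = w'" "rarr ?m0 2 = l'"
    "rarr ?m0 4 0 = 0" "rarr ?m0 0 0 = \<epsilon>"
    by (auto simp: init_memory_def w'_def l'_def fun_eq_iff)
  have zm: "z = nat \<lceil>10 / rarr ?m0 0 0\<rceil>" by (simp add: m0(5) z_def)
  have "\<exists>m'. ev n g Algorithm ?m0 m' total_time \<and> P.outok m' \<and> g {} \<le> rarr m' 3 0 \<and>
     (\<exists>M. (\<forall>e<n. g {e} + l' e \<le> M) \<and> 0 \<le> M \<and> (M = 0 \<or> (\<exists>e<n. M = g {e} + l' e)) \<and>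
       (\<forall>p. 2 ^ p < 2 * n \<longrightarrow> (\<forall>t\<le>n. \<forall>bb\<le>n. \<forall>i<(z ^ 8) ^ (z ^ 8).
          found g n l' w' z k Q (2 ^ p * M) t bb (guess_of i) (rarr m' 3 0))))"
    by (rule ht_exD[OF ht_Algorithm[OF k_def Q_def zm m0(1-4)]])
  then obtain m' where m': "ev n g Algorithm ?m0 m' total_time" "P.outok m'" "g {} \<le> rarr m' 3 0"
    and exM: "\<exists>M. (\<forall>e<n. g {e} + l' e \<le> M) \<and> 0 \<le> M \<and> (M = 0 \<or> (\<exists>e<n. M = g {e} + l' e)) \<and>
       (\<forall>p. 2 ^ p < 2 * n \<longrightarrow> (\<forall>t\<le>n. \<forall>bb\<le>n. \<forall>i<(z ^ 8) ^ (z ^ 8).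
          found g n l' w' z k Q (2 ^ p * M) t bb (guess_of i) (rarr m' 3 0)))"
    by (elim exE) (elim conjE, rule that, assumption+)
  from exM obtain M where M: "\<forall>e<n. g {e} + l' e \<le> M" "0 \<le> M" "M = 0 \<or> (\<exists>e<n. M = g {e} + l' e)"
    and fnd0: "\<forall>p. 2 ^ p < 2 * n \<longrightarrow> (\<forall>t\<le>n. \<forall>bb\<le>n. \<forall>i<(z ^ 8) ^ (z ^ 8).
          found g n l' w' z k Q (2 ^ p * M) t bb (guess_of i) (rarr m' 3 0))"
    by (elim exE) (elim conjE, rule that, assumption+)
  note fnd = fnd0[rule_format]
  let ?S = "stored_set n 1 m'"
  have Sn: "?S \<subseteq> {..<n}" by (auto simp: stored_set_def)
  have out: "sum w ?S \<le> 1" "rarr m' 3 0 = g ?S + l ?S"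
    using m'(2) sw[OF Sn] sl[OF Sn] by (simp_all add: P.outok_def P.obj_def)
  have main: "(1 - 1 / exp 1) * g Opt + l Opt - \<epsilon> * (g Opt + l Opt) \<le> g ?S + l ?S"
    if opt: "is_arg_max (\<lambda>T. g T + l T) (\<lambda>T. T \<subseteq> {..<n} \<and> (\<Sum>e\<in>T. w e) \<le> 1) Opt" for Opt
  proof -
    define F where "F = g Opt + l Opt"
    have On: "Opt \<subseteq> {..<n}" "sum w Opt \<le> 1" using opt by (auto simp: is_arg_max_def)
    have best: "g T + l T \<le> F" if "T \<subseteq> {..<n}" "sum w T \<le> 1" for T
      using opt that unfolding is_arg_max_def F_def by (meson not_less)
    have g0: "0 \<le> g Opt" "0 \<le> l Opt" using g(1) l(1) On by (auto simp: nonneg_on_def)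
    have le_F: "(1 - 1 / exp 1) * g Opt + l Opt - \<epsilon> * F \<le> F"
    proof -
      have "(1 - 1 / exp 1) * g Opt \<le> 1 * g Opt" using g0 by (intro mult_right_mono) auto
      moreover have "0 \<le> \<epsilon> * F" using \<epsilon> g0 by (simp add: F_def)
      ultimately show ?thesis by (simp add: F_def)
    qed
    have "(1 - 1 / exp 1) * g Opt + l Opt - \<epsilon> * F \<le> rarr m' 3 0"
    \<comment> \<open>Here \<open>M\<close> may be 0, which would make every scale 0; the recorded
      value of the empty set is already optimal.\<close>
    proof (cases "Opt = {} \<or> F = 0")
      case True
      have "l {} = 0" using l(2) by (simp add: linear_setfun_def)
      moreover have "0 \<le> g {}" using g(1) by (simp add: nonneg_on_def)
      ultimately have "F \<le> g {}" using True by (auto simp: F_def)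
      then show ?thesis using le_F m'(3) by linarith
    next
      case False
      then have ne: "Opt \<noteq> {}" and Fpos: "0 < F" using g0 by (auto simp: F_def)
      have finO: "finite Opt" by (rule finite_subset[OF On(1)]) simp
      have single: "g {e} + l' e \<le> F" if "e < n" for e
        using best[of "{e}"] that w by (simp add: l'_def)
      \<comment> \<open>By submodularity \<open>g\<close> of the optimum is at most the sum over its
        singletons, minus \<open>card Opt - 1\<close> copies of \<open>gg {}\<close>; these are
        nonnegative since \<open>Opt\<close> is not empty.\<close>
      have FnM: "F \<le> real n * M"
      proof -
        have "gg (Opt \<union> {}) - gg {} \<le> (\<Sum>e\<in>Opt. gg (insert e {}) - gg {})"
          by (rule gg.gain_le_sum_marginals[OF finO])
        also have "\<dots> = (\<Sum>e\<in>Opt. gg {e}) - real (card Opt) * gg {}" by (simp add: sum_subtractf)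
        finally have a: "gg Opt \<le> (\<Sum>e\<in>Opt. gg {e}) - (real (card Opt) - 1) * gg {}" by (simp add: algebra_simps)
        have "1 \<le> real (card Opt)" using ne finO by (simp add: Suc_le_eq card_gt_0_iff)
        then have "0 \<le> (real (card Opt) - 1) * gg {}" using gg.nonneg by simp
        then have "gg Opt \<le> (\<Sum>e\<in>Opt. gg {e})" using a by linarith
        then have "F \<le> (\<Sum>e\<in>Opt. gg {e}) + sum l' Opt" using gS[OF On(1)] sl[OF On(1)] by (simp add: F_def)
        also have "\<dots> = (\<Sum>e\<in>Opt. gg {e} + l' e)" by (simp add: sum.distrib)
        also have "\<dots> \<le> real (card Opt) * M"
        proof (rule sum_bounded_above)
          fix e assume "e \<in> Opt"
          then have "e < n" using On(1) by auto
          then show "gg {e} + l' e \<le> M" using M(1) gS[of "{e}"] by simp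
        qed
        also have "\<dots> \<le> real n * M"
          using card_mono[OF _ On(1)] M(2) by (intro mult_right_mono) auto
        finally show ?thesis .
      qed
      have Mpos: "0 < M" using FnM Fpos M(2) by (metis mult_zero_right not_le order.order_iff_strict)
      have MF: "M \<le> F" using M(3) single Mpos by auto
      \<comment> \<open>Minimality does both jobs: the previous scale misses \<open>F\<close>, so
        \<open>T \<le> 2 * F\<close>, and with \<open>F \<le> n * M\<close> it follows that
        \<open>2 ^ p < 2 * n\<close>, so this scale is visited. For \<open>p = 0\<close>,
        \<open>M \<le> F\<close> is used instead.\<close>
      define p where "p = (LEAST p. F \<le> 2 ^ p * M)"
      have "real n \<le> 2 ^ n" using of_nat_less_two_power[of n] by (simp add: less_imp_le)
      then have "F \<le> 2 ^ n * M" using FnM mult_right_mono[of "real n" "2 ^ n" M] M(2) by linarith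
      then have p: "F \<le> 2 ^ p * M" unfolding p_def by (rule LeastI)
      have n1: "1 \<le> n" using ne On(1) by (cases n) auto
      have p2: "2 ^ p < 2 * n \<and> 2 ^ p * M \<le> 2 * F"
      proof (cases p)
        case 0
        then show ?thesis using n1 MF Mpos by simp
      next
        case (Suc p')
        then have "\<not> F \<le> 2 ^ p' * M" using not_less_Least[of p' "\<lambda>p. F \<le> 2 ^ p * M"] by (simp add: p_def)
        then have lt: "2 ^ p' * M < F" by simp
        then have "2 ^ p' * M < real n * M" using FnM by linarith
        then have "(2::real) ^ p' < real n" using Mpos by simp
        then have "2 ^ p' < n" by (metis of_nat_less_iff of_nat_numeral of_nat_power)
        then show ?thesis using lt by (simp add: Suc)
      qed
      define T where "T = 2 ^ p * M"
      have Tpos: "0 < T" using Mpos by (simp add: T_def)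
      have T_ub: "gg S + sum l' S \<le> T" if "S \<subseteq> {..<n}" "sum w' S \<le> 1" for S
        using best[OF that(1)] that p gS[OF that(1)] sl[OF that(1)] sw[OF that(1)] by (simp add: T_def)
      obtain t bb G where guess: "t \<le> n" "bb \<le> n" "\<forall>x. G x < z ^ 8" "\<forall>x\<ge>z ^ 8. G x = 0"
        and R: "let Bt = real bb * w' t; lam = (\<lambda>j. G (z * k + j)); c = (\<lambda>q. G ((z + 1) * k + q));
         rws = knapsack_data.rows gg n l' w' z k Q t T Bt lam c (guess_policy k G);
         fl = knapsack_data.fillers gg n l' w' z k Q t T Bt lam c (guess_policy k G) k
         in \<exists>R\<subseteq>knapsack_data.pool z k fl. card R \<le> k \<and> R \<subseteq> {..<n} \<and> sum w' (fst (rws z) \<union> R) \<le> 1 \<and>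
         (1 - 1 / exp 1) * gg Opt + sum l' Opt - 5 * (T / real z) \<le> gg (fst (rws z) \<union> R) + sum l' (fst (rws z) \<union> R)"
      proof -
        have dummy: "gg (insert n S) = gg S" for S
        proof -
          have "{..<n} \<inter> insert n S = {..<n} \<inter> S" by auto
          then show ?thesis by (simp add: gg_def)
        qed
        have wn: "w' n = 0" by (simp add: w'_def)
        have O1: "sum w' Opt \<le> 1" using sw[OF On(1)] On(2) by simp
        show ?thesis
        proof (rule exE[OF exists_good_guess[OF ms dummy w'0 wn l'0 z2 Tpos _ _ On(1) O1, folded k_def Q_def]])
          show "gg S + sum l' S \<le> T" if "S \<subseteq> {..<n}" "sum w' S \<le> 1" for S using that by (rule T_ub)
          show "w' e \<le> 1" if "e < n" for e using that by (rule w'1)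
        qed (elim exE conjE, rule that, assumption+)
      qed
      obtain i where i: "i < (z ^ 8) ^ (z ^ 8)" "\<forall>y<z ^ 8. dig (z ^ 8) i y = G y"
        using dig_surj[of "z ^ 8" "z ^ 8" G] guess(3) z0 by auto
      have Gi: "guess_of i = G"
      proof
        fix x show "guess_of i x = G x" using i(2) guess(4) by (cases "x < z ^ 8") (auto simp: guess_of_def)
      qed
      define A where "A = fst (knapsack_data.rows gg n l' w' z k Q t T (real bb * w' t) (\<lambda>j. G (z * k + j))
          (\<lambda>q. G ((z + 1) * k + q)) (guess_policy k G) z)"
      define H where "H = knapsack_data.fillers gg n l' w' z k Q t T (real bb * w' t) (\<lambda>j. G (z * k + j))
          (\<lambda>q. G ((z + 1) * k + q)) (guess_policy k G) k"
      have fd: "\<forall>R\<subseteq>knapsack_data.pool z k H. card R \<le> k \<longrightarrow> sum w' ({..<n} \<inter> (A \<union> R)) \<le> 1 \<longrightarrow>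
          P.obj ({..<n} \<inter> (A \<union> R)) \<le> rarr m' 3 0"
        using fnd[OF conjunct1[OF p2] guess(1,2) i(1)]
        unfolding found_def Let_def Gi T_def[symmetric] gg_def[abs_def, symmetric] A_def[symmetric] H_def[symmetric] .
      obtain R where R': "R \<subseteq> knapsack_data.pool z k H" "card R \<le> k" "R \<subseteq> {..<n}" "sum w' (A \<union> R) \<le> 1"
         "(1 - 1 / exp 1) * gg Opt + sum l' Opt - 5 * (T / real z) \<le> gg (A \<union> R) + sum l' (A \<union> R)"
        using R unfolding Let_def A_def[symmetric] H_def[symmetric] by blast
      have An: "A \<subseteq> {..<n}"
      proof -
        interpret K: knapsack_data gg n l' w' z k Q t T "real bb * w' t" "\<lambda>j. G (z * k + j)" "\<lambda>q. G ((z + 1) * k + q)" .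
        show ?thesis unfolding A_def by (rule K.rows_subset)
      qed
      have int: "{..<n} \<inter> (A \<union> R) = A \<union> R" using An R'(3) by auto
      have "P.obj (A \<union> R) \<le> rarr m' 3 0" using fd[rule_format, OF R'(1,2)] R'(4) unfolding int by simp
      moreover have "gg (A \<union> R) = g (A \<union> R)" using gS An R'(3) by simp
      ultimately have v: "(1 - 1 / exp 1) * g Opt + l Opt - 5 * (T / real z) \<le> rarr m' 3 0"
        using R'(5) gS[OF On(1)] sl[OF On(1)] by (simp add: P.obj_def)
      have "5 * (T / real z) \<le> \<epsilon> * F"
      proof -
        have "5 * T \<le> 10 * F" using conjunct2[OF p2] unfolding T_def by linarith
        also have "10 * F \<le> (\<epsilon> * real z) * F"
          using zr \<epsilon> Fpos by (intro mult_right_mono) (auto simp: pos_divide_le_eq mult.commute)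
        finally show ?thesis using z0 by (simp add: pos_divide_le_eq mult_ac)
      qed
      then show ?thesis using v by linarith
    qed
    then show ?thesis using out(2) by (simp add: F_def)
  qed
  have tt: "total_time = outer.total_time n z (z ^ 6) (z ^ 3)" by (simp add: k_def Q_def)
  \<comment> \<open>The running time depends on the sizes alone, so the size conditions are exported
    with zero weights.\<close>
  have oz: "outer (\<lambda>_. 0) z (z ^ 6) (z ^ 3)"
    by unfold_locales (use z0 len in \<open>simp_all add: k_def Q_def\<close>)
  have main_all: "\<forall>Opt. is_arg_max (\<lambda>T. g T + l T) (\<lambda>T. T \<subseteq> {..<n} \<and> (\<Sum>e\<in>T. w e) \<le> 1) Opt \<longrightarrow>
       (1 - 1 / exp 1) * g Opt + l Opt - \<epsilon> * (g Opt + l Opt) \<le> g ?S + l ?S"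
    using main by (intro allI impI)
  show thesis
    by (rule that[OF m'(1)[unfolded tt] out(1) main_all z2 oz])
qed

theorem theorem3p1:
  "\<exists>(P :: com) (C :: real) (polylog :: real poly) (q :: real poly).
    \<forall>(n :: nat) (g :: nat set \<Rightarrow> real) (l :: nat set \<Rightarrow> real) (w :: nat \<Rightarrow> real) (\<epsilon> :: real).
      nonneg_on {..<n} g \<and> monotone_setfun {..<n} g \<and> submodular {..<n} g \<and>
      nonneg_on {..<n} l \<and> monotone_setfun {..<n} l \<and> linear_setfun {..<n} l \<and>
      (\<forall>e\<in>{..<n}. 0 \<le> w e \<and> w e \<le> 1) \<and> 0 < \<epsilon> \<and> \<epsilon> < 1
      \<longrightarrow>
      (\<exists>t. halts_within P n g l w \<epsilon> t \<and>
           (\<forall>S\<in>set_pmf (output_set P n g l w \<epsilon> t). S \<subseteq> {..<n} \<and> (\<Sum>e\<in>S. w e) \<le> 1) \<and>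
           (\<forall>Opt. is_arg_max (\<lambda>T. g T + l T) (\<lambda>T. T \<subseteq> {..<n} \<and> (\<Sum>e\<in>T. w e) \<le> 1) Opt \<longrightarrow>
              measure_pmf.expectation (output_set P n g l w \<epsilon> t) (\<lambda>S. g S + l S)
                \<ge> (1 - 1 / exp 1) * g Opt + l Opt - \<epsilon> * (g Opt + l Opt)) \<and>
           (let c = curvature {..<n} g in
              n \<ge> 1 \<and> c < 1 \<longrightarrow>
              real t \<le> C * (real n ^ 4 * poly polylog (ln (real n)) / (1 - c)\<^sup>2)
                         * (1 / \<epsilon> * max 1 (ln (1 / (1 - c)))) powr (poly q (1 / \<epsilon>) / (1 - c))))"
proof -
  obtain C where C: "1 \<le> C" "\<And>\<epsilon> z. 0 < \<epsilon> \<Longrightarrow> \<epsilon> < 1 \<Longrightarrow> z = nat \<lceil>10 / \<epsilon>\<rceil> \<Longrightarrow>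
     real ((z ^ (8 * z ^ 8)) ^ 5) \<le> C * (1 / \<epsilon>) powr (200 * 11 ^ 8 * (1 / \<epsilon>) ^ 8)"
    using epsilon_cost by blast
  define K where "K = 200 * (11::real) ^ 8"
  show ?thesis
  \<comment> \<open>The polynomial \<open>3 + 2 * x\<close> bounds the number of scales, 5000 stems
    from the step count, and \<open>K * x^8\<close> with \<open>K = 200 * 11^8\<close> is the
    exponent from \<open>epsilon_cost\<close>.\<close>
  proof (rule exI[of _ Algorithm], rule exI[of _ "5000 * C"], rule exI[of _ "[:3, 2:]"],
      rule exI[of _ "monom K 8"], intro allI impI)
    fix n :: nat and g l :: "nat set \<Rightarrow> real" and w :: "nat \<Rightarrow> real" and \<epsilon> :: real
    assume asm: "nonneg_on {..<n} g \<and> monotone_setfun {..<n} g \<and> submodular {..<n} g \<and>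
      nonneg_on {..<n} l \<and> monotone_setfun {..<n} l \<and> linear_setfun {..<n} l \<and>
      (\<forall>e\<in>{..<n}. 0 \<le> w e \<and> w e \<le> 1) \<and> 0 < \<epsilon> \<and> \<epsilon> < 1"
    then have g: "nonneg_on {..<n} g" "monotone_setfun {..<n} g" "submodular {..<n} g"
      and l: "nonneg_on {..<n} l" "linear_setfun {..<n} l"
      and w: "\<forall>e\<in>{..<n}. 0 \<le> w e \<and> w e \<le> 1" and \<epsilon>: "0 < \<epsilon>" "\<epsilon> < 1"
      by simp_all
    define z where "z = nat \<lceil>10 / \<epsilon>\<rceil>"
    obtain m' where m': "ev n g Algorithm (init_memory n l w \<epsilon>) m' (outer.total_time n z (z ^ 6) (z ^ 3))"
      and feasible: "(\<Sum>e\<in>stored_set n 1 m'. w e) \<le> 1"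
      and approx: "\<forall>Opt. is_arg_max (\<lambda>T. g T + l T) (\<lambda>T. T \<subseteq> {..<n} \<and> (\<Sum>e\<in>T. w e) \<le> 1) Opt \<longrightarrow>
       (1 - 1 / exp 1) * g Opt + l Opt - \<epsilon> * (g Opt + l Opt) \<le> g (stored_set n 1 m') + l (stored_set n 1 m')"
      and z2: "2 \<le> z" and oz: "outer (\<lambda>_. 0) z (z ^ 6) (z ^ 3)"
      by (rule algorithm_correct[OF g l w \<epsilon>, folded z_def]) (rule that, assumption+)
    interpret outer g n "\<lambda>_. 0" "\<lambda>_. 0" z "z ^ 6" "z ^ 3" by (rule oz)
    obtain t where t: "t \<le> total_time" "\<And>cs. run n g (Algorithm # cs, init_memory n l w \<epsilon>) t = return_pmf (cs, m')"
      using m' unfolding ev_def by blast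
    \<comment> \<open>No coin is tossed: the output distribution is a point mass, and its
      expectation is the value of the one set returned.\<close>
    have exec: "exec Algorithm n g l w \<epsilon> t = return_pmf ([], m')" unfolding exec_def by (rule t(2))
    have out: "output_set Algorithm n g l w \<epsilon> t = return_pmf (stored_set n 1 m')"
      by (simp add: output_set_def exec)
    define c where "c = curvature {..<n} g"
    have time: "real t \<le> 5000 * C * (real n ^ 4 * poly [:3, 2:] (ln (real n)) / (1 - c)\<^sup>2)
        * (1 / \<epsilon> * max 1 (ln (1 / (1 - c)))) powr (poly (monom K 8) (1 / \<epsilon>) / (1 - c))"
      if n: "1 \<le> n" and c: "c < 1"
    proof -
      have c1: "0 < 1 - c" "1 - c \<le> 1" using c curvature_le_1[OF g(1,3) n] by (simp_all add: c_def)
      let ?L = "3 + 2 * ln (real n)" and ?E = "K * (1 / \<epsilon>) ^ 8"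
      let ?X = "(1 / \<epsilon>) powr ?E" and ?B = "1 / \<epsilon> * max 1 (ln (1 / (1 - c)))"
      have x1: "1 < 1 / \<epsilon>" using \<epsilon> by simp
      have E0: "0 \<le> ?E" using \<epsilon> by (simp add: K_def)
      have L0: "0 \<le> ?L" using n by simp
      have "real t \<le> real total_time" using t(1) by simp
      also have "\<dots> \<le> real (5000 * (scales + 1) * (n ^ 4 * (z ^ (8 * z ^ 8)) ^ 5))"
        using total_time_bound[OF refl refl z2 n] by (simp only: of_nat_le_iff)
      also have "\<dots> = 5000 * real (scales + 1) * (real n ^ 4 * real ((z ^ (8 * z ^ 8)) ^ 5))"
        by (simp only: of_nat_mult of_nat_power of_nat_numeral)
      also have "\<dots> \<le> 5000 * ?L * (real n ^ 4 * (C * ?X))"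
      proof (intro mult_mono order_refl)
        show "real (scales + 1) \<le> ?L" by (rule scales_bound[OF n])
        show "real ((z ^ (8 * z ^ 8)) ^ 5) \<le> C * ?X" unfolding K_def by (rule C(2)[OF \<epsilon> z_def])
      qed (use L0 in \<open>auto intro!: mult_nonneg_nonneg\<close>)
      also have "\<dots> = 5000 * C * (real n ^ 4 * ?L) * ?X" by (simp only: mult_ac)
      \<comment> \<open>As \<open>0 < 1 - c \<le> 1\<close>, dividing by its square enlarges the
        factor. The base is at least \<open>1 / \<epsilon> > 1\<close>, so both enlarging it by the
        maximum and dividing the exponent by \<open>1 - c\<close> enlarge the power.\<close>
      also have "\<dots> \<le> 5000 * C * (real n ^ 4 * ?L / (1 - c)\<^sup>2) * ?B powr (?E / (1 - c))"
      proof (intro mult_mono order_refl)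
        have "(1 - c)\<^sup>2 \<le> 1" using c1 by (simp add: power_le_one)
        moreover have "0 < (1 - c)\<^sup>2" using c1 by simp
        moreover have "0 \<le> real n ^ 4 * ?L" using L0 by simp
        ultimately show "real n ^ 4 * ?L \<le> real n ^ 4 * ?L / (1 - c)\<^sup>2"
          using mult_left_mono[of "(1 - c)\<^sup>2" 1 "real n ^ 4 * ?L"] by (simp add: pos_le_divide_eq)
        have "1 / \<epsilon> * 1 \<le> ?B" using x1 \<epsilon> by (intro mult_left_mono) auto
        then have xB: "1 / \<epsilon> \<le> ?B" by simp
        have "?X \<le> ?B powr ?E" using xB x1 E0 \<epsilon> by (intro powr_mono2) auto
        also have "\<dots> \<le> ?B powr (?E / (1 - c))"
        proof (rule powr_mono)
          show "?E \<le> ?E / (1 - c)"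
            using mult_left_mono[OF c1(2) E0] c1(1) by (simp add: pos_le_divide_eq)
        qed (use xB x1 in linarith)
        finally show "?X \<le> ?B powr (?E / (1 - c))" .
      qed (use C(1) L0 in \<open>auto intro!: mult_nonneg_nonneg divide_nonneg_nonneg\<close>)
      finally have *: "real t \<le> 5000 * C * (real n ^ 4 * ?L / (1 - c)\<^sup>2) * ?B powr (?E / (1 - c))" .
      have E: "poly (monom K 8) (1 / \<epsilon>) = ?E" by (simp only: poly_monom)
      have L: "poly [:3, 2:] (ln (real n)) = ?L" by simp
      show ?thesis unfolding E L by (rule *)
    qed
    show "\<exists>t. halts_within Algorithm n g l w \<epsilon> t \<and>
           (\<forall>S\<in>set_pmf (output_set Algorithm n g l w \<epsilon> t). S \<subseteq> {..<n} \<and> (\<Sum>e\<in>S. w e) \<le> 1) \<and>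
           (\<forall>Opt. is_arg_max (\<lambda>T. g T + l T) (\<lambda>T. T \<subseteq> {..<n} \<and> (\<Sum>e\<in>T. w e) \<le> 1) Opt \<longrightarrow>
              measure_pmf.expectation (output_set Algorithm n g l w \<epsilon> t) (\<lambda>S. g S + l S)
                \<ge> (1 - 1 / exp 1) * g Opt + l Opt - \<epsilon> * (g Opt + l Opt)) \<and>
           (let c = curvature {..<n} g in
              n \<ge> 1 \<and> c < 1 \<longrightarrow>
              real t \<le> 5000 * C * (real n ^ 4 * poly [:3, 2:] (ln (real n)) / (1 - c)\<^sup>2)
                         * (1 / \<epsilon> * max 1 (ln (1 / (1 - c)))) powr (poly (monom K 8) (1 / \<epsilon>) / (1 - c)))"
    proof (intro exI[of _ t] conjI)
      show "halts_within Algorithm n g l w \<epsilon> t" by (simp add: halts_within_def exec)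
      show "\<forall>S\<in>set_pmf (output_set Algorithm n g l w \<epsilon> t). S \<subseteq> {..<n} \<and> (\<Sum>e\<in>S. w e) \<le> 1"
        using feasible by (auto simp: out stored_set_def)
      show "\<forall>Opt. is_arg_max (\<lambda>T. g T + l T) (\<lambda>T. T \<subseteq> {..<n} \<and> (\<Sum>e\<in>T. w e) \<le> 1) Opt \<longrightarrow>
              measure_pmf.expectation (output_set Algorithm n g l w \<epsilon> t) (\<lambda>S. g S + l S)
                \<ge> (1 - 1 / exp 1) * g Opt + l Opt - \<epsilon> * (g Opt + l Opt)"
        using approx by (simp add: out)
      show "let c = curvature {..<n} g in
              n \<ge> 1 \<and> c < 1 \<longrightarrow>
              real t \<le> 5000 * C * (real n ^ 4 * poly [:3, 2:] (ln (real n)) / (1 - c)\<^sup>2)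
                         * (1 / \<epsilon> * max 1 (ln (1 / (1 - c)))) powr (poly (monom K 8) (1 / \<epsilon>) / (1 - c))"
        unfolding Let_def c_def[symmetric] using time by blast
    qed
  qed
qed

end
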